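(* Let $(R,\{R_\gamma\}_{\gamma\in\Gamma})$ be a homogeneously semiprime Lie algebra with finite $\Gamma$-grading. Then $P_{gr}(R)$ is a $\Gamma$-graded algebra of quotients of $R$; $P_{gr}(R)$ embeds into $Q_{m-gr}(R)$ homogeneously and identically on $R$; $$O_{gr}(P_{gr}(R))\subseteq Q_{m-gr}(P_{gr}(R))=O_{gr}(Q_{m-gr}(P_{gr}(R)));$$ and $Q_{m-gr}(P_{gr}(R))_B$ is a $\Gamma$-graded algebra of quotients of $O_{gr}(P_{gr}(R))_B$ for any ultrafilter $B$ in $B_{gr}(R)$.
   Context: $F$ is an associative commutative ring with $1$; $\Gamma$ is an abelian group (additive). A $\Gamma$-graded $F$-algebra is $(R,\{R_\gamma\}_{\gamma\in\Gamma})$ with $R=\bigoplus_\gamma R_\gamma$, $R_\alpha R_\beta\subseteq R_{\alpha+\beta}$; the grading is finite if only finitely many $R_\gamma$ are nonzero. Submodules, subalgebras, ideals $I$ are homogeneous if $I=\bigoplus_\gamma(I\cap R_\gamma)$; homogeneous homomorphisms preserve degree. $R$ is homogeneously semiprime if $I^2\ne\{0\}$ for every nonzero homogeneous ideal $I$. $M(R)$ is the associative algebra generated by the operators $l_x:y\mapsto xy$, $r_x:y\mapsto yx$, and $M(R)'=F\,\mathrm{Id}_R+M(R)$ (acting on the right) is $\Gamma$-graded: degree $\alpha$ consists of sums of products of operators $l_x,r_x$ of homogeneous $x$ of total degree $\alpha$, and $\mathrm{Id}_R$ has degree $0$. For homogeneously semiprime $R$: $I_{gr}(R)$ is the graded injective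 hull of the graded right $M(R)'$-module $R$ (in the category of $\Gamma$-graded modules with homogeneous homomorphisms), $P_{gr}(R)=\mathrm{End}(I_{gr}(R))_{M(R)'-gr}R$, $\mathrm{CM}_{gr}(R)=\mathrm{End}(P_{gr}(R))_{M(R)'-gr}$, where $\mathrm{End}(\cdot)_{M(R)'-gr}$ is the algebra of homogeneous $M(R)'$-endomorphisms; $\mathrm{CM}_{gr}(R)$ is commutative and von Neumann regular. $P_{gr}(R)=\mathrm{CM}_{gr}(R)R$ is regarded as a $\Gamma$-graded $\mathrm{CM}_{gr}(R)$-algebra with components $\mathrm{CM}_{gr}(R)R_\gamma$ and multiplication extended from $R$ by $\mathrm{CM}_{gr}(R)$-linearity; $M(P_{gr}(R))'=\mathrm{CM}_{gr}(R)\mathrm{Id}+M(P_{gr}(R))$; $I_{gr}(P_{gr}(R))$ is the graded injective hull of the graded right $M(P_{gr}(R))'$-module $P_{gr}(R)$. $B_{gr}(R)=\{\alpha\in\mathrm{CM}_{gr}(R)\mid\alpha^2=\alpha\}$ is a Boolean ring with multiplication of $\mathrm{CM}_{gr}(R)$, addition $\alpha\oplus\beta=(\alpha-\beta)^2$, order $\alpha\le\beta$ iff $\alpha\beta=\alpha$. A subset is dense if its annihilator in $B_{gr}(R)$ is zero, orthogonal if distinct elements have zero product. $S\subseteq I_{gr}(P_{gr}(R))$ is orthogonally complete if for every dense orthogonal $\{\xi_a\}_{a\in I}\subseteq B_{gr}(R)$ and $\{x_a\}_{a\in I}\subseteq S$ there is $x\in S$ (unique, denoted $\sum^\perp_{a\in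 I}\xi_ax_a$) with $\xi_ax=\xi_ax_a$ for all $a$. $O_{gr}(S)$ is the intersection of all orthogonally complete subsets of $I_{gr}(P_{gr}(R))$ containing $S$; it consists of all $\sum^\perp\xi_ax_a$, $x_a\in S$. $O_{gr}(P_{gr}(R))$ is a $\Gamma$-graded $\mathrm{CM}_{gr}(R)$-algebra with components $O_{gr}(P_{gr}(R)_\gamma)$ and $\sum^\perp\xi_ax_a\star\sum^\perp\chi_by_b=\sum^\perp\xi_a\chi_b(x_a\star y_b)$, $\star=+,\cdot$. An ultrafilter in $B_{gr}(R)$ is $B\subseteq B_{gr}(R)\setminus\{0\}$ closed under products, upward closed for $\le$, and such that for every $\alpha\in B_{gr}(R)$ either $\alpha\in B$ or $\mathrm{Id}-\alpha\in B$. With $P=B_{gr}(R)\setminus B$ and $PS=\{\alpha x\mid\alpha\in P,x\in S\}$, $S_B=S/(S\cap PS)$, with the induced grading and operations. Lie quotients: for a $\Gamma$-graded Lie algebra $R$ with bracket $[\,,]$ and an ideal $I$, $\mathrm{Ann}_RI=\{x\in R\mid[x,I]=\{0\}\}$. A $\Gamma$-graded Lie algebra $Q$ is a ($\Gamma$-)graded algebra of quotients of $R$ if $R$ is a homogeneous subalgebra of $Q$ and for every $0\ne q\in Q_\gamma$, $\gamma\in\Gamma$, there is a homogeneous ideal $I$ of $R$ with $\mathrm{Ann}_RI=\{0\}$ and $\{0\}\ne[I,q]\subseteq R$. $\mathcal E_{gr}(R)$ is the set of homogeneous ideals of $R$ meeting every nonzero homogeneous ideal nontrivially; $\mathrm{PDer}_{gr}(I,R)_\gamma$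 is the set of linear maps $D:I\to R$ with $(xy)D=(xD)y+x(yD)$ for $x,y\in I$ and $(I\cap R_\alpha)D\subseteq R_{\alpha+\gamma}$ for all $\alpha$; $\mathrm{ad}_y:x\mapsto[x,y]$. For homogeneously semiprime $R$, the maximal graded algebra of quotients $Q_{m-gr}(R)$ is the $\Gamma$-graded Lie algebra determined uniquely up to a homogeneous isomorphism identical on $R$ by: (1) $R$ is a homogeneous subalgebra; (2) for each $x\in Q_{m-gr}(R)_\gamma$ there is $I\in\mathcal E_{gr}(R)$ with $[I,x]\subseteq R$; (3) if $x\in Q_{m-gr}(R)_\gamma$, $I\in\mathcal E_{gr}(R)$, $[I,x]=\{0\}$, then $x=0$; (4) for each $I\in\mathcal E_{gr}(R)$ and $D\in\mathrm{PDer}_{gr}(I,R)_\gamma$ there is $y\in Q_{m-gr}(R)_\gamma$ with $\mathrm{ad}_y|_I=D$. $Q_{m-gr}(P_{gr}(R))$ is formed for $P_{gr}(R)$ as a $\mathrm{CM}_{gr}(R)$-algebra; $P_{gr}(R)$ is essential among its homogeneous $M(P_{gr}(R))'$-submodules, and it is identified, by a homogeneous embedding identical on $P_{gr}(R)$, with a submodule of $I_{gr}(P_{gr}(R))$. *)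

theory Defs
  imports "HOL-Algebra.Module" "HOL-Algebra.QuotRing" "HOL-Algebra.Generated_Groups"
begin

section \<open>Graded nonassociative algebras\<close>

text \<open>
  A not necessarily associative algebra is a record of type \<^typ>\<open>('k, 'a) module\<close> whose field
  \<^const>\<open>mult\<close> is the product (the bracket, for a Lie algebra). The field \<^const>\<open>one\<close> of such a
  record has no meaning and is never used. The grading group is a type of class
  \<^class>\<open>ab_group_add\<close>, and a grading is the family of its components.
\<close>

definition fin_decomposition :: "('a, 'm) ring_scheme \<Rightarrow> ('g \<Rightarrow> 'a set) \<Rightarrow> 'a \<Rightarrow> ('g \<Rightarrow> 'a) \<Rightarrow> bool" where
  "fin_decomposition M C x f \<longleftrightarrow>
     (\<forall>\<gamma>. f \<gamma> \<in> C \<gamma>) \<and> finite {\<gamma>. f \<gamma> \<noteq> \<zero>\<^bsub>M\<^esub>} \<and> x = finsum M f {\<gamma>. f \<gamma> \<noteq> \<zero>\<^bsub>M\<^esub>}"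

definition internal_direct_sum :: "('a, 'm) ring_scheme \<Rightarrow> 'a set \<Rightarrow> ('g \<Rightarrow> 'a set) \<Rightarrow> bool" where
  "internal_direct_sum M X C \<longleftrightarrow>
     (\<forall>\<gamma>. subgroup (C \<gamma>) (add_monoid M) \<and> C \<gamma> \<subseteq> X) \<and> (\<forall>x\<in>X. \<exists>!f. fin_decomposition M C x f)"

definition homogeneous :: "('a, 'm) ring_scheme \<Rightarrow> ('g \<Rightarrow> 'a set) \<Rightarrow> 'a set \<Rightarrow> bool" where
  "homogeneous M MG X \<longleftrightarrow> internal_direct_sum M X (\<lambda>\<gamma>. X \<inter> MG \<gamma>)"

definition finite_grading :: "('a, 'm) ring_scheme \<Rightarrow> ('g \<Rightarrow> 'a set) \<Rightarrow> bool" where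
  "finite_grading M MG \<longleftrightarrow> finite {\<gamma>. MG \<gamma> \<noteq> {\<zero>\<^bsub>M\<^esub>}}"

locale nonassoc_algebra = module K A
  for K :: "('k, 'n) ring_scheme" and A :: "('k, 'a) module" +
  assumes prod_closed: "\<lbrakk>x \<in> carrier A; y \<in> carrier A\<rbrakk> \<Longrightarrow> x \<otimes>\<^bsub>A\<^esub> y \<in> carrier A"
    and prod_l_distr: "\<lbrakk>x \<in> carrier A; y \<in> carrier A; z \<in> carrier A\<rbrakk> \<Longrightarrow>
      (x \<oplus>\<^bsub>A\<^esub> y) \<otimes>\<^bsub>A\<^esub> z = x \<otimes>\<^bsub>A\<^esub> z \<oplus>\<^bsub>A\<^esub> y \<otimes>\<^bsub>A\<^esub> z"
    and prod_r_distr: "\<lbrakk>x \<in> carrier A; y \<in> carrier A; z \<in> carrier A\<rbrakk> \<Longrightarrow>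
      z \<otimes>\<^bsub>A\<^esub> (x \<oplus>\<^bsub>A\<^esub> y) = z \<otimes>\<^bsub>A\<^esub> x \<oplus>\<^bsub>A\<^esub> z \<otimes>\<^bsub>A\<^esub> y"
    and prod_l_smult: "\<lbrakk>k \<in> carrier K; x \<in> carrier A; y \<in> carrier A\<rbrakk> \<Longrightarrow>
      (k \<odot>\<^bsub>A\<^esub> x) \<otimes>\<^bsub>A\<^esub> y = k \<odot>\<^bsub>A\<^esub> (x \<otimes>\<^bsub>A\<^esub> y)"
    and prod_r_smult: "\<lbrakk>k \<in> carrier K; x \<in> carrier A; y \<in> carrier A\<rbrakk> \<Longrightarrow>
      x \<otimes>\<^bsub>A\<^esub> (k \<odot>\<^bsub>A\<^esub> y) = k \<odot>\<^bsub>A\<^esub> (x \<otimes>\<^bsub>A\<^esub> y)"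

locale graded_algebra = nonassoc_algebra K A
  for K :: "('k, 'n) ring_scheme" and A :: "('k, 'a) module"
    and AG :: "'g::ab_group_add \<Rightarrow> 'a set" +
  assumes grading_submodule: "submodule (AG \<gamma>) K A"
    and grading_direct: "internal_direct_sum A (carrier A) AG"
    and grading_prod: "\<lbrakk>x \<in> AG \<alpha>; y \<in> AG \<beta>\<rbrakk> \<Longrightarrow> x \<otimes>\<^bsub>A\<^esub> y \<in> AG (\<alpha> + \<beta>)"

locale graded_lie_algebra = graded_algebra K A AG
  for K :: "('k, 'n) ring_scheme" and A :: "('k, 'a) module"
    and AG :: "'g::ab_group_add \<Rightarrow> 'a set" +
  assumes alternating: "x \<in> carrier A \<Longrightarrow> x \<otimes>\<^bsub>A\<^esub> x = \<zero>\<^bsub>A\<^esub>"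
    and jacobi: "\<lbrakk>x \<in> carrier A; y \<in> carrier A; z \<in> carrier A\<rbrakk> \<Longrightarrow>
      (x \<otimes>\<^bsub>A\<^esub> y) \<otimes>\<^bsub>A\<^esub> z \<oplus>\<^bsub>A\<^esub> (y \<otimes>\<^bsub>A\<^esub> z) \<otimes>\<^bsub>A\<^esub> x \<oplus>\<^bsub>A\<^esub> (z \<otimes>\<^bsub>A\<^esub> x) \<otimes>\<^bsub>A\<^esub> y = \<zero>\<^bsub>A\<^esub>"

definition homogeneous_ideal ::
    "('k, 'n) ring_scheme \<Rightarrow> ('k, 'a) module \<Rightarrow> ('g \<Rightarrow> 'a set) \<Rightarrow> 'a set \<Rightarrow> bool" where
  "homogeneous_ideal K A AG I \<longleftrightarrow>
     submodule I K A \<and> homogeneous A AG I \<and>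
     (\<forall>x\<in>I. \<forall>a\<in>carrier A. a \<otimes>\<^bsub>A\<^esub> x \<in> I \<and> x \<otimes>\<^bsub>A\<^esub> a \<in> I)"

definition ideal_square :: "('k, 'a) module \<Rightarrow> 'a set \<Rightarrow> 'a set" where
  "ideal_square A I = generate (add_monoid A) {x \<otimes>\<^bsub>A\<^esub> y | x y. x \<in> I \<and> y \<in> I}"

definition homogeneously_semiprime ::
    "('k, 'n) ring_scheme \<Rightarrow> ('k, 'a) module \<Rightarrow> ('g \<Rightarrow> 'a set) \<Rightarrow> bool" where
  "homogeneously_semiprime K A AG \<longleftrightarrow>
     (\<forall>I. homogeneous_ideal K A AG I \<and> I \<noteq> {\<zero>\<^bsub>A\<^esub>} \<longrightarrow> ideal_square A I \<noteq> {\<zero>\<^bsub>A\<^esub>})"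

text \<open>
  An embedding of graded algebras plays the part of the inclusion of a homogeneous subalgebra:
  its image is a homogeneous subalgebra carrying the grading of the source.
\<close>

definition graded_embedding ::
    "('k, 'n) ring_scheme \<Rightarrow> ('k, 'a) module \<Rightarrow> ('g \<Rightarrow> 'a set) \<Rightarrow> ('k, 'b) module \<Rightarrow> ('g \<Rightarrow> 'b set)
      \<Rightarrow> ('a \<Rightarrow> 'b) \<Rightarrow> bool" where
  "graded_embedding K A AG C CG e \<longleftrightarrow>
     e \<in> carrier A \<rightarrow> carrier C \<and> inj_on e (carrier A) \<and>
     (\<forall>x\<in>carrier A. \<forall>y\<in>carrier A. e (x \<oplus>\<^bsub>A\<^esub> y) = e x \<oplus>\<^bsub>C\<^esub> e y \<and> e (x \<otimes>\<^bsub>A\<^esub> y) = e x \<otimes>\<^bsub>C\<^esub> e y) \<and>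
     (\<forall>k\<in>carrier K. \<forall>x\<in>carrier A. e (k \<odot>\<^bsub>A\<^esub> x) = k \<odot>\<^bsub>C\<^esub> e x) \<and>
     (\<forall>\<gamma>. e ` AG \<gamma> \<subseteq> CG \<gamma>)"


section \<open>The multiplication algebra\<close>

definition l_op :: "('k, 'a) module \<Rightarrow> 'a \<Rightarrow> 'a \<Rightarrow> 'a" where
  "l_op A x = (\<lambda>y\<in>carrier A. x \<otimes>\<^bsub>A\<^esub> y)"

definition r_op :: "('k, 'a) module \<Rightarrow> 'a \<Rightarrow> 'a \<Rightarrow> 'a" where
  "r_op A x = (\<lambda>y\<in>carrier A. y \<otimes>\<^bsub>A\<^esub> x)"

definition scalar_op :: "('k, 'a) module \<Rightarrow> 'k \<Rightarrow> 'a \<Rightarrow> 'a" where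
  "scalar_op A k = (\<lambda>y\<in>carrier A. k \<odot>\<^bsub>A\<^esub> y)"

definition op_add :: "('k, 'a) module \<Rightarrow> ('a \<Rightarrow> 'a) \<Rightarrow> ('a \<Rightarrow> 'a) \<Rightarrow> 'a \<Rightarrow> 'a" where
  "op_add A f g = (\<lambda>y\<in>carrier A. f y \<oplus>\<^bsub>A\<^esub> g y)"

text \<open>Operators act on the right, so the product of \<open>f\<close> and \<open>g\<close> applies \<open>f\<close> first.\<close>

definition op_mult :: "('k, 'a) module \<Rightarrow> ('a \<Rightarrow> 'a) \<Rightarrow> ('a \<Rightarrow> 'a) \<Rightarrow> 'a \<Rightarrow> 'a" where
  "op_mult A f g = compose (carrier A) g f"

inductive_set mult_ops :: "('k, 'n) ring_scheme \<Rightarrow> ('k, 'a) module \<Rightarrow> ('a \<Rightarrow> 'a) set"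
  for K :: "('k, 'n) ring_scheme" and A :: "('k, 'a) module" where
  "x \<in> carrier A \<Longrightarrow> l_op A x \<in> mult_ops K A"
| "x \<in> carrier A \<Longrightarrow> r_op A x \<in> mult_ops K A"
| "\<lbrakk>f \<in> mult_ops K A; g \<in> mult_ops K A\<rbrakk> \<Longrightarrow> op_add A f g \<in> mult_ops K A"
| "\<lbrakk>f \<in> mult_ops K A; g \<in> mult_ops K A\<rbrakk> \<Longrightarrow> op_mult A f g \<in> mult_ops K A"
| "\<lbrakk>k \<in> carrier K; f \<in> mult_ops K A\<rbrakk> \<Longrightarrow> op_mult A f (scalar_op A k) \<in> mult_ops K A"

definition mult_alg :: "('k, 'n) ring_scheme \<Rightarrow> ('k, 'a) module \<Rightarrow> ('a \<Rightarrow> 'a) ring" where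
  "mult_alg K A =
     \<lparr>carrier = {op_add A (scalar_op A k) f | k f. k \<in> carrier K \<and> f \<in> mult_ops K A},
      mult = op_mult A, one = (\<lambda>y\<in>carrier A. y),
      zero = (\<lambda>y\<in>carrier A. \<zero>\<^bsub>A\<^esub>), add = op_add A\<rparr>"

text \<open>
  \<open>mult_alg_gr K A AG \<alpha> f\<close>: \<open>f\<close> is a sum of products, of total degree \<open>\<alpha>\<close>, of multiplications by
  homogeneous elements, plus a multiple of the identity if \<open>\<alpha> = 0\<close>.
\<close>

inductive mult_alg_gr ::
    "('k, 'n) ring_scheme \<Rightarrow> ('k, 'a) module \<Rightarrow> ('g::ab_group_add \<Rightarrow> 'a set) \<Rightarrow> 'g \<Rightarrow> ('a \<Rightarrow> 'a) \<Rightarrow> bool"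
  for K :: "('k, 'n) ring_scheme" and A :: "('k, 'a) module" and AG :: "'g::ab_group_add \<Rightarrow> 'a set"
  where
  "k \<in> carrier K \<Longrightarrow> mult_alg_gr K A AG 0 (scalar_op A k)"
| "x \<in> AG \<alpha> \<Longrightarrow> mult_alg_gr K A AG \<alpha> (l_op A x)"
| "x \<in> AG \<alpha> \<Longrightarrow> mult_alg_gr K A AG \<alpha> (r_op A x)"
| "\<lbrakk>mult_alg_gr K A AG \<alpha> f; mult_alg_gr K A AG \<alpha> g\<rbrakk> \<Longrightarrow> mult_alg_gr K A AG \<alpha> (op_add A f g)"
| "\<lbrakk>mult_alg_gr K A AG \<alpha> f; mult_alg_gr K A AG \<beta> g\<rbrakk> \<Longrightarrow> mult_alg_gr K A AG (\<alpha> + \<beta>) (op_mult A f g)"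

definition mult_alg_grading ::
    "('k, 'n) ring_scheme \<Rightarrow> ('k, 'a) module \<Rightarrow> ('g::ab_group_add \<Rightarrow> 'a set) \<Rightarrow> 'g \<Rightarrow> ('a \<Rightarrow> 'a) set" where
  "mult_alg_grading K A AG \<alpha> = {f. mult_alg_gr K A AG \<alpha> f}"


section \<open>Graded right modules and graded injective hulls\<close>

text \<open>
  A right module over a ring \<open>S\<close> is a record of type \<^typ>\<open>('s, 'm) module\<close> in which \<^const>\<open>smult\<close>
  applied to \<open>s\<close> and \<open>m\<close> is the element \<open>m s\<close>; its fields \<^const>\<open>mult\<close> and \<^const>\<open>one\<close> have no meaning.
\<close>

locale graded_right_module = S?: ring S + M?: abelian_group M
  for S :: "('s, 'n) ring_scheme" and SG :: "'g::ab_group_add \<Rightarrow> 's set"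
    and M :: "('s, 'm) module" and MG :: "'g \<Rightarrow> 'm set" +
  assumes act_closed: "\<lbrakk>s \<in> carrier S; m \<in> carrier M\<rbrakk> \<Longrightarrow> s \<odot>\<^bsub>M\<^esub> m \<in> carrier M"
    and act_add: "\<lbrakk>s \<in> carrier S; m \<in> carrier M; n \<in> carrier M\<rbrakk> \<Longrightarrow>
      s \<odot>\<^bsub>M\<^esub> (m \<oplus>\<^bsub>M\<^esub> n) = s \<odot>\<^bsub>M\<^esub> m \<oplus>\<^bsub>M\<^esub> s \<odot>\<^bsub>M\<^esub> n"
    and add_act: "\<lbrakk>s \<in> carrier S; t \<in> carrier S; m \<in> carrier M\<rbrakk> \<Longrightarrow>
      (s \<oplus>\<^bsub>S\<^esub> t) \<odot>\<^bsub>M\<^esub> m = s \<odot>\<^bsub>M\<^esub> m \<oplus>\<^bsub>M\<^esub> t \<odot>\<^bsub>M\<^esub> m"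
    and mult_act: "\<lbrakk>s \<in> carrier S; t \<in> carrier S; m \<in> carrier M\<rbrakk> \<Longrightarrow>
      (s \<otimes>\<^bsub>S\<^esub> t) \<odot>\<^bsub>M\<^esub> m = t \<odot>\<^bsub>M\<^esub> (s \<odot>\<^bsub>M\<^esub> m)"
    and one_act: "m \<in> carrier M \<Longrightarrow> \<one>\<^bsub>S\<^esub> \<odot>\<^bsub>M\<^esub> m = m"
    and module_grading_direct: "internal_direct_sum M (carrier M) MG"
    and module_grading_act: "\<lbrakk>s \<in> SG \<alpha>; m \<in> MG \<gamma>\<rbrakk> \<Longrightarrow> s \<odot>\<^bsub>M\<^esub> m \<in> MG (\<gamma> + \<alpha>)"

definition homogeneous_right_submodule ::
    "('s, 'n) ring_scheme \<Rightarrow> ('s, 'm) module \<Rightarrow> ('g \<Rightarrow> 'm set) \<Rightarrow> 'm set \<Rightarrow> bool" where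
  "homogeneous_right_submodule S M MG X \<longleftrightarrow>
     subgroup X (add_monoid M) \<and> (\<forall>s\<in>carrier S. \<forall>x\<in>X. s \<odot>\<^bsub>M\<^esub> x \<in> X) \<and> homogeneous M MG X"

text \<open>Homomorphisms are undefined off the carrier, so that equal homomorphisms are equal functions.\<close>

definition graded_hom ::
    "('s, 'n) ring_scheme \<Rightarrow> ('s, 'm) module \<Rightarrow> ('g \<Rightarrow> 'm set) \<Rightarrow> ('s, 'l) module \<Rightarrow> ('g \<Rightarrow> 'l set)
      \<Rightarrow> ('m \<Rightarrow> 'l) set" where
  "graded_hom S M MG N NG =
     {f \<in> carrier M \<rightarrow>\<^sub>E carrier N.
        (\<forall>x\<in>carrier M. \<forall>y\<in>carrier M. f (x \<oplus>\<^bsub>M\<^esub> y) = f x \<oplus>\<^bsub>N\<^esub> f y) \<and>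
        (\<forall>s\<in>carrier S. \<forall>x\<in>carrier M. f (s \<odot>\<^bsub>M\<^esub> x) = s \<odot>\<^bsub>N\<^esub> f x) \<and>
        (\<forall>\<gamma>. f ` MG \<gamma> \<subseteq> NG \<gamma>)}"

text \<open>
  Injectivity in the category of graded modules: a homogeneous homomorphism into \<open>M\<close> from a homogeneous
  submodule of \<open>Y\<close> extends to \<open>Y\<close>. A definition cannot quantify over the types in which the modules
  \<open>Y\<close> live, so they are taken in the type \<^typ>\<open>'s \<times> 'm\<close>. It accommodates \<open>S\<close> with all shifts of
  its grading, so by Baer's criterion (in the graded form) the property does not depend on this choice;
  it also accommodates \<open>M\<close>.
\<close>

definition graded_injective ::
    "('s, 'n) ring_scheme \<Rightarrow> ('g::ab_group_add \<Rightarrow> 's set) \<Rightarrow> ('s, 'm) module \<Rightarrow> ('g \<Rightarrow> 'm set) \<Rightarrow> bool" where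
  "graded_injective S SG M MG \<longleftrightarrow>
     (\<forall>(Y :: ('s, 's \<times> 'm) module) YG X.
        graded_right_module S SG Y YG \<and> homogeneous_right_submodule S Y YG X \<longrightarrow>
        (\<forall>f \<in> graded_hom S (Y\<lparr>carrier := X\<rparr>) (\<lambda>\<gamma>. X \<inter> YG \<gamma>) M MG.
           \<exists>g \<in> graded_hom S Y YG M MG. \<forall>x\<in>X. g x = f x))"

text \<open>\<open>(I, IG)\<close> together with the embedding \<open>\<iota>\<close> of \<open>M\<close> is a graded injective hull of \<open>M\<close>.\<close>

definition graded_injective_hull ::
    "('s, 'n) ring_scheme \<Rightarrow> ('g::ab_group_add \<Rightarrow> 's set) \<Rightarrow> ('s, 'm) module \<Rightarrow> ('g \<Rightarrow> 'm set)
      \<Rightarrow> ('s, 'i) module \<Rightarrow> ('g \<Rightarrow> 'i set) \<Rightarrow> ('m \<Rightarrow> 'i) \<Rightarrow> bool" where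
  "graded_injective_hull S SG M MG I IG \<iota> \<longleftrightarrow>
     graded_right_module S SG I IG \<and> graded_injective S SG I IG \<and>
     \<iota> \<in> graded_hom S M MG I IG \<and> inj_on \<iota> (carrier M) \<and>
     (\<forall>X. homogeneous_right_submodule S I IG X \<and> X \<noteq> {\<zero>\<^bsub>I\<^esub>} \<longrightarrow> X \<inter> \<iota> ` carrier M \<noteq> {\<zero>\<^bsub>I\<^esub>})"

text \<open>The algebra \<open>A\<close> as a right module over its multiplication algebra.\<close>

definition mult_module :: "('k, 'a) module \<Rightarrow> ('a \<Rightarrow> 'a, 'a) module" where
  "mult_module A =
     \<lparr>carrier = carrier A, mult = mult A, one = one A, zero = zero A, add = add A,
      smult = (\<lambda>f x. f x)\<rparr>"

text \<open>
  \<open>hull_of_algebra K A AG I IG \<iota>\<close>: \<open>I\<close> is \<open>I\<^sub>g\<^sub>r(A)\<close>, for the \<open>K\<close>-algebra \<open>A\<close> embedded in it by \<open>\<iota>\<close>.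
\<close>

definition hull_of_algebra ::
    "('k, 'n) ring_scheme \<Rightarrow> ('k, 'a) module \<Rightarrow> ('g::ab_group_add \<Rightarrow> 'a set)
      \<Rightarrow> ('a \<Rightarrow> 'a, 'i) module \<Rightarrow> ('g \<Rightarrow> 'i set) \<Rightarrow> ('a \<Rightarrow> 'i) \<Rightarrow> bool" where
  "hull_of_algebra K A AG I IG \<iota> \<longleftrightarrow>
     graded_injective_hull (mult_alg K A) (mult_alg_grading K A AG) (mult_module A) AG I IG \<iota>"

text \<open>
  A module over the multiplication algebra of \<open>A\<close>, with the scalars of \<open>A\<close> acting through their
  multiples of the identity.
\<close>

definition scalars_of :: "('k, 'a) module \<Rightarrow> ('a \<Rightarrow> 'a, 'i) module \<Rightarrow> ('k, 'i) module" where
  "scalars_of A I =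
     \<lparr>carrier = carrier I, mult = mult I, one = one I, zero = zero I, add = add I,
      smult = (\<lambda>k x. scalar_op A k \<odot>\<^bsub>I\<^esub> x)\<rparr>"


section \<open>The graded central closure and the graded extended centroid\<close>

context
  fixes F :: "('f, 'n) ring_scheme" and R :: "('f, 'r) module"
    and I :: "('r \<Rightarrow> 'r, 'i) module" and IG :: "'g::ab_group_add \<Rightarrow> 'i set" and \<iota> :: "'r \<Rightarrow> 'i"
begin

definition closure_set :: "'i set" where
  "closure_set = generate (add_monoid I)
     {\<alpha> (\<iota> x) | \<alpha> x. \<alpha> \<in> graded_hom (mult_alg F R) I IG I IG \<and> x \<in> carrier R}"

definition closure_module :: "('r \<Rightarrow> 'r, 'i) module" where
  "closure_module = I\<lparr>carrier := closure_set\<rparr>"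

text \<open>Endomorphisms are written on the left: the product of \<open>\<alpha>\<close> and \<open>\<beta>\<close> applies \<open>\<beta>\<close> first.\<close>

definition extended_centroid :: "('i \<Rightarrow> 'i) ring" where
  "extended_centroid =
     \<lparr>carrier = graded_hom (mult_alg F R) closure_module (\<lambda>\<gamma>. closure_set \<inter> IG \<gamma>)
                  closure_module (\<lambda>\<gamma>. closure_set \<inter> IG \<gamma>),
      mult = compose closure_set, one = (\<lambda>x\<in>closure_set. x),
      zero = (\<lambda>x\<in>closure_set. \<zero>\<^bsub>I\<^esub>), add = (\<lambda>\<alpha> \<beta>. \<lambda>x\<in>closure_set. \<alpha> x \<oplus>\<^bsub>I\<^esub> \<beta> x)\<rparr>"

text \<open>The multiplication of \<open>R\<close> extended to the central closure by linearity.\<close>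

definition closure_mult :: "'i \<Rightarrow> 'i \<Rightarrow> 'i" where
  "closure_mult = (THE m.
     m \<in> closure_set \<rightarrow>\<^sub>E (closure_set \<rightarrow>\<^sub>E closure_set) \<and>
     (\<forall>p\<in>closure_set. \<forall>q\<in>closure_set. \<forall>s\<in>closure_set.
        m (p \<oplus>\<^bsub>I\<^esub> q) s = m p s \<oplus>\<^bsub>I\<^esub> m q s \<and> m s (p \<oplus>\<^bsub>I\<^esub> q) = m s p \<oplus>\<^bsub>I\<^esub> m s q) \<and>
     (\<forall>\<alpha>\<in>carrier extended_centroid. \<forall>p\<in>closure_set. \<forall>q\<in>closure_set.
        m (\<alpha> p) q = \<alpha> (m p q) \<and> m p (\<alpha> q) = \<alpha> (m p q)) \<and>
     (\<forall>x\<in>carrier R. \<forall>y\<in>carrier R. m (\<iota> x) (\<iota> y) = \<iota> (x \<otimes>\<^bsub>R\<^esub> y)))"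

definition central_closure :: "('i \<Rightarrow> 'i, 'i) module" where
  "central_closure =
     \<lparr>carrier = closure_set, mult = closure_mult, one = \<zero>\<^bsub>I\<^esub>, zero = \<zero>\<^bsub>I\<^esub>, add = add I,
      smult = (\<lambda>\<alpha> x. \<alpha> x)\<rparr>"

definition central_closure_grading :: "('g \<Rightarrow> 'r set) \<Rightarrow> 'g \<Rightarrow> 'i set" where
  "central_closure_grading RG \<gamma> = generate (add_monoid I)
     {\<alpha> (\<iota> x) | \<alpha> x. \<alpha> \<in> carrier extended_centroid \<and> x \<in> RG \<gamma>}"

text \<open>The central closure as an algebra over the ring of scalars \<open>F\<close> of \<open>R\<close>.\<close>

definition central_closure_base :: "('f, 'i) module" where
  "central_closure_base =
     \<lparr>carrier = closure_set, mult = closure_mult, one = \<zero>\<^bsub>I\<^esub>, zero = \<zero>\<^bsub>I\<^esub>, add = add I,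
      smult = smult (scalars_of R I)\<rparr>"

end


section \<open>Orthogonal completeness\<close>

definition idempotents :: "('k, 'n) ring_scheme \<Rightarrow> 'k set" where
  "idempotents K = {\<alpha> \<in> carrier K. \<alpha> \<otimes>\<^bsub>K\<^esub> \<alpha> = \<alpha>}"

definition dense_orthogonal :: "('k, 'n) ring_scheme \<Rightarrow> 'k set \<Rightarrow> bool" where
  "dense_orthogonal K D \<longleftrightarrow>
     D \<subseteq> idempotents K \<and>
     {\<beta> \<in> idempotents K. \<forall>\<xi>\<in>D. \<beta> \<otimes>\<^bsub>K\<^esub> \<xi> = \<zero>\<^bsub>K\<^esub>} = {\<zero>\<^bsub>K\<^esub>} \<and>
     (\<forall>\<xi>\<in>D. \<forall>\<chi>\<in>D. \<xi> \<noteq> \<chi> \<longrightarrow> \<xi> \<otimes>\<^bsub>K\<^esub> \<chi> = \<zero>\<^bsub>K\<^esub>)"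

text \<open>
  Families of idempotents are indexed by themselves, which loses nothing because their members are
  distinct. \<open>orth_sum M D x s\<close> says that \<open>s\<close> is the orthogonal sum of the elements \<open>x \<xi>\<close> along \<open>D\<close>.
\<close>

definition orth_sum :: "('k, 'm) module \<Rightarrow> 'k set \<Rightarrow> ('k \<Rightarrow> 'm) \<Rightarrow> 'm \<Rightarrow> bool" where
  "orth_sum M D x s \<longleftrightarrow> (\<forall>\<xi>\<in>D. \<xi> \<odot>\<^bsub>M\<^esub> s = \<xi> \<odot>\<^bsub>M\<^esub> x \<xi>)"

definition orth_complete :: "('k, 'n) ring_scheme \<Rightarrow> ('k, 'm) module \<Rightarrow> 'm set \<Rightarrow> bool" where
  "orth_complete K M T \<longleftrightarrow>
     T \<subseteq> carrier M \<and> (\<forall>D x. dense_orthogonal K D \<and> x \<in> D \<rightarrow> T \<longrightarrow> (\<exists>s\<in>T. orth_sum M D x s))"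

definition orth_hull :: "('k, 'n) ring_scheme \<Rightarrow> ('k, 'm) module \<Rightarrow> 'm set \<Rightarrow> 'm set" where
  "orth_hull K M T = \<Inter>{U. orth_complete K M U \<and> T \<subseteq> U}"

text \<open>
  The orthogonal completion, inside the \<open>K\<close>-module \<open>M\<close>, of the \<open>K\<close>-algebra \<open>A\<close> embedded in \<open>M\<close> by
  \<open>\<kappa>\<close>. Addition and scalars are those of \<open>M\<close>; the product of the orthogonal sums of \<open>x \<xi>\<close> and of
  \<open>y \<chi>\<close> is the orthogonal sum of the products of \<open>x \<xi>\<close> and \<open>y \<chi>\<close> along the products of \<open>\<xi>\<close> and \<open>\<chi>\<close>.
\<close>

definition orth_mult ::
    "('k, 'n) ring_scheme \<Rightarrow> ('k, 'a) module \<Rightarrow> ('k, 'm) module \<Rightarrow> ('a \<Rightarrow> 'm) \<Rightarrow> 'm \<Rightarrow> 'm \<Rightarrow> 'm" where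
  "orth_mult K A M \<kappa> u v = (THE z. z \<in> orth_hull K M (\<kappa> ` carrier A) \<and>
     (\<exists>D E x y. dense_orthogonal K D \<and> dense_orthogonal K E \<and>
        x \<in> D \<rightarrow> carrier A \<and> y \<in> E \<rightarrow> carrier A \<and>
        orth_sum M D (\<lambda>\<xi>. \<kappa> (x \<xi>)) u \<and> orth_sum M E (\<lambda>\<chi>. \<kappa> (y \<chi>)) v \<and>
        (\<forall>\<xi>\<in>D. \<forall>\<chi>\<in>E. (\<xi> \<otimes>\<^bsub>K\<^esub> \<chi>) \<odot>\<^bsub>M\<^esub> z = (\<xi> \<otimes>\<^bsub>K\<^esub> \<chi>) \<odot>\<^bsub>M\<^esub> \<kappa> (x \<xi> \<otimes>\<^bsub>A\<^esub> y \<chi>))))"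

definition orth_completion ::
    "('k, 'n) ring_scheme \<Rightarrow> ('k, 'a) module \<Rightarrow> ('k, 'm) module \<Rightarrow> ('a \<Rightarrow> 'm) \<Rightarrow> ('k, 'm) module" where
  "orth_completion K A M \<kappa> =
     \<lparr>carrier = orth_hull K M (\<kappa> ` carrier A), mult = orth_mult K A M \<kappa>,
      one = \<zero>\<^bsub>M\<^esub>, zero = \<zero>\<^bsub>M\<^esub>, add = add M, smult = smult M\<rparr>"

definition orth_completion_grading ::
    "('k, 'n) ring_scheme \<Rightarrow> ('g \<Rightarrow> 'a set) \<Rightarrow> ('k, 'm) module \<Rightarrow> ('a \<Rightarrow> 'm) \<Rightarrow> 'g \<Rightarrow> 'm set" where
  "orth_completion_grading K AG M \<kappa> \<gamma> = orth_hull K M (\<kappa> ` AG \<gamma>)"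


section \<open>Quotients by ultrafilters\<close>

definition idempotent_ultrafilter :: "('k, 'n) ring_scheme \<Rightarrow> 'k set \<Rightarrow> bool" where
  "idempotent_ultrafilter K B \<longleftrightarrow>
     B \<subseteq> idempotents K - {\<zero>\<^bsub>K\<^esub>} \<and>
     (\<forall>\<alpha>\<in>B. \<forall>\<beta>\<in>B. \<alpha> \<otimes>\<^bsub>K\<^esub> \<beta> \<in> B) \<and>
     (\<forall>\<alpha>\<in>B. \<forall>\<beta>\<in>idempotents K. \<alpha> \<otimes>\<^bsub>K\<^esub> \<beta> = \<alpha> \<longrightarrow> \<beta> \<in> B) \<and>
     (\<forall>\<alpha>\<in>idempotents K. \<alpha> \<in> B \<or> \<one>\<^bsub>K\<^esub> \<ominus>\<^bsub>K\<^esub> \<alpha> \<in> B)"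

definition ultra_kernel :: "('k, 'n) ring_scheme \<Rightarrow> 'k set \<Rightarrow> ('k, 'a) module \<Rightarrow> 'a set" where
  "ultra_kernel K B A = carrier A \<inter> {\<alpha> \<odot>\<^bsub>A\<^esub> x | \<alpha> x. \<alpha> \<in> idempotents K - B \<and> x \<in> carrier A}"

definition ultra_quotient :: "('k, 'n) ring_scheme \<Rightarrow> 'k set \<Rightarrow> ('k, 'a) module \<Rightarrow> ('k, 'a set) module" where
  "ultra_quotient K B A = (let N = ultra_kernel K B A in
     \<lparr>carrier = a_rcosets\<^bsub>A\<^esub> N, mult = rcoset_mult A N, one = N, zero = N, add = set_add A,
      smult = (\<lambda>k X. \<Union>x\<in>X. N +>\<^bsub>A\<^esub> (k \<odot>\<^bsub>A\<^esub> x))\<rparr>)"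

definition ultra_quotient_grading ::
    "('k, 'n) ring_scheme \<Rightarrow> 'k set \<Rightarrow> ('k, 'a) module \<Rightarrow> ('g \<Rightarrow> 'a set) \<Rightarrow> 'g \<Rightarrow> 'a set set" where
  "ultra_quotient_grading K B A AG \<gamma> = {ultra_kernel K B A +>\<^bsub>A\<^esub> x | x. x \<in> AG \<gamma>}"

text \<open>
  For \<open>A\<close> contained in \<open>C\<close>, the map on quotients induced by the inclusion: it sends the coset of
  \<open>x\<close> to the coset of \<open>x\<close>.
\<close>

definition ultra_inclusion :: "('k, 'n) ring_scheme \<Rightarrow> 'k set \<Rightarrow> ('k, 'a) module \<Rightarrow> 'a set \<Rightarrow> 'a set" where
  "ultra_inclusion K B C X = (\<Union>x\<in>X. ultra_kernel K B C +>\<^bsub>C\<^esub> x)"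


section \<open>Graded algebras of quotients of Lie algebras\<close>

definition annihilator :: "('k, 'a) module \<Rightarrow> 'a set \<Rightarrow> 'a set" where
  "annihilator A I = {x \<in> carrier A. \<forall>y\<in>I. x \<otimes>\<^bsub>A\<^esub> y = \<zero>\<^bsub>A\<^esub>}"

definition graded_algebra_of_quotients ::
    "('k, 'n) ring_scheme \<Rightarrow> ('k, 'a) module \<Rightarrow> ('g::ab_group_add \<Rightarrow> 'a set)
      \<Rightarrow> ('k, 'q) module \<Rightarrow> ('g \<Rightarrow> 'q set) \<Rightarrow> ('a \<Rightarrow> 'q) \<Rightarrow> bool" where
  "graded_algebra_of_quotients K A AG Q QG e \<longleftrightarrow>
     graded_lie_algebra K A AG \<and> graded_lie_algebra K Q QG \<and> graded_embedding K A AG Q QG e \<and>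
     (\<forall>\<gamma>. \<forall>q\<in>QG \<gamma>. q \<noteq> \<zero>\<^bsub>Q\<^esub> \<longrightarrow>
        (\<exists>I. homogeneous_ideal K A AG I \<and> annihilator A I = {\<zero>\<^bsub>A\<^esub>} \<and>
             (\<forall>x\<in>I. e x \<otimes>\<^bsub>Q\<^esub> q \<in> e ` carrier A) \<and> (\<exists>x\<in>I. e x \<otimes>\<^bsub>Q\<^esub> q \<noteq> \<zero>\<^bsub>Q\<^esub>)))"

definition essential_ideals ::
    "('k, 'n) ring_scheme \<Rightarrow> ('k, 'a) module \<Rightarrow> ('g \<Rightarrow> 'a set) \<Rightarrow> 'a set set" where
  "essential_ideals K A AG =
     {I. homogeneous_ideal K A AG I \<and>
         (\<forall>J. homogeneous_ideal K A AG J \<and> J \<noteq> {\<zero>\<^bsub>A\<^esub>} \<longrightarrow> I \<inter> J \<noteq> {\<zero>\<^bsub>A\<^esub>})}"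

definition partial_derivations ::
    "('k, 'n) ring_scheme \<Rightarrow> ('k, 'a) module \<Rightarrow> ('g::ab_group_add \<Rightarrow> 'a set) \<Rightarrow> 'a set \<Rightarrow> 'g \<Rightarrow> ('a \<Rightarrow> 'a) set" where
  "partial_derivations K A AG I \<gamma> =
     {D \<in> I \<rightarrow>\<^sub>E carrier A.
        (\<forall>x\<in>I. \<forall>y\<in>I. D (x \<oplus>\<^bsub>A\<^esub> y) = D x \<oplus>\<^bsub>A\<^esub> D y \<and>
                       D (x \<otimes>\<^bsub>A\<^esub> y) = D x \<otimes>\<^bsub>A\<^esub> y \<oplus>\<^bsub>A\<^esub> x \<otimes>\<^bsub>A\<^esub> D y) \<and>
        (\<forall>k\<in>carrier K. \<forall>x\<in>I. D (k \<odot>\<^bsub>A\<^esub> x) = k \<odot>\<^bsub>A\<^esub> D x) \<and>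
        (\<forall>\<alpha>. D ` (I \<inter> AG \<alpha>) \<subseteq> AG (\<alpha> + \<gamma>))}"

text \<open>\<open>Q\<close>, with the embedding \<open>e\<close> of \<open>A\<close>, is a maximal graded algebra of quotients of \<open>A\<close>.\<close>

definition maximal_graded_quotients ::
    "('k, 'n) ring_scheme \<Rightarrow> ('k, 'a) module \<Rightarrow> ('g::ab_group_add \<Rightarrow> 'a set)
      \<Rightarrow> ('k, 'q) module \<Rightarrow> ('g \<Rightarrow> 'q set) \<Rightarrow> ('a \<Rightarrow> 'q) \<Rightarrow> bool" where
  "maximal_graded_quotients K A AG Q QG e \<longleftrightarrow>
     graded_lie_algebra K Q QG \<and> graded_embedding K A AG Q QG e \<and>
     (\<forall>\<gamma>. \<forall>x\<in>QG \<gamma>. \<exists>I\<in>essential_ideals K A AG. \<forall>a\<in>I. e a \<otimes>\<^bsub>Q\<^esub> x \<in> e ` carrier A) \<and>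
     (\<forall>\<gamma>. \<forall>x\<in>QG \<gamma>. \<forall>I\<in>essential_ideals K A AG.
        (\<forall>a\<in>I. e a \<otimes>\<^bsub>Q\<^esub> x = \<zero>\<^bsub>Q\<^esub>) \<longrightarrow> x = \<zero>\<^bsub>Q\<^esub>) \<and>
     (\<forall>\<gamma>. \<forall>I\<in>essential_ideals K A AG. \<forall>D\<in>partial_derivations K A AG I \<gamma>.
        \<exists>y\<in>QG \<gamma>. \<forall>a\<in>I. e a \<otimes>\<^bsub>Q\<^esub> y = e (D a))"

text \<open>
  The algebra \<open>Q\<close>, containing \<open>A\<close> through \<open>\<kappa>\<close>, is realised as a homogeneous submodule of the module
  \<open>J\<close> over the multiplication algebra of \<open>A\<close>. The operators of \<open>A\<close> act on \<open>Q\<close> by its scalars and by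
  left and right multiplication by elements of \<open>A\<close>.
\<close>

definition realised_in ::
    "('k, 'n) ring_scheme \<Rightarrow> ('k, 'a) module \<Rightarrow> ('a \<Rightarrow> 'a, 'j) module \<Rightarrow> ('g \<Rightarrow> 'j set) \<Rightarrow> ('a \<Rightarrow> 'j)
      \<Rightarrow> ('k, 'j) module \<Rightarrow> ('g \<Rightarrow> 'j set) \<Rightarrow> bool" where
  "realised_in K A J JG \<kappa> Q QG \<longleftrightarrow>
     homogeneous_right_submodule (mult_alg K A) J JG (carrier Q) \<and>
     (\<forall>\<gamma>. QG \<gamma> = carrier Q \<inter> JG \<gamma>) \<and> \<zero>\<^bsub>Q\<^esub> = \<zero>\<^bsub>J\<^esub> \<and>
     (\<forall>x\<in>carrier Q. \<forall>y\<in>carrier Q. x \<oplus>\<^bsub>Q\<^esub> y = x \<oplus>\<^bsub>J\<^esub> y) \<and>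
     (\<forall>k\<in>carrier K. \<forall>x\<in>carrier Q. k \<odot>\<^bsub>Q\<^esub> x = scalar_op A k \<odot>\<^bsub>J\<^esub> x) \<and>
     (\<forall>a\<in>carrier A. \<forall>x\<in>carrier Q.
        \<kappa> a \<otimes>\<^bsub>Q\<^esub> x = l_op A a \<odot>\<^bsub>J\<^esub> x \<and> x \<otimes>\<^bsub>Q\<^esub> \<kappa> a = r_op A a \<odot>\<^bsub>J\<^esub> x)"

end

(*
  Everything rests on nonsingularity: an element of the hull of R annihilated by an ideal with zero
  annihilator vanishes. Bracketing with an element of the central closure P maps an essential ideal of R
  into R, so P is an algebra of quotients of R; bracketing with it is a partial derivation on that ideal, which
  a maximal algebra of quotients realises. Nonsingularity also makes the extended centroid commutative
  and the bracket on P well defined, and injectivity of the hull turns the projection of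
  V + Ann V onto V, for an ideal V of P, into an idempotent supporting V.

  A family in the maximal algebra of quotients Q of P along a dense orthogonal set of idempotents
  defines a partial derivation on an essential ideal, which is induced by the orthogonal sum of the
  family; the grading of Q is finite, so this may be done degree by degree. For the quotients by an
  ultrafilter, Zorn's lemma gives, for every element u of Q and essential ideal U of P, an element k of
  the orthogonal completion of U such that every idempotent annihilating [k, u] annihilates u. Hence
  [k, u] cannot vanish in the quotient unless u does.
*)

theory Submission
  imports Defs
begin

section \<open>Graded abelian groups\<close>

definition component :: "('a, 'm) ring_scheme \<Rightarrow> ('g \<Rightarrow> 'a set) \<Rightarrow> 'g \<Rightarrow> 'a \<Rightarrow> 'a" where
  "component M C \<gamma> x = (THE f. fin_decomposition M C x f) \<gamma>"

lemma (in abelian_group) fin_decomposition_superset: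
  assumes "\<And>\<gamma>. f \<gamma> \<in> C \<gamma>" "\<And>\<gamma>. C \<gamma> \<subseteq> carrier G" "finite A" "{\<gamma>. f \<gamma> \<noteq> \<zero>} \<subseteq> A"
  shows "fin_decomposition G C x f \<longleftrightarrow> x = finsum G f A"
proof -
  have fin: "finite {\<gamma>. f \<gamma> \<noteq> \<zero>}" using assms finite_subset by blast
  have "finsum G f {\<gamma>. f \<gamma> \<noteq> \<zero>} = finsum G f A"
    by (rule add.finprod_mono_neutral_cong_left) (use assms in auto)
  then show ?thesis using assms fin by (simp add: fin_decomposition_def)
qed

lemma (in abelian_group) finsum_induct:
  assumes "finite A" "P \<zero>" "\<And>i. i \<in> A \<Longrightarrow> f i \<in> carrier G \<and> P (f i)"
    and "\<And>y z. \<lbrakk>y \<in> carrier G; z \<in> carrier G; P y; P z\<rbrakk> \<Longrightarrow> P (y \<oplus> z)"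
  shows "P (finsum G f A)"
  using assms(1,3)
proof (induction A)
  case empty
  then show ?case by (simp add: assms)
next
  case (insert i A)
  then have "f \<in> A \<rightarrow> carrier G" "f i \<in> carrier G" by auto
  with insert show ?case by (simp add: assms)
qed

lemma (in abelian_group) subgroup_add_monoidI:
  assumes "X \<subseteq> carrier G" "\<zero> \<in> X" "\<And>x y. \<lbrakk>x \<in> X; y \<in> X\<rbrakk> \<Longrightarrow> x \<oplus> y \<in> X"
    and "\<And>x. x \<in> X \<Longrightarrow> \<ominus> x \<in> X"
  shows "subgroup X (add_monoid G)"
  using assms by (intro subgroup.intro) (auto simp: a_inv_def)

lemma (in abelian_group) subgroup_add_monoidD:
  assumes "subgroup X (add_monoid G)"
  shows "X \<subseteq> carrier G" "\<zero> \<in> X" "\<lbrakk>x \<in> X; y \<in> X\<rbrakk> \<Longrightarrow> x \<oplus> y \<in> X" "x \<in> X \<Longrightarrow> \<ominus> x \<in> X"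
  using subgroup.subset[OF assms] subgroup.one_closed[OF assms] subgroup.m_closed[OF assms]
    subgroup.m_inv_closed[OF assms] by (auto simp: a_inv_def)

lemma (in abelian_group) neg_zero [simp]: "\<ominus> \<zero> = \<zero>"
  by (rule minus_equality) auto

text \<open>The maps \<open>c \<gamma>\<close> play the part of the projections onto the summands.\<close>

lemma (in abelian_group) internal_direct_sumI:
  assumes X: "subgroup X (add_monoid G)"
    and C: "\<And>\<gamma>. subgroup (C \<gamma>) (add_monoid G)" "\<And>\<gamma>. C \<gamma> \<subseteq> X"
    and c: "\<And>\<gamma> x. x \<in> X \<Longrightarrow> c \<gamma> x \<in> C \<gamma>"
    and add: "\<And>\<gamma> x y. \<lbrakk>x \<in> X; y \<in> X\<rbrakk> \<Longrightarrow> c \<gamma> (x \<oplus> y) = c \<gamma> x \<oplus> c \<gamma> y"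
    and hom: "\<And>\<gamma> \<delta> x. x \<in> C \<gamma> \<Longrightarrow> c \<delta> x = (if \<delta> = \<gamma> then x else \<zero>)"
    and fin: "\<And>x. x \<in> X \<Longrightarrow> finite {\<gamma>. c \<gamma> x \<noteq> \<zero>}"
    and inj: "\<And>x. \<lbrakk>x \<in> X; \<And>\<gamma>. c \<gamma> x = \<zero>\<rbrakk> \<Longrightarrow> x = \<zero>"
  shows "internal_direct_sum G X C" "x \<in> X \<Longrightarrow> component G C \<gamma> x = c \<gamma> x"
proof -
  note XD = subgroup_add_monoidD[OF X]
  have Xc: "x \<in> carrier G" if "x \<in> X" for x using that XD by auto
  have Cc: "x \<in> carrier G" if "x \<in> C \<gamma>" for x \<gamma> using that C(2) Xc by auto
  have sum_in: "finsum G f A \<in> X \<and> c \<delta> (finsum G f A) = (if \<delta> \<in> A then f \<delta> else \<zero>)"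
    if "finite A" "\<And>\<gamma>. f \<gamma> \<in> C \<gamma>" for f A \<delta>
    using that(1)
  proof (induction A)
    case empty
    have "c \<delta> \<zero> = \<zero>" using hom[of \<zero> \<delta> \<delta>] subgroup_add_monoidD(2)[OF C(1)] by auto
    then show ?case using XD by simp
  next
    case (insert i A)
    have f: "f \<in> A \<rightarrow> carrier G" "f i \<in> carrier G" "f \<delta> \<in> carrier G" using that Cc by auto
    have "f i \<in> X" using C(2) that(2) by auto
    then show ?case using insert f XD add[of "f i" "finsum G f A"] hom[OF that(2)[of i], of \<delta>] by auto
  qed
  have dec: "fin_decomposition G C x (\<lambda>\<gamma>. c \<gamma> x)" if x: "x \<in> X" for x
  proof -
    let ?A = "{\<gamma>. c \<gamma> x \<noteq> \<zero>}"
    let ?y = "finsum G (\<lambda>\<gamma>. c \<gamma> x) ?A"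
    have y: "?y \<in> X" "c \<delta> ?y = c \<delta> x" for \<delta>
      using sum_in[OF fin[OF x], of "\<lambda>\<gamma>. c \<gamma> x"] c[OF x] by auto
    have ny: "\<ominus> ?y \<in> X" using y XD by simp
    have "c \<gamma> (x \<oplus> \<ominus> ?y) = \<zero>" for \<gamma>
    proof -
      have "c \<gamma> ?y \<oplus> c \<gamma> (\<ominus> ?y) = c \<gamma> \<zero>" using add[OF y(1) ny] y Xc by (simp add: r_neg)
      then show ?thesis using add[OF x ny] y(2)[of \<gamma>] hom[of \<zero> \<gamma> \<gamma>] subgroup_add_monoidD(2)[OF C(1)] by auto
    qed
    then have "x \<oplus> \<ominus> ?y = \<zero>" using inj[of "x \<oplus> \<ominus> ?y"] x ny XD by auto
    then have "x = ?y" using minus_equality[of x "\<ominus> ?y"] x y Xc by simp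
    then show ?thesis using fin[OF x] c[OF x] by (simp add: fin_decomposition_def)
  qed
  have uniq: "f \<gamma> = c \<gamma> x" if "fin_decomposition G C x f" for f x \<gamma>
    using that sum_in[of "{\<gamma>. f \<gamma> \<noteq> \<zero>}" f \<gamma>] unfolding fin_decomposition_def by auto
  have ex1: "\<exists>!f. fin_decomposition G C x f" if "x \<in> X" for x
  proof (rule ex1I)
    show "fin_decomposition G C x (\<lambda>\<gamma>. c \<gamma> x)" by (rule dec[OF that])
    show "f = (\<lambda>\<gamma>. c \<gamma> x)" if "fin_decomposition G C x f" for f
      using uniq[OF that] by (rule ext)
  qed
  then show "internal_direct_sum G X C" using C by (simp add: internal_direct_sum_def)
  show "component G C \<gamma> x = c \<gamma> x" if "x \<in> X"
    unfolding component_def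
    by (subst the1_equality[OF ex1[OF that]]) (use dec[OF that] in auto)
qed

locale graded_group = abelian_group M
  for M :: "('a, 'm) ring_scheme" (structure) and MG :: "'g \<Rightarrow> 'a set" +
  assumes direct: "internal_direct_sum M (carrier M) MG"
begin

abbreviation "cmp \<equiv> component M MG"

lemma grade_subgroup: "subgroup (MG \<gamma>) (add_monoid M)"
  using direct by (simp add: internal_direct_sum_def)

lemma grade_closed: "x \<in> MG \<gamma> \<Longrightarrow> x \<in> carrier M"
  using direct by (auto simp: internal_direct_sum_def)

lemmas grade_zero = subgroup_add_monoidD(2)[OF grade_subgroup]
  and grade_add = subgroup_add_monoidD(3)[OF grade_subgroup]
  and grade_neg = subgroup_add_monoidD(4)[OF grade_subgroup]

lemma component_unique:
  assumes "x \<in> carrier M" "fin_decomposition M MG x f"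
  shows "cmp \<gamma> x = f \<gamma>"
  using direct assms unfolding component_def internal_direct_sum_def
  by (metis the1_equality)

lemma component_decomposition:
  assumes "x \<in> carrier M"
  shows "fin_decomposition M MG x (\<lambda>\<gamma>. cmp \<gamma> x)"
proof -
  obtain f where f: "fin_decomposition M MG x f"
    using direct assms unfolding internal_direct_sum_def by blast
  have "(\<lambda>\<gamma>. cmp \<gamma> x) = f" using component_unique[OF assms f] by blast
  with f show ?thesis by simp
qed

lemma component_in: "x \<in> carrier M \<Longrightarrow> cmp \<gamma> x \<in> MG \<gamma>"
  and finite_components: "x \<in> carrier M \<Longrightarrow> finite {\<gamma>. cmp \<gamma> x \<noteq> \<zero>}"
  and component_sum: "x \<in> carrier M \<Longrightarrow> x = finsum M (\<lambda>\<gamma>. cmp \<gamma> x) {\<gamma>. cmp \<gamma> x \<noteq> \<zero>}"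
  using component_decomposition unfolding fin_decomposition_def by blast+

lemma component_closed: "x \<in> carrier M \<Longrightarrow> cmp \<gamma> x \<in> carrier M"
  using component_in grade_closed by blast

lemma component_homogeneous:
  assumes "x \<in> MG \<gamma>"
  shows "cmp \<delta> x = (if \<delta> = \<gamma> then x else \<zero>)"
proof -
  have "fin_decomposition M MG x (\<lambda>\<delta>. if \<delta> = \<gamma> then x else \<zero>)"
    by (subst fin_decomposition_superset[where A = "{\<gamma>}"])
      (use assms grade_zero grade_closed in \<open>auto simp: split: if_splits\<close>)
  then show ?thesis using component_unique assms grade_closed by blast
qed

lemma component_zero: "cmp \<delta> \<zero> = \<zero>"
  using component_homogeneous[OF grade_zero] by auto

lemma component_add:
  assumes "x \<in> carrier M" "y \<in> carrier M"
  shows "cmp \<gamma> (x \<oplus> y) = cmp \<gamma> x \<oplus> cmp \<gamma> y"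
proof -
  let ?A = "{\<gamma>. cmp \<gamma> x \<noteq> \<zero>} \<union> {\<gamma>. cmp \<gamma> y \<noteq> \<zero>}"
  have A: "finite ?A" using assms finite_components by simp
  have s: "z = finsum M (\<lambda>\<gamma>. cmp \<gamma> z) ?A" if "z = x \<or> z = y" for z
  proof -
    have "z \<in> carrier M" "{\<gamma>. cmp \<gamma> z \<noteq> \<zero>} \<subseteq> ?A" using that assms by auto
    note z = this
    have "fin_decomposition M MG z (\<lambda>\<gamma>. cmp \<gamma> z) \<longleftrightarrow> z = finsum M (\<lambda>\<gamma>. cmp \<gamma> z) ?A"
      by (rule fin_decomposition_superset[OF component_in[OF z(1)] _ A z(2)])
        (simp add: subsetI grade_closed)
    with component_decomposition[OF z(1)] show ?thesis by (rule rev_iffD1)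
  qed
  have "x \<oplus> y = finsum M (\<lambda>\<gamma>. cmp \<gamma> x \<oplus> cmp \<gamma> y) ?A"
    by (subst finsum_addf) (use s assms component_closed in auto)
  then have "fin_decomposition M MG (x \<oplus> y) (\<lambda>\<gamma>. cmp \<gamma> x \<oplus> cmp \<gamma> y)"
    by (subst fin_decomposition_superset[where A = ?A])
      (use A assms component_in grade_closed grade_add in auto)
  then show ?thesis using component_unique[of "x \<oplus> y"] assms by simp
qed

lemma component_neg:
  assumes "x \<in> carrier M"
  shows "cmp \<gamma> (\<ominus> x) = \<ominus> (cmp \<gamma> x)"
proof -
  have "cmp \<gamma> x \<oplus> cmp \<gamma> (\<ominus> x) = \<zero>"
    using component_add[of x "\<ominus> x" \<gamma>] assms by (simp add: r_neg component_zero)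
  then show ?thesis using assms component_closed by (metis a_inv_closed minus_equality a_comm)
qed

lemma component_eqI:
  assumes "x \<in> carrier M" "y \<in> carrier M" "\<And>\<gamma>. cmp \<gamma> x = cmp \<gamma> y"
  shows "x = y"
  using component_sum[OF assms(1)] component_sum[OF assms(2)] assms(3) by simp

lemma component_induct:
  assumes "x \<in> carrier M" "P \<zero>" "\<And>\<gamma>. P (cmp \<gamma> x)"
    and "\<And>y z. \<lbrakk>y \<in> carrier M; z \<in> carrier M; P y; P z\<rbrakk> \<Longrightarrow> P (y \<oplus> z)"
  shows "P x"
  by (subst component_sum[OF assms(1)], rule finsum_induct)
    (use assms finite_components component_closed in auto)

lemma homogeneous_induct:
  assumes "x \<in> carrier M" "\<And>\<gamma> y. y \<in> MG \<gamma> \<Longrightarrow> P y"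
    and "\<And>y z. \<lbrakk>y \<in> carrier M; z \<in> carrier M; P y; P z\<rbrakk> \<Longrightarrow> P (y \<oplus> z)"
  shows "P x"
  using assms(1)
proof (rule component_induct)
  show "P \<zero>" using assms(2)[OF grade_zero] .
  show "P (cmp \<gamma> x)" for \<gamma> using assms(2)[OF component_in] assms(1) by simp
qed (use assms in blast)

lemma homogeneousI:
  assumes "subgroup X (add_monoid M)" "\<And>x \<gamma>. x \<in> X \<Longrightarrow> cmp \<gamma> x \<in> X"
  shows "homogeneous M MG X"
  unfolding homogeneous_def
proof (rule internal_direct_sumI(1)[where c = cmp])
  note XD = subgroup_add_monoidD[OF assms(1)]
  show "subgroup (X \<inter> MG \<gamma>) (add_monoid M)" for \<gamma>
    by (rule add.subgroups_Inter_pair[OF assms(1) grade_subgroup])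
  show "finite {\<gamma>. cmp \<gamma> x \<noteq> \<zero>}" if "x \<in> X" for x
    using finite_components that XD by auto
  show "x = \<zero>" if "x \<in> X" "\<And>\<gamma>. cmp \<gamma> x = \<zero>" for x
    using component_eqI[of x \<zero>] that XD component_zero by auto
  show "cmp \<gamma> x \<in> X \<inter> MG \<gamma>" if "x \<in> X" for \<gamma> x
    using assms(2) component_in XD that by auto
  show "cmp \<gamma> (x \<oplus> y) = cmp \<gamma> x \<oplus> cmp \<gamma> y" if "x \<in> X" "y \<in> X" for \<gamma> x y
    by (rule component_add) (use that XD in auto)
qed (use assms component_homogeneous in auto)

lemma homogeneousD:
  assumes "homogeneous M MG X" "x \<in> X" "X \<subseteq> carrier M"
  shows "cmp \<gamma> x \<in> X"
proof -
  obtain f where f: "fin_decomposition M (\<lambda>\<gamma>. X \<inter> MG \<gamma>) x f"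
    using assms unfolding homogeneous_def internal_direct_sum_def by blast
  then have "fin_decomposition M MG x f" by (auto simp: fin_decomposition_def)
  then show ?thesis using f component_unique[of x f] assms by (auto simp: fin_decomposition_def)
qed

lemma homogeneous_iff:
  assumes "subgroup X (add_monoid M)"
  shows "homogeneous M MG X \<longleftrightarrow> (\<forall>x\<in>X. \<forall>\<gamma>. cmp \<gamma> x \<in> X)"
  using homogeneousI[OF assms] homogeneousD subgroup_add_monoidD(1)[OF assms] by blast

end

lemma additive_zero:
  assumes "abelian_group M" "abelian_group N" "h \<in> carrier M \<rightarrow> carrier N"
    and "\<And>x y. \<lbrakk>x \<in> carrier M; y \<in> carrier M\<rbrakk> \<Longrightarrow> h (x \<oplus>\<^bsub>M\<^esub> y) = h x \<oplus>\<^bsub>N\<^esub> h y"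
  shows "h \<zero>\<^bsub>M\<^esub> = \<zero>\<^bsub>N\<^esub>"
proof -
  interpret M: abelian_group M by fact
  interpret N: abelian_group N by fact
  have "h \<zero>\<^bsub>M\<^esub> \<oplus>\<^bsub>N\<^esub> h \<zero>\<^bsub>M\<^esub> = h \<zero>\<^bsub>M\<^esub>" using assms(4)[of "\<zero>\<^bsub>M\<^esub>" "\<zero>\<^bsub>M\<^esub>"] by simp
  then show ?thesis using assms(3) N.add.r_cancel_one' by (metis M.zero_closed PiE)
qed

lemma additive_neg:
  assumes "abelian_group M" "abelian_group N" "h \<in> carrier M \<rightarrow> carrier N"
    and "\<And>x y. \<lbrakk>x \<in> carrier M; y \<in> carrier M\<rbrakk> \<Longrightarrow> h (x \<oplus>\<^bsub>M\<^esub> y) = h x \<oplus>\<^bsub>N\<^esub> h y"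
    and "x \<in> carrier M"
  shows "h (\<ominus>\<^bsub>M\<^esub> x) = \<ominus>\<^bsub>N\<^esub> h x"
proof -
  interpret M: abelian_group M by fact
  interpret N: abelian_group N by fact
  have "h (\<ominus>\<^bsub>M\<^esub> x) \<oplus>\<^bsub>N\<^esub> h x = \<zero>\<^bsub>N\<^esub>"
    using assms(4)[of "\<ominus>\<^bsub>M\<^esub> x" x] assms(5) additive_zero[OF assms(1-4)] by (simp add: M.l_neg)
  then show ?thesis using assms(3,5) by (intro N.minus_equality[symmetric]) (auto simp: Pi_iff)
qed

lemma component_hom:
  fixes MG :: "'g::ab_group_add \<Rightarrow> 'a set"
  assumes "graded_group M MG" "graded_group N NG" "h \<in> carrier M \<rightarrow> carrier N"
    and add: "\<And>x y. \<lbrakk>x \<in> carrier M; y \<in> carrier M\<rbrakk> \<Longrightarrow> h (x \<oplus>\<^bsub>M\<^esub> y) = h x \<oplus>\<^bsub>N\<^esub> h y"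
    and deg: "\<And>\<gamma> x. x \<in> MG \<gamma> \<Longrightarrow> h x \<in> NG (\<gamma> + \<alpha>)"
    and x: "x \<in> carrier M"
  shows "component N NG (\<gamma> + \<alpha>) (h x) = h (component M MG \<gamma> x)"
proof -
  interpret M: graded_group M MG by fact
  interpret N: graded_group N NG by fact
  have h0: "h \<zero>\<^bsub>M\<^esub> = \<zero>\<^bsub>N\<^esub>"
    by (rule additive_zero[OF M.abelian_group_axioms N.abelian_group_axioms assms(3) add])
  show ?thesis using x
  proof (rule M.homogeneous_induct)
    fix \<delta> y assume y: "y \<in> MG \<delta>"
    then show "component N NG (\<gamma> + \<alpha>) (h y) = h (component M MG \<gamma> y)"
      using N.component_homogeneous[OF deg[OF y], of "\<gamma> + \<alpha>"] M.component_homogeneous[OF y, of \<gamma>] h0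
      by simp
  next
    fix y z assume "y \<in> carrier M" "z \<in> carrier M"
      "component N NG (\<gamma> + \<alpha>) (h y) = h (component M MG \<gamma> y)"
      "component N NG (\<gamma> + \<alpha>) (h z) = h (component M MG \<gamma> z)"
    then show "component N NG (\<gamma> + \<alpha>) (h (y \<oplus>\<^bsub>M\<^esub> z)) = h (component M MG \<gamma> (y \<oplus>\<^bsub>M\<^esub> z))"
      using assms(3) by (simp add: add M.component_add N.component_add M.component_closed Pi_iff)
  qed
qed

lemma (in abelian_group) abelian_group_restrict:
  assumes X: "subgroup X (add_monoid G)" and N: "carrier N = X" "\<zero>\<^bsub>N\<^esub> = \<zero>"
    and add: "\<And>x y. \<lbrakk>x \<in> X; y \<in> X\<rbrakk> \<Longrightarrow> x \<oplus>\<^bsub>N\<^esub> y = x \<oplus> y"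
  shows "abelian_group N" "\<And>x. x \<in> X \<Longrightarrow> \<ominus>\<^bsub>N\<^esub> x = \<ominus> x"
proof -
  note XD = subgroup_add_monoidD[OF X]
  have Xc: "x \<in> X \<Longrightarrow> x \<in> carrier G" for x using XD by auto
  show ab: "abelian_group N"
  proof (rule abelian_groupI)
    show "\<exists>y\<in>carrier N. y \<oplus>\<^bsub>N\<^esub> x = \<zero>\<^bsub>N\<^esub>" if "x \<in> carrier N" for x
      using that XD(4) Xc l_neg unfolding N by (intro bexI[of _ "\<ominus> x"]) (simp_all add: add)
    show "x \<oplus>\<^bsub>N\<^esub> y \<oplus>\<^bsub>N\<^esub> z = x \<oplus>\<^bsub>N\<^esub> (y \<oplus>\<^bsub>N\<^esub> z)"
      if "x \<in> carrier N" "y \<in> carrier N" "z \<in> carrier N" for x y z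
      using that XD(3) Xc a_assoc unfolding N by (simp add: add)
    show "x \<oplus>\<^bsub>N\<^esub> y = y \<oplus>\<^bsub>N\<^esub> x" if "x \<in> carrier N" "y \<in> carrier N" for x y
      using that Xc a_comm[of x y] unfolding N by (simp add: add)
  qed (use XD Xc in \<open>simp_all add: N add\<close>)
  show "\<ominus>\<^bsub>N\<^esub> x = \<ominus> x" if "x \<in> X" for x
  proof (rule abelian_group.minus_equality[OF ab])
    show "\<ominus> x \<oplus>\<^bsub>N\<^esub> x = \<zero>\<^bsub>N\<^esub>" using add[OF XD(4)[OF that] that] l_neg[OF Xc[OF that]] N by simp
  qed (use that XD(4) N in simp_all)
qed

lemma (in graded_group) graded_group_restrict:
  assumes X: "subgroup X (add_monoid M)" "homogeneous M MG X" and N: "carrier N = X" "\<zero>\<^bsub>N\<^esub> = \<zero>"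
    and add: "\<And>x y. \<lbrakk>x \<in> X; y \<in> X\<rbrakk> \<Longrightarrow> x \<oplus>\<^bsub>N\<^esub> y = x \<oplus> y"
  shows "graded_group N (\<lambda>\<gamma>. X \<inter> MG \<gamma>)"
    and "x \<in> X \<Longrightarrow> component N (\<lambda>\<gamma>. X \<inter> MG \<gamma>) \<gamma> x = cmp \<gamma> x"
proof -
  note XD = subgroup_add_monoidD[OF X(1)] and R = abelian_group_restrict[OF X(1) N add]
  interpret N: abelian_group N by (rule R(1))
  have sub: "subgroup (X \<inter> MG \<gamma>) (add_monoid N)" for \<gamma>
    by (rule N.subgroup_add_monoidI)
      (use N add XD grade_zero grade_add grade_neg R(2) in auto)
  have all: "subgroup (carrier N) (add_monoid N)" using N.add.subgroup_self by simp
  have 1: "x = \<zero>\<^bsub>N\<^esub>" if "x \<in> carrier N" "\<And>\<gamma>. cmp \<gamma> x = \<zero>\<^bsub>N\<^esub>" for x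
    using component_eqI[of x \<zero>] that N XD component_zero by auto
  have 2: "cmp \<gamma> x \<in> X \<inter> MG \<gamma>" if "x \<in> carrier N" for x \<gamma>
    using that N XD homogeneousD[OF X(2)] component_in by auto
  have 3: "cmp \<gamma> (x \<oplus>\<^bsub>N\<^esub> y) = cmp \<gamma> x \<oplus>\<^bsub>N\<^esub> cmp \<gamma> y" if "x \<in> carrier N" "y \<in> carrier N" for x y \<gamma>
  proof -
    have "x \<in> carrier M" "y \<in> carrier M" using that N XD by auto
    then show ?thesis
      using component_add that 2[OF that(1), of \<gamma>] 2[OF that(2), of \<gamma>] N by (simp add: add)
  qed
  have 4: "finite {\<gamma>. cmp \<gamma> x \<noteq> \<zero>\<^bsub>N\<^esub>}" if "x \<in> carrier N" for x
    using that N XD finite_components by auto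
  have 5: "cmp \<delta> x = (if \<delta> = \<gamma> then x else \<zero>\<^bsub>N\<^esub>)" if "x \<in> X \<inter> MG \<gamma>" for x \<gamma> \<delta>
    using that N component_homogeneous by auto
  have 6: "X \<inter> MG \<gamma> \<subseteq> carrier N" for \<gamma> using N by auto
  note C = N.internal_direct_sumI[where c = cmp, OF all sub 6 2 3 5 4 1]
  show "graded_group N (\<lambda>\<gamma>. X \<inter> MG \<gamma>)" by (intro graded_group.intro graded_group_axioms.intro R(1) C(1))
  show "component N (\<lambda>\<gamma>. X \<inter> MG \<gamma>) \<gamma> x = cmp \<gamma> x" if "x \<in> X"
  proof (rule C(2))
    show "x \<in> carrier N" unfolding N(1) by (rule that)
  qed
qed

section \<open>Homogeneous ideals of graded Lie algebras\<close>

sublocale graded_algebra \<subseteq> graded_group A AG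
  by (intro graded_group.intro graded_group_axioms.intro grading_direct) unfold_locales

context nonassoc_algebra
begin

lemma prod_l_zero: "x \<in> carrier A \<Longrightarrow> \<zero>\<^bsub>A\<^esub> \<otimes>\<^bsub>A\<^esub> x = \<zero>\<^bsub>A\<^esub>"
  using additive_zero[OF M.abelian_group_axioms M.abelian_group_axioms, of "\<lambda>y. y \<otimes>\<^bsub>A\<^esub> x"]
  by (auto simp: prod_closed prod_l_distr)

lemma prod_r_zero: "x \<in> carrier A \<Longrightarrow> x \<otimes>\<^bsub>A\<^esub> \<zero>\<^bsub>A\<^esub> = \<zero>\<^bsub>A\<^esub>"
  using additive_zero[OF M.abelian_group_axioms M.abelian_group_axioms, of "\<lambda>y. x \<otimes>\<^bsub>A\<^esub> y"]
  by (auto simp: prod_closed prod_r_distr)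

lemma prod_l_neg: "\<lbrakk>x \<in> carrier A; y \<in> carrier A\<rbrakk> \<Longrightarrow> (\<ominus>\<^bsub>A\<^esub> x) \<otimes>\<^bsub>A\<^esub> y = \<ominus>\<^bsub>A\<^esub> (x \<otimes>\<^bsub>A\<^esub> y)"
  using additive_neg[OF M.abelian_group_axioms M.abelian_group_axioms, of "\<lambda>z. z \<otimes>\<^bsub>A\<^esub> y"]
  by (auto simp: prod_closed prod_l_distr)

lemma prod_r_neg: "\<lbrakk>x \<in> carrier A; y \<in> carrier A\<rbrakk> \<Longrightarrow> x \<otimes>\<^bsub>A\<^esub> (\<ominus>\<^bsub>A\<^esub> y) = \<ominus>\<^bsub>A\<^esub> (x \<otimes>\<^bsub>A\<^esub> y)"
  using additive_neg[OF M.abelian_group_axioms M.abelian_group_axioms, of "\<lambda>z. x \<otimes>\<^bsub>A\<^esub> z"]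
  by (auto simp: prod_closed prod_r_distr)

end

context graded_algebra
begin

lemma component_prod_right:
  assumes "x \<in> carrier A" "y \<in> AG \<beta>"
  shows "component A AG (\<gamma> + \<beta>) (x \<otimes>\<^bsub>A\<^esub> y) = component A AG \<gamma> x \<otimes>\<^bsub>A\<^esub> y"
  by (rule component_hom[OF graded_group_axioms graded_group_axioms])
    (use assms grade_closed prod_closed prod_l_distr grading_prod in auto)

lemma component_prod_left:
  assumes "x \<in> AG \<alpha>" "y \<in> carrier A"
  shows "component A AG (\<gamma> + \<alpha>) (x \<otimes>\<^bsub>A\<^esub> y) = x \<otimes>\<^bsub>A\<^esub> component A AG \<gamma> y"
proof (rule component_hom[OF graded_group_axioms graded_group_axioms])
  show "x \<otimes>\<^bsub>A\<^esub> z \<in> AG (\<gamma> + \<alpha>)" if "z \<in> AG \<gamma>" for z \<gamma>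
    using grading_prod[OF assms(1) that] by (simp add: add.commute)
qed (use assms grade_closed prod_closed prod_r_distr in auto)

lemma grade_smult: "\<lbrakk>k \<in> carrier K; x \<in> AG \<gamma>\<rbrakk> \<Longrightarrow> k \<odot>\<^bsub>A\<^esub> x \<in> AG \<gamma>"
  using submodule.smult_closed[OF grading_submodule] .

lemma component_smult:
  assumes "k \<in> carrier K" "x \<in> carrier A"
  shows "component A AG \<gamma> (k \<odot>\<^bsub>A\<^esub> x) = k \<odot>\<^bsub>A\<^esub> component A AG \<gamma> x"
  using component_hom[OF graded_group_axioms graded_group_axioms, of "\<lambda>x. k \<odot>\<^bsub>A\<^esub> x" 0 x \<gamma>] assms
  by (auto simp: smult_r_distr grade_smult)

lemma homogeneous_submodule_iff:
  assumes "submodule V K A"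
  shows "homogeneous A AG V \<longleftrightarrow> (\<forall>x\<in>V. \<forall>\<gamma>. component A AG \<gamma> x \<in> V)"
  by (rule homogeneous_iff[OF submodule.axioms(1)[OF assms]])

lemma homogeneous_idealD:
  assumes "homogeneous_ideal K A AG V"
  shows "submodule V K A" "subgroup V (add_monoid A)" "V \<subseteq> carrier A" "\<zero>\<^bsub>A\<^esub> \<in> V"
    and "\<lbrakk>x \<in> V; y \<in> V\<rbrakk> \<Longrightarrow> x \<oplus>\<^bsub>A\<^esub> y \<in> V" "x \<in> V \<Longrightarrow> \<ominus>\<^bsub>A\<^esub> x \<in> V"
    and "\<lbrakk>k \<in> carrier K; x \<in> V\<rbrakk> \<Longrightarrow> k \<odot>\<^bsub>A\<^esub> x \<in> V"
    and "\<lbrakk>a \<in> carrier A; x \<in> V\<rbrakk> \<Longrightarrow> a \<otimes>\<^bsub>A\<^esub> x \<in> V" "\<lbrakk>a \<in> carrier A; x \<in> V\<rbrakk> \<Longrightarrow> x \<otimes>\<^bsub>A\<^esub> a \<in> V"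
    and "x \<in> V \<Longrightarrow> component A AG \<gamma> x \<in> V"
proof -
  show V: "submodule V K A" using assms by (simp add: homogeneous_ideal_def)
  show sub: "subgroup V (add_monoid A)" using V by (rule submodule.axioms(1))
  show "V \<subseteq> carrier A" "\<zero>\<^bsub>A\<^esub> \<in> V" "\<lbrakk>x \<in> V; y \<in> V\<rbrakk> \<Longrightarrow> x \<oplus>\<^bsub>A\<^esub> y \<in> V" "x \<in> V \<Longrightarrow> \<ominus>\<^bsub>A\<^esub> x \<in> V"
    using M.subgroup_add_monoidD[OF sub] by auto
  show "\<lbrakk>k \<in> carrier K; x \<in> V\<rbrakk> \<Longrightarrow> k \<odot>\<^bsub>A\<^esub> x \<in> V" using submodule.smult_closed[OF V] .
  show "\<lbrakk>a \<in> carrier A; x \<in> V\<rbrakk> \<Longrightarrow> a \<otimes>\<^bsub>A\<^esub> x \<in> V" "\<lbrakk>a \<in> carrier A; x \<in> V\<rbrakk> \<Longrightarrow> x \<otimes>\<^bsub>A\<^esub> a \<in> V"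
    using assms by (auto simp: homogeneous_ideal_def)
  show "x \<in> V \<Longrightarrow> component A AG \<gamma> x \<in> V"
    using assms homogeneous_submodule_iff[OF V] by (auto simp: homogeneous_ideal_def)
qed

lemma homogeneous_idealI:
  assumes "V \<subseteq> carrier A" "\<zero>\<^bsub>A\<^esub> \<in> V" "\<And>x y. \<lbrakk>x \<in> V; y \<in> V\<rbrakk> \<Longrightarrow> x \<oplus>\<^bsub>A\<^esub> y \<in> V"
    and smult: "\<And>k x. \<lbrakk>k \<in> carrier K; x \<in> V\<rbrakk> \<Longrightarrow> k \<odot>\<^bsub>A\<^esub> x \<in> V"
    and "\<And>a x. \<lbrakk>a \<in> carrier A; x \<in> V\<rbrakk> \<Longrightarrow> a \<otimes>\<^bsub>A\<^esub> x \<in> V"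
    and "\<And>a x. \<lbrakk>a \<in> carrier A; x \<in> V\<rbrakk> \<Longrightarrow> x \<otimes>\<^bsub>A\<^esub> a \<in> V"
    and "\<And>\<gamma> x. x \<in> V \<Longrightarrow> component A AG \<gamma> x \<in> V"
  shows "homogeneous_ideal K A AG V"
proof -
  have neg: "\<ominus>\<^bsub>A\<^esub> x \<in> V" if "x \<in> V" for x
  proof -
    have "\<ominus>\<^bsub>A\<^esub> x = (\<ominus>\<^bsub>K\<^esub> \<one>\<^bsub>K\<^esub>) \<odot>\<^bsub>A\<^esub> x" using that assms(1) by (simp add: smult_l_minus subset_iff)
    then show ?thesis using smult[of "\<ominus>\<^bsub>K\<^esub> \<one>\<^bsub>K\<^esub>" x] that by simp
  qed
  have "submodule V K A" by (rule submoduleI) (use assms neg in auto)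
  then show ?thesis using assms homogeneous_submodule_iff by (auto simp: homogeneous_ideal_def)
qed

lemma homogeneous_ideal_inter:
  assumes "homogeneous_ideal K A AG V" "homogeneous_ideal K A AG W"
  shows "homogeneous_ideal K A AG (V \<inter> W)"
  by (rule homogeneous_idealI) (use homogeneous_idealD[OF assms(1)] homogeneous_idealD[OF assms(2)] in auto)

lemma homogeneous_ideal_carrier: "homogeneous_ideal K A AG (carrier A)"
  by (rule homogeneous_idealI) (auto simp: prod_closed component_closed)

lemma homogeneous_annihilates:
  assumes "homogeneous_ideal K A AG V" "x \<in> carrier A" "\<And>y. y \<in> V \<Longrightarrow> x \<otimes>\<^bsub>A\<^esub> y = \<zero>\<^bsub>A\<^esub>" "y \<in> V"
  shows "component A AG \<gamma> x \<otimes>\<^bsub>A\<^esub> y = \<zero>\<^bsub>A\<^esub>"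
proof -
  note V = homogeneous_idealD[OF assms(1)]
  have "y \<in> carrier A" using V assms by auto
  then show ?thesis
  proof (rule component_induct)
    fix \<delta>
    have "component A AG \<gamma> x \<otimes>\<^bsub>A\<^esub> component A AG \<delta> y
        = component A AG (\<gamma> + \<delta>) (x \<otimes>\<^bsub>A\<^esub> component A AG \<delta> y)"
      using assms V(3) component_in by (subst component_prod_right) auto
    also have "\<dots> = \<zero>\<^bsub>A\<^esub>" using assms V by (simp add: component_zero)
    finally show "component A AG \<gamma> x \<otimes>\<^bsub>A\<^esub> component A AG \<delta> y = \<zero>\<^bsub>A\<^esub>" .
  qed (use assms in \<open>auto simp: prod_r_zero prod_r_distr component_closed\<close>)
qed

end

context graded_lie_algebra
begin

lemma anticommutative:
  assumes "x \<in> carrier A" "y \<in> carrier A"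
  shows "y \<otimes>\<^bsub>A\<^esub> x = \<ominus>\<^bsub>A\<^esub> (x \<otimes>\<^bsub>A\<^esub> y)"
proof -
  have "(y \<oplus>\<^bsub>A\<^esub> x) \<otimes>\<^bsub>A\<^esub> (y \<oplus>\<^bsub>A\<^esub> x) = (y \<otimes>\<^bsub>A\<^esub> y \<oplus>\<^bsub>A\<^esub> y \<otimes>\<^bsub>A\<^esub> x) \<oplus>\<^bsub>A\<^esub> (x \<otimes>\<^bsub>A\<^esub> y \<oplus>\<^bsub>A\<^esub> x \<otimes>\<^bsub>A\<^esub> x)"
    using assms by (simp add: prod_l_distr prod_r_distr prod_closed M.a_ac)
  then have "y \<otimes>\<^bsub>A\<^esub> x \<oplus>\<^bsub>A\<^esub> x \<otimes>\<^bsub>A\<^esub> y = \<zero>\<^bsub>A\<^esub>"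
    using assms by (simp add: alternating prod_closed)
  then show ?thesis using assms M.minus_equality prod_closed by metis
qed

lemma leibniz:
  assumes "x \<in> carrier A" "y \<in> carrier A" "z \<in> carrier A"
  shows "(x \<otimes>\<^bsub>A\<^esub> y) \<otimes>\<^bsub>A\<^esub> z = (x \<otimes>\<^bsub>A\<^esub> z) \<otimes>\<^bsub>A\<^esub> y \<oplus>\<^bsub>A\<^esub> x \<otimes>\<^bsub>A\<^esub> (y \<otimes>\<^bsub>A\<^esub> z)"
proof -
  have 1: "(y \<otimes>\<^bsub>A\<^esub> z) \<otimes>\<^bsub>A\<^esub> x = \<ominus>\<^bsub>A\<^esub> (x \<otimes>\<^bsub>A\<^esub> (y \<otimes>\<^bsub>A\<^esub> z))"
    using assms anticommutative[of x "y \<otimes>\<^bsub>A\<^esub> z"] by (simp add: prod_closed)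
  have 2: "(z \<otimes>\<^bsub>A\<^esub> x) \<otimes>\<^bsub>A\<^esub> y = \<ominus>\<^bsub>A\<^esub> ((x \<otimes>\<^bsub>A\<^esub> z) \<otimes>\<^bsub>A\<^esub> y)"
    using assms anticommutative[of x z] by (simp add: prod_l_neg prod_closed)
  have "(x \<otimes>\<^bsub>A\<^esub> y) \<otimes>\<^bsub>A\<^esub> z \<oplus>\<^bsub>A\<^esub> (\<ominus>\<^bsub>A\<^esub> (x \<otimes>\<^bsub>A\<^esub> (y \<otimes>\<^bsub>A\<^esub> z)) \<oplus>\<^bsub>A\<^esub> \<ominus>\<^bsub>A\<^esub> ((x \<otimes>\<^bsub>A\<^esub> z) \<otimes>\<^bsub>A\<^esub> y)) = \<zero>\<^bsub>A\<^esub>"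
    using jacobi[OF assms] assms unfolding 1 2 by (simp add: prod_closed M.a_assoc)
  then have "\<ominus>\<^bsub>A\<^esub> (\<ominus>\<^bsub>A\<^esub> (x \<otimes>\<^bsub>A\<^esub> (y \<otimes>\<^bsub>A\<^esub> z)) \<oplus>\<^bsub>A\<^esub> \<ominus>\<^bsub>A\<^esub> ((x \<otimes>\<^bsub>A\<^esub> z) \<otimes>\<^bsub>A\<^esub> y)) = (x \<otimes>\<^bsub>A\<^esub> y) \<otimes>\<^bsub>A\<^esub> z"
    using assms by (intro M.minus_equality) (auto simp: prod_closed)
  then show ?thesis using assms by (simp add: M.minus_add prod_closed M.a_comm)
qed

lemma leibniz_right:
  assumes "x \<in> carrier A" "y \<in> carrier A" "z \<in> carrier A"
  shows "x \<otimes>\<^bsub>A\<^esub> (y \<otimes>\<^bsub>A\<^esub> z) = (x \<otimes>\<^bsub>A\<^esub> y) \<otimes>\<^bsub>A\<^esub> z \<ominus>\<^bsub>A\<^esub> (x \<otimes>\<^bsub>A\<^esub> z) \<otimes>\<^bsub>A\<^esub> y"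
  unfolding leibniz[OF assms] using assms
  by (simp add: prod_closed a_minus_def M.a_comm[of _ "x \<otimes>\<^bsub>A\<^esub> (y \<otimes>\<^bsub>A\<^esub> z)"] M.a_assoc M.r_neg)

lemma homogeneous_idealI_left:
  assumes "V \<subseteq> carrier A" "\<zero>\<^bsub>A\<^esub> \<in> V" "\<And>x y. \<lbrakk>x \<in> V; y \<in> V\<rbrakk> \<Longrightarrow> x \<oplus>\<^bsub>A\<^esub> y \<in> V"
    and smult: "\<And>k x. \<lbrakk>k \<in> carrier K; x \<in> V\<rbrakk> \<Longrightarrow> k \<odot>\<^bsub>A\<^esub> x \<in> V"
    and l: "\<And>a x. \<lbrakk>a \<in> carrier A; x \<in> V\<rbrakk> \<Longrightarrow> a \<otimes>\<^bsub>A\<^esub> x \<in> V"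
    and "\<And>\<gamma> x. x \<in> V \<Longrightarrow> component A AG \<gamma> x \<in> V"
  shows "homogeneous_ideal K A AG V"
proof (rule homogeneous_idealI)
  fix a x assume ax: "a \<in> carrier A" "x \<in> V"
  then have x: "x \<in> carrier A" using assms(1) by auto
  have "x \<otimes>\<^bsub>A\<^esub> a = (\<ominus>\<^bsub>K\<^esub> \<one>\<^bsub>K\<^esub>) \<odot>\<^bsub>A\<^esub> (a \<otimes>\<^bsub>A\<^esub> x)"
    using ax x by (simp add: anticommutative[of a x] smult_l_minus prod_closed)
  then show "x \<otimes>\<^bsub>A\<^esub> a \<in> V" using smult l ax by simp
qed (use assms in auto)

lemma annihilatorD: "\<lbrakk>x \<in> annihilator A V; y \<in> V\<rbrakk> \<Longrightarrow> x \<otimes>\<^bsub>A\<^esub> y = \<zero>\<^bsub>A\<^esub>"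
  by (simp add: annihilator_def)

lemma homogeneous_ideal_annihilator:
  assumes "homogeneous_ideal K A AG V"
  shows "homogeneous_ideal K A AG (annihilator A V)"
proof (rule homogeneous_idealI_left)
  note V = homogeneous_idealD[OF assms]
  fix a x assume a: "a \<in> carrier A" and x: "x \<in> annihilator A V"
  have xc: "x \<in> carrier A" using x by (simp add: annihilator_def)
  have "(a \<otimes>\<^bsub>A\<^esub> x) \<otimes>\<^bsub>A\<^esub> y = \<zero>\<^bsub>A\<^esub>" if y: "y \<in> V" for y
  proof -
    have yc: "y \<in> carrier A" using y V by auto
    have "x \<otimes>\<^bsub>A\<^esub> (a \<otimes>\<^bsub>A\<^esub> y) = \<zero>\<^bsub>A\<^esub>" "x \<otimes>\<^bsub>A\<^esub> y = \<zero>\<^bsub>A\<^esub>" using x V(8)[OF a y] y by (auto dest: annihilatorD)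
    then show ?thesis
      using leibniz[OF a xc yc] anticommutative[of x "a \<otimes>\<^bsub>A\<^esub> y"] a xc yc
      by (simp add: prod_closed prod_r_zero)
  qed
  then show "a \<otimes>\<^bsub>A\<^esub> x \<in> annihilator A V" using a xc by (simp add: annihilator_def prod_closed)
next
  fix \<gamma> x assume "x \<in> annihilator A V"
  then show "component A AG \<gamma> x \<in> annihilator A V"
    using homogeneous_annihilates[OF assms, of x] by (auto simp: annihilator_def component_closed)
qed (use homogeneous_idealD[OF assms] in
    \<open>auto simp: annihilator_def prod_l_zero prod_l_distr prod_l_smult subset_iff\<close>)

lemma ideal_square_closed:
  assumes "homogeneous_ideal K A AG V"
  shows "ideal_square A V \<subseteq> carrier A" "ideal_square A V \<subseteq> V"
    and "subgroup (ideal_square A V) (add_monoid A)"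
    and "\<lbrakk>x \<in> V; y \<in> V\<rbrakk> \<Longrightarrow> x \<otimes>\<^bsub>A\<^esub> y \<in> ideal_square A V"
proof -
  note V = homogeneous_idealD[OF assms]
  have c: "{x \<otimes>\<^bsub>A\<^esub> y | x y. x \<in> V \<and> y \<in> V} \<subseteq> V" using V by auto
  have cc: "{x \<otimes>\<^bsub>A\<^esub> y | x y. x \<in> V \<and> y \<in> V} \<subseteq> carrier A" using c V by auto
  show "subgroup (ideal_square A V) (add_monoid A)"
    unfolding ideal_square_def by (rule M.add.generate_is_subgroup[OF cc])
  then show "ideal_square A V \<subseteq> carrier A" using M.subgroup_add_monoidD by auto
  show "ideal_square A V \<subseteq> V"
    unfolding ideal_square_def by (rule M.add.generate_subgroup_incl[OF c V(2)])
  show "\<lbrakk>x \<in> V; y \<in> V\<rbrakk> \<Longrightarrow> x \<otimes>\<^bsub>A\<^esub> y \<in> ideal_square A V"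
    unfolding ideal_square_def by (rule generate.incl) auto
qed

lemma ideal_square_induct [consumes 2, case_names prod add]:
  assumes V: "homogeneous_ideal K A AG V" and x: "x \<in> ideal_square A V"
    and prod: "\<And>x y. \<lbrakk>x \<in> V; y \<in> V\<rbrakk> \<Longrightarrow> P (x \<otimes>\<^bsub>A\<^esub> y)"
    and add: "\<And>x y. \<lbrakk>x \<in> ideal_square A V; y \<in> ideal_square A V; P x; P y\<rbrakk> \<Longrightarrow> P (x \<oplus>\<^bsub>A\<^esub> y)"
  shows "P x"
  using x unfolding ideal_square_def
proof (induction rule: generate.induct)
  note Vd = homogeneous_idealD[OF V]
  case one
  show ?case using prod[of "\<zero>\<^bsub>A\<^esub>" "\<zero>\<^bsub>A\<^esub>"] Vd by (simp add: prod_r_zero)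
next
  case (incl h)
  then show ?case using prod by auto
next
  note Vd = homogeneous_idealD[OF V]
  case (inv h)
  then obtain x y where h: "x \<in> V" "y \<in> V" "h = x \<otimes>\<^bsub>A\<^esub> y" by auto
  have "\<ominus>\<^bsub>A\<^esub> h = \<ominus>\<^bsub>A\<^esub> x \<otimes>\<^bsub>A\<^esub> y" using h Vd(3) by (simp add: prod_l_neg subset_iff)
  then show ?case using prod[of "\<ominus>\<^bsub>A\<^esub> x" y] h Vd by (simp add: a_inv_def)
next
  case (eng h1 h2)
  then show ?case using add[of h1 h2] by (simp add: ideal_square_def)
qed

lemma component_prod_in:
  assumes V: "homogeneous_ideal K A AG V" and S: "subgroup S (add_monoid A)"
    and VS: "\<And>x y. \<lbrakk>x \<in> V; y \<in> V\<rbrakk> \<Longrightarrow> x \<otimes>\<^bsub>A\<^esub> y \<in> S" and x: "x \<in> V" and y: "y \<in> V"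
  shows "component A AG \<gamma> (x \<otimes>\<^bsub>A\<^esub> y) \<in> S"
proof -
  note Vd = homogeneous_idealD[OF V] and Sd = M.subgroup_add_monoidD[OF S]
  have xc: "x \<in> carrier A" "y \<in> carrier A" using x y Vd by auto
  show ?thesis using xc(1)
  proof (rule component_induct)
    fix \<alpha>
    have xa: "component A AG \<alpha> x \<in> AG \<alpha>" "component A AG \<alpha> x \<in> V" "component A AG \<alpha> x \<in> carrier A"
      using component_in xc x Vd component_closed by auto
    show "component A AG \<gamma> (component A AG \<alpha> x \<otimes>\<^bsub>A\<^esub> y) \<in> S"
      using xc(2)
    proof (rule component_induct)
      fix \<beta>
      have "component A AG \<beta> y \<in> AG \<beta>" "component A AG \<beta> y \<in> V" using component_in xc y Vd by auto
      then show "component A AG \<gamma> (component A AG \<alpha> x \<otimes>\<^bsub>A\<^esub> component A AG \<beta> y) \<in> S"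
        using component_homogeneous[OF grading_prod[OF xa(1)], of "component A AG \<beta> y" \<beta> \<gamma>] VS xa Sd
        by auto
    qed (use xa Sd in \<open>auto simp: prod_r_zero prod_r_distr component_zero component_add prod_closed\<close>)
  qed (use xc Sd in \<open>auto simp: prod_l_zero prod_l_distr component_zero component_add prod_closed\<close>)
qed

lemma homogeneous_ideal_square:
  assumes V: "homogeneous_ideal K A AG V"
  shows "homogeneous_ideal K A AG (ideal_square A V)"
proof (rule homogeneous_idealI_left)
  note Vd = homogeneous_idealD[OF V] and S = ideal_square_closed[OF V]
  note Sd = M.subgroup_add_monoidD[OF S(3)]
  show "ideal_square A V \<subseteq> carrier A" "\<zero>\<^bsub>A\<^esub> \<in> ideal_square A V" using Sd by auto
  show "x \<oplus>\<^bsub>A\<^esub> y \<in> ideal_square A V" if "x \<in> ideal_square A V" "y \<in> ideal_square A V" for x y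
    using Sd(3) that .
  show "k \<odot>\<^bsub>A\<^esub> x \<in> ideal_square A V" if k: "k \<in> carrier K" and "x \<in> ideal_square A V" for k x
    using V that(2)
  proof (induction rule: ideal_square_induct)
    case (prod x y)
    then have "k \<odot>\<^bsub>A\<^esub> (x \<otimes>\<^bsub>A\<^esub> y) = (k \<odot>\<^bsub>A\<^esub> x) \<otimes>\<^bsub>A\<^esub> y" using k Vd(3) by (simp add: prod_l_smult subset_iff)
    then show ?case using S(4)[OF Vd(7)[OF k prod(1)] prod(2)] by simp
  qed (use k S(1) Sd in \<open>auto simp: smult_r_distr subset_iff\<close>)
  show "a \<otimes>\<^bsub>A\<^esub> x \<in> ideal_square A V" if a: "a \<in> carrier A" and "x \<in> ideal_square A V" for a x
    using V that(2)
  proof (induction rule: ideal_square_induct)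
    case (prod x y)
    then have c: "x \<in> carrier A" "y \<in> carrier A" using Vd by auto
    have "a \<otimes>\<^bsub>A\<^esub> (x \<otimes>\<^bsub>A\<^esub> y) = (a \<otimes>\<^bsub>A\<^esub> x) \<otimes>\<^bsub>A\<^esub> y \<oplus>\<^bsub>A\<^esub> \<ominus>\<^bsub>A\<^esub> ((a \<otimes>\<^bsub>A\<^esub> y) \<otimes>\<^bsub>A\<^esub> x)"
      using leibniz_right[OF a c] by (simp add: a_minus_def)
    moreover have "(a \<otimes>\<^bsub>A\<^esub> x) \<otimes>\<^bsub>A\<^esub> y \<in> ideal_square A V" "(a \<otimes>\<^bsub>A\<^esub> y) \<otimes>\<^bsub>A\<^esub> x \<in> ideal_square A V"
      using S(4) Vd(8)[OF a] prod by auto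
    ultimately show ?case using Sd by auto
  qed (use a S(1) Sd in \<open>auto simp: prod_r_distr subset_iff\<close>)
  show "component A AG \<gamma> x \<in> ideal_square A V" if "x \<in> ideal_square A V" for \<gamma> x
    using V that
  proof (induction rule: ideal_square_induct)
    case (prod x y)
    show ?case by (rule component_prod_in[OF V S(3) S(4) prod])
  next
    case (add x y)
    then show ?case using S(1) Sd by (auto simp: component_add subset_iff)
  qed
qed

end

locale semiprime_graded_lie_algebra = graded_lie_algebra +
  assumes semiprime: "homogeneously_semiprime K A AG"
begin

lemma ideal_prod_nonzero:
  assumes V: "homogeneous_ideal K A AG V" and nz: "V \<noteq> {\<zero>\<^bsub>A\<^esub>}"
  shows "\<exists>x\<in>V. \<exists>y\<in>V. x \<otimes>\<^bsub>A\<^esub> y \<noteq> \<zero>\<^bsub>A\<^esub>"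
proof (rule ccontr)
  assume contra: "\<not> (\<exists>x\<in>V. \<exists>y\<in>V. x \<otimes>\<^bsub>A\<^esub> y \<noteq> \<zero>\<^bsub>A\<^esub>)"
  have "x = \<zero>\<^bsub>A\<^esub>" if "x \<in> ideal_square A V" for x
    using V that
  proof (induction rule: ideal_square_induct)
    case (prod x y)
    then show ?case using contra by simp
  qed simp
  then have "ideal_square A V \<subseteq> {\<zero>\<^bsub>A\<^esub>}" by blast
  with M.subgroup_add_monoidD(2)[OF ideal_square_closed(3)[OF V]]
  have "ideal_square A V = {\<zero>\<^bsub>A\<^esub>}" by blast
  then show False using semiprime V nz by (auto simp: homogeneously_semiprime_def)
qed

lemma inter_annihilator:
  assumes V: "homogeneous_ideal K A AG V" and x: "x \<in> V" "x \<in> annihilator A V"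
  shows "x = \<zero>\<^bsub>A\<^esub>"
proof (rule ccontr)
  assume "x \<noteq> \<zero>\<^bsub>A\<^esub>"
  then have "V \<inter> annihilator A V \<noteq> {\<zero>\<^bsub>A\<^esub>}" using x by auto
  then obtain y z where "y \<in> V" "y \<in> annihilator A V" "z \<in> V" "y \<otimes>\<^bsub>A\<^esub> z \<noteq> \<zero>\<^bsub>A\<^esub>"
    using ideal_prod_nonzero[OF homogeneous_ideal_inter[OF V homogeneous_ideal_annihilator[OF V]]]
    by blast
  then show False by (simp add: annihilatorD)
qed

lemma annihilator_zero_in:
  assumes "homogeneous_ideal K A AG V"
  shows "\<zero>\<^bsub>A\<^esub> \<in> annihilator A V"
  using homogeneous_idealD(4)[OF homogeneous_ideal_annihilator[OF assms]] .

lemma essential_iff: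
  "U \<in> essential_ideals K A AG \<longleftrightarrow> homogeneous_ideal K A AG U \<and> annihilator A U = {\<zero>\<^bsub>A\<^esub>}"
proof safe
  assume U: "U \<in> essential_ideals K A AG"
  then show Ui: "homogeneous_ideal K A AG U" by (simp add: essential_ideals_def)
  show "\<zero>\<^bsub>A\<^esub> \<in> annihilator A U" using annihilator_zero_in[OF Ui] .
  fix x assume x: "x \<in> annihilator A U"
  show "x = \<zero>\<^bsub>A\<^esub>"
  proof (rule ccontr)
    assume "x \<noteq> \<zero>\<^bsub>A\<^esub>"
    with x have "annihilator A U \<noteq> {\<zero>\<^bsub>A\<^esub>}" by auto
    then have "U \<inter> annihilator A U \<noteq> {\<zero>\<^bsub>A\<^esub>}"
      using U homogeneous_ideal_annihilator[OF Ui] by (simp add: essential_ideals_def)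
    then obtain y where "y \<in> U" "y \<in> annihilator A U" "y \<noteq> \<zero>\<^bsub>A\<^esub>"
      using homogeneous_idealD(4)[OF Ui] annihilator_zero_in[OF Ui] by auto
    then show False using inter_annihilator[OF Ui] by blast
  qed
next
  assume U: "homogeneous_ideal K A AG U" and ann: "annihilator A U = {\<zero>\<^bsub>A\<^esub>}"
  have "V = {\<zero>\<^bsub>A\<^esub>}" if V: "homogeneous_ideal K A AG V" and int: "U \<inter> V = {\<zero>\<^bsub>A\<^esub>}" for V
  proof -
    note Vd = homogeneous_idealD[OF V] and Ud = homogeneous_idealD[OF U]
    have "x \<in> annihilator A U" if x: "x \<in> V" for x
    proof -
      have "x \<otimes>\<^bsub>A\<^esub> y \<in> U \<inter> V" if "y \<in> U" for y using Vd(9)[of y x] Ud(8)[of x y] Vd(3) Ud(3) x that by auto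
      then show ?thesis using x Vd int by (auto simp: annihilator_def)
    qed
    then show ?thesis using Vd(4) ann by blast
  qed
  then show "U \<in> essential_ideals K A AG" using U by (auto simp: essential_ideals_def)
qed

lemma essential_annihilates:
  assumes "U \<in> essential_ideals K A AG" "x \<in> carrier A" "\<And>y. y \<in> U \<Longrightarrow> y \<otimes>\<^bsub>A\<^esub> x = \<zero>\<^bsub>A\<^esub>"
  shows "x = \<zero>\<^bsub>A\<^esub>"
proof -
  have U: "U \<subseteq> carrier A" using assms(1) essential_iff homogeneous_idealD(3) by blast
  have "x \<otimes>\<^bsub>A\<^esub> y = \<zero>\<^bsub>A\<^esub>" if "y \<in> U" for y
    using anticommutative[of y x] assms(2) assms(3)[OF that] that U by auto
  then have "x \<in> annihilator A U" using assms(2) by (simp add: annihilator_def)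
  then show ?thesis using assms(1) essential_iff by auto
qed

lemma essential_ideal: "U \<in> essential_ideals K A AG \<Longrightarrow> homogeneous_ideal K A AG U"
  by (simp add: essential_iff)

lemma essential_meets:
  assumes "U \<in> essential_ideals K A AG" "homogeneous_ideal K A AG V" "V \<noteq> {\<zero>\<^bsub>A\<^esub>}"
  obtains x where "x \<in> U" "x \<in> V" "x \<noteq> \<zero>\<^bsub>A\<^esub>"
proof -
  have "U \<inter> V \<noteq> {\<zero>\<^bsub>A\<^esub>}" using assms by (simp add: essential_ideals_def)
  moreover have "\<zero>\<^bsub>A\<^esub> \<in> U \<inter> V" using assms homogeneous_idealD(4) essential_ideal by blast
  ultimately show ?thesis using that by blast
qed

lemma essential_if_meets:
  assumes U: "homogeneous_ideal K A AG U"
    and "\<And>V. \<lbrakk>homogeneous_ideal K A AG V; V \<noteq> {\<zero>\<^bsub>A\<^esub>}\<rbrakk> \<Longrightarrow> \<exists>x\<in>U \<inter> V. x \<noteq> \<zero>\<^bsub>A\<^esub>"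
  shows "U \<in> essential_ideals K A AG"
  using assms unfolding essential_ideals_def by fast

lemma essential_carrier: "carrier A \<in> essential_ideals K A AG"
proof (rule essential_if_meets[OF homogeneous_ideal_carrier])
  fix V assume V: "homogeneous_ideal K A AG V" "V \<noteq> {\<zero>\<^bsub>A\<^esub>}"
  then show "\<exists>x\<in>carrier A \<inter> V. x \<noteq> \<zero>\<^bsub>A\<^esub>" using homogeneous_idealD(3,4)[OF V(1)] by auto
qed

lemma essential_inter:
  assumes "U \<in> essential_ideals K A AG" "U' \<in> essential_ideals K A AG"
  shows "U \<inter> U' \<in> essential_ideals K A AG"
proof (rule essential_if_meets)
  show "homogeneous_ideal K A AG (U \<inter> U')"
    using assms by (intro homogeneous_ideal_inter essential_ideal)
  fix V assume V: "homogeneous_ideal K A AG V" "V \<noteq> {\<zero>\<^bsub>A\<^esub>}"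
  have "U' \<inter> V \<noteq> {\<zero>\<^bsub>A\<^esub>}" using assms(2) V by (simp add: essential_ideals_def)
  then obtain x where "x \<in> U" "x \<in> U' \<inter> V" "x \<noteq> \<zero>\<^bsub>A\<^esub>"
    using essential_meets[OF assms(1) homogeneous_ideal_inter[OF essential_ideal[OF assms(2)] V(1)]]
    by metis
  then show "\<exists>x\<in>U \<inter> U' \<inter> V. x \<noteq> \<zero>\<^bsub>A\<^esub>" by auto
qed

lemma essential_square:
  assumes "U \<in> essential_ideals K A AG"
  shows "ideal_square A U \<in> essential_ideals K A AG"
proof (rule essential_if_meets)
  have U: "homogeneous_ideal K A AG U" using assms by (rule essential_ideal)
  show "homogeneous_ideal K A AG (ideal_square A U)" by (rule homogeneous_ideal_square[OF U])
  fix V assume V: "homogeneous_ideal K A AG V" "V \<noteq> {\<zero>\<^bsub>A\<^esub>}"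
  have "U \<inter> V \<noteq> {\<zero>\<^bsub>A\<^esub>}" using assms V by (simp add: essential_ideals_def)
  then obtain x y where "x \<in> U \<inter> V" "y \<in> U \<inter> V" "x \<otimes>\<^bsub>A\<^esub> y \<noteq> \<zero>\<^bsub>A\<^esub>"
    using ideal_prod_nonzero[OF homogeneous_ideal_inter[OF U V(1)]] by blast
  then show "\<exists>x\<in>ideal_square A U \<inter> V. x \<noteq> \<zero>\<^bsub>A\<^esub>"
    using ideal_square_closed(4)[OF U, of x y] homogeneous_idealD(3,8)[OF V(1)] by auto
qed

end

section \<open>Graded algebras of quotients of semiprime Lie algebras\<close>

locale graded_quotients =
  A: semiprime_graded_lie_algebra K A AG + T: graded_lie_algebra K T TG
  for K :: "('k, 'n) ring_scheme" and A :: "('k, 'a) module"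
    and AG :: "'g::ab_group_add \<Rightarrow> 'a set" and T :: "('k, 't) module" and TG :: "'g \<Rightarrow> 't set" +
  fixes e :: "'a \<Rightarrow> 't"
  assumes embedding: "graded_embedding K A AG T TG e"
    and absorb: "x \<in> TG \<gamma> \<Longrightarrow> \<exists>U\<in>essential_ideals K A AG. \<forall>a\<in>U. e a \<otimes>\<^bsub>T\<^esub> x \<in> e ` carrier A"
    and faithful: "\<lbrakk>x \<in> TG \<gamma>; U \<in> essential_ideals K A AG; \<forall>a\<in>U. e a \<otimes>\<^bsub>T\<^esub> x = \<zero>\<^bsub>T\<^esub>\<rbrakk> \<Longrightarrow> x = \<zero>\<^bsub>T\<^esub>"
begin

lemma e_closed: "a \<in> carrier A \<Longrightarrow> e a \<in> carrier T"
  and e_inj: "\<lbrakk>e a = e b; a \<in> carrier A; b \<in> carrier A\<rbrakk> \<Longrightarrow> a = b"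
  and e_add: "\<lbrakk>a \<in> carrier A; b \<in> carrier A\<rbrakk> \<Longrightarrow> e (a \<oplus>\<^bsub>A\<^esub> b) = e a \<oplus>\<^bsub>T\<^esub> e b"
  and e_prod: "\<lbrakk>a \<in> carrier A; b \<in> carrier A\<rbrakk> \<Longrightarrow> e (a \<otimes>\<^bsub>A\<^esub> b) = e a \<otimes>\<^bsub>T\<^esub> e b"
  and e_smult: "\<lbrakk>k \<in> carrier K; a \<in> carrier A\<rbrakk> \<Longrightarrow> e (k \<odot>\<^bsub>A\<^esub> a) = k \<odot>\<^bsub>T\<^esub> e a"
  and e_grade: "a \<in> AG \<gamma> \<Longrightarrow> e a \<in> TG \<gamma>"
  using embedding unfolding graded_embedding_def inj_on_def by blast+

lemma e_zero: "e \<zero>\<^bsub>A\<^esub> = \<zero>\<^bsub>T\<^esub>"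
  using additive_zero[OF A.M.abelian_group_axioms T.M.abelian_group_axioms, of e]
  by (simp add: e_closed e_add)

lemma e_neg: "a \<in> carrier A \<Longrightarrow> e (\<ominus>\<^bsub>A\<^esub> a) = \<ominus>\<^bsub>T\<^esub> e a"
  using additive_neg[OF A.M.abelian_group_axioms T.M.abelian_group_axioms, of e]
  by (simp add: e_closed e_add)

lemma e_component: "a \<in> carrier A \<Longrightarrow> component T TG \<gamma> (e a) = e (component A AG \<gamma> a)"
  using component_hom[OF A.graded_group_axioms T.graded_group_axioms, of e 0 a \<gamma>]
  by (simp add: e_closed e_add e_grade)

lemma e_grade_iff:
  assumes "a \<in> carrier A"
  shows "e a \<in> TG \<gamma> \<longleftrightarrow> a \<in> AG \<gamma>"
proof
  assume "e a \<in> TG \<gamma>"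
  then have "e (component A AG \<gamma> a) = e a"
    using e_component[OF assms] T.component_homogeneous[of "e a" \<gamma> \<gamma>] by simp
  then have "component A AG \<gamma> a = a" using e_inj A.component_closed assms by blast
  then show "a \<in> AG \<gamma>" using A.component_in[OF assms, of \<gamma>] by simp
qed (rule e_grade)

lemma faithful_carrier:
  assumes x: "x \<in> carrier T" and U: "U \<in> essential_ideals K A AG"
    and z: "\<And>a. a \<in> U \<Longrightarrow> e a \<otimes>\<^bsub>T\<^esub> x = \<zero>\<^bsub>T\<^esub>"
  shows "x = \<zero>\<^bsub>T\<^esub>"
proof (rule T.component_eqI[OF x T.M.zero_closed])
  fix \<gamma>
  note Ud = A.homogeneous_idealD[OF A.essential_ideal[OF U]]
  have xc: "component T TG \<gamma> x \<in> carrier T" by (rule T.component_closed[OF x])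
  have "e a \<otimes>\<^bsub>T\<^esub> component T TG \<gamma> x = \<zero>\<^bsub>T\<^esub>" if a: "a \<in> U" for a
  proof -
    have ac: "a \<in> carrier A" using a Ud(3) by auto
    show ?thesis using ac
    proof (rule A.component_induct)
      fix \<alpha>
      have "component A AG \<alpha> a \<in> AG \<alpha>" "component A AG \<alpha> a \<in> U"
        using A.component_in ac a Ud(10) by auto
      then show "e (component A AG \<alpha> a) \<otimes>\<^bsub>T\<^esub> component T TG \<gamma> x = \<zero>\<^bsub>T\<^esub>"
        using T.component_prod_left[OF e_grade x] z by (metis T.component_zero)
    qed (simp_all add: e_zero e_add e_closed xc T.prod_l_zero T.prod_l_distr)
  qed
  then have "component T TG \<gamma> x = \<zero>\<^bsub>T\<^esub>" using faithful[OF T.component_in[OF x] U] by blast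
  then show "component T TG \<gamma> x = component T TG \<gamma> \<zero>\<^bsub>T\<^esub>" by (simp add: T.component_zero)
qed

lemma absorb_carrier:
  assumes "x \<in> carrier T"
  shows "\<exists>U\<in>essential_ideals K A AG. \<forall>a\<in>U. e a \<otimes>\<^bsub>T\<^esub> x \<in> e ` carrier A"
  using assms
proof (rule T.homogeneous_induct)
  fix y z assume y: "y \<in> carrier T" and z: "z \<in> carrier T"
  assume "\<exists>U\<in>essential_ideals K A AG. \<forall>a\<in>U. e a \<otimes>\<^bsub>T\<^esub> y \<in> e ` carrier A"
    and "\<exists>U\<in>essential_ideals K A AG. \<forall>a\<in>U. e a \<otimes>\<^bsub>T\<^esub> z \<in> e ` carrier A"
  then obtain U V where U: "U \<in> essential_ideals K A AG" "\<forall>a\<in>U. e a \<otimes>\<^bsub>T\<^esub> y \<in> e ` carrier A"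
    and V: "V \<in> essential_ideals K A AG" "\<forall>a\<in>V. e a \<otimes>\<^bsub>T\<^esub> z \<in> e ` carrier A" by blast
  show "\<exists>U\<in>essential_ideals K A AG. \<forall>a\<in>U. e a \<otimes>\<^bsub>T\<^esub> (y \<oplus>\<^bsub>T\<^esub> z) \<in> e ` carrier A"
  proof (intro bexI ballI)
    show "U \<inter> V \<in> essential_ideals K A AG" by (rule A.essential_inter[OF U(1) V(1)])
    fix a assume a: "a \<in> U \<inter> V"
    then have ac: "e a \<in> carrier T"
      using A.homogeneous_idealD(3)[OF A.essential_ideal[OF U(1)]] e_closed by auto
    obtain b c where "b \<in> carrier A" "c \<in> carrier A" "e a \<otimes>\<^bsub>T\<^esub> y = e b" "e a \<otimes>\<^bsub>T\<^esub> z = e c"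
      using U(2) V(2) a by blast
    then show "e a \<otimes>\<^bsub>T\<^esub> (y \<oplus>\<^bsub>T\<^esub> z) \<in> e ` carrier A"
      using ac y z by (simp add: T.prod_r_distr e_add[symmetric])
  qed
qed (rule absorb)

lemma graded_algebra_of_quotients: "graded_algebra_of_quotients K A AG T TG e"
  unfolding graded_algebra_of_quotients_def
proof (intro conjI allI ballI impI)
  fix \<gamma> q assume q: "q \<in> TG \<gamma>" "q \<noteq> \<zero>\<^bsub>T\<^esub>"
  obtain U where U: "U \<in> essential_ideals K A AG" "\<forall>a\<in>U. e a \<otimes>\<^bsub>T\<^esub> q \<in> e ` carrier A"
    using absorb[OF q(1)] by blast
  then show "\<exists>I. homogeneous_ideal K A AG I \<and> annihilator A I = {\<zero>\<^bsub>A\<^esub>} \<and>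
             (\<forall>x\<in>I. e x \<otimes>\<^bsub>T\<^esub> q \<in> e ` carrier A) \<and> (\<exists>x\<in>I. e x \<otimes>\<^bsub>T\<^esub> q \<noteq> \<zero>\<^bsub>T\<^esub>)"
    using A.essential_iff[of U] faithful[OF q(1) U(1)] q(2) by blast
qed (rule A.graded_lie_algebra_axioms T.graded_lie_algebra_axioms embedding)+

end

lemma graded_quotients_if_maximal:
  assumes "graded_lie_algebra K A AG" "homogeneously_semiprime K A AG"
    and Q: "maximal_graded_quotients K A AG Q QG e"
  shows "graded_quotients K A AG Q QG e"
proof (intro graded_quotients.intro graded_quotients_axioms.intro semiprime_graded_lie_algebra.intro
      semiprime_graded_lie_algebra_axioms.intro assms(1,2))
  show "graded_lie_algebra K Q QG" "graded_embedding K A AG Q QG e"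
    using Q by (simp_all add: maximal_graded_quotients_def)
  show "\<exists>U\<in>essential_ideals K A AG. \<forall>a\<in>U. e a \<otimes>\<^bsub>Q\<^esub> x \<in> e ` carrier A" if "x \<in> QG \<gamma>" for x \<gamma>
    using Q that by (simp add: maximal_graded_quotients_def)
  show "x = \<zero>\<^bsub>Q\<^esub>" if "x \<in> QG \<gamma>" "U \<in> essential_ideals K A AG" "\<forall>a\<in>U. e a \<otimes>\<^bsub>Q\<^esub> x = \<zero>\<^bsub>Q\<^esub>" for x \<gamma> U
    using Q that unfolding maximal_graded_quotients_def by meson
qed

text \<open>
  If the second algebra is maximal, \<open>corr\<close> below is the graph of the embedding: every element has
  a partner because bracketing with it is a partial derivation.
\<close>

locale graded_quotients_pair = T: graded_quotients K A AG T TG e + Q: graded_quotients K A AG Q QG \<epsilon>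
  for K :: "('k, 'n) ring_scheme" and A :: "('k, 'a) module"
    and AG :: "'g::ab_group_add \<Rightarrow> 'a set" and T :: "('k, 't) module" and TG :: "'g \<Rightarrow> 't set"
    and e :: "'a \<Rightarrow> 't" and Q :: "('k, 'q) module" and QG :: "'g \<Rightarrow> 'q set" and \<epsilon> :: "'a \<Rightarrow> 'q"
begin

definition corr :: "'t \<Rightarrow> 'q \<Rightarrow> bool" where
  "corr p y \<longleftrightarrow> p \<in> carrier T \<and> y \<in> carrier Q \<and>
     (\<exists>U\<in>essential_ideals K A AG. \<forall>a\<in>U. \<exists>b\<in>carrier A. e a \<otimes>\<^bsub>T\<^esub> p = e b \<and> \<epsilon> a \<otimes>\<^bsub>Q\<^esub> y = \<epsilon> b)"

lemma essential_subset: "\<lbrakk>U \<in> essential_ideals K A AG; a \<in> U\<rbrakk> \<Longrightarrow> a \<in> carrier A"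
  using T.A.homogeneous_idealD(3)[OF T.A.essential_ideal] by auto

lemma corr_add:
  assumes "corr p y" "corr q z"
  shows "corr (p \<oplus>\<^bsub>T\<^esub> q) (y \<oplus>\<^bsub>Q\<^esub> z)"
proof -
  from assms obtain U V where U: "U \<in> essential_ideals K A AG"
      "\<forall>a\<in>U. \<exists>b\<in>carrier A. e a \<otimes>\<^bsub>T\<^esub> p = e b \<and> \<epsilon> a \<otimes>\<^bsub>Q\<^esub> y = \<epsilon> b"
    and V: "V \<in> essential_ideals K A AG"
      "\<forall>a\<in>V. \<exists>b\<in>carrier A. e a \<otimes>\<^bsub>T\<^esub> q = e b \<and> \<epsilon> a \<otimes>\<^bsub>Q\<^esub> z = \<epsilon> b"
    unfolding corr_def by blast
  have c: "p \<in> carrier T" "q \<in> carrier T" "y \<in> carrier Q" "z \<in> carrier Q"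
    using assms by (auto simp: corr_def)
  have "\<exists>b\<in>carrier A. e a \<otimes>\<^bsub>T\<^esub> (p \<oplus>\<^bsub>T\<^esub> q) = e b \<and> \<epsilon> a \<otimes>\<^bsub>Q\<^esub> (y \<oplus>\<^bsub>Q\<^esub> z) = \<epsilon> b" if a: "a \<in> U \<inter> V" for a
  proof -
    obtain b b' where b: "b \<in> carrier A" "e a \<otimes>\<^bsub>T\<^esub> p = e b \<and> \<epsilon> a \<otimes>\<^bsub>Q\<^esub> y = \<epsilon> b"
      "b' \<in> carrier A" "e a \<otimes>\<^bsub>T\<^esub> q = e b' \<and> \<epsilon> a \<otimes>\<^bsub>Q\<^esub> z = \<epsilon> b'" using U(2) V(2) a by blast
    have "a \<in> carrier A" using a essential_subset U by blast
    then show ?thesis using b c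
      by (intro bexI[of _ "b \<oplus>\<^bsub>A\<^esub> b'"])
        (simp_all add: T.e_add Q.e_add T.T.prod_r_distr Q.T.prod_r_distr T.e_closed Q.e_closed)
  qed
  then show ?thesis
    unfolding corr_def using c T.A.essential_inter[OF U(1) V(1)]
    by (auto intro!: bexI[of _ "U \<inter> V"])
qed

lemma corr_smult:
  assumes k: "k \<in> carrier K" and py: "corr p y"
  shows "corr (k \<odot>\<^bsub>T\<^esub> p) (k \<odot>\<^bsub>Q\<^esub> y)"
proof -
  from py obtain U where U: "U \<in> essential_ideals K A AG"
      "\<forall>a\<in>U. \<exists>b\<in>carrier A. e a \<otimes>\<^bsub>T\<^esub> p = e b \<and> \<epsilon> a \<otimes>\<^bsub>Q\<^esub> y = \<epsilon> b"
    unfolding corr_def by blast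
  have c: "p \<in> carrier T" "y \<in> carrier Q" using py by (auto simp: corr_def)
  have "\<exists>b\<in>carrier A. e a \<otimes>\<^bsub>T\<^esub> (k \<odot>\<^bsub>T\<^esub> p) = e b \<and> \<epsilon> a \<otimes>\<^bsub>Q\<^esub> (k \<odot>\<^bsub>Q\<^esub> y) = \<epsilon> b" if a: "a \<in> U" for a
  proof -
    obtain b where b: "b \<in> carrier A" "e a \<otimes>\<^bsub>T\<^esub> p = e b \<and> \<epsilon> a \<otimes>\<^bsub>Q\<^esub> y = \<epsilon> b" using U(2) a by blast
    have "a \<in> carrier A" using a essential_subset U by blast
    then show ?thesis using b c k
      by (intro bexI[of _ "k \<odot>\<^bsub>A\<^esub> b"])
        (simp_all add: T.e_smult Q.e_smult T.T.prod_r_smult Q.T.prod_r_smult T.e_closed Q.e_closed)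
  qed
  then show ?thesis unfolding corr_def using c k U(1) by auto
qed

lemma corr_base: "x \<in> carrier A \<Longrightarrow> corr (e x) (\<epsilon> x)"
  unfolding corr_def
  by (intro conjI T.e_closed Q.e_closed bexI[OF _ T.A.essential_carrier] ballI)
    (use T.e_prod Q.e_prod T.A.prod_closed in metis)+

lemma corr_zero_left:
  assumes "corr \<zero>\<^bsub>T\<^esub> y"
  shows "y = \<zero>\<^bsub>Q\<^esub>"
proof -
  from assms obtain U where U: "U \<in> essential_ideals K A AG"
      "\<forall>a\<in>U. \<exists>b\<in>carrier A. e a \<otimes>\<^bsub>T\<^esub> \<zero>\<^bsub>T\<^esub> = e b \<and> \<epsilon> a \<otimes>\<^bsub>Q\<^esub> y = \<epsilon> b" and y: "y \<in> carrier Q"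
    unfolding corr_def by blast
  have "\<epsilon> a \<otimes>\<^bsub>Q\<^esub> y = \<zero>\<^bsub>Q\<^esub>" if a: "a \<in> U" for a
  proof -
    obtain b where b: "b \<in> carrier A" "e a \<otimes>\<^bsub>T\<^esub> \<zero>\<^bsub>T\<^esub> = e b" "\<epsilon> a \<otimes>\<^bsub>Q\<^esub> y = \<epsilon> b" using U(2) a by blast
    have "e b = e \<zero>\<^bsub>A\<^esub>" using b(2) T.e_closed essential_subset[OF U(1) a] by (simp add: T.T.prod_r_zero T.e_zero)
    then have "b = \<zero>\<^bsub>A\<^esub>" using T.e_inj b(1) by blast
    then show ?thesis using b(3) Q.e_zero by simp
  qed
  then show ?thesis by (rule Q.faithful_carrier[OF y U(1)])
qed

lemma corr_neg:
  assumes "corr p y"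
  shows "corr (\<ominus>\<^bsub>T\<^esub> p) (\<ominus>\<^bsub>Q\<^esub> y)"
  using corr_smult[of "\<ominus>\<^bsub>K\<^esub> \<one>\<^bsub>K\<^esub>", OF _ assms] assms
  by (simp add: corr_def T.T.smult_l_minus Q.T.smult_l_minus)

lemma corr_right_unique:
  assumes "corr p y" "corr p z"
  shows "y = z"
proof -
  have c: "p \<in> carrier T" "y \<in> carrier Q" "z \<in> carrier Q" using assms by (auto simp: corr_def)
  have "corr \<zero>\<^bsub>T\<^esub> (y \<oplus>\<^bsub>Q\<^esub> \<ominus>\<^bsub>Q\<^esub> z)"
    using corr_add[OF assms(1) corr_neg[OF assms(2)]] c by (simp add: T.T.M.r_neg)
  then show ?thesis using corr_zero_left c Q.T.M.minus_equality[of y "\<ominus>\<^bsub>Q\<^esub> z"] by fastforce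
qed

lemma corr_square:
  assumes K: "U \<in> essential_ideals K A AG" "p \<in> carrier T" "y \<in> carrier Q"
      "\<And>a. a \<in> U \<Longrightarrow> \<exists>b\<in>carrier A. e a \<otimes>\<^bsub>T\<^esub> p = e b \<and> \<epsilon> a \<otimes>\<^bsub>Q\<^esub> y = \<epsilon> b"
    and a: "a \<in> ideal_square A U"
  shows "\<exists>b\<in>U. e a \<otimes>\<^bsub>T\<^esub> p = e b \<and> \<epsilon> a \<otimes>\<^bsub>Q\<^esub> y = \<epsilon> b"
proof -
  note I = T.A.essential_ideal[OF K(1)]
  note Id = T.A.homogeneous_idealD[OF I]
  show ?thesis using I a
  proof (induction rule: T.A.ideal_square_induct)
    case (prod u v)
    then have c: "u \<in> carrier A" "v \<in> carrier A" using Id by auto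
    obtain b where b: "b \<in> carrier A" "e u \<otimes>\<^bsub>T\<^esub> p = e b" "\<epsilon> u \<otimes>\<^bsub>Q\<^esub> y = \<epsilon> b" using K(4)[OF prod(1)] by blast
    obtain d where d: "d \<in> carrier A" "e v \<otimes>\<^bsub>T\<^esub> p = e d" "\<epsilon> v \<otimes>\<^bsub>Q\<^esub> y = \<epsilon> d" using K(4)[OF prod(2)] by blast
    have "b \<otimes>\<^bsub>A\<^esub> v \<oplus>\<^bsub>A\<^esub> u \<otimes>\<^bsub>A\<^esub> d \<in> U" using Id(5) Id(8)[OF b(1) prod(2)] Id(9)[OF d(1) prod(1)] by blast
    moreover have "e (u \<otimes>\<^bsub>A\<^esub> v) \<otimes>\<^bsub>T\<^esub> p = e (b \<otimes>\<^bsub>A\<^esub> v \<oplus>\<^bsub>A\<^esub> u \<otimes>\<^bsub>A\<^esub> d)"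
      using c b d K T.T.leibniz[of "e u" "e v" p]
      by (simp add: T.e_prod T.e_add T.e_closed T.A.prod_closed)
    moreover have "\<epsilon> (u \<otimes>\<^bsub>A\<^esub> v) \<otimes>\<^bsub>Q\<^esub> y = \<epsilon> (b \<otimes>\<^bsub>A\<^esub> v \<oplus>\<^bsub>A\<^esub> u \<otimes>\<^bsub>A\<^esub> d)"
      using c b d K Q.T.leibniz[of "\<epsilon> u" "\<epsilon> v" y]
      by (simp add: Q.e_prod Q.e_add Q.e_closed T.A.prod_closed)
    ultimately show ?case by blast
  next
    case (add u v)
    then obtain b d where b: "b \<in> U" "e u \<otimes>\<^bsub>T\<^esub> p = e b" "\<epsilon> u \<otimes>\<^bsub>Q\<^esub> y = \<epsilon> b"
      and d: "d \<in> U" "e v \<otimes>\<^bsub>T\<^esub> p = e d" "\<epsilon> v \<otimes>\<^bsub>Q\<^esub> y = \<epsilon> d" by blast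
    have c: "u \<in> carrier A" "v \<in> carrier A" "b \<in> carrier A" "d \<in> carrier A"
      using add T.A.ideal_square_closed(1)[OF I] Id(3) b d by auto
    show ?case
      using c b d K by (intro bexI[of _ "b \<oplus>\<^bsub>A\<^esub> d"] conjI)
        (simp_all add: T.e_add Q.e_add T.e_closed Q.e_closed T.T.prod_l_distr Q.T.prod_l_distr Id(5))
  qed
qed

lemma corr_prod:
  assumes "corr p y" "corr q z"
  shows "corr (p \<otimes>\<^bsub>T\<^esub> q) (y \<otimes>\<^bsub>Q\<^esub> z)"
proof -
  from assms obtain U V where U: "U \<in> essential_ideals K A AG"
      "\<forall>a\<in>U. \<exists>b\<in>carrier A. e a \<otimes>\<^bsub>T\<^esub> p = e b \<and> \<epsilon> a \<otimes>\<^bsub>Q\<^esub> y = \<epsilon> b"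
    and V: "V \<in> essential_ideals K A AG"
      "\<forall>a\<in>V. \<exists>b\<in>carrier A. e a \<otimes>\<^bsub>T\<^esub> q = e b \<and> \<epsilon> a \<otimes>\<^bsub>Q\<^esub> z = \<epsilon> b"
    unfolding corr_def by blast
  have c: "p \<in> carrier T" "q \<in> carrier T" "y \<in> carrier Q" "z \<in> carrier Q"
    using assms by (auto simp: corr_def)
  define W where "W = U \<inter> V"
  have W: "W \<in> essential_ideals K A AG" unfolding W_def by (rule T.A.essential_inter[OF U(1) V(1)])
  have "\<exists>b\<in>carrier A. e a \<otimes>\<^bsub>T\<^esub> (p \<otimes>\<^bsub>T\<^esub> q) = e b \<and> \<epsilon> a \<otimes>\<^bsub>Q\<^esub> (y \<otimes>\<^bsub>Q\<^esub> z) = \<epsilon> b"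
    if a: "a \<in> ideal_square A W" for a
  proof -
    obtain b where b: "b \<in> W" "e a \<otimes>\<^bsub>T\<^esub> p = e b" "\<epsilon> a \<otimes>\<^bsub>Q\<^esub> y = \<epsilon> b"
      using corr_square[OF W c(1,3) _ a] U(2) unfolding W_def by blast
    obtain d where d: "d \<in> W" "e a \<otimes>\<^bsub>T\<^esub> q = e d" "\<epsilon> a \<otimes>\<^bsub>Q\<^esub> z = \<epsilon> d"
      using corr_square[OF W c(2,4) _ a] V(2) unfolding W_def by blast
    obtain b' where b': "b' \<in> carrier A" "e b \<otimes>\<^bsub>T\<^esub> q = e b'" "\<epsilon> b \<otimes>\<^bsub>Q\<^esub> z = \<epsilon> b'"
      using V(2) b(1) W_def by blast
    obtain d' where d': "d' \<in> carrier A" "e d \<otimes>\<^bsub>T\<^esub> p = e d'" "\<epsilon> d \<otimes>\<^bsub>Q\<^esub> y = \<epsilon> d'"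
      using U(2) d(1) W_def by blast
    have ac: "a \<in> carrier A" using a essential_subset[OF T.A.essential_square[OF W]] by blast
    have "e a \<otimes>\<^bsub>T\<^esub> (p \<otimes>\<^bsub>T\<^esub> q) = e (b' \<ominus>\<^bsub>A\<^esub> d')"
      using T.T.leibniz_right[of "e a" p q] ac c b d b' d'
      by (simp add: T.e_closed T.e_add T.e_neg a_minus_def)
    moreover have "\<epsilon> a \<otimes>\<^bsub>Q\<^esub> (y \<otimes>\<^bsub>Q\<^esub> z) = \<epsilon> (b' \<ominus>\<^bsub>A\<^esub> d')"
      using Q.T.leibniz_right[of "\<epsilon> a" y z] ac c b d b' d'
      by (simp add: Q.e_closed Q.e_add Q.e_neg a_minus_def)
    ultimately show ?thesis using b' d' by auto
  qed
  then show ?thesis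
    unfolding corr_def using c T.T.prod_closed Q.T.prod_closed T.A.essential_square[OF W] by auto
qed

end

sublocale graded_quotients_pair \<subseteq> swap: graded_quotients_pair K A AG Q QG \<epsilon> T TG e ..

lemma (in graded_quotients_pair) swap_corr: "swap.corr y p \<longleftrightarrow> corr p y"
  unfolding swap.corr_def corr_def by blast

theorem (in graded_quotients) embeds_in_maximal:
  fixes Q :: "('k, 'q) module"
  assumes Q: "maximal_graded_quotients K A AG Q QG \<epsilon>"
  shows "\<exists>\<psi>. graded_embedding K T TG Q QG \<psi> \<and> (\<forall>x\<in>carrier A. \<psi> (e x) = \<epsilon> x)"
proof -
  interpret Q: graded_quotients K A AG Q QG \<epsilon>
    by (rule graded_quotients_if_maximal[OF A.graded_lie_algebra_axioms A.semiprime Q])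
  interpret P: graded_quotients_pair K A AG T TG e Q QG \<epsilon> ..
  have hom: "\<exists>y\<in>QG \<gamma>. P.corr p y" if p: "p \<in> TG \<gamma>" for p \<gamma>
  proof -
    have pc: "p \<in> carrier T" using p T.grade_closed by auto
    obtain U where U: "U \<in> essential_ideals K A AG" and ab: "\<forall>a\<in>U. e a \<otimes>\<^bsub>T\<^esub> p \<in> e ` carrier A"
      using absorb[OF p] by blast
    note Ud = A.homogeneous_idealD[OF A.essential_ideal[OF U]]
    define D where "D = (\<lambda>a\<in>U. THE b. b \<in> carrier A \<and> e a \<otimes>\<^bsub>T\<^esub> p = e b)"
    have D: "D a \<in> carrier A" "e a \<otimes>\<^bsub>T\<^esub> p = e (D a)" if a: "a \<in> U" for a
    proof -
      obtain b where b: "b \<in> carrier A" "e a \<otimes>\<^bsub>T\<^esub> p = e b" using ab a by blast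
      have "D a = b" using a b e_inj unfolding D_def by (auto intro!: the_equality)
      with b show "D a \<in> carrier A" "e a \<otimes>\<^bsub>T\<^esub> p = e (D a)" by simp_all
    qed
    have Uc: "a \<in> carrier A" if "a \<in> U" for a using that Ud by auto
    have D_eq: "D a = b" if "a \<in> U" "b \<in> carrier A" "e a \<otimes>\<^bsub>T\<^esub> p = e b" for a b
      using that D e_inj by metis
    have "D \<in> partial_derivations K A AG U \<gamma>"
      unfolding partial_derivations_def
    proof (intro CollectI conjI ballI allI)
      show "D \<in> U \<rightarrow>\<^sub>E carrier A"
      proof (rule PiE_I)
        show "D a = undefined" if "a \<notin> U" for a using that by (simp add: D_def)
      qed (rule D(1))
      fix x y assume xy: "x \<in> U" "y \<in> U"
      then have c: "x \<in> carrier A" "y \<in> carrier A" using Uc by auto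
      show "D (x \<oplus>\<^bsub>A\<^esub> y) = D x \<oplus>\<^bsub>A\<^esub> D y"
        by (rule D_eq) (use c D[OF xy(1)] D[OF xy(2)] Ud(5)[OF xy] pc in
          \<open>simp_all add: e_add T.prod_l_distr e_closed\<close>)
      show "D (x \<otimes>\<^bsub>A\<^esub> y) = D x \<otimes>\<^bsub>A\<^esub> y \<oplus>\<^bsub>A\<^esub> x \<otimes>\<^bsub>A\<^esub> D y"
      proof (rule D_eq)
        show "x \<otimes>\<^bsub>A\<^esub> y \<in> U" using Ud(8) c xy by blast
        show "e (x \<otimes>\<^bsub>A\<^esub> y) \<otimes>\<^bsub>T\<^esub> p = e (D x \<otimes>\<^bsub>A\<^esub> y \<oplus>\<^bsub>A\<^esub> x \<otimes>\<^bsub>A\<^esub> D y)"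
          using T.leibniz[of "e x" "e y" p] c pc D[OF xy(1)] D[OF xy(2)]
          by (simp add: e_prod e_add e_closed A.prod_closed)
      qed (use c D(1)[OF xy(1)] D(1)[OF xy(2)] A.prod_closed in simp)
    next
      fix k x assume "k \<in> carrier K" "x \<in> U"
      then show "D (k \<odot>\<^bsub>A\<^esub> x) = k \<odot>\<^bsub>A\<^esub> D x"
        using D[of x] Uc[of x] Ud(7)[of k x] pc
        by (intro D_eq) (simp_all add: e_smult T.prod_l_smult e_closed)
    next
      fix \<alpha> show "D ` (U \<inter> AG \<alpha>) \<subseteq> AG (\<alpha> + \<gamma>)"
      proof safe
        fix a assume a: "a \<in> U" "a \<in> AG \<alpha>"
        show "D a \<in> AG (\<alpha> + \<gamma>)"
          using T.grading_prod[OF e_grade[OF a(2)] p] D[OF a(1)] e_grade_iff by simp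
      qed
    qed
    with Q U have "\<exists>y\<in>QG \<gamma>. \<forall>a\<in>U. \<epsilon> a \<otimes>\<^bsub>Q\<^esub> y = \<epsilon> (D a)" by (simp add: maximal_graded_quotients_def)
    then obtain y where y: "y \<in> QG \<gamma>" "\<forall>a\<in>U. \<epsilon> a \<otimes>\<^bsub>Q\<^esub> y = \<epsilon> (D a)" by blast
    then have "P.corr p y"
      unfolding P.corr_def using D pc Q.T.grade_closed[OF y(1)]
      by (intro conjI bexI[OF _ U] ballI) (auto intro!: bexI[of _ "D _"])
    then show ?thesis using y by blast
  qed
  have total: "\<exists>y. P.corr p y" if "p \<in> carrier T" for p
    using that
  proof (rule T.homogeneous_induct)
    show "\<exists>y. P.corr z y" if "z \<in> TG \<gamma>" for \<gamma> z using hom[OF that] by blast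
    show "\<exists>w. P.corr (y \<oplus>\<^bsub>T\<^esub> z) w" if "\<exists>w. P.corr y w" "\<exists>w. P.corr z w" for y z
      using P.corr_add that by blast
  qed
  define \<psi> where "\<psi> p = (THE y. P.corr p y)" for p
  have \<psi>_eq: "\<psi> p = y" if "P.corr p y" for p y
    unfolding \<psi>_def using that P.corr_right_unique by blast
  have \<psi>: "P.corr p (\<psi> p)" if "p \<in> carrier T" for p
    using total[OF that] \<psi>_eq by blast
  have "graded_embedding K T TG Q QG \<psi>"
    unfolding graded_embedding_def
  proof (intro conjI ballI allI)
    show "\<psi> \<in> carrier T \<rightarrow> carrier Q" using \<psi> P.corr_def by blast
    show "inj_on \<psi> (carrier T)"
      using \<psi> P.swap.corr_right_unique P.swap_corr by (metis inj_onI)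
    fix p q assume p: "p \<in> carrier T" and q: "q \<in> carrier T"
    show "\<psi> (p \<oplus>\<^bsub>T\<^esub> q) = \<psi> p \<oplus>\<^bsub>Q\<^esub> \<psi> q" by (rule \<psi>_eq[OF P.corr_add[OF \<psi>[OF p] \<psi>[OF q]]])
    show "\<psi> (p \<otimes>\<^bsub>T\<^esub> q) = \<psi> p \<otimes>\<^bsub>Q\<^esub> \<psi> q" by (rule \<psi>_eq[OF P.corr_prod[OF \<psi>[OF p] \<psi>[OF q]]])
  next
    fix k p assume k: "k \<in> carrier K" and p: "p \<in> carrier T"
    show "\<psi> (k \<odot>\<^bsub>T\<^esub> p) = k \<odot>\<^bsub>Q\<^esub> \<psi> p" by (rule \<psi>_eq[OF P.corr_smult[OF k \<psi>[OF p]]])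
  next
    fix \<gamma> show "\<psi> ` TG \<gamma> \<subseteq> QG \<gamma>" using hom \<psi>_eq by blast
  qed
  moreover have "\<forall>x\<in>carrier A. \<psi> (e x) = \<epsilon> x" using \<psi>_eq[OF P.corr_base] by simp
  ultimately show ?thesis by blast
qed

section \<open>Modules over the multiplication algebra\<close>

sublocale graded_right_module \<subseteq> graded_group M MG
  by (intro graded_group.intro graded_group_axioms.intro module_grading_direct) unfold_locales

context graded_right_module
begin

lemma act_zero: "s \<in> carrier S \<Longrightarrow> s \<odot>\<^bsub>M\<^esub> \<zero>\<^bsub>M\<^esub> = \<zero>\<^bsub>M\<^esub>"
  using additive_zero[OF M.abelian_group_axioms M.abelian_group_axioms, of "\<lambda>m. s \<odot>\<^bsub>M\<^esub> m"]
  by (simp add: act_closed act_add)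

lemma act_neg: "\<lbrakk>s \<in> carrier S; m \<in> carrier M\<rbrakk> \<Longrightarrow> s \<odot>\<^bsub>M\<^esub> (\<ominus>\<^bsub>M\<^esub> m) = \<ominus>\<^bsub>M\<^esub> (s \<odot>\<^bsub>M\<^esub> m)"
  using additive_neg[OF M.abelian_group_axioms M.abelian_group_axioms, of "\<lambda>m. s \<odot>\<^bsub>M\<^esub> m"]
  by (simp add: act_closed act_add)

end

context graded_lie_algebra
begin

lemma l_op_closed: "x \<in> carrier A \<Longrightarrow> l_op A x \<in> carrier A \<rightarrow>\<^sub>E carrier A"
  by (auto simp: l_op_def prod_closed)

lemma scalar_op_closed: "k \<in> carrier K \<Longrightarrow> scalar_op A k \<in> carrier A \<rightarrow>\<^sub>E carrier A"
  by (auto simp: scalar_op_def)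

lemma r_op_eq_l_op: "x \<in> carrier A \<Longrightarrow> r_op A x = l_op A (\<ominus>\<^bsub>A\<^esub> x)"
  by (auto simp: r_op_def l_op_def fun_eq_iff prod_l_neg anticommutative[of x])

lemma op_add_closed:
  "\<lbrakk>f \<in> carrier A \<rightarrow>\<^sub>E carrier A; g \<in> carrier A \<rightarrow>\<^sub>E carrier A\<rbrakk> \<Longrightarrow> op_add A f g \<in> carrier A \<rightarrow>\<^sub>E carrier A"
  by (auto simp: op_add_def)

lemma op_mult_closed:
  "\<lbrakk>f \<in> carrier A \<rightarrow>\<^sub>E carrier A; g \<in> carrier A \<rightarrow>\<^sub>E carrier A\<rbrakk> \<Longrightarrow> op_mult A f g \<in> carrier A \<rightarrow>\<^sub>E carrier A"
  by (auto simp: op_mult_def compose_def)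

lemma mult_ops_closed: "f \<in> mult_ops K A \<Longrightarrow> f \<in> carrier A \<rightarrow>\<^sub>E carrier A"
proof (induction rule: mult_ops.induct)
  case (2 x)
  then show ?case using l_op_closed[of "\<ominus>\<^bsub>A\<^esub> x"] by (simp add: r_op_eq_l_op)
qed (assumption | rule l_op_closed op_add_closed op_mult_closed scalar_op_closed)+

lemma mult_ops_in_mult_alg:
  assumes "f \<in> mult_ops K A"
  shows "f \<in> carrier (mult_alg K A)"
proof -
  have "f = op_add A (scalar_op A \<zero>\<^bsub>K\<^esub>) f"
  proof
    fix y show "f y = op_add A (scalar_op A \<zero>\<^bsub>K\<^esub>) f y"
      using mult_ops_closed[OF assms]
      by (cases "y \<in> carrier A") (auto simp: op_add_def scalar_op_def PiE_iff extensional_def)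
  qed
  then show ?thesis using assms R.zero_closed by (auto simp: mult_alg_def)
qed

lemma l_op_in_mult_alg: "x \<in> carrier A \<Longrightarrow> l_op A x \<in> carrier (mult_alg K A)"
  by (intro mult_ops_in_mult_alg mult_ops.intros)

lemma scalar_op_in_mult_alg:
  assumes "k \<in> carrier K"
  shows "scalar_op A k \<in> carrier (mult_alg K A)"
proof -
  have "scalar_op A k = op_add A (scalar_op A k) (l_op A \<zero>\<^bsub>A\<^esub>)"
    using assms by (auto simp: fun_eq_iff op_add_def scalar_op_def l_op_def prod_l_zero)
  moreover have "l_op A \<zero>\<^bsub>A\<^esub> \<in> mult_ops K A" by (intro mult_ops.intros) simp
  ultimately show ?thesis using assms by (auto simp: mult_alg_def)
qed

lemma add_mult_alg: "f \<oplus>\<^bsub>mult_alg K A\<^esub> g = op_add A f g"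
  and mult_mult_alg: "f \<otimes>\<^bsub>mult_alg K A\<^esub> g = op_mult A f g"
  and one_mult_alg: "\<one>\<^bsub>mult_alg K A\<^esub> = scalar_op A \<one>\<^bsub>K\<^esub>"
  by (auto simp: mult_alg_def l_op_def scalar_op_def prod_l_zero fun_eq_iff)

text \<open>By anticommutativity, the right multiplications are among the left ones.\<close>

lemma mult_alg_induct [consumes 1, case_names scalar left add mult]:
  assumes s: "s \<in> carrier (mult_alg K A)"
    and scalar: "\<And>k. k \<in> carrier K \<Longrightarrow> P (scalar_op A k)"
    and left: "\<And>x. x \<in> carrier A \<Longrightarrow> P (l_op A x)"
    and add: "\<And>f g. \<lbrakk>f \<in> carrier (mult_alg K A); g \<in> carrier (mult_alg K A); P f; P g\<rbrakk>
      \<Longrightarrow> P (f \<oplus>\<^bsub>mult_alg K A\<^esub> g)"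
    and mult: "\<And>f g. \<lbrakk>f \<in> carrier (mult_alg K A); g \<in> carrier (mult_alg K A); P f; P g\<rbrakk>
      \<Longrightarrow> P (f \<otimes>\<^bsub>mult_alg K A\<^esub> g)"
  shows "P s"
proof -
  have ops: "P f" if "f \<in> mult_ops K A" for f
    using that
  proof (induction rule: mult_ops.induct)
    case (1 x)
    then show ?case by (rule left)
  next
    case (2 x)
    then show ?case using left[of "\<ominus>\<^bsub>A\<^esub> x"] by (simp add: r_op_eq_l_op)
  next
    case (3 f g)
    then show ?case using add[of f g] by (simp add: add_mult_alg mult_ops_in_mult_alg)
  next
    case (4 f g)
    then show ?case using mult[of f g] by (simp add: mult_mult_alg mult_ops_in_mult_alg)
  next
    case (5 k f)
    then show ?case using mult[of f "scalar_op A k"] scalar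
      by (simp add: mult_mult_alg mult_ops_in_mult_alg scalar_op_in_mult_alg)
  qed
  obtain k f where "k \<in> carrier K" "f \<in> mult_ops K A" "s = op_add A (scalar_op A k) f"
    using s by (auto simp: mult_alg_def)
  then show ?thesis using add[of "scalar_op A k" f] scalar ops
    by (simp add: add_mult_alg mult_ops_in_mult_alg scalar_op_in_mult_alg)
qed

lemma l_op_add: "\<lbrakk>x \<in> carrier A; y \<in> carrier A\<rbrakk> \<Longrightarrow> l_op A (x \<oplus>\<^bsub>A\<^esub> y) = l_op A x \<oplus>\<^bsub>mult_alg K A\<^esub> l_op A y"
  by (auto simp: add_mult_alg l_op_def op_add_def fun_eq_iff prod_l_distr)

lemma l_op_prod:
  assumes "x \<in> carrier A" "y \<in> carrier A"
  shows "l_op A y \<otimes>\<^bsub>mult_alg K A\<^esub> l_op A x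
    = l_op A (x \<otimes>\<^bsub>A\<^esub> y) \<oplus>\<^bsub>mult_alg K A\<^esub> (l_op A x \<otimes>\<^bsub>mult_alg K A\<^esub> l_op A y)"
proof -
  have "x \<otimes>\<^bsub>A\<^esub> (y \<otimes>\<^bsub>A\<^esub> z) = (x \<otimes>\<^bsub>A\<^esub> y) \<otimes>\<^bsub>A\<^esub> z \<oplus>\<^bsub>A\<^esub> y \<otimes>\<^bsub>A\<^esub> (x \<otimes>\<^bsub>A\<^esub> z)" if "z \<in> carrier A" for z
    using leibniz_right[OF assms that] anticommutative[of "x \<otimes>\<^bsub>A\<^esub> z" y] assms that
    by (simp add: prod_closed a_minus_def)
  then show ?thesis using assms
    by (auto simp: add_mult_alg mult_mult_alg l_op_def op_add_def op_mult_def compose_def fun_eq_iff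
        prod_closed)
qed

lemma l_op_smult:
  assumes "k \<in> carrier K" "x \<in> carrier A"
  shows "l_op A (k \<odot>\<^bsub>A\<^esub> x) = l_op A x \<otimes>\<^bsub>mult_alg K A\<^esub> scalar_op A k"
    and "l_op A (k \<odot>\<^bsub>A\<^esub> x) = scalar_op A k \<otimes>\<^bsub>mult_alg K A\<^esub> l_op A x"
  using assms by (auto simp: mult_mult_alg l_op_def scalar_op_def op_mult_def compose_def fun_eq_iff
      prod_closed prod_l_smult prod_r_smult)

lemma scalar_op_add:
  "\<lbrakk>k \<in> carrier K; k' \<in> carrier K\<rbrakk> \<Longrightarrow> scalar_op A (k \<oplus>\<^bsub>K\<^esub> k') = scalar_op A k \<oplus>\<^bsub>mult_alg K A\<^esub> scalar_op A k'"
  by (auto simp: add_mult_alg scalar_op_def op_add_def fun_eq_iff smult_l_distr)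

lemma scalar_op_mult:
  "\<lbrakk>k \<in> carrier K; k' \<in> carrier K\<rbrakk> \<Longrightarrow> scalar_op A (k \<otimes>\<^bsub>K\<^esub> k') = scalar_op A k' \<otimes>\<^bsub>mult_alg K A\<^esub> scalar_op A k"
  by (auto simp: mult_mult_alg scalar_op_def op_mult_def compose_def fun_eq_iff smult_assoc1)

end

locale graded_hull = semiprime_graded_lie_algebra K A AG
  for K :: "('k, 'n) ring_scheme" and A :: "('k, 'a) module"
    and AG :: "'g::ab_group_add \<Rightarrow> 'a set" +
  fixes I :: "('a \<Rightarrow> 'a, 'i) module" and IG :: "'g \<Rightarrow> 'i set" and \<iota> :: "'a \<Rightarrow> 'i"
  assumes hull: "hull_of_algebra K A AG I IG \<iota>"

sublocale graded_hull \<subseteq> Im: graded_right_module "mult_alg K A" "mult_alg_grading K A AG" I IG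
  using hull by (simp add: hull_of_algebra_def graded_injective_hull_def)

context graded_hull
begin

definition lact :: "'a \<Rightarrow> 'i \<Rightarrow> 'i" where
  "lact x m = l_op A x \<odot>\<^bsub>I\<^esub> m"

definition kact :: "'k \<Rightarrow> 'i \<Rightarrow> 'i" where
  "kact k m = scalar_op A k \<odot>\<^bsub>I\<^esub> m"

lemma lact_closed: "\<lbrakk>x \<in> carrier A; m \<in> carrier I\<rbrakk> \<Longrightarrow> lact x m \<in> carrier I"
  by (simp add: lact_def l_op_in_mult_alg Im.act_closed)

lemma kact_closed: "\<lbrakk>k \<in> carrier K; m \<in> carrier I\<rbrakk> \<Longrightarrow> kact k m \<in> carrier I"
  by (simp add: kact_def scalar_op_in_mult_alg Im.act_closed)

lemma lact_add: "\<lbrakk>x \<in> carrier A; m \<in> carrier I; n \<in> carrier I\<rbrakk> \<Longrightarrow> lact x (m \<oplus>\<^bsub>I\<^esub> n) = lact x m \<oplus>\<^bsub>I\<^esub> lact x n"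
  by (simp add: lact_def l_op_in_mult_alg Im.act_add)

lemma kact_add: "\<lbrakk>k \<in> carrier K; m \<in> carrier I; n \<in> carrier I\<rbrakk> \<Longrightarrow> kact k (m \<oplus>\<^bsub>I\<^esub> n) = kact k m \<oplus>\<^bsub>I\<^esub> kact k n"
  by (simp add: kact_def scalar_op_in_mult_alg Im.act_add)

lemma lact_zero: "x \<in> carrier A \<Longrightarrow> lact x \<zero>\<^bsub>I\<^esub> = \<zero>\<^bsub>I\<^esub>"
  by (simp add: lact_def l_op_in_mult_alg Im.act_zero)

lemma kact_zero: "k \<in> carrier K \<Longrightarrow> kact k \<zero>\<^bsub>I\<^esub> = \<zero>\<^bsub>I\<^esub>"
  by (simp add: kact_def scalar_op_in_mult_alg Im.act_zero)

lemma lact_neg: "\<lbrakk>x \<in> carrier A; m \<in> carrier I\<rbrakk> \<Longrightarrow> lact x (\<ominus>\<^bsub>I\<^esub> m) = \<ominus>\<^bsub>I\<^esub> lact x m"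
  by (simp add: lact_def l_op_in_mult_alg Im.act_neg)

lemma add_lact: "\<lbrakk>x \<in> carrier A; y \<in> carrier A; m \<in> carrier I\<rbrakk> \<Longrightarrow> lact (x \<oplus>\<^bsub>A\<^esub> y) m = lact x m \<oplus>\<^bsub>I\<^esub> lact y m"
  by (simp add: lact_def l_op_add l_op_in_mult_alg Im.add_act)

lemma zero_lact:
  assumes m: "m \<in> carrier I"
  shows "lact \<zero>\<^bsub>A\<^esub> m = \<zero>\<^bsub>I\<^esub>"
  using additive_zero[OF M.abelian_group_axioms Im.M.abelian_group_axioms, of "\<lambda>x. lact x m"]
  by (simp add: m lact_closed add_lact)

lemma prod_lact:
  assumes "x \<in> carrier A" "y \<in> carrier A" "m \<in> carrier I"
  shows "lact x (lact y m) = lact (x \<otimes>\<^bsub>A\<^esub> y) m \<oplus>\<^bsub>I\<^esub> lact y (lact x m)"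
proof -
  have c: "l_op A x \<in> carrier (mult_alg K A)" "l_op A y \<in> carrier (mult_alg K A)"
    "l_op A (x \<otimes>\<^bsub>A\<^esub> y) \<in> carrier (mult_alg K A)"
    using assms by (simp_all add: l_op_in_mult_alg prod_closed)
  have "lact x (lact y m) = (l_op A y \<otimes>\<^bsub>mult_alg K A\<^esub> l_op A x) \<odot>\<^bsub>I\<^esub> m"
    unfolding lact_def using c assms by (simp add: Im.mult_act)
  also have "\<dots> = l_op A (x \<otimes>\<^bsub>A\<^esub> y) \<odot>\<^bsub>I\<^esub> m \<oplus>\<^bsub>I\<^esub> (l_op A x \<otimes>\<^bsub>mult_alg K A\<^esub> l_op A y) \<odot>\<^bsub>I\<^esub> m"
    unfolding l_op_prod[OF assms(1,2)]
    by (rule Im.add_act[OF c(3) Im.S.m_closed[OF c(1,2)] assms(3)])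
  also have "\<dots> = lact (x \<otimes>\<^bsub>A\<^esub> y) m \<oplus>\<^bsub>I\<^esub> lact y (lact x m)"
    unfolding lact_def using c assms by (simp add: Im.mult_act)
  finally show ?thesis .
qed

lemma smult_lact:
  assumes "k \<in> carrier K" "x \<in> carrier A" "m \<in> carrier I"
  shows "lact (k \<odot>\<^bsub>A\<^esub> x) m = kact k (lact x m)" "lact (k \<odot>\<^bsub>A\<^esub> x) m = lact x (kact k m)"
  unfolding lact_def kact_def
  using l_op_smult(1)[OF assms(1,2)] l_op_smult(2)[OF assms(1,2)]
  by (metis Im.mult_act assms l_op_in_mult_alg scalar_op_in_mult_alg)+

lemma add_kact: "\<lbrakk>k \<in> carrier K; k' \<in> carrier K; m \<in> carrier I\<rbrakk> \<Longrightarrow> kact (k \<oplus>\<^bsub>K\<^esub> k') m = kact k m \<oplus>\<^bsub>I\<^esub> kact k' m"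
  by (simp add: kact_def scalar_op_add scalar_op_in_mult_alg Im.add_act)

lemma mult_kact: "\<lbrakk>k \<in> carrier K; k' \<in> carrier K; m \<in> carrier I\<rbrakk> \<Longrightarrow> kact (k \<otimes>\<^bsub>K\<^esub> k') m = kact k (kact k' m)"
  by (simp add: kact_def scalar_op_mult scalar_op_in_mult_alg Im.mult_act)

lemma one_kact: "m \<in> carrier I \<Longrightarrow> kact \<one>\<^bsub>K\<^esub> m = m"
  using Im.one_act by (simp add: kact_def one_mult_alg)

lemma lact_grade: "\<lbrakk>x \<in> AG \<alpha>; m \<in> IG \<gamma>\<rbrakk> \<Longrightarrow> lact x m \<in> IG (\<gamma> + \<alpha>)"
  unfolding lact_def
  by (rule Im.module_grading_act) (auto simp: mult_alg_grading_def intro: mult_alg_gr.intros)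

lemma kact_grade: "\<lbrakk>k \<in> carrier K; m \<in> IG \<gamma>\<rbrakk> \<Longrightarrow> kact k m \<in> IG \<gamma>"
  using Im.module_grading_act[of "scalar_op A k" 0 m \<gamma>]
  by (auto simp: kact_def mult_alg_grading_def intro: mult_alg_gr.intros)

lemma component_kact:
  "\<lbrakk>k \<in> carrier K; m \<in> carrier I\<rbrakk> \<Longrightarrow> component I IG \<gamma> (kact k m) = kact k (component I IG \<gamma> m)"
  using component_hom[OF Im.graded_group_axioms Im.graded_group_axioms, of "kact k" 0 m \<gamma>]
  by (simp add: kact_closed kact_add kact_grade)

lemma component_lact:
  "\<lbrakk>x \<in> AG \<alpha>; m \<in> carrier I\<rbrakk> \<Longrightarrow> component I IG (\<gamma> + \<alpha>) (lact x m) = lact x (component I IG \<gamma> m)"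
  using component_hom[OF Im.graded_group_axioms Im.graded_group_axioms, of "lact x" \<alpha> m \<gamma>]
  by (simp add: lact_closed lact_add lact_grade grade_closed)

lemma \<iota>_closed: "x \<in> carrier A \<Longrightarrow> \<iota> x \<in> carrier I"
  and \<iota>_add: "\<lbrakk>x \<in> carrier A; y \<in> carrier A\<rbrakk> \<Longrightarrow> \<iota> (x \<oplus>\<^bsub>A\<^esub> y) = \<iota> x \<oplus>\<^bsub>I\<^esub> \<iota> y"
  and \<iota>_act: "\<lbrakk>s \<in> carrier (mult_alg K A); x \<in> carrier A\<rbrakk> \<Longrightarrow> \<iota> (s x) = s \<odot>\<^bsub>I\<^esub> \<iota> x"
  and \<iota>_grade: "x \<in> AG \<gamma> \<Longrightarrow> \<iota> x \<in> IG \<gamma>"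
  and \<iota>_inj: "\<lbrakk>\<iota> x = \<iota> y; x \<in> carrier A; y \<in> carrier A\<rbrakk> \<Longrightarrow> x = y"
  using hull by (auto simp: hull_of_algebra_def graded_injective_hull_def graded_hom_def mult_module_def
      inj_on_def image_subset_iff)

lemma \<iota>_prod: "\<lbrakk>x \<in> carrier A; y \<in> carrier A\<rbrakk> \<Longrightarrow> \<iota> (x \<otimes>\<^bsub>A\<^esub> y) = lact x (\<iota> y)"
  using \<iota>_act[OF l_op_in_mult_alg, of x y] by (simp add: lact_def l_op_def)

lemma \<iota>_smult: "\<lbrakk>k \<in> carrier K; x \<in> carrier A\<rbrakk> \<Longrightarrow> \<iota> (k \<odot>\<^bsub>A\<^esub> x) = kact k (\<iota> x)"
  using \<iota>_act[OF scalar_op_in_mult_alg, of k x] by (simp add: kact_def scalar_op_def)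

lemma \<iota>_zero: "\<iota> \<zero>\<^bsub>A\<^esub> = \<zero>\<^bsub>I\<^esub>"
  using additive_zero[OF M.abelian_group_axioms Im.M.abelian_group_axioms, of \<iota>]
  by (simp add: \<iota>_closed \<iota>_add)

lemma \<iota>_neg: "x \<in> carrier A \<Longrightarrow> \<iota> (\<ominus>\<^bsub>A\<^esub> x) = \<ominus>\<^bsub>I\<^esub> \<iota> x"
  using additive_neg[OF M.abelian_group_axioms Im.M.abelian_group_axioms, of \<iota>]
  by (simp add: \<iota>_closed \<iota>_add)

lemma \<iota>_component: "x \<in> carrier A \<Longrightarrow> component I IG \<gamma> (\<iota> x) = \<iota> (component A AG \<gamma> x)"
  using component_hom[OF graded_group_axioms Im.graded_group_axioms, of \<iota> 0 x \<gamma>]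
  by (simp add: \<iota>_closed \<iota>_add \<iota>_grade)

lemma homogeneous_right_submoduleI:
  assumes "X \<subseteq> carrier I" "\<zero>\<^bsub>I\<^esub> \<in> X" "\<And>p q. \<lbrakk>p \<in> X; q \<in> X\<rbrakk> \<Longrightarrow> p \<oplus>\<^bsub>I\<^esub> q \<in> X"
    and k: "\<And>k p. \<lbrakk>k \<in> carrier K; p \<in> X\<rbrakk> \<Longrightarrow> kact k p \<in> X"
    and l: "\<And>x p. \<lbrakk>x \<in> carrier A; p \<in> X\<rbrakk> \<Longrightarrow> lact x p \<in> X"
    and c: "\<And>\<gamma> p. p \<in> X \<Longrightarrow> component I IG \<gamma> p \<in> X"
  shows "homogeneous_right_submodule (mult_alg K A) I IG X"
proof -
  have act: "s \<odot>\<^bsub>I\<^esub> p \<in> X" if "s \<in> carrier (mult_alg K A)" "p \<in> X" for s p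
    using that
  proof (induction arbitrary: p rule: mult_alg_induct)
    case (add f g)
    then show ?case using assms Im.add_act[of f g p] by auto
  next
    case (mult f g)
    then show ?case using assms Im.mult_act[of f g p] by auto
  qed (use k l in \<open>auto simp: kact_def lact_def\<close>)
  have neg: "\<ominus>\<^bsub>I\<^esub> p \<in> X" if p: "p \<in> X" for p
  proof -
    have pc: "p \<in> carrier I" using p assms(1) by auto
    have "kact (\<ominus>\<^bsub>K\<^esub> \<one>\<^bsub>K\<^esub>) p \<oplus>\<^bsub>I\<^esub> p = kact (\<ominus>\<^bsub>K\<^esub> \<one>\<^bsub>K\<^esub> \<oplus>\<^bsub>K\<^esub> \<one>\<^bsub>K\<^esub>) p"
      using pc by (simp add: add_kact one_kact)
    also have "\<dots> = \<zero>\<^bsub>I\<^esub>"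
      using pc
        additive_zero[OF R.abelian_group_axioms Im.M.abelian_group_axioms, of "\<lambda>k. kact k p"]
      by (simp add: R.l_neg kact_closed add_kact)
    finally have "\<ominus>\<^bsub>I\<^esub> p = kact (\<ominus>\<^bsub>K\<^esub> \<one>\<^bsub>K\<^esub>) p" using pc by (intro Im.M.minus_equality) (auto simp: kact_closed)
    then show ?thesis using k[of "\<ominus>\<^bsub>K\<^esub> \<one>\<^bsub>K\<^esub>" p] p by simp
  qed
  have "subgroup X (add_monoid I)" by (rule Im.M.subgroup_add_monoidI) (use assms neg in auto)
  then show ?thesis using act c by (simp add: homogeneous_right_submodule_def Im.homogeneous_iff)
qed

lemma homogeneous_right_submoduleD:
  assumes "homogeneous_right_submodule (mult_alg K A) I IG X"
  shows "subgroup X (add_monoid I)" "X \<subseteq> carrier I" "\<zero>\<^bsub>I\<^esub> \<in> X" "\<lbrakk>p \<in> X; q \<in> X\<rbrakk> \<Longrightarrow> p \<oplus>\<^bsub>I\<^esub> q \<in> X"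
    and "p \<in> X \<Longrightarrow> \<ominus>\<^bsub>I\<^esub> p \<in> X"
    and "\<lbrakk>k \<in> carrier K; p \<in> X\<rbrakk> \<Longrightarrow> kact k p \<in> X" "\<lbrakk>x \<in> carrier A; p \<in> X\<rbrakk> \<Longrightarrow> lact x p \<in> X"
    and "p \<in> X \<Longrightarrow> component I IG \<gamma> p \<in> X"
proof -
  show X: "subgroup X (add_monoid I)" using assms by (simp add: homogeneous_right_submodule_def)
  note Xd = Im.M.subgroup_add_monoidD[OF X]
  show "X \<subseteq> carrier I" "\<zero>\<^bsub>I\<^esub> \<in> X" "\<lbrakk>p \<in> X; q \<in> X\<rbrakk> \<Longrightarrow> p \<oplus>\<^bsub>I\<^esub> q \<in> X" "p \<in> X \<Longrightarrow> \<ominus>\<^bsub>I\<^esub> p \<in> X"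
    by (fact Xd)+
  show "\<lbrakk>k \<in> carrier K; p \<in> X\<rbrakk> \<Longrightarrow> kact k p \<in> X" "\<lbrakk>x \<in> carrier A; p \<in> X\<rbrakk> \<Longrightarrow> lact x p \<in> X"
    using assms by (simp_all add: homogeneous_right_submodule_def kact_def lact_def l_op_in_mult_alg
        scalar_op_in_mult_alg)
  show "p \<in> X \<Longrightarrow> component I IG \<gamma> p \<in> X"
    using assms Im.homogeneous_iff[OF X] by (simp add: homogeneous_right_submodule_def)
qed

lemma submodule_meets:
  assumes X: "homogeneous_right_submodule (mult_alg K A) I IG X" and "p \<in> X" "p \<noteq> \<zero>\<^bsub>I\<^esub>"
  shows "\<exists>x\<in>carrier A. \<iota> x \<in> X \<and> x \<noteq> \<zero>\<^bsub>A\<^esub>"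
proof -
  have "X \<noteq> {\<zero>\<^bsub>I\<^esub>}" using assms by auto
  then have "X \<inter> \<iota> ` carrier A \<noteq> {\<zero>\<^bsub>I\<^esub>}"
    using hull X by (simp add: hull_of_algebra_def graded_injective_hull_def mult_module_def)
  moreover have "\<zero>\<^bsub>I\<^esub> \<in> X \<inter> \<iota> ` carrier A"
    using homogeneous_right_submoduleD(3)[OF X] \<iota>_zero by (metis IntI M.zero_closed imageI)
  ultimately obtain x where "x \<in> carrier A" "\<iota> x \<in> X" "\<iota> x \<noteq> \<zero>\<^bsub>I\<^esub>" by blast
  then show ?thesis using \<iota>_zero by auto
qed

lemma hull_faithful:
  assumes U: "U \<in> essential_ideals K A AG" and q: "q \<in> carrier I" and "\<And>a. a \<in> U \<Longrightarrow> lact a q = \<zero>\<^bsub>I\<^esub>"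
  shows "q = \<zero>\<^bsub>I\<^esub>"
proof (rule ccontr)
  assume nz: "q \<noteq> \<zero>\<^bsub>I\<^esub>"
  note Ud = homogeneous_idealD[OF essential_ideal[OF U]]
  define N where "N = {q \<in> carrier I. \<forall>a\<in>U. lact a q = \<zero>\<^bsub>I\<^esub>}"
  have Uc: "a \<in> carrier A" if "a \<in> U" for a using that Ud(3) by auto
  have "homogeneous_right_submodule (mult_alg K A) I IG N"
  proof (rule homogeneous_right_submoduleI)
    show "N \<subseteq> carrier I" "\<zero>\<^bsub>I\<^esub> \<in> N" using Uc by (auto simp: N_def lact_zero)
    show "p \<oplus>\<^bsub>I\<^esub> r \<in> N" if "p \<in> N" "r \<in> N" for p r using that Uc by (auto simp: N_def lact_add)
    show "kact k p \<in> N" if "k \<in> carrier K" "p \<in> N" for k p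
      using that Uc smult_lact[of k _ p] kact_zero by (auto simp: N_def kact_closed)
    show "lact x p \<in> N" if x: "x \<in> carrier A" and p: "p \<in> N" for x p
    proof -
      have "lact a (lact x p) = \<zero>\<^bsub>I\<^esub>" if a: "a \<in> U" for a
      proof -
        have "lact (a \<otimes>\<^bsub>A\<^esub> x) p = \<zero>\<^bsub>I\<^esub>" "lact a p = \<zero>\<^bsub>I\<^esub>" using p a Ud(9)[OF x a] by (auto simp: N_def)
        then show ?thesis using prod_lact[OF Uc[OF a] x, of p] p x by (simp add: N_def lact_zero)
      qed
      then show ?thesis using p x by (simp add: N_def lact_closed)
    qed
    show "component I IG \<gamma> p \<in> N" if p: "p \<in> N" for \<gamma> p
    proof -
      have pc: "p \<in> carrier I" using p by (simp add: N_def)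
      have "lact a (component I IG \<gamma> p) = \<zero>\<^bsub>I\<^esub>" if a: "a \<in> U" for a
        using Uc[OF a]
      proof (rule component_induct)
        fix \<alpha>
        have a': "component A AG \<alpha> a \<in> AG \<alpha>" "component A AG \<alpha> a \<in> U"
          using component_in[OF Uc[OF a]] Ud(10)[OF a] by auto
        have "lact (component A AG \<alpha> a) p = \<zero>\<^bsub>I\<^esub>" using a'(2) p by (simp add: N_def)
        then show "lact (component A AG \<alpha> a) (component I IG \<gamma> p) = \<zero>\<^bsub>I\<^esub>"
          using component_lact[OF a'(1) pc, of \<gamma>] by (simp add: Im.component_zero)
      qed (simp_all add: zero_lact add_lact Im.component_closed[OF pc])
      then show ?thesis using Im.component_closed[OF pc] by (simp add: N_def)
    qed
  qed
  then obtain x where x: "x \<in> carrier A" "\<iota> x \<in> N" "x \<noteq> \<zero>\<^bsub>A\<^esub>"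
    using submodule_meets[of N q] assms nz by (auto simp: N_def)
  have "a \<otimes>\<^bsub>A\<^esub> x = \<zero>\<^bsub>A\<^esub>" if "a \<in> U" for a
    using x that Uc[OF that] \<iota>_prod[of a x] \<iota>_inj[of "a \<otimes>\<^bsub>A\<^esub> x" "\<zero>\<^bsub>A\<^esub>"] \<iota>_zero
    by (simp add: N_def prod_closed)
  then show False using essential_annihilates[OF U x(1)] x(3) by blast
qed

lemma hull_eqI:
  assumes "U \<in> essential_ideals K A AG" "p \<in> carrier I" "q \<in> carrier I"
    and "\<And>a. a \<in> U \<Longrightarrow> lact a p = lact a q"
  shows "p = q"
proof -
  have U: "a \<in> carrier A" if "a \<in> U" for a
    using homogeneous_idealD(3)[OF essential_ideal[OF assms(1)]] that by auto
  have "lact a (p \<oplus>\<^bsub>I\<^esub> \<ominus>\<^bsub>I\<^esub> q) = \<zero>\<^bsub>I\<^esub>" if "a \<in> U" for a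
    using assms U[OF that] that by (simp add: lact_add lact_neg Im.M.r_neg lact_closed)
  then have "p \<oplus>\<^bsub>I\<^esub> \<ominus>\<^bsub>I\<^esub> q = \<zero>\<^bsub>I\<^esub>" using hull_faithful[OF assms(1)] assms by simp
  then show ?thesis using Im.M.minus_equality[of p "\<ominus>\<^bsub>I\<^esub> q"] assms by simp
qed

end

section \<open>The graded central closure and the graded extended centroid\<close>

context graded_hull
begin

lemma act_in_submodule:
  assumes "homogeneous_right_submodule (mult_alg K A) I IG X" "s \<in> carrier (mult_alg K A)" "p \<in> X"
  shows "s \<odot>\<^bsub>I\<^esub> p \<in> X"
  using assms by (simp add: homogeneous_right_submodule_def)

lemma graded_hom_iff:
  assumes X: "homogeneous_right_submodule (mult_alg K A) I IG X" and Y: "Y \<subseteq> carrier I"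
  shows "f \<in> graded_hom (mult_alg K A) (I\<lparr>carrier := X\<rparr>) (\<lambda>\<gamma>. X \<inter> IG \<gamma>) (I\<lparr>carrier := Y\<rparr>) (\<lambda>\<gamma>. Y \<inter> IG \<gamma>) \<longleftrightarrow>
    f \<in> X \<rightarrow>\<^sub>E Y \<and> (\<forall>p\<in>X. \<forall>q\<in>X. f (p \<oplus>\<^bsub>I\<^esub> q) = f p \<oplus>\<^bsub>I\<^esub> f q) \<and>
    (\<forall>k\<in>carrier K. \<forall>p\<in>X. f (kact k p) = kact k (f p)) \<and>
    (\<forall>x\<in>carrier A. \<forall>p\<in>X. f (lact x p) = lact x (f p)) \<and>
    (\<forall>\<gamma>. \<forall>p\<in>X. p \<in> IG \<gamma> \<longrightarrow> f p \<in> IG \<gamma>)" (is "?l \<longleftrightarrow> ?r")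
proof
  assume ?l
  then show ?r
    by (auto simp: graded_hom_def kact_def lact_def scalar_op_in_mult_alg l_op_in_mult_alg
        image_subset_iff)
next
  assume r: ?r
  note Xd = homogeneous_right_submoduleD[OF X]
  have fX: "f p \<in> Y" if "p \<in> X" for p using r that by auto
  have fI: "f p \<in> carrier I" if "p \<in> X" for p using fX[OF that] Y by auto
  have XI: "p \<in> carrier I" if "p \<in> X" for p using Xd(2) that by auto
  have "\<forall>p\<in>X. f (s \<odot>\<^bsub>I\<^esub> p) = s \<odot>\<^bsub>I\<^esub> f p" if "s \<in> carrier (mult_alg K A)" for s
    using that
  proof (induction rule: mult_alg_induct)
    case (add s t)
    then show ?case using r act_in_submodule[OF X] fI XI by (simp add: Im.add_act)
  next
    case (mult s t)
    then show ?case using act_in_submodule[OF X] fI XI by (simp add: Im.mult_act)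
  qed (use r in \<open>simp_all add: kact_def lact_def\<close>)
  then show ?l using r by (auto simp: graded_hom_def)
qed

lemma kact_neg: "\<lbrakk>k \<in> carrier K; m \<in> carrier I\<rbrakk> \<Longrightarrow> kact k (\<ominus>\<^bsub>I\<^esub> m) = \<ominus>\<^bsub>I\<^esub> kact k m"
  by (simp add: kact_def scalar_op_in_mult_alg Im.act_neg)

abbreviation "E \<equiv> graded_hom (mult_alg K A) I IG I IG"
abbreviation "P \<equiv> closure_set K A I IG \<iota>"
abbreviation "CM \<equiv> extended_centroid K A I IG \<iota>"

lemma submodule_carrier: "homogeneous_right_submodule (mult_alg K A) I IG (carrier I)"
  by (rule homogeneous_right_submoduleI) (auto simp: kact_closed lact_closed Im.component_closed)

lemma E_iff:
  "f \<in> E \<longleftrightarrow> f \<in> carrier I \<rightarrow>\<^sub>E carrier I \<and>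
    (\<forall>p\<in>carrier I. \<forall>q\<in>carrier I. f (p \<oplus>\<^bsub>I\<^esub> q) = f p \<oplus>\<^bsub>I\<^esub> f q) \<and>
    (\<forall>k\<in>carrier K. \<forall>p\<in>carrier I. f (kact k p) = kact k (f p)) \<and>
    (\<forall>x\<in>carrier A. \<forall>p\<in>carrier I. f (lact x p) = lact x (f p)) \<and>
    (\<forall>\<gamma>. \<forall>p\<in>carrier I. p \<in> IG \<gamma> \<longrightarrow> f p \<in> IG \<gamma>)"
proof -
  have "carrier I \<inter> IG \<gamma> = IG \<gamma>" for \<gamma> using Im.grade_closed by auto
  then show ?thesis using graded_hom_iff[OF submodule_carrier order.refl, of f] by simp
qed

lemma E_closed: "\<lbrakk>f \<in> E; p \<in> carrier I\<rbrakk> \<Longrightarrow> f p \<in> carrier I"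
  and E_add: "\<lbrakk>f \<in> E; p \<in> carrier I; q \<in> carrier I\<rbrakk> \<Longrightarrow> f (p \<oplus>\<^bsub>I\<^esub> q) = f p \<oplus>\<^bsub>I\<^esub> f q"
  and E_kact: "\<lbrakk>f \<in> E; k \<in> carrier K; p \<in> carrier I\<rbrakk> \<Longrightarrow> f (kact k p) = kact k (f p)"
  and E_lact: "\<lbrakk>f \<in> E; x \<in> carrier A; p \<in> carrier I\<rbrakk> \<Longrightarrow> f (lact x p) = lact x (f p)"
  and E_grade: "\<lbrakk>f \<in> E; p \<in> IG \<gamma>\<rbrakk> \<Longrightarrow> f p \<in> IG \<gamma>"
  unfolding E_iff using Im.grade_closed by auto

lemma E_compose: "\<lbrakk>f \<in> E; g \<in> E\<rbrakk> \<Longrightarrow> (\<lambda>p\<in>carrier I. f (g p)) \<in> E"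
  using E_closed[of f] E_closed[of g] E_grade[of f] E_grade[of g]
  by (subst E_iff) (auto simp: E_add E_kact E_lact kact_closed lact_closed)

lemma E_id: "(\<lambda>p\<in>carrier I. p) \<in> E"
  by (subst E_iff) (auto simp: kact_closed lact_closed)

lemma E_component:
  assumes "f \<in> E" "p \<in> carrier I"
  shows "component I IG \<gamma> (f p) = f (component I IG \<gamma> p)"
  using component_hom[OF Im.graded_group_axioms Im.graded_group_axioms, of f 0 p \<gamma>] assms
  by (simp add: E_closed E_add E_grade)

lemma closure_generator_closed: "{\<alpha> (\<iota> x) | \<alpha> x. \<alpha> \<in> E \<and> x \<in> carrier A} \<subseteq> carrier I"
  using E_closed \<iota>_closed by auto

lemma closure_subgroup: "subgroup P (add_monoid I)"
  unfolding closure_set_def using closure_generator_closed by (intro Im.M.add.generate_is_subgroup) simp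

lemmas closure_subgroupD = Im.M.subgroup_add_monoidD[OF closure_subgroup]

lemma closure_closed: "p \<in> P \<Longrightarrow> p \<in> carrier I"
  using closure_subgroupD(1) by auto

lemma closure_generator: "\<lbrakk>\<alpha> \<in> E; x \<in> carrier A\<rbrakk> \<Longrightarrow> \<alpha> (\<iota> x) \<in> P"
  unfolding closure_set_def by (rule generate.incl) auto

lemma closure_base: "x \<in> carrier A \<Longrightarrow> \<iota> x \<in> P"
  using closure_generator[OF E_id, of x] by (simp add: \<iota>_closed)

lemma closure_induct_E [consumes 1, case_names gen add]:
  assumes p: "p \<in> P" and gen: "\<And>\<alpha> x. \<lbrakk>\<alpha> \<in> E; x \<in> carrier A\<rbrakk> \<Longrightarrow> Q (\<alpha> (\<iota> x))"
    and add: "\<And>p q. \<lbrakk>p \<in> P; q \<in> P; Q p; Q q\<rbrakk> \<Longrightarrow> Q (p \<oplus>\<^bsub>I\<^esub> q)"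
  shows "Q p"
  using p unfolding closure_set_def
proof (induction rule: generate.induct)
  case one
  show ?case using gen[OF E_id M.zero_closed] by (simp add: \<iota>_zero)
next
  case (incl h)
  then show ?case using gen by auto
next
  case (inv h)
  then obtain \<alpha> x where h: "\<alpha> \<in> E" "x \<in> carrier A" "h = \<alpha> (\<iota> x)" by auto
  have "\<ominus>\<^bsub>I\<^esub> h = \<alpha> (\<iota> (\<ominus>\<^bsub>A\<^esub> x))"
    using additive_neg[OF Im.M.abelian_group_axioms Im.M.abelian_group_axioms, of \<alpha> "\<iota> x"] h
    by (simp add: E_closed E_add \<iota>_neg \<iota>_closed)
  then show ?case using gen[of \<alpha> "\<ominus>\<^bsub>A\<^esub> x"] h by (simp add: a_inv_def)
next
  case (eng h1 h2)
  then show ?case using add[of h1 h2] by (simp add: closure_set_def)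
qed

lemma closure_submodule: "homogeneous_right_submodule (mult_alg K A) I IG P"
proof (rule homogeneous_right_submoduleI)
  show "P \<subseteq> carrier I" "\<zero>\<^bsub>I\<^esub> \<in> P" "\<And>p q. \<lbrakk>p \<in> P; q \<in> P\<rbrakk> \<Longrightarrow> p \<oplus>\<^bsub>I\<^esub> q \<in> P"
    by (fact closure_subgroupD)+
  show "kact k p \<in> P" if k: "k \<in> carrier K" and p: "p \<in> P" for k p
    using p
  proof (induction rule: closure_induct_E)
    case (gen \<alpha> x)
    then have "kact k (\<alpha> (\<iota> x)) = \<alpha> (\<iota> (k \<odot>\<^bsub>A\<^esub> x))" using k by (simp add: \<iota>_smult E_kact \<iota>_closed)
    then show ?case using closure_generator gen k by simp
  qed (use k in \<open>simp add: kact_add closure_closed closure_subgroupD\<close>)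
  show "lact x p \<in> P" if x: "x \<in> carrier A" and p: "p \<in> P" for x p
    using p
  proof (induction rule: closure_induct_E)
    case (gen \<alpha> y)
    then have "lact x (\<alpha> (\<iota> y)) = \<alpha> (\<iota> (x \<otimes>\<^bsub>A\<^esub> y))" using x by (simp add: \<iota>_prod E_lact \<iota>_closed)
    then show ?case using closure_generator gen x by (simp add: prod_closed)
  qed (use x in \<open>simp add: lact_add closure_closed closure_subgroupD\<close>)
  show "component I IG \<gamma> p \<in> P" if p: "p \<in> P" for \<gamma> p
    using p
  proof (induction rule: closure_induct_E)
    case (gen \<alpha> x)
    then show ?case
      using closure_generator by (simp add: E_component \<iota>_component \<iota>_closed component_closed)
  qed (simp add: Im.component_add closure_closed closure_subgroupD)
qed

lemmas closure_D = homogeneous_right_submoduleD[OF closure_submodule]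

lemma centroid_iff:
  "\<alpha> \<in> carrier CM \<longleftrightarrow> \<alpha> \<in> P \<rightarrow>\<^sub>E P \<and> (\<forall>p\<in>P. \<forall>q\<in>P. \<alpha> (p \<oplus>\<^bsub>I\<^esub> q) = \<alpha> p \<oplus>\<^bsub>I\<^esub> \<alpha> q) \<and>
    (\<forall>k\<in>carrier K. \<forall>p\<in>P. \<alpha> (kact k p) = kact k (\<alpha> p)) \<and>
    (\<forall>x\<in>carrier A. \<forall>p\<in>P. \<alpha> (lact x p) = lact x (\<alpha> p)) \<and>
    (\<forall>\<gamma>. \<forall>p\<in>P. p \<in> IG \<gamma> \<longrightarrow> \<alpha> p \<in> IG \<gamma>)"
  using graded_hom_iff[OF closure_submodule closure_D(2)]
  by (simp add: extended_centroid_def closure_module_def)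

lemma centroid_closed: "\<lbrakk>\<alpha> \<in> carrier CM; p \<in> P\<rbrakk> \<Longrightarrow> \<alpha> p \<in> P"
  and centroid_add: "\<lbrakk>\<alpha> \<in> carrier CM; p \<in> P; q \<in> P\<rbrakk> \<Longrightarrow> \<alpha> (p \<oplus>\<^bsub>I\<^esub> q) = \<alpha> p \<oplus>\<^bsub>I\<^esub> \<alpha> q"
  and centroid_kact: "\<lbrakk>\<alpha> \<in> carrier CM; k \<in> carrier K; p \<in> P\<rbrakk> \<Longrightarrow> \<alpha> (kact k p) = kact k (\<alpha> p)"
  and centroid_lact: "\<lbrakk>\<alpha> \<in> carrier CM; x \<in> carrier A; p \<in> P\<rbrakk> \<Longrightarrow> \<alpha> (lact x p) = lact x (\<alpha> p)"
  and centroid_grade: "\<lbrakk>\<alpha> \<in> carrier CM; p \<in> P; p \<in> IG \<gamma>\<rbrakk> \<Longrightarrow> \<alpha> p \<in> IG \<gamma>"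
  and centroid_outside: "\<lbrakk>\<alpha> \<in> carrier CM; p \<notin> P\<rbrakk> \<Longrightarrow> \<alpha> p = undefined"
  unfolding centroid_iff by (auto simp: PiE_iff extensional_def)

lemma centroidI:
  assumes "\<And>p. p \<in> P \<Longrightarrow> f p \<in> P" "\<And>p q. \<lbrakk>p \<in> P; q \<in> P\<rbrakk> \<Longrightarrow> f (p \<oplus>\<^bsub>I\<^esub> q) = f p \<oplus>\<^bsub>I\<^esub> f q"
    and "\<And>k p. \<lbrakk>k \<in> carrier K; p \<in> P\<rbrakk> \<Longrightarrow> f (kact k p) = kact k (f p)"
    and "\<And>x p. \<lbrakk>x \<in> carrier A; p \<in> P\<rbrakk> \<Longrightarrow> f (lact x p) = lact x (f p)"
    and "\<And>\<gamma> p. \<lbrakk>p \<in> P; p \<in> IG \<gamma>\<rbrakk> \<Longrightarrow> f p \<in> IG \<gamma>"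
  shows "(\<lambda>p\<in>P. f p) \<in> carrier CM"
  using assms closure_D(4,6,7) unfolding centroid_iff by simp

lemma centroid_ext:
  assumes "\<alpha> \<in> carrier CM" "\<beta> \<in> carrier CM" "\<And>p. p \<in> P \<Longrightarrow> \<alpha> p = \<beta> p"
  shows "\<alpha> = \<beta>"
  using assms centroid_outside by (metis ext)

lemma E_closure: "\<lbrakk>\<alpha> \<in> E; p \<in> P\<rbrakk> \<Longrightarrow> \<alpha> p \<in> P"
proof -
  assume \<alpha>: "\<alpha> \<in> E" and p: "p \<in> P"
  show "\<alpha> p \<in> P" using p
  proof (induction rule: closure_induct_E)
    case (gen \<beta> x)
    then show ?case using closure_generator[OF E_compose[OF \<alpha> gen(1)] gen(2)] by (simp add: \<iota>_closed)
  qed (simp add: E_add[OF \<alpha>] closure_closed closure_subgroupD)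
qed

lemma E_restrict: "\<alpha> \<in> E \<Longrightarrow> (\<lambda>p\<in>P. \<alpha> p) \<in> carrier CM"
  by (rule centroidI) (simp_all add: E_closure E_add E_kact E_lact E_grade closure_closed)

lemma closure_induct [consumes 1, case_names gen add]:
  assumes p: "p \<in> P" and gen: "\<And>\<alpha> x \<gamma>. \<lbrakk>\<alpha> \<in> carrier CM; x \<in> AG \<gamma>\<rbrakk> \<Longrightarrow> Q (\<alpha> (\<iota> x))"
    and add: "\<And>p q. \<lbrakk>p \<in> P; q \<in> P; Q p; Q q\<rbrakk> \<Longrightarrow> Q (p \<oplus>\<^bsub>I\<^esub> q)"
  shows "Q p"
  using p
proof (induction rule: closure_induct_E)
  case (gen \<alpha> x)
  show ?case using gen(2)
  proof (rule homogeneous_induct)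
    show "Q (\<alpha> (\<iota> y))" if "y \<in> AG \<gamma>" for y \<gamma>
      using assms(2)[OF E_restrict[OF gen(1)] that] closure_base[OF grade_closed[OF that]] by simp
    show "Q (\<alpha> (\<iota> (y \<oplus>\<^bsub>A\<^esub> z)))" if "y \<in> carrier A" "z \<in> carrier A" "Q (\<alpha> (\<iota> y))" "Q (\<alpha> (\<iota> z))" for y z
      using that add[OF closure_generator[OF gen(1)] closure_generator[OF gen(1)]] gen(1)
      by (simp add: \<iota>_add E_add \<iota>_closed)
  qed
qed (rule add)

lemma centroid_mult: "\<alpha> \<otimes>\<^bsub>CM\<^esub> \<beta> = (\<lambda>p\<in>P. \<alpha> (\<beta> p))"
  and centroid_sum: "\<alpha> \<oplus>\<^bsub>CM\<^esub> \<beta> = (\<lambda>p\<in>P. \<alpha> p \<oplus>\<^bsub>I\<^esub> \<beta> p)"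
  and centroid_one: "\<one>\<^bsub>CM\<^esub> = (\<lambda>p\<in>P. p)"
  and centroid_zero: "\<zero>\<^bsub>CM\<^esub> = (\<lambda>p\<in>P. \<zero>\<^bsub>I\<^esub>)"
  by (simp_all add: extended_centroid_def compose_def)

lemma centroid_mult_closed: "\<lbrakk>\<alpha> \<in> carrier CM; \<beta> \<in> carrier CM\<rbrakk> \<Longrightarrow> \<alpha> \<otimes>\<^bsub>CM\<^esub> \<beta> \<in> carrier CM"
  unfolding centroid_mult
  by (rule centroidI) (simp_all add: centroid_closed centroid_add centroid_kact centroid_lact centroid_grade)

lemma centroid_sum_closed: "\<lbrakk>\<alpha> \<in> carrier CM; \<beta> \<in> carrier CM\<rbrakk> \<Longrightarrow> \<alpha> \<oplus>\<^bsub>CM\<^esub> \<beta> \<in> carrier CM"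
  unfolding centroid_sum
  by (rule centroidI)
    (simp_all add: centroid_closed closure_closed closure_D(4) centroid_add centroid_kact centroid_lact
      centroid_grade kact_add lact_add Im.M.a_ac Im.grade_add)

lemma centroid_one_closed: "\<one>\<^bsub>CM\<^esub> \<in> carrier CM"
  unfolding centroid_one by (rule centroidI) simp_all

lemma centroid_zero_closed: "\<zero>\<^bsub>CM\<^esub> \<in> carrier CM"
  unfolding centroid_zero
  by (rule centroidI) (simp_all add: closure_D(3) kact_zero lact_zero Im.grade_zero)

lemma centroid_neg_closed: "\<alpha> \<in> carrier CM \<Longrightarrow> (\<lambda>p\<in>P. \<ominus>\<^bsub>I\<^esub> \<alpha> p) \<in> carrier CM"
proof (rule centroidI)
  assume \<alpha>: "\<alpha> \<in> carrier CM"
  show "\<ominus>\<^bsub>I\<^esub> \<alpha> p \<in> P" if "p \<in> P" for p using that \<alpha> by (simp add: centroid_closed closure_D(5))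
  show "\<ominus>\<^bsub>I\<^esub> \<alpha> (p \<oplus>\<^bsub>I\<^esub> q) = \<ominus>\<^bsub>I\<^esub> \<alpha> p \<oplus>\<^bsub>I\<^esub> \<ominus>\<^bsub>I\<^esub> \<alpha> q" if "p \<in> P" "q \<in> P" for p q
    using that \<alpha> by (simp add: centroid_add centroid_closed closure_closed Im.M.minus_add)
  show "\<ominus>\<^bsub>I\<^esub> \<alpha> (kact k p) = kact k (\<ominus>\<^bsub>I\<^esub> \<alpha> p)" if "k \<in> carrier K" "p \<in> P" for k p
    using that \<alpha> by (simp add: centroid_kact kact_neg centroid_closed closure_closed)
  show "\<ominus>\<^bsub>I\<^esub> \<alpha> (lact x p) = lact x (\<ominus>\<^bsub>I\<^esub> \<alpha> p)" if "x \<in> carrier A" "p \<in> P" for x p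
    using that \<alpha> by (simp add: centroid_lact lact_neg centroid_closed closure_closed)
  show "\<ominus>\<^bsub>I\<^esub> \<alpha> p \<in> IG \<gamma>" if "p \<in> P" "p \<in> IG \<gamma>" for \<gamma> p
    using that \<alpha> by (simp add: centroid_grade Im.grade_neg)
qed

sublocale cl: graded_group "I\<lparr>carrier := P\<rparr>" "\<lambda>\<gamma>. P \<inter> IG \<gamma>"
  using closure_submodule closure_subgroup
  by (intro Im.graded_group_restrict(1)) (simp_all add: homogeneous_right_submodule_def)

lemma closure_component: "p \<in> P \<Longrightarrow> component (I\<lparr>carrier := P\<rparr>) (\<lambda>\<gamma>. P \<inter> IG \<gamma>) \<gamma> p = component I IG \<gamma> p"
  using closure_submodule closure_subgroup
  by (intro Im.graded_group_restrict(2)) (simp_all add: homogeneous_right_submodule_def)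

lemma closure_component_in: "p \<in> P \<Longrightarrow> component I IG \<gamma> p \<in> P \<inter> IG \<gamma>"
  using closure_D(8) Im.component_in closure_closed by simp

lemma closure_neg: "p \<in> P \<Longrightarrow> \<ominus>\<^bsub>I\<lparr>carrier := P\<rparr>\<^esub> p = \<ominus>\<^bsub>I\<^esub> p"
  by (rule Im.M.abelian_group_restrict(2)[OF closure_subgroup]) simp_all

lemma centroid_component:
  assumes "\<alpha> \<in> carrier CM" "p \<in> P"
  shows "component I IG \<gamma> (\<alpha> p) = \<alpha> (component I IG \<gamma> p)"
  using component_hom[OF cl.graded_group_axioms Im.graded_group_axioms, of \<alpha> 0 p \<gamma>] assms
  by (simp add: centroid_closed centroid_add centroid_grade closure_closed closure_component)

lemma centroid_zero_right: "\<alpha> \<in> carrier CM \<Longrightarrow> \<alpha> \<zero>\<^bsub>I\<^esub> = \<zero>\<^bsub>I\<^esub>"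
  using additive_zero[OF cl.abelian_group_axioms Im.M.abelian_group_axioms, of \<alpha>]
  by (simp add: centroid_closed centroid_add closure_closed)

lemma centroid_neg_right: "\<lbrakk>\<alpha> \<in> carrier CM; p \<in> P\<rbrakk> \<Longrightarrow> \<alpha> (\<ominus>\<^bsub>I\<^esub> p) = \<ominus>\<^bsub>I\<^esub> \<alpha> p"
  using additive_neg[OF cl.abelian_group_axioms Im.M.abelian_group_axioms, of \<alpha> p]
  by (simp add: centroid_closed centroid_add closure_closed closure_neg)

lemma preimage_ideal:
  assumes X: "homogeneous_right_submodule (mult_alg K A) I IG X"
  shows "homogeneous_ideal K A AG {x \<in> carrier A. \<iota> x \<in> X}"
proof (rule homogeneous_idealI_left)
  note Xd = homogeneous_right_submoduleD[OF X]
  show "{x \<in> carrier A. \<iota> x \<in> X} \<subseteq> carrier A" "\<zero>\<^bsub>A\<^esub> \<in> {x \<in> carrier A. \<iota> x \<in> X}"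
    using Xd(3) by (auto simp: \<iota>_zero)
  show "x \<oplus>\<^bsub>A\<^esub> y \<in> {x \<in> carrier A. \<iota> x \<in> X}" if "x \<in> {x \<in> carrier A. \<iota> x \<in> X}" "y \<in> {x \<in> carrier A. \<iota> x \<in> X}"
    for x y using that Xd(4) by (simp add: \<iota>_add)
  show "k \<odot>\<^bsub>A\<^esub> x \<in> {x \<in> carrier A. \<iota> x \<in> X}" if "k \<in> carrier K" "x \<in> {x \<in> carrier A. \<iota> x \<in> X}" for k x
    using that Xd(6) by (simp add: \<iota>_smult)
  show "a \<otimes>\<^bsub>A\<^esub> x \<in> {x \<in> carrier A. \<iota> x \<in> X}" if "a \<in> carrier A" "x \<in> {x \<in> carrier A. \<iota> x \<in> X}" for a x
    using that Xd(7) by (simp add: \<iota>_prod prod_closed)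
  show "component A AG \<gamma> x \<in> {x \<in> carrier A. \<iota> x \<in> X}" if "x \<in> {x \<in> carrier A. \<iota> x \<in> X}" for \<gamma> x
    using that Xd(8)[of "\<iota> x" \<gamma>] by (simp add: \<iota>_component component_closed)
qed

lemma image_submodule:
  assumes "homogeneous_ideal K A AG V" "\<alpha> \<in> carrier CM"
  shows "homogeneous_right_submodule (mult_alg K A) I IG ((\<lambda>x. \<alpha> (\<iota> x)) ` V)"
proof (rule homogeneous_right_submoduleI)
  note Vd = homogeneous_idealD[OF assms(1)]
  have VA: "x \<in> carrier A" if "x \<in> V" for x using that Vd(3) by auto
  note VP = closure_base[OF VA]
  show "(\<lambda>x. \<alpha> (\<iota> x)) ` V \<subseteq> carrier I" using VP assms centroid_closed closure_closed by auto
  show "\<zero>\<^bsub>I\<^esub> \<in> (\<lambda>x. \<alpha> (\<iota> x)) ` V"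
    using Vd(4) centroid_zero_right[OF assms(2)] \<iota>_zero by (intro image_eqI[of _ _ "\<zero>\<^bsub>A\<^esub>"]) auto
  show "p \<oplus>\<^bsub>I\<^esub> q \<in> (\<lambda>x. \<alpha> (\<iota> x)) ` V" if h: "p \<in> (\<lambda>x. \<alpha> (\<iota> x)) ` V" "q \<in> (\<lambda>x. \<alpha> (\<iota> x)) ` V" for p q
  proof -
    obtain x where x: "x \<in> V" "p = \<alpha> (\<iota> x)" using h(1) by blast
    moreover obtain y where "y \<in> V" "q = \<alpha> (\<iota> y)" using h(2) by blast
    ultimately show ?thesis using Vd(5)[of x y] VP VA assms(2)
      by (intro image_eqI[of _ _ "x \<oplus>\<^bsub>A\<^esub> y"]) (simp_all add: \<iota>_add centroid_add)
  qed
  show "kact k p \<in> (\<lambda>x. \<alpha> (\<iota> x)) ` V" if h: "k \<in> carrier K" "p \<in> (\<lambda>x. \<alpha> (\<iota> x)) ` V" for k p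
  proof -
    obtain x where "x \<in> V" "p = \<alpha> (\<iota> x)" using h by blast
    then show ?thesis using Vd(7)[of k x] h(1) VP VA assms(2)
      by (intro image_eqI[of _ _ "k \<odot>\<^bsub>A\<^esub> x"]) (simp_all add: \<iota>_smult centroid_kact)
  qed
  show "lact a p \<in> (\<lambda>x. \<alpha> (\<iota> x)) ` V" if h: "a \<in> carrier A" "p \<in> (\<lambda>x. \<alpha> (\<iota> x)) ` V" for a p
  proof -
    obtain x where "x \<in> V" "p = \<alpha> (\<iota> x)" using h by blast
    then show ?thesis using Vd(8)[of a x] h(1) VP VA assms(2)
      by (intro image_eqI[of _ _ "a \<otimes>\<^bsub>A\<^esub> x"]) (simp_all add: \<iota>_prod centroid_lact)
  qed
  show "component I IG \<gamma> p \<in> (\<lambda>x. \<alpha> (\<iota> x)) ` V" if h: "p \<in> (\<lambda>x. \<alpha> (\<iota> x)) ` V" for \<gamma> p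
  proof -
    obtain x where "x \<in> V" "p = \<alpha> (\<iota> x)" using h by blast
    then show ?thesis using Vd(10)[of x \<gamma>] VP VA assms(2)
      by (intro image_eqI[of _ _ "component A AG \<gamma> x"]) (simp_all add: centroid_component \<iota>_component)
  qed
qed

lemma closure_component_generator:
  assumes "\<alpha> \<in> carrier CM" "x \<in> carrier A"
  shows "component I IG \<gamma> (\<alpha> (\<iota> x)) = \<alpha> (\<iota> (component A AG \<gamma> x))"
  using assms by (simp add: centroid_component closure_base \<iota>_component)

lemma essential_domain:
  assumes \<alpha>: "\<alpha> \<in> carrier CM"
  shows "{x \<in> carrier A. \<alpha> (\<iota> x) \<in> \<iota> ` carrier A} \<in> essential_ideals K A AG"
proof (rule essential_if_meets)
  let ?U = "{x \<in> carrier A. \<alpha> (\<iota> x) \<in> \<iota> ` carrier A}"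
  show U: "homogeneous_ideal K A AG ?U"
  proof (rule homogeneous_idealI_left)
    show "?U \<subseteq> carrier A" by auto
    show "\<zero>\<^bsub>A\<^esub> \<in> ?U" using \<iota>_zero centroid_zero_right[OF \<alpha>] by (auto intro: image_eqI[of _ _ "\<zero>\<^bsub>A\<^esub>"])
    show "x \<oplus>\<^bsub>A\<^esub> y \<in> ?U" if h: "x \<in> ?U" "y \<in> ?U" for x y
    proof -
      obtain x' where x': "x' \<in> carrier A" "\<alpha> (\<iota> x) = \<iota> x'" using h(1) by auto
      obtain y' where "y' \<in> carrier A" "\<alpha> (\<iota> y) = \<iota> y'" using h(2) by auto
      with x' show ?thesis using h \<alpha>
        by (auto simp: \<iota>_add centroid_add closure_base intro!: image_eqI[of _ _ "x' \<oplus>\<^bsub>A\<^esub> y'"])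
    qed
    show "k \<odot>\<^bsub>A\<^esub> x \<in> ?U" if h: "k \<in> carrier K" "x \<in> ?U" for k x
    proof -
      obtain x' where "x' \<in> carrier A" "\<alpha> (\<iota> x) = \<iota> x'" using h by auto
      then show ?thesis using h \<alpha>
        by (auto simp: \<iota>_smult centroid_kact closure_base intro!: image_eqI[of _ _ "k \<odot>\<^bsub>A\<^esub> x'"])
    qed
    show "a \<otimes>\<^bsub>A\<^esub> x \<in> ?U" if h: "a \<in> carrier A" "x \<in> ?U" for a x
    proof -
      obtain x' where "x' \<in> carrier A" "\<alpha> (\<iota> x) = \<iota> x'" using h by auto
      then show ?thesis using h \<alpha>
        by (auto simp: \<iota>_prod centroid_lact closure_base prod_closed intro!: image_eqI[of _ _ "a \<otimes>\<^bsub>A\<^esub> x'"])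
    qed
    show "component A AG \<gamma> x \<in> ?U" if h: "x \<in> ?U" for \<gamma> x
    proof -
      obtain x' where "x' \<in> carrier A" "\<alpha> (\<iota> x) = \<iota> x'" using h by auto
      then show ?thesis using h closure_component_generator[OF \<alpha>, of x \<gamma>]
        by (auto simp: \<iota>_component component_closed intro!: image_eqI[of _ _ "component A AG \<gamma> x'"])
    qed
  qed
  fix V assume V: "homogeneous_ideal K A AG V" "V \<noteq> {\<zero>\<^bsub>A\<^esub>}"
  note Vd = homogeneous_idealD[OF V(1)]
  show "\<exists>x\<in>?U \<inter> V. x \<noteq> \<zero>\<^bsub>A\<^esub>"
  proof (cases "\<forall>v\<in>V. \<alpha> (\<iota> v) = \<zero>\<^bsub>I\<^esub>")
    case True
    obtain v where "v \<in> V" "v \<noteq> \<zero>\<^bsub>A\<^esub>" using V(2) Vd(4) by blast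
    moreover have "v \<in> ?U" using True \<open>v \<in> V\<close> Vd(3) \<iota>_zero by (auto intro: image_eqI[of _ _ "\<zero>\<^bsub>A\<^esub>"])
    ultimately show ?thesis by auto
  next
    case False
    then obtain v where v: "v \<in> V" "\<alpha> (\<iota> v) \<noteq> \<zero>\<^bsub>I\<^esub>" by blast
    then obtain y where y: "y \<in> carrier A" "\<iota> y \<in> (\<lambda>x. \<alpha> (\<iota> x)) ` V" "y \<noteq> \<zero>\<^bsub>A\<^esub>"
      using submodule_meets[OF image_submodule[OF V(1) \<alpha>], of "\<alpha> (\<iota> v)"] by blast
    then obtain u where u: "u \<in> V" "\<iota> y = \<alpha> (\<iota> u)" by blast
    have "u \<noteq> \<zero>\<^bsub>A\<^esub>"
      using u y \<iota>_zero centroid_zero_right[OF \<alpha>] \<iota>_inj[of y "\<zero>\<^bsub>A\<^esub>"] by auto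
    moreover have "u \<in> ?U" using u y Vd(3) by force
    ultimately show ?thesis using u by auto
  qed
qed

lemma closure_absorb:
  assumes "p \<in> P"
  shows "\<exists>U\<in>essential_ideals K A AG. \<forall>a\<in>U. lact a p \<in> \<iota> ` carrier A"
  using assms
proof (induction rule: closure_induct)
  case (gen \<alpha> x \<gamma>)
  have xc: "x \<in> carrier A" using gen grade_closed by auto
  note U = essential_domain[OF gen(1)]
  have "lact a (\<alpha> (\<iota> x)) \<in> \<iota> ` carrier A" if a: "a \<in> carrier A" "\<alpha> (\<iota> a) \<in> \<iota> ` carrier A" for a
  proof -
    have "a \<otimes>\<^bsub>A\<^esub> x \<in> {x \<in> carrier A. \<alpha> (\<iota> x) \<in> \<iota> ` carrier A}"
      using homogeneous_idealD(9)[OF essential_ideal[OF U] xc, of a] a by simp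
    then show ?thesis using centroid_lact[OF gen(1) a(1) closure_base[OF xc]] \<iota>_prod[OF a(1) xc] by simp
  qed
  then show ?case by (intro bexI[OF _ U] ballI) simp
next
  case (add p q)
  then obtain U V where U: "U \<in> essential_ideals K A AG" "\<forall>a\<in>U. lact a p \<in> \<iota> ` carrier A"
    and V: "V \<in> essential_ideals K A AG" "\<forall>a\<in>V. lact a q \<in> \<iota> ` carrier A" by blast
  have "lact a (p \<oplus>\<^bsub>I\<^esub> q) \<in> \<iota> ` carrier A" if "a \<in> U \<inter> V" for a
  proof -
    have "a \<in> carrier A" using that homogeneous_idealD(3)[OF essential_ideal[OF U(1)]] by blast
    moreover obtain b c where "b \<in> carrier A" "c \<in> carrier A" "lact a p = \<iota> b" "lact a q = \<iota> c"
      using U(2) V(2) \<open>a \<in> U \<inter> V\<close> by blast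
    ultimately show ?thesis using add closure_closed by (simp add: lact_add \<iota>_add[symmetric])
  qed
  then show ?case by (intro bexI[OF _ essential_inter[OF U(1) V(1)]] ballI)
qed

lemma centroid_eqI:
  assumes \<alpha>: "\<alpha> \<in> carrier CM" and \<beta>: "\<beta> \<in> carrier CM" and U: "U \<in> essential_ideals K A AG"
    and eq: "\<And>x. x \<in> U \<Longrightarrow> \<alpha> (\<iota> x) = \<beta> (\<iota> x)"
  shows "\<alpha> = \<beta>"
proof (rule centroid_ext[OF \<alpha> \<beta>])
  have UA: "a \<in> carrier A" if "a \<in> U" "U \<in> essential_ideals K A AG" for a U
    using that homogeneous_idealD(3)[OF essential_ideal] by blast
  have base: "\<alpha> (\<iota> x) = \<beta> (\<iota> x)" if x: "x \<in> carrier A" for x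
  proof (rule hull_eqI[OF U])
    show "\<alpha> (\<iota> x) \<in> carrier I" "\<beta> (\<iota> x) \<in> carrier I"
      using x \<alpha> \<beta> centroid_closed closure_base closure_closed by auto
    fix a assume a: "a \<in> U"
    have "a \<otimes>\<^bsub>A\<^esub> x \<in> U" using homogeneous_idealD(9)[OF essential_ideal[OF U] x a] .
    then show "lact a (\<alpha> (\<iota> x)) = lact a (\<beta> (\<iota> x))"
      using eq[of "a \<otimes>\<^bsub>A\<^esub> x"] \<iota>_prod[OF UA[OF a U] x] centroid_lact[OF \<alpha> UA[OF a U] closure_base[OF x]]
        centroid_lact[OF \<beta> UA[OF a U] closure_base[OF x]] by simp
  qed
  fix p assume p: "p \<in> P"
  obtain W where W: "W \<in> essential_ideals K A AG" "\<forall>a\<in>W. lact a p \<in> \<iota> ` carrier A"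
    using closure_absorb[OF p] by blast
  show "\<alpha> p = \<beta> p"
  proof (rule hull_eqI[OF W(1)])
    show "\<alpha> p \<in> carrier I" "\<beta> p \<in> carrier I" using p \<alpha> \<beta> centroid_closed closure_closed by auto
    fix a assume a: "a \<in> W"
    obtain b where "b \<in> carrier A" "lact a p = \<iota> b" using W(2) a by blast
    then show "lact a (\<alpha> p) = lact a (\<beta> p)"
      using base[of b] centroid_lact[OF \<alpha> UA[OF a W(1)] p] centroid_lact[OF \<beta> UA[OF a W(1)] p] by simp
  qed
qed

lemma equalizer_ideal:
  assumes \<alpha>: "\<alpha> \<in> carrier CM" and \<beta>: "\<beta> \<in> carrier CM"
  shows "homogeneous_ideal K A AG {x \<in> carrier A. \<alpha> (\<iota> x) = \<beta> (\<iota> x)}"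
  by (rule homogeneous_idealI_left)
    (simp_all add: subset_iff \<iota>_zero centroid_zero_right \<iota>_add \<iota>_smult \<iota>_prod prod_closed centroid_add centroid_kact
      centroid_lact closure_base component_closed closure_component_generator[symmetric] \<alpha> \<beta>)

text \<open>
  On a bracket of two elements of the common domain, both composites move one factor each, so they
  agree there; such brackets meet every nonzero ideal by semiprimeness.
\<close>

lemma centroid_commute:
  assumes \<alpha>: "\<alpha> \<in> carrier CM" and \<beta>: "\<beta> \<in> carrier CM"
  shows "\<alpha> \<otimes>\<^bsub>CM\<^esub> \<beta> = \<beta> \<otimes>\<^bsub>CM\<^esub> \<alpha>"
proof (rule centroid_eqI)
  let ?U = "{x \<in> carrier A. (\<alpha> \<otimes>\<^bsub>CM\<^esub> \<beta>) (\<iota> x) = (\<beta> \<otimes>\<^bsub>CM\<^esub> \<alpha>) (\<iota> x)}"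
  have c: "\<alpha> \<otimes>\<^bsub>CM\<^esub> \<beta> \<in> carrier CM" "\<beta> \<otimes>\<^bsub>CM\<^esub> \<alpha> \<in> carrier CM"
    using \<alpha> \<beta> by (simp_all add: centroid_mult_closed)
  show "\<alpha> \<otimes>\<^bsub>CM\<^esub> \<beta> \<in> carrier CM" "\<beta> \<otimes>\<^bsub>CM\<^esub> \<alpha> \<in> carrier CM" by (fact c)+
  let ?D = "\<lambda>\<alpha>. {x \<in> carrier A. \<alpha> (\<iota> x) \<in> \<iota> ` carrier A}"
  have D: "?D \<alpha> \<inter> ?D \<beta> \<in> essential_ideals K A AG"
    by (intro essential_inter essential_domain \<alpha> \<beta>)
  show "?U \<in> essential_ideals K A AG"
  proof (rule essential_if_meets[OF equalizer_ideal[OF c]])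
    fix V assume V: "homogeneous_ideal K A AG V" "V \<noteq> {\<zero>\<^bsub>A\<^esub>}"
    have "?D \<alpha> \<inter> ?D \<beta> \<inter> V \<noteq> {\<zero>\<^bsub>A\<^esub>}" using D V by (simp add: essential_ideals_def)
    then obtain x y where x: "x \<in> ?D \<alpha> \<inter> ?D \<beta> \<inter> V" and y: "y \<in> ?D \<alpha> \<inter> ?D \<beta> \<inter> V"
      and nz: "x \<otimes>\<^bsub>A\<^esub> y \<noteq> \<zero>\<^bsub>A\<^esub>"
      using ideal_prod_nonzero[OF homogeneous_ideal_inter[OF essential_ideal[OF D] V(1)]] by blast
    have xc: "x \<in> carrier A" and yc: "y \<in> carrier A" using x y by auto
    obtain x' y' where x': "x' \<in> carrier A" "\<alpha> (\<iota> x) = \<iota> x'" and y': "y' \<in> carrier A" "\<beta> (\<iota> y) = \<iota> y'"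
      using x y by auto
    note P = closure_base[OF xc] closure_base[OF yc] closure_base[OF x'(1)] closure_base[OF y'(1)]
    have anti: "\<iota> (a \<otimes>\<^bsub>A\<^esub> b) = \<ominus>\<^bsub>I\<^esub> lact b (\<iota> a)" if "a \<in> carrier A" "b \<in> carrier A" for a b
      using that by (simp add: anticommutative[of b a] \<iota>_neg \<iota>_prod prod_closed)
    have "\<alpha> (\<beta> (\<iota> (x \<otimes>\<^bsub>A\<^esub> y))) = \<alpha> (\<iota> (x \<otimes>\<^bsub>A\<^esub> y'))"
      using xc yc y' \<beta> P by (simp add: \<iota>_prod centroid_lact)
    also have "\<dots> = \<ominus>\<^bsub>I\<^esub> lact y' (\<alpha> (\<iota> x))"
      using xc y' \<alpha> P by (simp add: anti centroid_lact centroid_neg_right closure_D(7))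
    also have "\<dots> = \<iota> (x' \<otimes>\<^bsub>A\<^esub> y')" using x' y' by (simp add: anti)
    finally have 1: "\<alpha> (\<beta> (\<iota> (x \<otimes>\<^bsub>A\<^esub> y))) = \<iota> (x' \<otimes>\<^bsub>A\<^esub> y')" .
    have "\<beta> (\<alpha> (\<iota> (x \<otimes>\<^bsub>A\<^esub> y))) = \<beta> (\<ominus>\<^bsub>I\<^esub> lact y (\<alpha> (\<iota> x)))"
      using xc yc \<alpha> P by (simp add: anti centroid_lact centroid_neg_right closure_D(7))
    also have "\<dots> = \<beta> (\<iota> (x' \<otimes>\<^bsub>A\<^esub> y))" using x' yc by (simp add: anti)
    also have "\<dots> = \<iota> (x' \<otimes>\<^bsub>A\<^esub> y')" using x' yc y' \<beta> P by (simp add: \<iota>_prod centroid_lact)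
    finally have 2: "\<beta> (\<alpha> (\<iota> (x \<otimes>\<^bsub>A\<^esub> y))) = \<iota> (x' \<otimes>\<^bsub>A\<^esub> y')" .
    have "x \<otimes>\<^bsub>A\<^esub> y \<in> ?U"
      using 1 2 xc yc by (simp add: centroid_mult closure_base prod_closed)
    moreover have "x \<otimes>\<^bsub>A\<^esub> y \<in> V" using homogeneous_idealD(8)[OF V(1) xc] y by simp
    ultimately show "\<exists>x\<in>?U \<inter> V. x \<noteq> \<zero>\<^bsub>A\<^esub>" using nz by blast
  qed
  show "(\<alpha> \<otimes>\<^bsub>CM\<^esub> \<beta>) (\<iota> x) = (\<beta> \<otimes>\<^bsub>CM\<^esub> \<alpha>) (\<iota> x)" if "x \<in> ?U" for x using that by simp
qed

lemma centroid_apply_commute: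
  assumes "\<alpha> \<in> carrier CM" "\<beta> \<in> carrier CM" "p \<in> P"
  shows "\<alpha> (\<beta> p) = \<beta> (\<alpha> p)"
  using fun_cong[OF centroid_commute[OF assms(1,2)], of p] assms(3) by (simp add: centroid_mult)

lemma centroid_cring: "cring CM"
proof (rule cringI)
  note C = centroid_closed closure_closed
  show "abelian_group CM"
  proof (rule abelian_groupI)
    show "\<alpha> \<oplus>\<^bsub>CM\<^esub> \<beta> \<oplus>\<^bsub>CM\<^esub> \<delta> = \<alpha> \<oplus>\<^bsub>CM\<^esub> (\<beta> \<oplus>\<^bsub>CM\<^esub> \<delta>)"
      if "\<alpha> \<in> carrier CM" "\<beta> \<in> carrier CM" "\<delta> \<in> carrier CM" for \<alpha> \<beta> \<delta>
      unfolding centroid_sum using that C by (auto simp: Im.M.a_assoc)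
    show "\<alpha> \<oplus>\<^bsub>CM\<^esub> \<beta> = \<beta> \<oplus>\<^bsub>CM\<^esub> \<alpha>" if "\<alpha> \<in> carrier CM" "\<beta> \<in> carrier CM" for \<alpha> \<beta>
      unfolding centroid_sum using that C by (auto simp: Im.M.a_comm)
    show "\<zero>\<^bsub>CM\<^esub> \<oplus>\<^bsub>CM\<^esub> \<alpha> = \<alpha>" if "\<alpha> \<in> carrier CM" for \<alpha>
      by (rule centroid_ext[OF centroid_sum_closed[OF centroid_zero_closed that] that])
        (use that C in \<open>simp add: centroid_sum centroid_zero\<close>)
    show "\<exists>\<beta>\<in>carrier CM. \<beta> \<oplus>\<^bsub>CM\<^esub> \<alpha> = \<zero>\<^bsub>CM\<^esub>" if "\<alpha> \<in> carrier CM" for \<alpha>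
      using centroid_neg_closed[OF that] centroid_closed[OF that] closure_closed
      by (intro bexI[of _ "\<lambda>p\<in>P. \<ominus>\<^bsub>I\<^esub> \<alpha> p"]) (auto simp: centroid_sum centroid_zero Im.M.l_neg)
  qed (simp_all add: centroid_sum_closed centroid_zero_closed)
  show "comm_monoid CM"
  proof (rule comm_monoidI)
    show "\<alpha> \<otimes>\<^bsub>CM\<^esub> \<beta> \<otimes>\<^bsub>CM\<^esub> \<delta> = \<alpha> \<otimes>\<^bsub>CM\<^esub> (\<beta> \<otimes>\<^bsub>CM\<^esub> \<delta>)"
      if "\<alpha> \<in> carrier CM" "\<beta> \<in> carrier CM" "\<delta> \<in> carrier CM" for \<alpha> \<beta> \<delta>
      unfolding centroid_mult using that by (auto simp: centroid_closed)
    show "\<one>\<^bsub>CM\<^esub> \<otimes>\<^bsub>CM\<^esub> \<alpha> = \<alpha>" if "\<alpha> \<in> carrier CM" for \<alpha>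
      by (rule centroid_ext[OF centroid_mult_closed[OF centroid_one_closed that] that])
        (use that in \<open>simp add: centroid_mult centroid_one centroid_closed\<close>)
  qed (simp_all add: centroid_mult_closed centroid_one_closed centroid_commute)
  show "(\<alpha> \<oplus>\<^bsub>CM\<^esub> \<beta>) \<otimes>\<^bsub>CM\<^esub> \<delta> = \<alpha> \<otimes>\<^bsub>CM\<^esub> \<delta> \<oplus>\<^bsub>CM\<^esub> \<beta> \<otimes>\<^bsub>CM\<^esub> \<delta>"
    if "\<alpha> \<in> carrier CM" "\<beta> \<in> carrier CM" "\<delta> \<in> carrier CM" for \<alpha> \<beta> \<delta>
    unfolding centroid_sum centroid_mult using that by (auto simp: centroid_closed)
qed

end

subsection \<open>The bracket on the central closure\<close>

context graded_hull
begin

text \<open>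
  By the Jacobi identity, the bracket of two elements of the closure is determined by the brackets of
  the elements of an essential ideal with its factors.
\<close>

definition bracket_rel :: "'i \<Rightarrow> 'i \<Rightarrow> 'i \<Rightarrow> bool" where
  "bracket_rel p q z \<longleftrightarrow> z \<in> P \<and> (\<exists>U\<in>essential_ideals K A AG. \<forall>a\<in>U. \<exists>b\<in>carrier A. \<exists>c\<in>carrier A.
     lact a p = \<iota> b \<and> lact a q = \<iota> c \<and> lact a z = lact b q \<oplus>\<^bsub>I\<^esub> \<ominus>\<^bsub>I\<^esub> lact c p)"

lemma essential_closed: "\<lbrakk>U \<in> essential_ideals K A AG; a \<in> U\<rbrakk> \<Longrightarrow> a \<in> carrier A"
  using homogeneous_idealD(3)[OF essential_ideal] by blast

lemma bracket_rel_unique: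
  assumes "bracket_rel p q z" "bracket_rel p q z'"
  shows "z = z'"
proof -
  from assms(1) obtain U where U: "U \<in> essential_ideals K A AG"
      "\<forall>a\<in>U. \<exists>b\<in>carrier A. \<exists>c\<in>carrier A.
        lact a p = \<iota> b \<and> lact a q = \<iota> c \<and> lact a z = lact b q \<oplus>\<^bsub>I\<^esub> \<ominus>\<^bsub>I\<^esub> lact c p"
    unfolding bracket_rel_def by blast
  from assms(2) obtain V where V: "V \<in> essential_ideals K A AG"
      "\<forall>a\<in>V. \<exists>b\<in>carrier A. \<exists>c\<in>carrier A.
        lact a p = \<iota> b \<and> lact a q = \<iota> c \<and> lact a z' = lact b q \<oplus>\<^bsub>I\<^esub> \<ominus>\<^bsub>I\<^esub> lact c p"
    unfolding bracket_rel_def by blast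
  show ?thesis
  proof (rule hull_eqI[OF essential_inter[OF U(1) V(1)]])
    show "z \<in> carrier I" "z' \<in> carrier I" using assms closure_closed by (auto simp: bracket_rel_def)
    fix a assume a: "a \<in> U \<inter> V"
    obtain b c where "b \<in> carrier A" "c \<in> carrier A" "lact a p = \<iota> b" "lact a q = \<iota> c"
        "lact a z = lact b q \<oplus>\<^bsub>I\<^esub> \<ominus>\<^bsub>I\<^esub> lact c p" using U(2) a by blast
    moreover obtain b' c' where "b' \<in> carrier A" "c' \<in> carrier A" "lact a p = \<iota> b'" "lact a q = \<iota> c'"
        "lact a z' = lact b' q \<oplus>\<^bsub>I\<^esub> \<ominus>\<^bsub>I\<^esub> lact c' p" using V(2) a by blast
    ultimately show "lact a z = lact a z'" using \<iota>_inj by metis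
  qed
qed

lemma bracket_rel_add_left:
  assumes "bracket_rel p q z" "bracket_rel p' q z'" and p: "p \<in> P" "p' \<in> P" "q \<in> P"
  shows "bracket_rel (p \<oplus>\<^bsub>I\<^esub> p') q (z \<oplus>\<^bsub>I\<^esub> z')"
proof -
  from assms(1) obtain U where U: "U \<in> essential_ideals K A AG"
      "\<forall>a\<in>U. \<exists>b\<in>carrier A. \<exists>c\<in>carrier A.
        lact a p = \<iota> b \<and> lact a q = \<iota> c \<and> lact a z = lact b q \<oplus>\<^bsub>I\<^esub> \<ominus>\<^bsub>I\<^esub> lact c p"
    unfolding bracket_rel_def by blast
  from assms(2) obtain V where V: "V \<in> essential_ideals K A AG"
      "\<forall>a\<in>V. \<exists>b\<in>carrier A. \<exists>c\<in>carrier A.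
        lact a p' = \<iota> b \<and> lact a q = \<iota> c \<and> lact a z' = lact b q \<oplus>\<^bsub>I\<^esub> \<ominus>\<^bsub>I\<^esub> lact c p'"
    unfolding bracket_rel_def by blast
  have z: "z \<in> P" "z' \<in> P" using assms by (auto simp: bracket_rel_def)
  note I = closure_closed[OF z(1)] closure_closed[OF z(2)] closure_closed[OF p(1)]
    closure_closed[OF p(2)] closure_closed[OF p(3)]
  have "\<exists>b\<in>carrier A. \<exists>c\<in>carrier A. lact a (p \<oplus>\<^bsub>I\<^esub> p') = \<iota> b \<and> lact a q = \<iota> c \<and>
      lact a (z \<oplus>\<^bsub>I\<^esub> z') = lact b q \<oplus>\<^bsub>I\<^esub> \<ominus>\<^bsub>I\<^esub> lact c (p \<oplus>\<^bsub>I\<^esub> p')" if a: "a \<in> U \<inter> V" for a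
  proof -
    have ac: "a \<in> carrier A" using essential_closed[OF U(1)] a by simp
    obtain b c where b: "b \<in> carrier A" "c \<in> carrier A" "lact a p = \<iota> b" "lact a q = \<iota> c"
        "lact a z = lact b q \<oplus>\<^bsub>I\<^esub> \<ominus>\<^bsub>I\<^esub> lact c p" using U(2) a by blast
    obtain b' c' where b': "b' \<in> carrier A" "c' \<in> carrier A" "lact a p' = \<iota> b'" "lact a q = \<iota> c'"
        "lact a z' = lact b' q \<oplus>\<^bsub>I\<^esub> \<ominus>\<^bsub>I\<^esub> lact c' p'" using V(2) a by blast
    have "c' = c" using \<iota>_inj b b' by metis
    then show ?thesis using ac b b' I
      by (intro bexI[of _ "b \<oplus>\<^bsub>A\<^esub> b'"] bexI[of _ c] conjI)
        (simp_all add: lact_add add_lact \<iota>_add lact_closed Im.M.minus_add Im.M.a_ac)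
  qed
  then show ?thesis unfolding bracket_rel_def using z
    by (intro conjI bexI[OF _ essential_inter[OF U(1) V(1)]] ballI) (simp_all add: closure_D(4))
qed

lemma bracket_rel_swap:
  assumes "bracket_rel p q z" "p \<in> P" "q \<in> P"
  shows "bracket_rel q p (\<ominus>\<^bsub>I\<^esub> z)"
proof -
  from assms(1) obtain U where U: "U \<in> essential_ideals K A AG"
      "\<forall>a\<in>U. \<exists>b\<in>carrier A. \<exists>c\<in>carrier A.
        lact a p = \<iota> b \<and> lact a q = \<iota> c \<and> lact a z = lact b q \<oplus>\<^bsub>I\<^esub> \<ominus>\<^bsub>I\<^esub> lact c p"
    unfolding bracket_rel_def by blast
  have z: "z \<in> P" using assms by (simp add: bracket_rel_def)
  have "\<exists>b\<in>carrier A. \<exists>c\<in>carrier A. lact a q = \<iota> b \<and> lact a p = \<iota> c \<and>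
      lact a (\<ominus>\<^bsub>I\<^esub> z) = lact b p \<oplus>\<^bsub>I\<^esub> \<ominus>\<^bsub>I\<^esub> lact c q" if a: "a \<in> U" for a
  proof -
    obtain b c where b: "b \<in> carrier A" "c \<in> carrier A" "lact a p = \<iota> b" "lact a q = \<iota> c"
        "lact a z = lact b q \<oplus>\<^bsub>I\<^esub> \<ominus>\<^bsub>I\<^esub> lact c p" using U(2) a by blast
    then show ?thesis using z assms essential_closed[OF U(1) a] closure_closed
      by (intro bexI[of _ c] bexI[of _ b] conjI)
        (simp_all add: lact_neg lact_closed Im.M.minus_add Im.M.a_ac)
  qed
  then show ?thesis unfolding bracket_rel_def using z
    by (intro conjI bexI[OF _ U(1)] ballI) (simp_all add: closure_D(5))
qed

lemma \<iota>_prod_right: "\<lbrakk>a \<in> carrier A; b \<in> carrier A\<rbrakk> \<Longrightarrow> \<iota> (a \<otimes>\<^bsub>A\<^esub> b) = \<ominus>\<^bsub>I\<^esub> lact b (\<iota> a)"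
  by (simp add: anticommutative[of b a] \<iota>_neg \<iota>_prod prod_closed)

lemma bracket_rel_generators:
  assumes \<alpha>: "\<alpha> \<in> carrier CM" and \<beta>: "\<beta> \<in> carrier CM" and x: "x \<in> carrier A" and y: "y \<in> carrier A"
  shows "bracket_rel (\<alpha> (\<iota> x)) (\<beta> (\<iota> y)) (\<alpha> (\<beta> (\<iota> (x \<otimes>\<^bsub>A\<^esub> y))))"
proof -
  let ?D = "\<lambda>\<alpha>. {x \<in> carrier A. \<alpha> (\<iota> x) \<in> \<iota> ` carrier A}"
  have D: "?D \<alpha> \<inter> ?D \<beta> \<in> essential_ideals K A AG"
    by (intro essential_inter essential_domain \<alpha> \<beta>)
  have "\<exists>b\<in>carrier A. \<exists>c\<in>carrier A. lact a (\<alpha> (\<iota> x)) = \<iota> b \<and> lact a (\<beta> (\<iota> y)) = \<iota> c \<and>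
      lact a (\<alpha> (\<beta> (\<iota> (x \<otimes>\<^bsub>A\<^esub> y)))) = lact b (\<beta> (\<iota> y)) \<oplus>\<^bsub>I\<^esub> \<ominus>\<^bsub>I\<^esub> lact c (\<alpha> (\<iota> x))"
    if a: "a \<in> ?D \<alpha> \<inter> ?D \<beta>" for a
  proof -
    have ac: "a \<in> carrier A" using a by simp
    have "a \<otimes>\<^bsub>A\<^esub> x \<in> ?D \<alpha>" "a \<otimes>\<^bsub>A\<^esub> y \<in> ?D \<beta>"
      using homogeneous_idealD(9)[OF essential_ideal[OF essential_domain[OF \<alpha>]] x, of a]
        homogeneous_idealD(9)[OF essential_ideal[OF essential_domain[OF \<beta>]] y, of a] a by auto
    then obtain b c where b: "b \<in> carrier A" "\<alpha> (\<iota> (a \<otimes>\<^bsub>A\<^esub> x)) = \<iota> b"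
      and c: "c \<in> carrier A" "\<beta> (\<iota> (a \<otimes>\<^bsub>A\<^esub> y)) = \<iota> c" by auto
    note Pc = closure_base[OF x] closure_base[OF y] closure_base[OF b(1)] closure_base[OF c(1)]
      closure_base[OF prod_closed[OF ac x]] closure_base[OF prod_closed[OF ac y]]
      closure_base[OF prod_closed[OF x y]] closure_base[OF prod_closed[OF prod_closed[OF ac x] y]]
      closure_base[OF prod_closed[OF prod_closed[OF ac y] x]]
    have 1: "lact a (\<alpha> (\<iota> x)) = \<iota> b" "lact a (\<beta> (\<iota> y)) = \<iota> c"
      using centroid_lact[OF \<alpha> ac Pc(1)] centroid_lact[OF \<beta> ac Pc(2)] b c \<iota>_prod[OF ac x] \<iota>_prod[OF ac y]
      by simp_all
    have "lact b (\<beta> (\<iota> y)) = \<beta> (\<ominus>\<^bsub>I\<^esub> lact y (\<iota> b))"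
      using centroid_lact[OF \<beta> b(1) Pc(2)] \<iota>_prod[OF b(1) y] \<iota>_prod_right[OF b(1) y] by simp
    also have "\<ominus>\<^bsub>I\<^esub> lact y (\<iota> b) = \<alpha> (\<iota> ((a \<otimes>\<^bsub>A\<^esub> x) \<otimes>\<^bsub>A\<^esub> y))"
      using \<iota>_prod_right[OF prod_closed[OF ac x] y] centroid_lact[OF \<alpha> y Pc(5)] b \<alpha> Pc y
      by (simp add: centroid_neg_right closure_D(7))
    finally have 2: "lact b (\<beta> (\<iota> y)) = \<alpha> (\<beta> (\<iota> ((a \<otimes>\<^bsub>A\<^esub> x) \<otimes>\<^bsub>A\<^esub> y)))"
      using centroid_apply_commute[OF \<alpha> \<beta> Pc(8)] by simp
    have "lact c (\<alpha> (\<iota> x)) = \<alpha> (\<ominus>\<^bsub>I\<^esub> lact x (\<iota> c))"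
      using centroid_lact[OF \<alpha> c(1) Pc(1)] \<iota>_prod[OF c(1) x] \<iota>_prod_right[OF c(1) x] by simp
    also have "\<ominus>\<^bsub>I\<^esub> lact x (\<iota> c) = \<beta> (\<iota> ((a \<otimes>\<^bsub>A\<^esub> y) \<otimes>\<^bsub>A\<^esub> x))"
      using \<iota>_prod_right[OF prod_closed[OF ac y] x] centroid_lact[OF \<beta> x Pc(6)] c \<beta> Pc x
      by (simp add: centroid_neg_right closure_D(7))
    finally have 3: "lact c (\<alpha> (\<iota> x)) = \<alpha> (\<beta> (\<iota> ((a \<otimes>\<^bsub>A\<^esub> y) \<otimes>\<^bsub>A\<^esub> x)))" .
    have "lact a (\<alpha> (\<beta> (\<iota> (x \<otimes>\<^bsub>A\<^esub> y)))) = \<alpha> (\<beta> (\<iota> (a \<otimes>\<^bsub>A\<^esub> (x \<otimes>\<^bsub>A\<^esub> y))))"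
      using ac x y Pc \<alpha> \<beta> by (simp add: \<iota>_prod[of a] prod_closed centroid_lact centroid_closed)
    also have "\<dots> = lact b (\<beta> (\<iota> y)) \<oplus>\<^bsub>I\<^esub> \<ominus>\<^bsub>I\<^esub> lact c (\<alpha> (\<iota> x))"
      unfolding 2 3 leibniz_right[OF ac x y] using ac x y Pc \<alpha> \<beta>
      by (simp add: a_minus_def \<iota>_add \<iota>_neg prod_closed centroid_add centroid_neg_right centroid_closed
          closure_D(5))
    finally show ?thesis using 1 b(1) c(1) by blast
  qed
  moreover have "\<alpha> (\<beta> (\<iota> (x \<otimes>\<^bsub>A\<^esub> y))) \<in> P" using \<alpha> \<beta> x y centroid_closed closure_base prod_closed by simp
  ultimately show ?thesis unfolding bracket_rel_def by (intro conjI bexI[OF _ D] ballI) simp_all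
qed

lemma bracket_rel_total:
  assumes "p \<in> P" "q \<in> P"
  shows "\<exists>z. bracket_rel p q z"
  using assms(1)
proof (induction rule: closure_induct)
  case (gen \<alpha> x \<gamma>)
  have x: "x \<in> carrier A" using gen grade_closed by blast
  show ?case using assms(2)
  proof (induction rule: closure_induct)
    case (gen \<beta> y \<delta>)
    then show ?case using bracket_rel_generators \<open>\<alpha> \<in> carrier CM\<close> x grade_closed by blast
  next
    case (add q r)
    then obtain z w where zw: "bracket_rel (\<alpha> (\<iota> x)) q z" "bracket_rel (\<alpha> (\<iota> x)) r w" by blast
    have c: "\<alpha> (\<iota> x) \<in> P" using gen x centroid_closed closure_base by blast
    have "bracket_rel (q \<oplus>\<^bsub>I\<^esub> r) (\<alpha> (\<iota> x)) (\<ominus>\<^bsub>I\<^esub> z \<oplus>\<^bsub>I\<^esub> \<ominus>\<^bsub>I\<^esub> w)"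
      by (rule bracket_rel_add_left) (use zw add c bracket_rel_swap in simp_all)
    then show ?case using bracket_rel_swap c add closure_D(4) by blast
  qed
next
  case (add p r)
  then show ?case using bracket_rel_add_left assms(2) by blast
qed

definition bracket :: "'i \<Rightarrow> 'i \<Rightarrow> 'i" where
  "bracket p q = (THE z. bracket_rel p q z)"

lemma bracket_eqI: "bracket_rel p q z \<Longrightarrow> bracket p q = z"
  unfolding bracket_def using bracket_rel_unique by blast

lemma bracket_rel_bracket: "\<lbrakk>p \<in> P; q \<in> P\<rbrakk> \<Longrightarrow> bracket_rel p q (bracket p q)"
  using bracket_rel_total bracket_eqI by blast

lemma bracket_closed: "\<lbrakk>p \<in> P; q \<in> P\<rbrakk> \<Longrightarrow> bracket p q \<in> P"
  using bracket_rel_bracket by (simp add: bracket_rel_def)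

lemma bracket_add_left:
  "\<lbrakk>p \<in> P; p' \<in> P; q \<in> P\<rbrakk> \<Longrightarrow> bracket (p \<oplus>\<^bsub>I\<^esub> p') q = bracket p q \<oplus>\<^bsub>I\<^esub> bracket p' q"
  by (intro bracket_eqI bracket_rel_add_left bracket_rel_bracket)

lemma bracket_swap: "\<lbrakk>p \<in> P; q \<in> P\<rbrakk> \<Longrightarrow> bracket q p = \<ominus>\<^bsub>I\<^esub> bracket p q"
  by (intro bracket_eqI bracket_rel_swap bracket_rel_bracket)

lemma bracket_add_right:
  "\<lbrakk>p \<in> P; q \<in> P; q' \<in> P\<rbrakk> \<Longrightarrow> bracket p (q \<oplus>\<^bsub>I\<^esub> q') = bracket p q \<oplus>\<^bsub>I\<^esub> bracket p q'"
  by (simp add: bracket_swap[of _ p] bracket_add_left closure_D(4) Im.M.minus_add bracket_closed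
      closure_closed)

lemma bracket_generators:
  "\<lbrakk>\<alpha> \<in> carrier CM; \<beta> \<in> carrier CM; x \<in> carrier A; y \<in> carrier A\<rbrakk>
    \<Longrightarrow> bracket (\<alpha> (\<iota> x)) (\<beta> (\<iota> y)) = \<alpha> (\<beta> (\<iota> (x \<otimes>\<^bsub>A\<^esub> y)))"
  by (intro bracket_eqI bracket_rel_generators)

lemma bracket_centroid_left:
  assumes \<delta>: "\<delta> \<in> carrier CM" and "p \<in> P" "q \<in> P"
  shows "bracket (\<delta> p) q = \<delta> (bracket p q)"
  using assms(2)
proof (induction rule: closure_induct)
  case (gen \<alpha> x \<gamma>)
  have x: "x \<in> carrier A" using gen grade_closed by blast
  note ax = centroid_closed[OF gen(1) closure_base[OF x]]
  show ?case using assms(3)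
  proof (induction rule: closure_induct)
    case (gen \<beta> y \<gamma>')
    have y: "y \<in> carrier A" using gen grade_closed by blast
    have "bracket ((\<delta> \<otimes>\<^bsub>CM\<^esub> \<alpha>) (\<iota> x)) (\<beta> (\<iota> y)) = (\<delta> \<otimes>\<^bsub>CM\<^esub> \<alpha>) (\<beta> (\<iota> (x \<otimes>\<^bsub>A\<^esub> y)))"
      using bracket_generators[OF centroid_mult_closed[OF \<delta> \<open>\<alpha> \<in> carrier CM\<close>] gen(1) x y] .
    then show ?case using bracket_generators[OF \<open>\<alpha> \<in> carrier CM\<close> gen(1) x y] x y gen(1)
      by (simp add: centroid_mult closure_base prod_closed centroid_closed)
  next
    case (add q r)
    then show ?case using ax centroid_closed[OF \<delta> ax]
      by (simp add: bracket_add_right centroid_add[OF \<delta>] bracket_closed)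
  qed
next
  case (add p r)
  then show ?case using assms(3) centroid_closed[OF \<delta>]
    by (simp add: bracket_add_left centroid_add[OF \<delta>] bracket_closed)
qed

lemma bracket_centroid_right:
  assumes "\<delta> \<in> carrier CM" "p \<in> P" "q \<in> P"
  shows "bracket p (\<delta> q) = \<delta> (bracket p q)"
  using assms by (simp add: bracket_swap[of _ p] centroid_closed bracket_centroid_left
      centroid_neg_right bracket_closed)

lemma bracket_base: "\<lbrakk>x \<in> carrier A; y \<in> carrier A\<rbrakk> \<Longrightarrow> bracket (\<iota> x) (\<iota> y) = \<iota> (x \<otimes>\<^bsub>A\<^esub> y)"
  using bracket_generators[OF centroid_one_closed centroid_one_closed, of x y]
  by (simp add: centroid_one closure_base prod_closed)

lemma bracket_base_left:
  assumes x: "x \<in> carrier A" and p: "p \<in> P"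
  shows "bracket (\<iota> x) p = lact x p"
  using p
proof (induction rule: closure_induct)
  case (gen \<alpha> y \<gamma>)
  have "y \<in> carrier A" using gen grade_closed by blast
  then show ?case using x gen
    by (simp add: bracket_centroid_right closure_base bracket_base \<iota>_prod centroid_lact)
next
  case (add p q)
  then show ?case using x by (simp add: bracket_add_right closure_base lact_add closure_closed)
qed

lemma closure_mult_eq: "closure_mult K A I IG \<iota> = (\<lambda>p\<in>P. \<lambda>q\<in>P. bracket p q)"
  unfolding closure_mult_def
proof (rule the_equality)
  show "(\<lambda>p\<in>P. \<lambda>q\<in>P. bracket p q) \<in> P \<rightarrow>\<^sub>E (P \<rightarrow>\<^sub>E P) \<and>
    (\<forall>p\<in>P. \<forall>q\<in>P. \<forall>s\<in>P.
      (\<lambda>p\<in>P. \<lambda>q\<in>P. bracket p q) (p \<oplus>\<^bsub>I\<^esub> q) s =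
        (\<lambda>p\<in>P. \<lambda>q\<in>P. bracket p q) p s \<oplus>\<^bsub>I\<^esub> (\<lambda>p\<in>P. \<lambda>q\<in>P. bracket p q) q s \<and>
      (\<lambda>p\<in>P. \<lambda>q\<in>P. bracket p q) s (p \<oplus>\<^bsub>I\<^esub> q) =
        (\<lambda>p\<in>P. \<lambda>q\<in>P. bracket p q) s p \<oplus>\<^bsub>I\<^esub> (\<lambda>p\<in>P. \<lambda>q\<in>P. bracket p q) s q) \<and>
    (\<forall>\<alpha>\<in>carrier CM. \<forall>p\<in>P. \<forall>q\<in>P.
      (\<lambda>p\<in>P. \<lambda>q\<in>P. bracket p q) (\<alpha> p) q = \<alpha> ((\<lambda>p\<in>P. \<lambda>q\<in>P. bracket p q) p q) \<and>
      (\<lambda>p\<in>P. \<lambda>q\<in>P. bracket p q) p (\<alpha> q) = \<alpha> ((\<lambda>p\<in>P. \<lambda>q\<in>P. bracket p q) p q)) \<and>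
    (\<forall>x\<in>carrier A. \<forall>y\<in>carrier A. (\<lambda>p\<in>P. \<lambda>q\<in>P. bracket p q) (\<iota> x) (\<iota> y) = \<iota> (x \<otimes>\<^bsub>A\<^esub> y))"
    by (simp add: bracket_closed bracket_add_left bracket_add_right closure_D(4) centroid_closed
        bracket_centroid_left bracket_centroid_right bracket_base closure_base)
  fix m
  assume m: "m \<in> P \<rightarrow>\<^sub>E (P \<rightarrow>\<^sub>E P) \<and>
    (\<forall>p\<in>P. \<forall>q\<in>P. \<forall>s\<in>P. m (p \<oplus>\<^bsub>I\<^esub> q) s = m p s \<oplus>\<^bsub>I\<^esub> m q s \<and> m s (p \<oplus>\<^bsub>I\<^esub> q) = m s p \<oplus>\<^bsub>I\<^esub> m s q) \<and>
    (\<forall>\<alpha>\<in>carrier CM. \<forall>p\<in>P. \<forall>q\<in>P. m (\<alpha> p) q = \<alpha> (m p q) \<and> m p (\<alpha> q) = \<alpha> (m p q)) \<and>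
    (\<forall>x\<in>carrier A. \<forall>y\<in>carrier A. m (\<iota> x) (\<iota> y) = \<iota> (x \<otimes>\<^bsub>A\<^esub> y))"
  have "m p q = bracket p q" if p: "p \<in> P" and q: "q \<in> P" for p q
    using p
  proof (induction rule: closure_induct)
    case (gen \<alpha> x \<gamma>)
    have x: "x \<in> carrier A" using gen grade_closed by blast
    show ?case using q
    proof (induction rule: closure_induct)
      case (gen \<beta> y \<gamma>')
      have y: "y \<in> carrier A" using gen grade_closed by blast
      show ?case using m \<open>\<alpha> \<in> carrier CM\<close> gen x y
        by (simp add: bracket_generators closure_base centroid_closed)
    next
      case (add q r)
      then show ?case using m \<open>\<alpha> \<in> carrier CM\<close> x
        by (simp add: bracket_add_right closure_base centroid_closed)
    qed
  next
    case (add p r)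
    then show ?case using m q by (simp add: bracket_add_left)
  qed
  moreover have "m \<in> extensional P" "m p \<in> extensional P" if "p \<in> P" for p
    using m that by (auto simp: PiE_iff)
  moreover have "m \<in> extensional P" using m by (auto simp: PiE_iff)
  ultimately show "m = (\<lambda>p\<in>P. \<lambda>q\<in>P. bracket p q)"
    by (intro ext) (auto simp: extensional_def restrict_def)
qed

abbreviation "PA \<equiv> central_closure K A I IG \<iota>"
abbreviation "PF \<equiv> central_closure_base K A I IG \<iota>"
abbreviation "PG \<equiv> central_closure_grading K A I IG \<iota> AG"

lemma closure_grading: "PG \<gamma> = P \<inter> IG \<gamma>"
proof
  have gen: "{\<alpha> (\<iota> x) | \<alpha> x. \<alpha> \<in> carrier CM \<and> x \<in> AG \<gamma>} \<subseteq> P \<inter> IG \<gamma>"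
    using closure_base grade_closed \<iota>_grade centroid_closed centroid_grade by auto
  moreover have "subgroup (P \<inter> IG \<gamma>) (add_monoid I)"
    using Im.M.add.subgroups_Inter_pair closure_subgroup Im.grade_subgroup by blast
  ultimately show "PG \<gamma> \<subseteq> P \<inter> IG \<gamma>"
    unfolding central_closure_grading_def by (rule Im.M.add.generate_subgroup_incl)
  have sub: "subgroup (PG \<gamma>) (add_monoid I)"
    unfolding central_closure_grading_def
    by (rule Im.M.add.generate_is_subgroup) (use gen closure_closed in auto)
  note subD = Im.M.subgroup_add_monoidD[OF sub]
  have "component I IG \<gamma> p \<in> PG \<gamma>" if "p \<in> P" for p
    using that
  proof (induction rule: closure_induct)
    case (gen \<alpha> x \<delta>)
    then have "\<alpha> (\<iota> x) \<in> IG \<delta>" using closure_base grade_closed \<iota>_grade centroid_grade by blast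
    moreover have "\<alpha> (\<iota> x) \<in> PG \<gamma>" if "\<delta> = \<gamma>"
      unfolding central_closure_grading_def using gen that by (intro generate.incl) auto
    ultimately show ?case using Im.component_homogeneous[of "\<alpha> (\<iota> x)" \<delta> \<gamma>] subD(2) by auto
  next
    case (add p q)
    then show ?case using subD(3) by (simp add: Im.component_add closure_closed)
  qed
  then show "P \<inter> IG \<gamma> \<subseteq> PG \<gamma>" using Im.component_homogeneous[of _ \<gamma> \<gamma>] by force
qed

lemma bracket_zero: "q \<in> P \<Longrightarrow> bracket \<zero>\<^bsub>I\<^esub> q = \<zero>\<^bsub>I\<^esub>" "q \<in> P \<Longrightarrow> bracket q \<zero>\<^bsub>I\<^esub> = \<zero>\<^bsub>I\<^esub>"
  using additive_zero[OF cl.abelian_group_axioms Im.M.abelian_group_axioms, of "\<lambda>p. bracket p q"]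
    additive_zero[OF cl.abelian_group_axioms Im.M.abelian_group_axioms, of "bracket q"]
  by (simp_all add: bracket_closed bracket_add_left bracket_add_right closure_closed)

lemma bracket_components:
  assumes "p \<in> P" "q \<in> P"
  shows "bracket (component I IG \<gamma> p) (component I IG \<delta> q) \<in> IG (\<gamma> + \<delta>)"
  using assms(1)
proof (induction rule: closure_induct)
  case (gen \<alpha> x \<gamma>')
  have x: "x \<in> carrier A" using gen grade_closed by blast
  have x': "\<alpha> (\<iota> x) \<in> P" "\<alpha> (\<iota> x) \<in> IG \<gamma>'"
    using gen(1) closure_base[OF x] \<iota>_grade[OF gen(2)] centroid_closed centroid_grade by auto
  show ?case using assms(2)
  proof (induction rule: closure_induct)
    case (gen \<beta> y \<delta>')
    have y: "y \<in> carrier A" using gen grade_closed by blast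
    have y': "\<beta> (\<iota> y) \<in> P" "\<beta> (\<iota> y) \<in> IG \<delta>'"
      using gen(1) closure_base[OF y] \<iota>_grade[OF gen(2)] centroid_closed centroid_grade by auto
    note xy = closure_base[OF prod_closed[OF x y]]
    have "\<beta> (\<iota> (x \<otimes>\<^bsub>A\<^esub> y)) \<in> IG (\<gamma>' + \<delta>')"
      by (rule centroid_grade[OF gen(1) xy \<iota>_grade[OF grading_prod[OF \<open>x \<in> AG \<gamma>'\<close> gen(2)]]])
    then have "bracket (\<alpha> (\<iota> x)) (\<beta> (\<iota> y)) \<in> IG (\<gamma>' + \<delta>')"
      unfolding bracket_generators[OF \<open>\<alpha> \<in> carrier CM\<close> gen(1) x y]
      by (rule centroid_grade[OF \<open>\<alpha> \<in> carrier CM\<close> centroid_closed[OF gen(1) xy]])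
    then show ?case
      using x' y' by (simp add: Im.component_homogeneous bracket_zero Im.grade_zero closure_D(3))
  next
    case (add q r)
    then show ?case using x' closure_component_in
      by (simp add: Im.component_add closure_closed bracket_add_right Im.grade_add)
  qed
next
  case (add p r)
  then show ?case using assms(2) closure_component_in
    by (simp add: Im.component_add closure_closed bracket_add_left Im.grade_add)
qed

lemma bracket_grade:
  assumes "p \<in> P" "p \<in> IG \<gamma>" "q \<in> P" "q \<in> IG \<delta>"
  shows "bracket p q \<in> IG (\<gamma> + \<delta>)"
  using bracket_components[OF assms(1,3), of \<gamma> \<delta>] assms by (simp add: Im.component_homogeneous)

lemma bracket_alternating:
  assumes "p \<in> P"
  shows "bracket p p = \<zero>\<^bsub>I\<^esub>"
  using assms
proof (induction rule: closure_induct)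
  case (gen \<alpha> x \<gamma>)
  then have "x \<in> carrier A" using grade_closed by blast
  then show ?case using gen by (simp add: bracket_generators alternating \<iota>_zero centroid_zero_right)
next
  case (add p q)
  then have "bracket (p \<oplus>\<^bsub>I\<^esub> q) (p \<oplus>\<^bsub>I\<^esub> q)
      = (bracket p p \<oplus>\<^bsub>I\<^esub> bracket q p) \<oplus>\<^bsub>I\<^esub> (bracket p q \<oplus>\<^bsub>I\<^esub> bracket q q)"
    by (simp add: bracket_add_left bracket_add_right closure_D(4))
  also have "\<dots> = \<zero>\<^bsub>I\<^esub>"
    using add bracket_swap[of p q] bracket_closed closure_closed by (simp add: Im.M.l_neg)
  finally show ?case .
qed

definition jacobiator :: "'i \<Rightarrow> 'i \<Rightarrow> 'i \<Rightarrow> 'i" where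
  "jacobiator p q r = bracket (bracket p q) r \<oplus>\<^bsub>I\<^esub> bracket (bracket q r) p \<oplus>\<^bsub>I\<^esub> bracket (bracket r p) q"

lemma jacobiator_cyclic:
  "\<lbrakk>p \<in> P; q \<in> P; r \<in> P\<rbrakk> \<Longrightarrow> jacobiator p q r = jacobiator q r p"
  unfolding jacobiator_def by (simp add: Im.M.a_ac bracket_closed closure_closed)

lemma jacobiator_add:
  "\<lbrakk>p \<in> P; p' \<in> P; q \<in> P; r \<in> P\<rbrakk> \<Longrightarrow> jacobiator (p \<oplus>\<^bsub>I\<^esub> p') q r = jacobiator p q r \<oplus>\<^bsub>I\<^esub> jacobiator p' q r"
  unfolding jacobiator_def
  by (simp add: bracket_add_left bracket_add_right bracket_closed closure_closed Im.M.a_ac)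

lemma jacobiator_centroid:
  "\<lbrakk>\<alpha> \<in> carrier CM; p \<in> P; q \<in> P; r \<in> P\<rbrakk> \<Longrightarrow> jacobiator (\<alpha> p) q r = \<alpha> (jacobiator p q r)"
  unfolding jacobiator_def
  by (simp add: bracket_centroid_left bracket_centroid_right bracket_closed centroid_add closure_D(4))

lemma jacobiator_vanishes:
  assumes "p \<in> P" "q \<in> P" "r \<in> P" "\<And>x. x \<in> carrier A \<Longrightarrow> jacobiator (\<iota> x) q r = \<zero>\<^bsub>I\<^esub>"
  shows "jacobiator p q r = \<zero>\<^bsub>I\<^esub>"
  using assms(1)
proof (induction rule: closure_induct)
  case (gen \<alpha> x \<gamma>)
  then have "x \<in> carrier A" using grade_closed by blast
  then show ?case using gen assms by (simp add: jacobiator_centroid closure_base centroid_zero_right)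
qed (simp add: jacobiator_add assms)

lemma bracket_jacobi:
  assumes "p \<in> P" "q \<in> P" "r \<in> P"
  shows "jacobiator p q r = \<zero>\<^bsub>I\<^esub>"
proof (rule jacobiator_vanishes[OF assms])
  fix x assume x: "x \<in> carrier A"
  note xP = closure_base[OF x]
  have "jacobiator q r (\<iota> x) = \<zero>\<^bsub>I\<^esub>"
  proof (rule jacobiator_vanishes[OF assms(2,3) xP])
    fix y assume y: "y \<in> carrier A"
    note yP = closure_base[OF y]
    have "jacobiator r (\<iota> x) (\<iota> y) = \<zero>\<^bsub>I\<^esub>"
    proof (rule jacobiator_vanishes[OF assms(3) xP yP])
      fix z assume "z \<in> carrier A"
      then show "jacobiator (\<iota> z) (\<iota> x) (\<iota> y) = \<zero>\<^bsub>I\<^esub>"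
        using jacobi[of z x y] x y
        by (simp add: jacobiator_def bracket_base prod_closed \<iota>_add[symmetric] \<iota>_zero)
    qed
    then show "jacobiator (\<iota> y) r (\<iota> x) = \<zero>\<^bsub>I\<^esub>"
      using jacobiator_cyclic[OF assms(3) xP yP] jacobiator_cyclic[OF xP yP assms(3)] by simp
  qed
  then show "jacobiator (\<iota> x) q r = \<zero>\<^bsub>I\<^esub>" using jacobiator_cyclic[OF xP assms(2,3)] by simp
qed

lemma closure_lie_algebra:
  assumes L: "cring L"
    and N: "carrier N = P" "mult N = closure_mult K A I IG \<iota>" "zero N = \<zero>\<^bsub>I\<^esub>" "add N = add I"
    and closed: "\<And>k p. \<lbrakk>k \<in> carrier L; p \<in> P\<rbrakk> \<Longrightarrow> k \<odot>\<^bsub>N\<^esub> p \<in> P"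
    and l: "\<And>k k' p. \<lbrakk>k \<in> carrier L; k' \<in> carrier L; p \<in> P\<rbrakk> \<Longrightarrow> (k \<oplus>\<^bsub>L\<^esub> k') \<odot>\<^bsub>N\<^esub> p = k \<odot>\<^bsub>N\<^esub> p \<oplus>\<^bsub>I\<^esub> k' \<odot>\<^bsub>N\<^esub> p"
    and r: "\<And>k p q. \<lbrakk>k \<in> carrier L; p \<in> P; q \<in> P\<rbrakk> \<Longrightarrow> k \<odot>\<^bsub>N\<^esub> (p \<oplus>\<^bsub>I\<^esub> q) = k \<odot>\<^bsub>N\<^esub> p \<oplus>\<^bsub>I\<^esub> k \<odot>\<^bsub>N\<^esub> q"
    and assoc: "\<And>k k' p. \<lbrakk>k \<in> carrier L; k' \<in> carrier L; p \<in> P\<rbrakk> \<Longrightarrow> (k \<otimes>\<^bsub>L\<^esub> k') \<odot>\<^bsub>N\<^esub> p = k \<odot>\<^bsub>N\<^esub> (k' \<odot>\<^bsub>N\<^esub> p)"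
    and one: "\<And>p. p \<in> P \<Longrightarrow> \<one>\<^bsub>L\<^esub> \<odot>\<^bsub>N\<^esub> p = p"
    and bl: "\<And>k p q. \<lbrakk>k \<in> carrier L; p \<in> P; q \<in> P\<rbrakk> \<Longrightarrow> bracket (k \<odot>\<^bsub>N\<^esub> p) q = k \<odot>\<^bsub>N\<^esub> bracket p q"
    and gr: "\<And>k p \<gamma>. \<lbrakk>k \<in> carrier L; p \<in> P; p \<in> IG \<gamma>\<rbrakk> \<Longrightarrow> k \<odot>\<^bsub>N\<^esub> p \<in> IG \<gamma>"
  shows "graded_lie_algebra L N PG" "\<And>p \<gamma>. p \<in> P \<Longrightarrow> component N PG \<gamma> p = component I IG \<gamma> p"
proof -
  have PG: "PG = (\<lambda>\<gamma>. P \<inter> IG \<gamma>)" using closure_grading by blast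
  have gg: "graded_group N PG" "\<And>p \<gamma>. p \<in> P \<Longrightarrow> component N PG \<gamma> p = component I IG \<gamma> p"
    unfolding PG using closure_submodule closure_subgroup N
      Im.graded_group_restrict[OF closure_subgroup, of N]
    by (simp_all add: homogeneous_right_submodule_def)
  show "\<And>p \<gamma>. p \<in> P \<Longrightarrow> component N PG \<gamma> p = component I IG \<gamma> p" by (rule gg(2))
  interpret gN: graded_group N PG by (rule gg(1))
  interpret N: module L N
    by (rule moduleI[OF L gN.abelian_group_axioms]) (simp_all add: N closed l r assoc one)
  have br: "k \<odot>\<^bsub>N\<^esub> bracket p q = bracket p (k \<odot>\<^bsub>N\<^esub> q)" if "k \<in> carrier L" "p \<in> P" "q \<in> P" for k p q
  proof -
    have "k \<odot>\<^bsub>N\<^esub> bracket p q = k \<odot>\<^bsub>N\<^esub> (\<ominus>\<^bsub>N\<^esub> bracket q p)"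
      using that bracket_swap[of q p] Im.M.abelian_group_restrict(2)[OF closure_subgroup N(1,3)] N(4)
      by (simp add: bracket_closed)
    also have "\<dots> = \<ominus>\<^bsub>N\<^esub> bracket (k \<odot>\<^bsub>N\<^esub> q) p"
      using that by (simp add: N.smult_r_minus N bracket_closed bl)
    also have "\<dots> = bracket p (k \<odot>\<^bsub>N\<^esub> q)"
      using that bracket_swap[of "k \<odot>\<^bsub>N\<^esub> q" p] closed N(4)
        Im.M.abelian_group_restrict(2)[OF closure_subgroup N(1,3)]
      by (simp add: bracket_closed)
    finally show ?thesis .
  qed
  show "graded_lie_algebra L N PG"
  proof (intro graded_lie_algebra.intro graded_lie_algebra_axioms.intro graded_algebra.intro
      graded_algebra_axioms.intro nonassoc_algebra.intro nonassoc_algebra_axioms.intro N.module_axioms)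
    show "submodule (PG \<gamma>) L N" for \<gamma>
    proof (rule N.submoduleI)
      show "PG \<gamma> \<subseteq> carrier N" "\<zero>\<^bsub>N\<^esub> \<in> PG \<gamma>" using gN.grade_closed gN.grade_zero by auto
      show "\<ominus>\<^bsub>N\<^esub> a \<in> PG \<gamma>" if "a \<in> PG \<gamma>" for a using gN.grade_neg[OF that] .
      show "a \<oplus>\<^bsub>N\<^esub> b \<in> PG \<gamma>" if "a \<in> PG \<gamma>" "b \<in> PG \<gamma>" for a b using gN.grade_add[OF that] .
      show "k \<odot>\<^bsub>N\<^esub> x \<in> PG \<gamma>" if "k \<in> carrier L" "x \<in> PG \<gamma>" for k x
        using that closed gr unfolding PG by simp
    qed
    show "internal_direct_sum N (carrier N) PG" by (rule gN.direct)
    show "x \<otimes>\<^bsub>N\<^esub> y \<in> PG (\<alpha> + \<beta>)" if "x \<in> PG \<alpha>" "y \<in> PG \<beta>" for x y \<alpha> \<beta>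
      using that bracket_grade bracket_closed unfolding PG N closure_mult_eq by simp
    show "x \<otimes>\<^bsub>N\<^esub> y \<otimes>\<^bsub>N\<^esub> z \<oplus>\<^bsub>N\<^esub> y \<otimes>\<^bsub>N\<^esub> z \<otimes>\<^bsub>N\<^esub> x \<oplus>\<^bsub>N\<^esub> z \<otimes>\<^bsub>N\<^esub> x \<otimes>\<^bsub>N\<^esub> y = \<zero>\<^bsub>N\<^esub>"
      if "x \<in> carrier N" "y \<in> carrier N" "z \<in> carrier N" for x y z
      using that bracket_jacobi[of x y z]
      by (simp add: N closure_mult_eq bracket_closed jacobiator_def)
  qed (simp_all add: N closure_mult_eq bracket_closed bracket_add_left bracket_add_right
      bracket_alternating bl closed br closure_D(4))
qed

lemma central_closure_simps:
  "carrier PA = P" "mult PA = closure_mult K A I IG \<iota>" "zero PA = \<zero>\<^bsub>I\<^esub>" "add PA = add I"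
  "\<alpha> \<odot>\<^bsub>PA\<^esub> p = \<alpha> p"
  by (simp_all add: central_closure_def)

lemma central_closure_base_simps:
  "carrier PF = P" "mult PF = closure_mult K A I IG \<iota>" "zero PF = \<zero>\<^bsub>I\<^esub>" "add PF = add I"
  "k \<odot>\<^bsub>PF\<^esub> p = kact k p"
  by (simp_all add: central_closure_base_def scalars_of_def kact_def)

lemma closure_prod: "\<lbrakk>p \<in> P; q \<in> P\<rbrakk> \<Longrightarrow> p \<otimes>\<^bsub>PA\<^esub> q = bracket p q" "\<lbrakk>p \<in> P; q \<in> P\<rbrakk> \<Longrightarrow> p \<otimes>\<^bsub>PF\<^esub> q = bracket p q"
  by (simp_all add: central_closure_simps central_closure_base_simps closure_mult_eq)

lemma scalar_in_centroid: "k \<in> carrier K \<Longrightarrow> (\<lambda>p\<in>P. kact k p) \<in> carrier CM"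
  by (rule centroidI)
    (simp_all add: closure_D(6) closure_closed kact_add kact_grade mult_kact[symmetric] R.m_comm
      smult_lact[symmetric])

lemma central_closure_lie: "graded_lie_algebra CM PA PG"
  and central_closure_component: "p \<in> P \<Longrightarrow> component PA PG \<gamma> p = component I IG \<gamma> p"
  by (rule closure_lie_algebra[OF centroid_cring];
      simp add: central_closure_simps centroid_closed centroid_sum centroid_mult centroid_one
        centroid_add centroid_grade bracket_centroid_left)+

lemma central_closure_base_lie: "graded_lie_algebra K PF PG"
proof (rule closure_lie_algebra(1)[OF R.is_cring])
  show "bracket (k \<odot>\<^bsub>PF\<^esub> p) q = k \<odot>\<^bsub>PF\<^esub> bracket p q" if "k \<in> carrier K" "p \<in> P" "q \<in> P" for k p q
    using bracket_centroid_left[OF scalar_in_centroid[OF that(1)] that(2,3)] that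
    by (simp add: central_closure_base_simps bracket_closed)
qed (simp_all add: central_closure_base_simps closure_D(6) closure_closed add_kact kact_add mult_kact
    one_kact kact_grade)

lemma central_closure_quotients: "graded_quotients K A AG PF PG \<iota>"
proof (intro graded_quotients.intro graded_quotients_axioms.intro semiprime_graded_lie_algebra_axioms
    central_closure_base_lie)
  show "graded_embedding K A AG PF PG \<iota>"
    unfolding graded_embedding_def central_closure_base_simps(1,4,5) closure_grading
    using \<iota>_inj \<iota>_grade grade_closed
    by (auto simp: closure_base \<iota>_add \<iota>_smult closure_prod bracket_base intro!: inj_onI)
  show "\<exists>U\<in>essential_ideals K A AG. \<forall>a\<in>U. \<iota> a \<otimes>\<^bsub>PF\<^esub> x \<in> \<iota> ` carrier A" if "x \<in> PG \<gamma>" for x \<gamma>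
  proof -
    have x: "x \<in> P" using that by (simp add: closure_grading)
    then obtain U where "U \<in> essential_ideals K A AG" "\<forall>a\<in>U. lact a x \<in> \<iota> ` carrier A"
      using closure_absorb by blast
    then show ?thesis using x essential_closed
      by (intro bexI[of _ U] ballI) (auto simp: closure_prod closure_base bracket_base_left)
  qed
  show "x = \<zero>\<^bsub>PF\<^esub>" if x: "x \<in> PG \<gamma>" and U: "U \<in> essential_ideals K A AG"
      and z: "\<forall>a\<in>U. \<iota> a \<otimes>\<^bsub>PF\<^esub> x = \<zero>\<^bsub>PF\<^esub>" for x \<gamma> U
  proof -
    have xP: "x \<in> P" using x by (simp add: closure_grading)
    have "lact a x = \<zero>\<^bsub>I\<^esub>" if "a \<in> U" for a
      using bspec[OF z that] xP essential_closed[OF U that]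
      by (simp add: closure_prod closure_base bracket_base_left central_closure_base_simps(3))
    then show ?thesis using hull_faithful[OF U closure_closed[OF xP]]
      by (simp add: central_closure_base_simps)
  qed
qed

lemma closure_ideal_submodule:
  assumes V: "homogeneous_ideal CM PA PG V"
  shows "homogeneous_right_submodule (mult_alg K A) I IG V"
proof -
  interpret PA: graded_lie_algebra CM PA PG by (rule central_closure_lie)
  note Vd = PA.homogeneous_idealD[OF V]
  have VP: "p \<in> P" if "p \<in> V" for p using that Vd(3) by (auto simp: central_closure_simps)
  show ?thesis
  proof (rule homogeneous_right_submoduleI)
    show "V \<subseteq> carrier I" using VP closure_closed by auto
    show "\<zero>\<^bsub>I\<^esub> \<in> V" using Vd(4) by (simp add: central_closure_simps)
    show "p \<oplus>\<^bsub>I\<^esub> q \<in> V" if "p \<in> V" "q \<in> V" for p q using Vd(5)[OF that] by (simp add: central_closure_simps)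
    show "kact k p \<in> V" if "k \<in> carrier K" "p \<in> V" for k p
      using Vd(7)[OF scalar_in_centroid[OF that(1)] that(2)] VP[OF that(2)]
      by (simp add: central_closure_simps)
    show "lact x p \<in> V" if "x \<in> carrier A" "p \<in> V" for x p
      using Vd(8)[of "\<iota> x" p] that VP[OF that(2)] closure_base[OF that(1)]
      by (simp add: central_closure_simps(1) closure_prod bracket_base_left)
    show "component I IG \<gamma> p \<in> V" if "p \<in> V" for \<gamma> p
      using Vd(10)[OF that, of \<gamma>] VP[OF that] by (simp add: central_closure_component)
  qed
qed

lemma central_closure_semiprime: "homogeneously_semiprime CM PA PG"
  unfolding homogeneously_semiprime_def
proof (intro allI impI)
  fix V assume "homogeneous_ideal CM PA PG V \<and> V \<noteq> {\<zero>\<^bsub>PA\<^esub>}"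
  then have V: "homogeneous_ideal CM PA PG V" and nz: "V \<noteq> {\<zero>\<^bsub>I\<^esub>}"
    by (simp_all add: central_closure_simps)
  interpret PA: graded_lie_algebra CM PA PG by (rule central_closure_lie)
  note X = closure_ideal_submodule[OF V]
  obtain p where "p \<in> V" "p \<noteq> \<zero>\<^bsub>I\<^esub>" using nz homogeneous_right_submoduleD(3)[OF X] by blast
  then obtain x where "x \<in> carrier A" "\<iota> x \<in> V" "x \<noteq> \<zero>\<^bsub>A\<^esub>" using submodule_meets[OF X] by blast
  then have "{x \<in> carrier A. \<iota> x \<in> V} \<noteq> {\<zero>\<^bsub>A\<^esub>}" by blast
  with ideal_prod_nonzero[OF preimage_ideal[OF X]] obtain y z where
    y: "y \<in> carrier A" "\<iota> y \<in> V" and z: "z \<in> carrier A" "\<iota> z \<in> V" and yz: "y \<otimes>\<^bsub>A\<^esub> z \<noteq> \<zero>\<^bsub>A\<^esub>" by blast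
  have "\<iota> (y \<otimes>\<^bsub>A\<^esub> z) \<in> ideal_square PA V"
    using PA.ideal_square_closed(4)[OF V y(2) z(2)] y z
    by (simp add: closure_prod closure_base bracket_base)
  moreover have "\<iota> (y \<otimes>\<^bsub>A\<^esub> z) \<noteq> \<zero>\<^bsub>PA\<^esub>"
    using yz y z \<iota>_inj[of "y \<otimes>\<^bsub>A\<^esub> z" "\<zero>\<^bsub>A\<^esub>"] \<iota>_zero by (auto simp: central_closure_simps prod_closed)
  ultimately show "ideal_square PA V \<noteq> {\<zero>\<^bsub>PA\<^esub>}" by blast
qed

lemma central_closure_finite:
  assumes "finite_grading A AG"
  shows "finite_grading PA PG"
proof -
  have "PG \<gamma> = {\<zero>\<^bsub>I\<^esub>}" if "AG \<gamma> = {\<zero>\<^bsub>A\<^esub>}" for \<gamma>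
  proof -
    have gens: "{\<alpha> (\<iota> x) | \<alpha> x. \<alpha> \<in> carrier CM \<and> x \<in> AG \<gamma>} \<subseteq> {\<zero>\<^bsub>I\<^esub>}"
      using that centroid_zero_right by (auto simp: \<iota>_zero)
    have "subgroup {\<zero>\<^bsub>I\<^esub>} (add_monoid I)" by (rule Im.M.subgroup_add_monoidI) auto
    from Im.M.add.generate_subgroup_incl[OF gens this]
    have "PG \<gamma> \<subseteq> {\<zero>\<^bsub>I\<^esub>}" unfolding central_closure_grading_def by simp
    moreover have "\<zero>\<^bsub>I\<^esub> \<in> PG \<gamma>" by (simp add: closure_grading closure_D(3) Im.grade_zero)
    ultimately show ?thesis by blast
  qed
  then have "{\<gamma>. PG \<gamma> \<noteq> {\<zero>\<^bsub>PA\<^esub>}} \<subseteq> {\<gamma>. AG \<gamma> \<noteq> {\<zero>\<^bsub>A\<^esub>}}" by (auto simp: central_closure_simps)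
  then show ?thesis using assms finite_subset unfolding finite_grading_def by blast
qed

end

subsection \<open>Extension of homomorphisms and support idempotents\<close>

text \<open>The injectivity hypothesis speaks about modules on pairs, so a copy of the module is made there.\<close>

lemma (in graded_right_module) graded_injective_extend:
  assumes inj: "graded_injective S SG M MG" and X: "homogeneous_right_submodule S M MG X"
    and f: "f \<in> graded_hom S (M\<lparr>carrier := X\<rparr>) (\<lambda>\<gamma>. X \<inter> MG \<gamma>) M MG"
  shows "\<exists>g\<in>graded_hom S M MG M MG. \<forall>x\<in>X. g x = f x"
proof -
  define j :: "'m \<Rightarrow> 's \<times> 'm" where "j = (\<lambda>m. (undefined, m))"
  define Y where "Y = \<lparr>carrier = j ` carrier M, mult = (\<lambda>x y. x), one = j \<zero>\<^bsub>M\<^esub>, zero = j \<zero>\<^bsub>M\<^esub>,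
    add = (\<lambda>x y. j (snd x \<oplus>\<^bsub>M\<^esub> snd y)), smult = (\<lambda>s x. j (s \<odot>\<^bsub>M\<^esub> snd x))\<rparr>"
  define YG where "YG \<gamma> = j ` MG \<gamma>" for \<gamma>
  have [simp]: "snd (j m) = m" for m by (simp add: j_def)
  have j_inj [simp]: "j m = j n \<longleftrightarrow> m = n" for m n by (simp add: j_def)
  have Y: "carrier Y = j ` carrier M" "zero Y = j \<zero>\<^bsub>M\<^esub>" "x \<oplus>\<^bsub>Y\<^esub> y = j (snd x \<oplus>\<^bsub>M\<^esub> snd y)"
    "s \<odot>\<^bsub>Y\<^esub> x = j (s \<odot>\<^bsub>M\<^esub> snd x)" for x y s by (simp_all add: Y_def)
  have X_sub: "subgroup X (add_monoid M)" using X by (simp add: homogeneous_right_submodule_def)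
  note Xd = M.subgroup_add_monoidD[OF X_sub]
  have Xc: "component M MG \<gamma> x \<in> X" if "x \<in> X" for x \<gamma>
    using X that homogeneous_iff[OF X_sub] by (simp add: homogeneous_right_submodule_def)
  have Yab: "abelian_group Y"
  proof (rule abelian_groupI)
    show "\<exists>y\<in>carrier Y. y \<oplus>\<^bsub>Y\<^esub> x = \<zero>\<^bsub>Y\<^esub>" if "x \<in> carrier Y" for x
      using that by (auto simp: Y M.l_neg intro!: bexI[of _ "j (\<ominus>\<^bsub>M\<^esub> snd x)"])
  qed (auto simp: Y M.a_ac)
  interpret Y: abelian_group Y by (rule Yab)
  have Yneg: "\<ominus>\<^bsub>Y\<^esub> (j m) = j (\<ominus>\<^bsub>M\<^esub> m)" if "m \<in> carrier M" for m
    using that by (intro Y.minus_equality) (auto simp: Y M.l_neg)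
  have sub: "subgroup (j ` Z) (add_monoid Y)" if Z: "subgroup Z (add_monoid M)" for Z
  proof -
    note Zd = M.subgroup_add_monoidD[OF Z]
    show ?thesis
    proof (rule Y.subgroup_add_monoidI)
      show "\<ominus>\<^bsub>Y\<^esub> x \<in> j ` Z" if "x \<in> j ` Z" for x using that Zd(1,4) Yneg by auto
    qed (use Zd(1-3) in \<open>auto simp: Y\<close>)
  qed
  have all: "subgroup (carrier Y) (add_monoid Y)"
    using Y.add.subgroup_self by simp
  note dir = Y.internal_direct_sumI[where c = "\<lambda>\<gamma> x. j (component M MG \<gamma> (snd x))" and C = YG, OF all]
  have 1: "subgroup (YG \<gamma>) (add_monoid Y)" for \<gamma> unfolding YG_def by (rule sub[OF grade_subgroup])
  have 2: "YG \<gamma> \<subseteq> carrier Y" for \<gamma> using grade_closed by (auto simp: YG_def Y)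
  have 3: "j (component M MG \<gamma> (snd x)) \<in> YG \<gamma>" if "x \<in> carrier Y" for x \<gamma>
    using that component_in by (auto simp: YG_def Y)
  have 4: "j (component M MG \<gamma> (snd (x \<oplus>\<^bsub>Y\<^esub> y)))
      = j (component M MG \<gamma> (snd x)) \<oplus>\<^bsub>Y\<^esub> j (component M MG \<gamma> (snd y))"
    if "x \<in> carrier Y" "y \<in> carrier Y" for x y \<gamma>
    using that component_add by (auto simp: Y)
  have 5: "j (component M MG \<delta> (snd x)) = (if \<delta> = \<gamma> then x else \<zero>\<^bsub>Y\<^esub>)" if "x \<in> YG \<gamma>" for x \<gamma> \<delta>
    using that component_homogeneous by (auto simp: Y YG_def)
  have 6: "finite {\<gamma>. j (component M MG \<gamma> (snd x)) \<noteq> \<zero>\<^bsub>Y\<^esub>}" if "x \<in> carrier Y" for x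
    using that finite_components by (auto simp: Y)
  have 7: "x = \<zero>\<^bsub>Y\<^esub>" if "x \<in> carrier Y" "\<And>\<gamma>. j (component M MG \<gamma> (snd x)) = \<zero>\<^bsub>Y\<^esub>" for x
    using that component_eqI[of "snd x" "\<zero>\<^bsub>M\<^esub>"] by (auto simp: Y component_zero)
  have dirs: "internal_direct_sum Y (carrier Y) YG"
    "\<And>x \<gamma>. x \<in> carrier Y \<Longrightarrow> component Y YG \<gamma> x = j (component M MG \<gamma> (snd x))"
    by (rule dir[OF 1 2 3 4 5 6 7]; assumption)+
  interpret Yg: graded_group Y YG
    by (intro graded_group.intro graded_group_axioms.intro Yab dirs(1))
  have Y_mod: "graded_right_module S SG Y YG"
  proof (intro graded_right_module.intro graded_right_module_axioms.intro Yab S.ring_axioms dirs(1))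
    show "s \<odot>\<^bsub>Y\<^esub> m \<in> YG (\<gamma> + \<alpha>)" if "s \<in> SG \<alpha>" "m \<in> YG \<gamma>" for s \<alpha> m \<gamma>
      using that module_grading_act by (auto simp: YG_def Y)
    show "s \<odot>\<^bsub>Y\<^esub> m \<in> carrier Y" if "s \<in> carrier S" "m \<in> carrier Y" for s m
      using that act_closed by (auto simp: Y)
    show "s \<odot>\<^bsub>Y\<^esub> (m \<oplus>\<^bsub>Y\<^esub> n) = s \<odot>\<^bsub>Y\<^esub> m \<oplus>\<^bsub>Y\<^esub> s \<odot>\<^bsub>Y\<^esub> n"
      if "s \<in> carrier S" "m \<in> carrier Y" "n \<in> carrier Y" for s m n
      using that act_add by (auto simp: Y)
    show "(s \<oplus>\<^bsub>S\<^esub> t) \<odot>\<^bsub>Y\<^esub> m = s \<odot>\<^bsub>Y\<^esub> m \<oplus>\<^bsub>Y\<^esub> t \<odot>\<^bsub>Y\<^esub> m"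
      if "s \<in> carrier S" "t \<in> carrier S" "m \<in> carrier Y" for s t m
      using that add_act by (auto simp: Y)
    show "(s \<otimes>\<^bsub>S\<^esub> t) \<odot>\<^bsub>Y\<^esub> m = t \<odot>\<^bsub>Y\<^esub> (s \<odot>\<^bsub>Y\<^esub> m)"
      if "s \<in> carrier S" "t \<in> carrier S" "m \<in> carrier Y" for s t m
      using that mult_act by (auto simp: Y)
    show "\<one>\<^bsub>S\<^esub> \<odot>\<^bsub>Y\<^esub> m = m" if "m \<in> carrier Y" for m using that one_act by (auto simp: Y)
  qed
  have "homogeneous Y YG (j ` X)"
  proof (rule Yg.homogeneousI[OF sub[OF X_sub]])
    fix x \<gamma> assume "x \<in> j ` X"
    then obtain m where m: "m \<in> X" "x = j m" by blast
    then have "x \<in> carrier Y" using Xd(1) unfolding Y(1) by blast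
    from dirs(2)[OF this] have "component Y YG \<gamma> x = j (component M MG \<gamma> m)" unfolding m(2) by simp
    then show "component Y YG \<gamma> x \<in> j ` X" using Xc[OF m(1)] by simp
  qed
  then have X_mod: "homogeneous_right_submodule S Y YG (j ` X)"
    using X sub[OF X_sub] by (auto simp: homogeneous_right_submodule_def Y)
  define f' where "f' = (\<lambda>y\<in>j ` X. f (snd y))"
  have act: "s \<odot>\<^bsub>M\<^esub> x \<in> X" if "s \<in> carrier S" "x \<in> X" for s x
    using X that by (simp add: homogeneous_right_submodule_def)
  have f: "f x \<in> carrier M" "f (x \<oplus>\<^bsub>M\<^esub> y) = f x \<oplus>\<^bsub>M\<^esub> f y" "s \<in> carrier S \<Longrightarrow> f (s \<odot>\<^bsub>M\<^esub> x) = s \<odot>\<^bsub>M\<^esub> f x"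
    "x \<in> MG \<gamma> \<Longrightarrow> f x \<in> MG \<gamma>" if "x \<in> X" "y \<in> X" for x y s \<gamma>
    using f that by (auto simp: graded_hom_def image_subset_iff)
  have "f' \<in> graded_hom S (Y\<lparr>carrier := j ` X\<rparr>) (\<lambda>\<gamma>. j ` X \<inter> YG \<gamma>) M MG"
    unfolding graded_hom_def f'_def using f act Xd(3) by (auto simp: Y YG_def)
  then obtain g where g: "g \<in> graded_hom S Y YG M MG" "\<forall>x\<in>j ` X. g x = f' x"
    using inj Y_mod X_mod unfolding graded_injective_def by blast
  have gD: "g (j x) \<in> carrier M" "g (j (x \<oplus>\<^bsub>M\<^esub> y)) = g (j x) \<oplus>\<^bsub>M\<^esub> g (j y)"
    "s \<in> carrier S \<Longrightarrow> g (j (s \<odot>\<^bsub>M\<^esub> x)) = s \<odot>\<^bsub>M\<^esub> g (j x)"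
    if "x \<in> carrier M" "y \<in> carrier M" for x y s
    using g(1) that by (auto simp: graded_hom_def Y)
  have g_grade: "g (j x) \<in> MG \<gamma>" if "x \<in> MG \<gamma>" for x \<gamma>
    using g(1) that by (auto simp: graded_hom_def YG_def image_subset_iff)
  have "(\<lambda>x\<in>carrier M. g (j x)) \<in> graded_hom S M MG M MG"
    unfolding graded_hom_def using gD g_grade grade_closed by (auto simp: act_closed)
  moreover have "(\<lambda>x\<in>carrier M. g (j x)) x = f x" if "x \<in> X" for x
    using that Xd(1) g(2) by (auto simp: f'_def)
  ultimately show ?thesis by blast
qed

context graded_hull
begin

lemma support_idempotent:
  assumes V: "homogeneous_ideal CM PA PG V"
  shows "\<exists>e\<in>idempotents CM. \<forall>\<alpha>\<in>carrier CM. (\<forall>v\<in>V. \<alpha> v = \<zero>\<^bsub>I\<^esub>) \<longleftrightarrow> \<alpha> \<otimes>\<^bsub>CM\<^esub> e = \<zero>\<^bsub>CM\<^esub>"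
proof -
  interpret PA: graded_lie_algebra CM PA PG by (rule central_closure_lie)
  interpret PA: semiprime_graded_lie_algebra CM PA PG
    by unfold_locales (rule central_closure_semiprime)
  define W where "W = annihilator PA V"
  have W: "homogeneous_ideal CM PA PG W" unfolding W_def by (rule PA.homogeneous_ideal_annihilator[OF V])
  note Vd = homogeneous_right_submoduleD[OF closure_ideal_submodule[OF V]]
    and Wd = homogeneous_right_submoduleD[OF closure_ideal_submodule[OF W]]
  have VP: "v \<in> P" if "v \<in> V" for v
    using PA.homogeneous_idealD(3)[OF V] that by (auto simp: central_closure_simps)
  have WP: "w \<in> P" if "w \<in> W" for w
    using PA.homogeneous_idealD(3)[OF W] that by (auto simp: central_closure_simps)
  have VI: "v \<in> carrier I" if "v \<in> V" for v using VP[OF that] closure_closed by simp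
  have WI: "w \<in> carrier I" if "w \<in> W" for w using WP[OF that] closure_closed by simp
  have VW: "z = \<zero>\<^bsub>I\<^esub>" if "z \<in> V" "z \<in> W" for z
    using PA.inter_annihilator[OF V that(1)] that(2) by (simp add: W_def central_closure_simps)
  define X where "X = {v \<oplus>\<^bsub>I\<^esub> w | v w. v \<in> V \<and> w \<in> W}"
  have X: "homogeneous_right_submodule (mult_alg K A) I IG X"
  proof (rule homogeneous_right_submoduleI)
    show "X \<subseteq> carrier I" using VI WI by (auto simp: X_def)
    show "\<zero>\<^bsub>I\<^esub> \<in> X" unfolding X_def using Vd(3) Wd(3) by force
    show "p \<oplus>\<^bsub>I\<^esub> q \<in> X" if h: "p \<in> X" "q \<in> X" for p q
    proof -
      obtain v w where vw: "v \<in> V" "w \<in> W" "p = v \<oplus>\<^bsub>I\<^esub> w" using h(1) X_def by blast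
      obtain v' w' where vw': "v' \<in> V" "w' \<in> W" "q = v' \<oplus>\<^bsub>I\<^esub> w'" using h(2) X_def by blast
      have "p \<oplus>\<^bsub>I\<^esub> q = (v \<oplus>\<^bsub>I\<^esub> v') \<oplus>\<^bsub>I\<^esub> (w \<oplus>\<^bsub>I\<^esub> w')" using vw vw' VI WI by (simp add: Im.M.a_ac)
      then show ?thesis unfolding X_def using Vd(4) Wd(4) vw vw' by blast
    qed
    show "kact k p \<in> X" if h: "k \<in> carrier K" "p \<in> X" for k p
    proof -
      obtain v w where vw: "v \<in> V" "w \<in> W" "p = v \<oplus>\<^bsub>I\<^esub> w" using h(2) X_def by blast
      have "kact k p = kact k v \<oplus>\<^bsub>I\<^esub> kact k w" using vw VI WI h(1) by (simp add: kact_add)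
      then show ?thesis unfolding X_def using Vd(6) Wd(6) vw h(1) by blast
    qed
    show "lact x p \<in> X" if h: "x \<in> carrier A" "p \<in> X" for x p
    proof -
      obtain v w where vw: "v \<in> V" "w \<in> W" "p = v \<oplus>\<^bsub>I\<^esub> w" using h(2) X_def by blast
      have "lact x p = lact x v \<oplus>\<^bsub>I\<^esub> lact x w" using vw VI WI h(1) by (simp add: lact_add)
      then show ?thesis unfolding X_def using Vd(7) Wd(7) vw h(1) by blast
    qed
    show "component I IG \<gamma> p \<in> X" if h: "p \<in> X" for \<gamma> p
    proof -
      obtain v w where vw: "v \<in> V" "w \<in> W" "p = v \<oplus>\<^bsub>I\<^esub> w" using h X_def by blast
      have "component I IG \<gamma> p = component I IG \<gamma> v \<oplus>\<^bsub>I\<^esub> component I IG \<gamma> w"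
        using vw VI WI by (simp add: Im.component_add)
      then show ?thesis unfolding X_def using Vd(8) Wd(8) vw by blast
    qed
  qed
  define f where "f = (\<lambda>p\<in>X. THE v. v \<in> V \<and> (\<exists>w\<in>W. p = v \<oplus>\<^bsub>I\<^esub> w))"
  have f: "f (v \<oplus>\<^bsub>I\<^esub> w) = v" if vw: "v \<in> V" "w \<in> W" for v w
  proof -
    have "v' = v" if vw': "v' \<in> V" "w' \<in> W" and eq: "v \<oplus>\<^bsub>I\<^esub> w = v' \<oplus>\<^bsub>I\<^esub> w'" for v' w'
    proof -
      have "v' \<oplus>\<^bsub>I\<^esub> \<ominus>\<^bsub>I\<^esub> v = (v' \<oplus>\<^bsub>I\<^esub> w') \<oplus>\<^bsub>I\<^esub> \<ominus>\<^bsub>I\<^esub> w' \<oplus>\<^bsub>I\<^esub> \<ominus>\<^bsub>I\<^esub> v"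
        using vw vw' VI WI by (simp add: Im.M.a_assoc Im.M.r_neg)
      also have "\<dots> = w \<oplus>\<^bsub>I\<^esub> \<ominus>\<^bsub>I\<^esub> w'"
      proof -
        have "v \<oplus>\<^bsub>I\<^esub> w \<oplus>\<^bsub>I\<^esub> \<ominus>\<^bsub>I\<^esub> w' \<oplus>\<^bsub>I\<^esub> \<ominus>\<^bsub>I\<^esub> v = (w \<oplus>\<^bsub>I\<^esub> \<ominus>\<^bsub>I\<^esub> w') \<oplus>\<^bsub>I\<^esub> (v \<oplus>\<^bsub>I\<^esub> \<ominus>\<^bsub>I\<^esub> v)"
          using vw vw' VI WI by (simp add: Im.M.a_ac del: Im.M.r_neg)
        then show ?thesis unfolding eq[symmetric] using vw vw' VI WI by (simp add: Im.M.r_neg)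
      qed
      finally have "v' \<oplus>\<^bsub>I\<^esub> \<ominus>\<^bsub>I\<^esub> v = w \<oplus>\<^bsub>I\<^esub> \<ominus>\<^bsub>I\<^esub> w'" .
      moreover have "v' \<oplus>\<^bsub>I\<^esub> \<ominus>\<^bsub>I\<^esub> v \<in> V" "w \<oplus>\<^bsub>I\<^esub> \<ominus>\<^bsub>I\<^esub> w' \<in> W" using vw vw' Vd(4,5) Wd(4,5) by blast+
      ultimately have "v' \<oplus>\<^bsub>I\<^esub> \<ominus>\<^bsub>I\<^esub> v = \<zero>\<^bsub>I\<^esub>" using VW by simp
      then show ?thesis using Im.M.minus_equality[of v' "\<ominus>\<^bsub>I\<^esub> v"] VI[OF vw(1)] VI[OF vw'(1)] by simp
    qed
    moreover have "v \<oplus>\<^bsub>I\<^esub> w \<in> X" using vw X_def by blast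
    ultimately show ?thesis unfolding f_def using vw by (auto intro!: the_equality)
  qed
  have fV: "f v = v" if "v \<in> V" for v using f[OF that Wd(3)] VI[OF that] by simp
  have fW: "f w = \<zero>\<^bsub>I\<^esub>" if "w \<in> W" for w using f[OF Vd(3) that] WI[OF that] by simp
  have split: "\<exists>v\<in>V. \<exists>w\<in>W. p = v \<oplus>\<^bsub>I\<^esub> w" if "p \<in> X" for p using that X_def by blast
  have "f \<in> graded_hom (mult_alg K A) (I\<lparr>carrier := X\<rparr>) (\<lambda>\<gamma>. X \<inter> IG \<gamma>) (I\<lparr>carrier := carrier I\<rparr>) (\<lambda>\<gamma>. carrier I \<inter> IG \<gamma>)"
    unfolding graded_hom_iff[OF X order.refl]
  proof (intro conjI ballI allI impI)
    show "f \<in> X \<rightarrow>\<^sub>E carrier I"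
    proof (rule PiE_I)
      show "f p \<in> carrier I" if "p \<in> X" for p using split[OF that] f VI by auto
      show "f p = undefined" if "p \<notin> X" for p using that by (simp add: f_def)
    qed
    show "f (p \<oplus>\<^bsub>I\<^esub> q) = f p \<oplus>\<^bsub>I\<^esub> f q" if h: "p \<in> X" "q \<in> X" for p q
    proof -
      obtain v w where vw: "v \<in> V" "w \<in> W" "p = v \<oplus>\<^bsub>I\<^esub> w" using split[OF h(1)] by blast
      obtain v' w' where vw': "v' \<in> V" "w' \<in> W" "q = v' \<oplus>\<^bsub>I\<^esub> w'" using split[OF h(2)] by blast
      have "p \<oplus>\<^bsub>I\<^esub> q = (v \<oplus>\<^bsub>I\<^esub> v') \<oplus>\<^bsub>I\<^esub> (w \<oplus>\<^bsub>I\<^esub> w')" using vw vw' VI WI by (simp add: Im.M.a_ac)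
      then show ?thesis using f[OF Vd(4)[OF vw(1) vw'(1)] Wd(4)[OF vw(2) vw'(2)]] f vw vw' by simp
    qed
    show "f (kact k p) = kact k (f p)" if h: "k \<in> carrier K" "p \<in> X" for k p
    proof -
      obtain v w where vw: "v \<in> V" "w \<in> W" "p = v \<oplus>\<^bsub>I\<^esub> w" using split[OF h(2)] by blast
      have "kact k p = kact k v \<oplus>\<^bsub>I\<^esub> kact k w" using vw VI WI h(1) by (simp add: kact_add)
      then show ?thesis using f[OF Vd(6)[OF h(1) vw(1)] Wd(6)[OF h(1) vw(2)]] f vw by simp
    qed
    show "f (lact x p) = lact x (f p)" if h: "x \<in> carrier A" "p \<in> X" for x p
    proof -
      obtain v w where vw: "v \<in> V" "w \<in> W" "p = v \<oplus>\<^bsub>I\<^esub> w" using split[OF h(2)] by blast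
      have "lact x p = lact x v \<oplus>\<^bsub>I\<^esub> lact x w" using vw VI WI h(1) by (simp add: lact_add)
      then show ?thesis using f[OF Vd(7)[OF h(1) vw(1)] Wd(7)[OF h(1) vw(2)]] f vw by simp
    qed
    show "f p \<in> IG \<gamma>" if h: "p \<in> X" "p \<in> IG \<gamma>" for \<gamma> p
    proof -
      obtain v w where vw: "v \<in> V" "w \<in> W" "p = v \<oplus>\<^bsub>I\<^esub> w" using split[OF h(1)] by blast
      have "p = component I IG \<gamma> v \<oplus>\<^bsub>I\<^esub> component I IG \<gamma> w"
        using Im.component_homogeneous[OF h(2), of \<gamma>] vw VI WI by (simp add: Im.component_add)
      then show ?thesis
        using f[OF Vd(8)[OF vw(1)] Wd(8)[OF vw(2)]] Im.component_in[OF VI[OF vw(1)]] by simp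
    qed
  qed
  moreover have "carrier I \<inter> IG \<gamma> = IG \<gamma>" for \<gamma> using Im.grade_closed by auto
  moreover have "graded_injective (mult_alg K A) (mult_alg_grading K A AG) I IG"
    using hull by (simp add: hull_of_algebra_def graded_injective_hull_def)
  ultimately obtain g where g: "g \<in> E" "\<forall>p\<in>X. g p = f p"
    using Im.graded_injective_extend[OF _ X, of f] by auto
  define e where "e = (\<lambda>p\<in>P. g p)"
  have e: "e \<in> carrier CM" unfolding e_def by (rule E_restrict[OF g(1)])
  have VX: "v \<in> X" if "v \<in> V" for v
  proof -
    have "v = v \<oplus>\<^bsub>I\<^esub> \<zero>\<^bsub>I\<^esub>" using VI[OF that] by simp
    then show ?thesis unfolding X_def using that Wd(3) by blast
  qed
  have WX: "w \<in> X" if "w \<in> W" for w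
  proof -
    have "w = \<zero>\<^bsub>I\<^esub> \<oplus>\<^bsub>I\<^esub> w" using WI[OF that] by simp
    then show ?thesis unfolding X_def using that Vd(3) by blast
  qed
  have eV: "e v = v" if "v \<in> V" for v using that g(2) VX fV VP by (simp add: e_def)
  have eW: "e w = \<zero>\<^bsub>I\<^esub>" if "w \<in> W" for w using that g(2) WX fW WP by (simp add: e_def)
  have agree: "\<alpha> = \<beta>" if \<alpha>: "\<alpha> \<in> carrier CM" and \<beta>: "\<beta> \<in> carrier CM"
    and V': "\<And>v. v \<in> V \<Longrightarrow> \<alpha> v = \<beta> v" and W': "\<And>w. w \<in> W \<Longrightarrow> \<alpha> w = \<beta> w" for \<alpha> \<beta>
  proof (rule centroid_ext[OF \<alpha> \<beta>])
    fix p assume p: "p \<in> P"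
    have ap: "\<alpha> p \<in> P" "\<beta> p \<in> P" using \<alpha> \<beta> p centroid_closed by auto
    define d where "d = \<alpha> p \<oplus>\<^bsub>I\<^esub> \<ominus>\<^bsub>I\<^esub> \<beta> p"
    have d: "d \<in> P" unfolding d_def using ap closure_D(4,5) by blast
    have "bracket d z = \<zero>\<^bsub>I\<^esub>" if z: "z \<in> V \<or> z \<in> W" for z
    proof -
      have zP: "z \<in> P" using z VP WP by blast
      have "bracket p z \<in> V \<or> bracket p z \<in> W"
        using z PA.homogeneous_idealD(8)[OF V, of p z] PA.homogeneous_idealD(8)[OF W, of p z] p zP
        by (auto simp: central_closure_simps(1) closure_prod)
      then have "\<alpha> (bracket p z) = \<beta> (bracket p z)" using V' W' by blast
      then have "bracket (\<alpha> p) z = bracket (\<beta> p) z"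
        using bracket_centroid_left[OF \<alpha> p zP] bracket_centroid_left[OF \<beta> p zP] by simp
      moreover have "bracket (\<ominus>\<^bsub>I\<^esub> \<beta> p) z = \<ominus>\<^bsub>I\<^esub> bracket (\<beta> p) z"
        using additive_neg[OF cl.abelian_group_axioms Im.M.abelian_group_axioms, of "\<lambda>q. bracket q z" "\<beta> p"]
          ap zP by (simp add: bracket_closed closure_closed bracket_add_left closure_neg)
      ultimately show ?thesis unfolding d_def
        using ap zP closure_D(5) by (simp add: bracket_add_left bracket_closed closure_closed Im.M.r_neg)
    qed
    then have "d \<in> annihilator PA V" "d \<in> annihilator PA W"
      using d VP WP by (auto simp: annihilator_def central_closure_simps(1,3) closure_prod)
    then have "d = \<zero>\<^bsub>I\<^esub>"
      using PA.inter_annihilator[OF W, of d] by (simp add: W_def central_closure_simps)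
    then show "\<alpha> p = \<beta> p" using Im.M.minus_equality[of "\<alpha> p" "\<ominus>\<^bsub>I\<^esub> \<beta> p"] ap closure_closed by (simp add: d_def)
  qed
  have "e \<otimes>\<^bsub>CM\<^esub> e = e"
    by (rule agree[OF centroid_mult_closed[OF e e] e])
      (simp_all add: centroid_mult eV eW VP WP centroid_zero_right[OF e])
  then have "e \<in> idempotents CM" using e by (simp add: idempotents_def)
  moreover have "(\<forall>v\<in>V. \<alpha> v = \<zero>\<^bsub>I\<^esub>) \<longleftrightarrow> \<alpha> \<otimes>\<^bsub>CM\<^esub> e = \<zero>\<^bsub>CM\<^esub>" if \<alpha>: "\<alpha> \<in> carrier CM" for \<alpha>
  proof
    assume "\<forall>v\<in>V. \<alpha> v = \<zero>\<^bsub>I\<^esub>"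
    then show "\<alpha> \<otimes>\<^bsub>CM\<^esub> e = \<zero>\<^bsub>CM\<^esub>"
      by (intro agree centroid_mult_closed \<alpha> e centroid_zero_closed)
        (simp_all add: centroid_mult centroid_zero eV eW VP WP centroid_zero_right[OF \<alpha>])
  next
    assume "\<alpha> \<otimes>\<^bsub>CM\<^esub> e = \<zero>\<^bsub>CM\<^esub>"
    then have "(\<alpha> \<otimes>\<^bsub>CM\<^esub> e) v = \<zero>\<^bsub>I\<^esub>" if "v \<in> V" for v using VP[OF that] by (simp add: centroid_zero)
    then show "\<forall>v\<in>V. \<alpha> v = \<zero>\<^bsub>I\<^esub>" using VP eV by (simp add: centroid_mult)
  qed
  ultimately show ?thesis by blast
qed

end

section \<open>Orthogonal completeness\<close>

context cring
begin

lemma idempotentD: "\<xi> \<in> idempotents R \<Longrightarrow> \<xi> \<in> carrier R" "\<xi> \<in> idempotents R \<Longrightarrow> \<xi> \<otimes> \<xi> = \<xi>"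
  by (simp_all add: idempotents_def)

lemma idempotent_mult: "\<lbrakk>\<xi> \<in> idempotents R; \<chi> \<in> idempotents R\<rbrakk> \<Longrightarrow> \<xi> \<otimes> \<chi> \<in> idempotents R"
proof -
  assume h: "\<xi> \<in> idempotents R" "\<chi> \<in> idempotents R"
  then have c: "\<xi> \<in> carrier R" "\<chi> \<in> carrier R" by (simp_all add: idempotents_def)
  then have "(\<xi> \<otimes> \<chi>) \<otimes> (\<xi> \<otimes> \<chi>) = (\<xi> \<otimes> \<xi>) \<otimes> (\<chi> \<otimes> \<chi>)" by (simp add: m_ac)
  then show ?thesis using h by (simp add: idempotents_def)
qed

lemma idempotent_zero: "\<zero> \<in> idempotents R" and idempotent_one: "\<one> \<in> idempotents R"
  by (simp_all add: idempotents_def)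

lemma idempotent_complement:
  assumes "\<xi> \<in> idempotents R"
  shows "\<one> \<ominus> \<xi> \<in> idempotents R"
proof -
  note c = idempotentD[OF assms]
  have "(\<one> \<oplus> \<ominus> \<xi>) \<otimes> (\<one> \<oplus> \<ominus> \<xi>) = \<one> \<oplus> \<ominus> \<xi> \<oplus> (\<ominus> \<xi> \<oplus> \<xi>)"
    using c by (simp add: l_distr r_distr l_minus r_minus l_neg r_neg)
  then show ?thesis using c by (simp add: idempotents_def a_minus_def l_neg)
qed

lemma dense_orthogonalD:
  assumes "dense_orthogonal R D"
  shows "\<xi> \<in> D \<Longrightarrow> \<xi> \<in> idempotents R" "\<xi> \<in> D \<Longrightarrow> \<xi> \<in> carrier R" "\<xi> \<in> D \<Longrightarrow> \<xi> \<otimes> \<xi> = \<xi>"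
    and "\<lbrakk>\<xi> \<in> D; \<chi> \<in> D; \<xi> \<noteq> \<chi>\<rbrakk> \<Longrightarrow> \<xi> \<otimes> \<chi> = \<zero>"
    and "\<lbrakk>\<beta> \<in> idempotents R; \<And>\<xi>. \<xi> \<in> D \<Longrightarrow> \<beta> \<otimes> \<xi> = \<zero>\<rbrakk> \<Longrightarrow> \<beta> = \<zero>"
  using assms by (auto simp: dense_orthogonal_def idempotents_def)

lemma dense_orthogonalI:
  assumes "\<And>\<xi>. \<xi> \<in> D \<Longrightarrow> \<xi> \<in> idempotents R" "\<And>\<xi> \<chi>. \<lbrakk>\<xi> \<in> D; \<chi> \<in> D; \<xi> \<noteq> \<chi>\<rbrakk> \<Longrightarrow> \<xi> \<otimes> \<chi> = \<zero>"
    and "\<And>\<beta>. \<lbrakk>\<beta> \<in> idempotents R; \<And>\<xi>. \<xi> \<in> D \<Longrightarrow> \<beta> \<otimes> \<xi> = \<zero>\<rbrakk> \<Longrightarrow> \<beta> = \<zero>"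
  shows "dense_orthogonal R D"
proof -
  have "\<zero> \<otimes> \<xi> = \<zero>" if "\<xi> \<in> D" for \<xi> using assms(1)[OF that] by (simp add: idempotents_def)
  then have "{\<beta> \<in> idempotents R. \<forall>\<xi>\<in>D. \<beta> \<otimes> \<xi> = \<zero>} = {\<zero>}" using assms(3) idempotent_zero by auto
  then show ?thesis using assms(1,2) by (auto simp: dense_orthogonal_def)
qed

lemma dense_orthogonal_one: "dense_orthogonal R {\<one>}"
  by (rule dense_orthogonalI) (auto simp: idempotents_def)

lemma dense_orthogonal_refine:
  assumes D: "dense_orthogonal R D" and E: "\<And>\<xi>. \<xi> \<in> D \<Longrightarrow> dense_orthogonal R (E \<xi>)"
  shows "dense_orthogonal R {\<xi> \<otimes> \<chi> | \<xi> \<chi>. \<xi> \<in> D \<and> \<chi> \<in> E \<xi>}"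
proof (rule dense_orthogonalI)
  fix \<eta> assume "\<eta> \<in> {\<xi> \<otimes> \<chi> | \<xi> \<chi>. \<xi> \<in> D \<and> \<chi> \<in> E \<xi>}"
  then show "\<eta> \<in> idempotents R"
    using dense_orthogonalD(1)[OF D] dense_orthogonalD(1)[OF E] idempotent_mult by auto
next
  fix \<eta> \<theta> assume "\<eta> \<in> {\<xi> \<otimes> \<chi> | \<xi> \<chi>. \<xi> \<in> D \<and> \<chi> \<in> E \<xi>}" "\<theta> \<in> {\<xi> \<otimes> \<chi> | \<xi> \<chi>. \<xi> \<in> D \<and> \<chi> \<in> E \<xi>}"
    and ne: "\<eta> \<noteq> \<theta>"
  then obtain \<xi> \<chi> \<xi>' \<chi>' where h: "\<xi> \<in> D" "\<chi> \<in> E \<xi>" "\<eta> = \<xi> \<otimes> \<chi>" "\<xi>' \<in> D" "\<chi>' \<in> E \<xi>'" "\<theta> = \<xi>' \<otimes> \<chi>'"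
    by blast
  note c = dense_orthogonalD(2)[OF D h(1)] dense_orthogonalD(2)[OF D h(4)]
    dense_orthogonalD(2)[OF E[OF h(1)] h(2)] dense_orthogonalD(2)[OF E[OF h(4)] h(5)]
  have "\<eta> \<otimes> \<theta> = (\<xi> \<otimes> \<xi>') \<otimes> (\<chi> \<otimes> \<chi>')" using c h by (simp add: m_ac)
  moreover have "\<xi> \<otimes> \<xi>' = \<zero> \<or> \<chi> \<otimes> \<chi>' = \<zero>"
  proof (cases "\<xi> = \<xi>'")
    case True
    then show ?thesis using ne h dense_orthogonalD(4)[OF E[OF h(1)], of \<chi> \<chi>'] by blast
  next
    case False
    then show ?thesis using dense_orthogonalD(4)[OF D h(1) h(4)] by blast
  qed
  ultimately show "\<eta> \<otimes> \<theta> = \<zero>" using c by auto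
next
  fix \<beta> assume \<beta>: "\<beta> \<in> idempotents R"
    and z: "\<And>\<eta>. \<eta> \<in> {\<xi> \<otimes> \<chi> | \<xi> \<chi>. \<xi> \<in> D \<and> \<chi> \<in> E \<xi>} \<Longrightarrow> \<beta> \<otimes> \<eta> = \<zero>"
  show "\<beta> = \<zero>"
  proof (rule dense_orthogonalD(5)[OF D \<beta>])
    fix \<xi> assume \<xi>: "\<xi> \<in> D"
    show "\<beta> \<otimes> \<xi> = \<zero>"
    proof (rule dense_orthogonalD(5)[OF E[OF \<xi>]])
      show "\<beta> \<otimes> \<xi> \<in> idempotents R" using idempotent_mult \<beta> dense_orthogonalD(1)[OF D \<xi>] by blast
      fix \<chi> assume \<chi>: "\<chi> \<in> E \<xi>"
      have "\<beta> \<otimes> (\<xi> \<otimes> \<chi>) = \<zero>" using z \<xi> \<chi> by blast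
      then show "\<beta> \<otimes> \<xi> \<otimes> \<chi> = \<zero>"
        using \<beta> dense_orthogonalD(2)[OF D \<xi>] dense_orthogonalD(2)[OF E[OF \<xi>] \<chi>]
        by (simp add: m_assoc idempotentD)
    qed
  qed
qed

lemma dense_orthogonal_mult:
  assumes "dense_orthogonal R D" "dense_orthogonal R E"
  shows "dense_orthogonal R {\<xi> \<otimes> \<chi> | \<xi> \<chi>. \<xi> \<in> D \<and> \<chi> \<in> E}"
  using dense_orthogonal_refine[of D "\<lambda>_. E"] assms by simp

end

locale supported_lie_algebra = semiprime_graded_lie_algebra +
  assumes support: "homogeneous_ideal K A AG V \<Longrightarrow>
    \<exists>e\<in>idempotents K. \<forall>\<alpha>\<in>idempotents K. (\<forall>v\<in>V. \<alpha> \<odot>\<^bsub>A\<^esub> v = \<zero>\<^bsub>A\<^esub>) \<longleftrightarrow> \<alpha> \<otimes>\<^bsub>K\<^esub> e = \<zero>\<^bsub>K\<^esub>"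
begin

lemma smult_zero_ideal:
  assumes S: "S \<subseteq> carrier K"
  shows "homogeneous_ideal K A AG {x \<in> carrier A. \<forall>\<alpha>\<in>S. \<alpha> \<odot>\<^bsub>A\<^esub> x = \<zero>\<^bsub>A\<^esub>}"
proof (rule homogeneous_idealI_left)
  have S': "\<alpha> \<in> carrier K" if "\<alpha> \<in> S" for \<alpha> using that S by auto
  show "k \<odot>\<^bsub>A\<^esub> x \<in> {x \<in> carrier A. \<forall>\<alpha>\<in>S. \<alpha> \<odot>\<^bsub>A\<^esub> x = \<zero>\<^bsub>A\<^esub>}"
    if k: "k \<in> carrier K" and x: "x \<in> {x \<in> carrier A. \<forall>\<alpha>\<in>S. \<alpha> \<odot>\<^bsub>A\<^esub> x = \<zero>\<^bsub>A\<^esub>}" for k x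
  proof -
    have "\<alpha> \<odot>\<^bsub>A\<^esub> (k \<odot>\<^bsub>A\<^esub> x) = \<zero>\<^bsub>A\<^esub>" if \<alpha>: "\<alpha> \<in> S" for \<alpha>
    proof -
      have "\<alpha> \<odot>\<^bsub>A\<^esub> (k \<odot>\<^bsub>A\<^esub> x) = k \<odot>\<^bsub>A\<^esub> (\<alpha> \<odot>\<^bsub>A\<^esub> x)"
        using k x S'[OF \<alpha>] by (simp add: smult_assoc1[symmetric] R.m_comm)
      then show ?thesis using k x \<alpha> by simp
    qed
    then show ?thesis using k x by simp
  qed
  show "a \<otimes>\<^bsub>A\<^esub> x \<in> {x \<in> carrier A. \<forall>\<alpha>\<in>S. \<alpha> \<odot>\<^bsub>A\<^esub> x = \<zero>\<^bsub>A\<^esub>}"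
    if "a \<in> carrier A" "x \<in> {x \<in> carrier A. \<forall>\<alpha>\<in>S. \<alpha> \<odot>\<^bsub>A\<^esub> x = \<zero>\<^bsub>A\<^esub>}" for a x
    using that S' by (simp add: prod_closed prod_r_smult[symmetric] prod_r_zero)
  show "component A AG \<gamma> x \<in> {x \<in> carrier A. \<forall>\<alpha>\<in>S. \<alpha> \<odot>\<^bsub>A\<^esub> x = \<zero>\<^bsub>A\<^esub>}"
    if "x \<in> {x \<in> carrier A. \<forall>\<alpha>\<in>S. \<alpha> \<odot>\<^bsub>A\<^esub> x = \<zero>\<^bsub>A\<^esub>}" for \<gamma> x
    using that S' by (simp add: component_closed component_smult[symmetric] component_zero)
qed (use S in \<open>auto simp: smult_r_distr subset_iff\<close>)

lemma dense_separates:
  assumes D: "dense_orthogonal K D" and x: "x \<in> carrier A" "\<And>\<xi>. \<xi> \<in> D \<Longrightarrow> \<xi> \<odot>\<^bsub>A\<^esub> x = \<zero>\<^bsub>A\<^esub>"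
  shows "x = \<zero>\<^bsub>A\<^esub>"
proof -
  note Dd = R.dense_orthogonalD[OF D]
  let ?V = "{x \<in> carrier A. \<forall>\<alpha>\<in>D. \<alpha> \<odot>\<^bsub>A\<^esub> x = \<zero>\<^bsub>A\<^esub>}"
  obtain e where e: "e \<in> idempotents K"
    "\<And>\<alpha>. \<alpha> \<in> idempotents K \<Longrightarrow> (\<forall>v\<in>?V. \<alpha> \<odot>\<^bsub>A\<^esub> v = \<zero>\<^bsub>A\<^esub>) \<longleftrightarrow> \<alpha> \<otimes>\<^bsub>K\<^esub> e = \<zero>\<^bsub>K\<^esub>"
    using support[OF smult_zero_ideal[of D]] Dd(2) by blast
  have "e \<otimes>\<^bsub>K\<^esub> \<xi> = \<zero>\<^bsub>K\<^esub>" if "\<xi> \<in> D" for \<xi>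
    using e(2)[OF Dd(1)[OF that]] that Dd(2)[OF that] R.idempotentD(1)[OF e(1)] by (simp add: R.m_comm)
  then have "e = \<zero>\<^bsub>K\<^esub>" using Dd(5)[OF e(1)] by blast
  then have "\<forall>v\<in>?V. \<one>\<^bsub>K\<^esub> \<odot>\<^bsub>A\<^esub> v = \<zero>\<^bsub>A\<^esub>" using e(2)[OF R.idempotent_one] by simp
  then show ?thesis using x by simp
qed

lemma dense_eqI:
  assumes D: "dense_orthogonal K D" and x: "x \<in> carrier A" "y \<in> carrier A"
    and eq: "\<And>\<xi>. \<xi> \<in> D \<Longrightarrow> \<xi> \<odot>\<^bsub>A\<^esub> x = \<xi> \<odot>\<^bsub>A\<^esub> y"
  shows "x = y"
proof -
  note Dd = R.dense_orthogonalD[OF D]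
  have "x \<oplus>\<^bsub>A\<^esub> \<ominus>\<^bsub>A\<^esub> y = \<zero>\<^bsub>A\<^esub>"
    by (rule dense_separates[OF D]) (use x Dd(2) eq in \<open>simp_all add: smult_r_distr smult_r_minus M.r_neg\<close>)
  then show ?thesis using M.minus_equality[of x "\<ominus>\<^bsub>A\<^esub> y"] x by simp
qed

lemma element_support:
  assumes z: "z \<in> carrier A"
  shows "\<exists>e\<in>idempotents K. \<forall>\<alpha>\<in>idempotents K. \<alpha> \<odot>\<^bsub>A\<^esub> z = \<zero>\<^bsub>A\<^esub> \<longleftrightarrow> \<alpha> \<otimes>\<^bsub>K\<^esub> e = \<zero>\<^bsub>K\<^esub>"
proof -
  let ?S = "{\<alpha> \<in> idempotents K. \<alpha> \<odot>\<^bsub>A\<^esub> z = \<zero>\<^bsub>A\<^esub>}"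
  let ?V = "{x \<in> carrier A. \<forall>\<alpha>\<in>?S. \<alpha> \<odot>\<^bsub>A\<^esub> x = \<zero>\<^bsub>A\<^esub>}"
  have "homogeneous_ideal K A AG ?V" by (rule smult_zero_ideal) (auto simp: idempotents_def)
  from support[OF this] obtain e where e: "e \<in> idempotents K"
    "\<forall>\<alpha>\<in>idempotents K. (\<forall>v\<in>?V. \<alpha> \<odot>\<^bsub>A\<^esub> v = \<zero>\<^bsub>A\<^esub>) \<longleftrightarrow> \<alpha> \<otimes>\<^bsub>K\<^esub> e = \<zero>\<^bsub>K\<^esub>" by blast
  have "(\<forall>v\<in>?V. \<alpha> \<odot>\<^bsub>A\<^esub> v = \<zero>\<^bsub>A\<^esub>) \<longleftrightarrow> \<alpha> \<odot>\<^bsub>A\<^esub> z = \<zero>\<^bsub>A\<^esub>" if "\<alpha> \<in> idempotents K" for \<alpha>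
  proof
    assume "\<forall>v\<in>?V. \<alpha> \<odot>\<^bsub>A\<^esub> v = \<zero>\<^bsub>A\<^esub>"
    moreover have "z \<in> ?V" using z by simp
    ultimately show "\<alpha> \<odot>\<^bsub>A\<^esub> z = \<zero>\<^bsub>A\<^esub>" by blast
  next
    assume "\<alpha> \<odot>\<^bsub>A\<^esub> z = \<zero>\<^bsub>A\<^esub>"
    then show "\<forall>v\<in>?V. \<alpha> \<odot>\<^bsub>A\<^esub> v = \<zero>\<^bsub>A\<^esub>" using that by simp
  qed
  then show ?thesis using e by auto
qed

lemma fixed_ideal:
  assumes V: "homogeneous_ideal K A AG V" and \<xi>: "\<xi> \<in> idempotents K"
  shows "homogeneous_ideal K A AG {v \<in> V. \<xi> \<odot>\<^bsub>A\<^esub> v = v}"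
proof (rule homogeneous_idealI_left)
  note Vd = homogeneous_idealD[OF V] and c = R.idempotentD(1)[OF \<xi>]
  have VA: "v \<in> carrier A" if "v \<in> V" for v using that Vd(3) by auto
  show "{v \<in> V. \<xi> \<odot>\<^bsub>A\<^esub> v = v} \<subseteq> carrier A" using VA by auto
  show "\<zero>\<^bsub>A\<^esub> \<in> {v \<in> V. \<xi> \<odot>\<^bsub>A\<^esub> v = v}" using Vd(4) c by simp
  show "x \<oplus>\<^bsub>A\<^esub> y \<in> {v \<in> V. \<xi> \<odot>\<^bsub>A\<^esub> v = v}" if "x \<in> {v \<in> V. \<xi> \<odot>\<^bsub>A\<^esub> v = v}" "y \<in> {v \<in> V. \<xi> \<odot>\<^bsub>A\<^esub> v = v}"
    for x y using that Vd(5) VA c by (simp add: smult_r_distr)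
  show "k \<odot>\<^bsub>A\<^esub> x \<in> {v \<in> V. \<xi> \<odot>\<^bsub>A\<^esub> v = v}" if k: "k \<in> carrier K" and x: "x \<in> {v \<in> V. \<xi> \<odot>\<^bsub>A\<^esub> v = v}" for k x
  proof -
    have "\<xi> \<odot>\<^bsub>A\<^esub> (k \<odot>\<^bsub>A\<^esub> x) = k \<odot>\<^bsub>A\<^esub> (\<xi> \<odot>\<^bsub>A\<^esub> x)"
      using k x c VA smult_assoc1[of \<xi> k x] smult_assoc1[of k \<xi> x] R.m_comm[of \<xi> k] by simp
    then show ?thesis using k x Vd(7) by simp
  qed
  show "a \<otimes>\<^bsub>A\<^esub> x \<in> {v \<in> V. \<xi> \<odot>\<^bsub>A\<^esub> v = v}" if "a \<in> carrier A" "x \<in> {v \<in> V. \<xi> \<odot>\<^bsub>A\<^esub> v = v}" for a x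
    using that Vd(8) VA c by (simp add: prod_r_smult[symmetric])
  show "component A AG \<gamma> x \<in> {v \<in> V. \<xi> \<odot>\<^bsub>A\<^esub> v = v}" if "x \<in> {v \<in> V. \<xi> \<odot>\<^bsub>A\<^esub> v = v}" for \<gamma> x
    using that Vd(10) VA c by (simp add: component_smult[symmetric])
qed

end

lemma (in graded_algebra) homogeneous_ideal_sum:
  assumes V: "homogeneous_ideal K A AG V" and W: "homogeneous_ideal K A AG W"
  shows "homogeneous_ideal K A AG {v \<oplus>\<^bsub>A\<^esub> w | v w. v \<in> V \<and> w \<in> W}" (is "homogeneous_ideal K A AG ?X")
proof (rule homogeneous_idealI)
  note Vd = homogeneous_idealD[OF V] and Wd = homogeneous_idealD[OF W]
  have VA: "v \<in> carrier A" if "v \<in> V" for v using that Vd(3) by auto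
  have WA: "v \<in> carrier A" if "v \<in> W" for v using that Wd(3) by auto
  have split: "\<exists>v w. v \<in> V \<and> w \<in> W \<and> x = v \<oplus>\<^bsub>A\<^esub> w" if "x \<in> ?X" for x using that by blast
  have I: "v \<oplus>\<^bsub>A\<^esub> w \<in> ?X" if "v \<in> V" "w \<in> W" for v w using that by blast
  show "?X \<subseteq> carrier A" using VA WA by auto
  show "\<zero>\<^bsub>A\<^esub> \<in> ?X" using I[OF Vd(4) Wd(4)] by simp
  show "x \<oplus>\<^bsub>A\<^esub> y \<in> ?X" if h: "x \<in> ?X" "y \<in> ?X" for x y
  proof -
    obtain v w where vw: "v \<in> V" "w \<in> W" "x = v \<oplus>\<^bsub>A\<^esub> w" using split[OF h(1)] by blast
    obtain v' w' where vw': "v' \<in> V" "w' \<in> W" "y = v' \<oplus>\<^bsub>A\<^esub> w'" using split[OF h(2)] by blast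
    have "x \<oplus>\<^bsub>A\<^esub> y = (v \<oplus>\<^bsub>A\<^esub> v') \<oplus>\<^bsub>A\<^esub> (w \<oplus>\<^bsub>A\<^esub> w')" using vw vw' VA WA by (simp add: M.a_ac)
    then show ?thesis using I[OF Vd(5)[OF vw(1) vw'(1)] Wd(5)[OF vw(2) vw'(2)]] by simp
  qed
  show "k \<odot>\<^bsub>A\<^esub> x \<in> ?X" if h: "k \<in> carrier K" "x \<in> ?X" for k x
  proof -
    obtain v w where vw: "v \<in> V" "w \<in> W" "x = v \<oplus>\<^bsub>A\<^esub> w" using split[OF h(2)] by blast
    have "k \<odot>\<^bsub>A\<^esub> x = k \<odot>\<^bsub>A\<^esub> v \<oplus>\<^bsub>A\<^esub> k \<odot>\<^bsub>A\<^esub> w" using vw h(1) VA WA by (simp add: smult_r_distr)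
    then show ?thesis using I[OF Vd(7)[OF h(1) vw(1)] Wd(7)[OF h(1) vw(2)]] by simp
  qed
  show "a \<otimes>\<^bsub>A\<^esub> x \<in> ?X" if h: "a \<in> carrier A" "x \<in> ?X" for a x
  proof -
    obtain v w where vw: "v \<in> V" "w \<in> W" "x = v \<oplus>\<^bsub>A\<^esub> w" using split[OF h(2)] by blast
    have "a \<otimes>\<^bsub>A\<^esub> x = a \<otimes>\<^bsub>A\<^esub> v \<oplus>\<^bsub>A\<^esub> a \<otimes>\<^bsub>A\<^esub> w" using vw h(1) VA WA by (simp add: prod_r_distr)
    then show ?thesis using I[OF Vd(8)[OF h(1) vw(1)] Wd(8)[OF h(1) vw(2)]] by simp
  qed
  show "x \<otimes>\<^bsub>A\<^esub> a \<in> ?X" if h: "a \<in> carrier A" "x \<in> ?X" for a x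
  proof -
    obtain v w where vw: "v \<in> V" "w \<in> W" "x = v \<oplus>\<^bsub>A\<^esub> w" using split[OF h(2)] by blast
    have "x \<otimes>\<^bsub>A\<^esub> a = v \<otimes>\<^bsub>A\<^esub> a \<oplus>\<^bsub>A\<^esub> w \<otimes>\<^bsub>A\<^esub> a" using vw h(1) VA WA by (simp add: prod_l_distr)
    then show ?thesis using I[OF Vd(9)[OF h(1) vw(1)] Wd(9)[OF h(1) vw(2)]] by simp
  qed
  show "component A AG \<gamma> x \<in> ?X" if h: "x \<in> ?X" for \<gamma> x
  proof -
    obtain v w where vw: "v \<in> V" "w \<in> W" "x = v \<oplus>\<^bsub>A\<^esub> w" using split[OF h] by blast
    have "component A AG \<gamma> x = component A AG \<gamma> v \<oplus>\<^bsub>A\<^esub> component A AG \<gamma> w"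
      using vw VA WA by (simp add: component_add)
    then show ?thesis using I[OF Vd(10)[OF vw(1)] Wd(10)[OF vw(2)]] by simp
  qed
qed

lemma (in graded_algebra) homogeneous_ideal_Union:
  assumes L: "\<And>x y. \<lbrakk>x \<in> L; y \<in> L\<rbrakk> \<Longrightarrow> x \<oplus>\<^bsub>A\<^esub> y \<in> L" "\<zero>\<^bsub>A\<^esub> \<in> L"
  shows "homogeneous_ideal K A AG (\<Union>{V. homogeneous_ideal K A AG V \<and> V \<subseteq> L})" (is "homogeneous_ideal K A AG ?X")
proof (rule homogeneous_idealI)
  have split: "\<exists>V. homogeneous_ideal K A AG V \<and> V \<subseteq> L \<and> x \<in> V" if "x \<in> ?X" for x using that by blast
  have I: "x \<in> ?X" if "homogeneous_ideal K A AG V" "V \<subseteq> L" "x \<in> V" for V x using that by blast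
  show "?X \<subseteq> carrier A" using homogeneous_idealD(3) by blast
  have "homogeneous_ideal K A AG {\<zero>\<^bsub>A\<^esub>}"
    by (rule homogeneous_idealI) (auto simp: prod_l_zero prod_r_zero component_zero)
  then show "\<zero>\<^bsub>A\<^esub> \<in> ?X" using I[of "{\<zero>\<^bsub>A\<^esub>}"] L(2) by blast
  show "x \<oplus>\<^bsub>A\<^esub> y \<in> ?X" if h: "x \<in> ?X" "y \<in> ?X" for x y
  proof -
    obtain V where V: "homogeneous_ideal K A AG V" "V \<subseteq> L" "x \<in> V" using split[OF h(1)] by blast
    obtain W where W: "homogeneous_ideal K A AG W" "W \<subseteq> L" "y \<in> W" using split[OF h(2)] by blast
    show ?thesis
    proof (rule I[OF homogeneous_ideal_sum[OF V(1) W(1)]])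
      show "{v \<oplus>\<^bsub>A\<^esub> w | v w. v \<in> V \<and> w \<in> W} \<subseteq> L" using V(2) W(2) L(1) by blast
      show "x \<oplus>\<^bsub>A\<^esub> y \<in> {v \<oplus>\<^bsub>A\<^esub> w | v w. v \<in> V \<and> w \<in> W}" using V(3) W(3) by blast
    qed
  qed
  fix x assume "x \<in> ?X"
  then obtain V where V: "homogeneous_ideal K A AG V" "V \<subseteq> L" "x \<in> V" using split by blast
  note Vd = homogeneous_idealD[OF V(1)]
  show "k \<odot>\<^bsub>A\<^esub> x \<in> ?X" if "k \<in> carrier K" for k using I[OF V(1,2) Vd(7)[OF that V(3)]] .
  show "a \<otimes>\<^bsub>A\<^esub> x \<in> ?X" if "a \<in> carrier A" for a using I[OF V(1,2) Vd(8)[OF that V(3)]] .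
  show "x \<otimes>\<^bsub>A\<^esub> a \<in> ?X" if "a \<in> carrier A" for a using I[OF V(1,2) Vd(9)[OF that V(3)]] .
  show "component A AG \<gamma> x \<in> ?X" for \<gamma> using I[OF V(1,2) Vd(10)[OF V(3)]] .
qed

locale orth_quotients =
  A: supported_lie_algebra K A AG + graded_quotients K A AG Q QG \<kappa>
  for K :: "('k, 'n) ring_scheme" and A :: "('k, 'a) module"
    and AG :: "'g::ab_group_add \<Rightarrow> 'a set" and Q :: "('k, 'q) module" and QG :: "'g \<Rightarrow> 'q set"
    and \<kappa> :: "'a \<Rightarrow> 'q" +
  assumes maximal: "maximal_graded_quotients K A AG Q QG \<kappa>"
    and finite_A: "finite_grading A AG"
begin

lemma faithful_eqI:
  assumes U: "U \<in> essential_ideals K A AG" and x: "x \<in> carrier Q" "y \<in> carrier Q"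
    and eq: "\<And>a. a \<in> U \<Longrightarrow> \<kappa> a \<otimes>\<^bsub>Q\<^esub> x = \<kappa> a \<otimes>\<^bsub>Q\<^esub> y"
  shows "x = y"
proof -
  have c: "\<kappa> a \<in> carrier Q" if "a \<in> U" for a
    using that A.homogeneous_idealD(3)[OF A.essential_ideal[OF U]] e_closed by blast
  have "x \<oplus>\<^bsub>Q\<^esub> \<ominus>\<^bsub>Q\<^esub> y = \<zero>\<^bsub>Q\<^esub>"
    by (rule faithful_carrier[OF _ U])
      (use x eq c in \<open>simp_all add: T.prod_r_distr T.prod_r_neg T.M.r_neg T.prod_closed\<close>)
  then show ?thesis using T.M.minus_equality[of x "\<ominus>\<^bsub>Q\<^esub> y"] x by simp
qed

lemma Q_separates:
  assumes D: "dense_orthogonal K D" and x: "x \<in> carrier Q" "y \<in> carrier Q"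
    and eq: "\<And>\<xi>. \<xi> \<in> D \<Longrightarrow> \<xi> \<odot>\<^bsub>Q\<^esub> x = \<xi> \<odot>\<^bsub>Q\<^esub> y"
  shows "x = y"
proof -
  note Dd = A.R.dense_orthogonalD[OF D]
  obtain U where U: "U \<in> essential_ideals K A AG" "\<forall>a\<in>U. \<kappa> a \<otimes>\<^bsub>Q\<^esub> x \<in> \<kappa> ` carrier A"
    using absorb_carrier[OF x(1)] by blast
  obtain V where V: "V \<in> essential_ideals K A AG" "\<forall>a\<in>V. \<kappa> a \<otimes>\<^bsub>Q\<^esub> y \<in> \<kappa> ` carrier A"
    using absorb_carrier[OF x(2)] by blast
  show ?thesis
  proof (rule faithful_eqI[OF A.essential_inter[OF U(1) V(1)] x])
    fix a assume a: "a \<in> U \<inter> V"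
    have ac: "\<kappa> a \<in> carrier Q"
      using a A.homogeneous_idealD(3)[OF A.essential_ideal[OF U(1)]] e_closed by blast
    obtain b where b: "b \<in> carrier A" "\<kappa> a \<otimes>\<^bsub>Q\<^esub> x = \<kappa> b" using U(2) a by blast
    obtain c where c: "c \<in> carrier A" "\<kappa> a \<otimes>\<^bsub>Q\<^esub> y = \<kappa> c" using V(2) a by blast
    have "b = c"
    proof (rule A.dense_eqI[OF D b(1) c(1)])
      fix \<xi> assume \<xi>: "\<xi> \<in> D"
      have "\<kappa> (\<xi> \<odot>\<^bsub>A\<^esub> b) = \<xi> \<odot>\<^bsub>Q\<^esub> (\<kappa> a \<otimes>\<^bsub>Q\<^esub> x)" using b Dd(2)[OF \<xi>] by (simp add: e_smult)
      also have "\<dots> = \<xi> \<odot>\<^bsub>Q\<^esub> (\<kappa> a \<otimes>\<^bsub>Q\<^esub> y)"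
        using eq[OF \<xi>] Dd(2)[OF \<xi>] ac x by (simp add: T.prod_r_smult[symmetric])
      also have "\<dots> = \<kappa> (\<xi> \<odot>\<^bsub>A\<^esub> c)" using c Dd(2)[OF \<xi>] by (simp add: e_smult)
      finally show "\<xi> \<odot>\<^bsub>A\<^esub> b = \<xi> \<odot>\<^bsub>A\<^esub> c" using e_inj b c Dd(2)[OF \<xi>] by simp
    qed
    then show "\<kappa> a \<otimes>\<^bsub>Q\<^esub> x = \<kappa> a \<otimes>\<^bsub>Q\<^esub> y" using b c by simp
  qed
qed

text \<open>
  The brackets with the prospective orthogonal sum are known on the largest ideal on which they stay in
  the algebra. That ideal is essential because the idempotents are dense, and maximality provides the
  element inducing the resulting partial derivation.
\<close>

lemma orth_sum_homogeneous:
  assumes D: "dense_orthogonal K D" and x: "\<And>\<xi>. \<xi> \<in> D \<Longrightarrow> x \<xi> \<in> QG \<gamma>"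
  shows "\<exists>y\<in>QG \<gamma>. \<forall>\<xi>\<in>D. \<xi> \<odot>\<^bsub>Q\<^esub> y = \<xi> \<odot>\<^bsub>Q\<^esub> x \<xi>"
proof -
  note Dd = A.R.dense_orthogonalD[OF D]
  have xc: "x \<xi> \<in> carrier Q" if "\<xi> \<in> D" for \<xi> using x[OF that] T.grade_closed by blast
  define sums where "sums a b \<longleftrightarrow> b \<in> carrier A \<and> (\<forall>\<xi>\<in>D. \<xi> \<odot>\<^bsub>Q\<^esub> \<kappa> b = \<xi> \<odot>\<^bsub>Q\<^esub> (\<kappa> a \<otimes>\<^bsub>Q\<^esub> x \<xi>))" for a b
  have sums_unique: "b = c" if b: "sums a b" and c: "sums a c" for a b c
  proof -
    have bc: "b \<in> carrier A" "c \<in> carrier A" using b c by (auto simp: sums_def)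
    have "\<kappa> b = \<kappa> c"
      by (rule Q_separates[OF D]) (use b c bc in \<open>auto simp: sums_def e_closed\<close>)
    then show ?thesis using e_inj bc by blast
  qed
  have sums_add: "sums (a \<oplus>\<^bsub>A\<^esub> a') (b \<oplus>\<^bsub>A\<^esub> b')"
    if "sums a b" "sums a' b'" "a \<in> carrier A" "a' \<in> carrier A" for a a' b b'
    using that xc Dd(2)
    by (simp add: sums_def e_add e_closed T.prod_l_distr T.smult_r_distr T.prod_closed)
  have sums_smult: "sums (k \<odot>\<^bsub>A\<^esub> a) (k \<odot>\<^bsub>A\<^esub> b)" if h: "sums a b" "a \<in> carrier A" "k \<in> carrier K" for a b k
  proof -
    have b: "b \<in> carrier A" using h(1) by (simp add: sums_def)
    have "\<xi> \<odot>\<^bsub>Q\<^esub> \<kappa> (k \<odot>\<^bsub>A\<^esub> b) = \<xi> \<odot>\<^bsub>Q\<^esub> (\<kappa> (k \<odot>\<^bsub>A\<^esub> a) \<otimes>\<^bsub>Q\<^esub> x \<xi>)" if \<xi>: "\<xi> \<in> D" for \<xi>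
    proof -
      have "\<xi> \<odot>\<^bsub>Q\<^esub> \<kappa> (k \<odot>\<^bsub>A\<^esub> b) = k \<odot>\<^bsub>Q\<^esub> (\<xi> \<odot>\<^bsub>Q\<^esub> \<kappa> b)"
        using b h(3) Dd(2)[OF \<xi>] by (simp add: e_smult e_closed T.smult_assoc1[symmetric] A.R.m_comm)
      also have "\<dots> = k \<odot>\<^bsub>Q\<^esub> (\<xi> \<odot>\<^bsub>Q\<^esub> (\<kappa> a \<otimes>\<^bsub>Q\<^esub> x \<xi>))" using h(1) \<xi> by (simp add: sums_def)
      also have "\<dots> = \<xi> \<odot>\<^bsub>Q\<^esub> (\<kappa> (k \<odot>\<^bsub>A\<^esub> a) \<otimes>\<^bsub>Q\<^esub> x \<xi>)"
        using h Dd(2)[OF \<xi>] xc[OF \<xi>]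
        by (simp add: e_smult e_closed T.prod_l_smult T.smult_assoc1[symmetric] A.R.m_comm T.prod_closed)
      finally show ?thesis .
    qed
    then show ?thesis using b h(3) by (simp add: sums_def)
  qed
  have sums_prod: "sums (a \<otimes>\<^bsub>A\<^esub> a') (b \<otimes>\<^bsub>A\<^esub> a' \<oplus>\<^bsub>A\<^esub> a \<otimes>\<^bsub>A\<^esub> b')"
    if h: "sums a b" "sums a' b'" "a \<in> carrier A" "a' \<in> carrier A" for a a' b b'
  proof -
    have b: "b \<in> carrier A" "b' \<in> carrier A" using h by (auto simp: sums_def)
    have "\<xi> \<odot>\<^bsub>Q\<^esub> \<kappa> (b \<otimes>\<^bsub>A\<^esub> a' \<oplus>\<^bsub>A\<^esub> a \<otimes>\<^bsub>A\<^esub> b') = \<xi> \<odot>\<^bsub>Q\<^esub> (\<kappa> (a \<otimes>\<^bsub>A\<^esub> a') \<otimes>\<^bsub>Q\<^esub> x \<xi>)" if \<xi>: "\<xi> \<in> D" for \<xi>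
    proof -
      note c = e_closed[OF b(1)] e_closed[OF b(2)] e_closed[OF h(3)] e_closed[OF h(4)] xc[OF \<xi>] Dd(2)[OF \<xi>]
      have "\<xi> \<odot>\<^bsub>Q\<^esub> \<kappa> (b \<otimes>\<^bsub>A\<^esub> a' \<oplus>\<^bsub>A\<^esub> a \<otimes>\<^bsub>A\<^esub> b')
          = (\<xi> \<odot>\<^bsub>Q\<^esub> \<kappa> b) \<otimes>\<^bsub>Q\<^esub> \<kappa> a' \<oplus>\<^bsub>Q\<^esub> \<kappa> a \<otimes>\<^bsub>Q\<^esub> (\<xi> \<odot>\<^bsub>Q\<^esub> \<kappa> b')"
        using b h(3,4) c by (simp add: e_add e_prod A.prod_closed T.prod_closed T.smult_r_distr
            T.prod_l_smult T.prod_r_smult)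
      also have "\<dots> = (\<xi> \<odot>\<^bsub>Q\<^esub> (\<kappa> a \<otimes>\<^bsub>Q\<^esub> x \<xi>)) \<otimes>\<^bsub>Q\<^esub> \<kappa> a' \<oplus>\<^bsub>Q\<^esub> \<kappa> a \<otimes>\<^bsub>Q\<^esub> (\<xi> \<odot>\<^bsub>Q\<^esub> (\<kappa> a' \<otimes>\<^bsub>Q\<^esub> x \<xi>))"
        using h(1,2) \<xi> by (simp add: sums_def)
      also have "\<dots> = \<xi> \<odot>\<^bsub>Q\<^esub> ((\<kappa> a \<otimes>\<^bsub>Q\<^esub> x \<xi>) \<otimes>\<^bsub>Q\<^esub> \<kappa> a' \<oplus>\<^bsub>Q\<^esub> \<kappa> a \<otimes>\<^bsub>Q\<^esub> (\<kappa> a' \<otimes>\<^bsub>Q\<^esub> x \<xi>))"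
        using c by (simp add: T.smult_r_distr T.prod_closed T.prod_l_smult T.prod_r_smult)
      also have "\<dots> = \<xi> \<odot>\<^bsub>Q\<^esub> (\<kappa> (a \<otimes>\<^bsub>A\<^esub> a') \<otimes>\<^bsub>Q\<^esub> x \<xi>)"
        using T.leibniz[OF c(3,4,5)] h(3,4) by (simp add: e_prod)
      finally show ?thesis .
    qed
    then show ?thesis using b h(3,4) by (simp add: sums_def A.prod_closed)
  qed
  have sums_zero: "sums \<zero>\<^bsub>A\<^esub> \<zero>\<^bsub>A\<^esub>" using xc Dd(2) by (simp add: sums_def e_zero T.prod_l_zero)
  define L where "L = {a \<in> carrier A. \<exists>b. sums a b}"
  define U where "U = \<Union>{V. homogeneous_ideal K A AG V \<and> V \<subseteq> L}"
  have UL: "U \<subseteq> L" by (auto simp: U_def)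
  have U: "homogeneous_ideal K A AG U"
    unfolding U_def
  proof (rule A.homogeneous_ideal_Union)
    show "x \<oplus>\<^bsub>A\<^esub> y \<in> L" if "x \<in> L" "y \<in> L" for x y
      using that sums_add[of x _ y] unfolding L_def by blast
    show "\<zero>\<^bsub>A\<^esub> \<in> L" using sums_zero unfolding L_def by blast
  qed
  note Ud = A.homogeneous_idealD[OF U]
  have Uess: "U \<in> essential_ideals K A AG"
  proof (rule A.essential_if_meets[OF U])
    fix V assume V: "homogeneous_ideal K A AG V" "V \<noteq> {\<zero>\<^bsub>A\<^esub>}"
    note Vd = A.homogeneous_idealD[OF V(1)]
    obtain v where v: "v \<in> V" "v \<noteq> \<zero>\<^bsub>A\<^esub>" using V(2) Vd(4) by blast
    then obtain \<xi> where \<xi>: "\<xi> \<in> D" "\<xi> \<odot>\<^bsub>A\<^esub> v \<noteq> \<zero>\<^bsub>A\<^esub>"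
      using A.dense_separates[OF D, of v] Vd(3) by blast
    note c = Dd(2)[OF \<xi>(1)]
    have fixV: "homogeneous_ideal K A AG {v \<in> V. \<xi> \<odot>\<^bsub>A\<^esub> v = v}" by (rule A.fixed_ideal[OF V(1) Dd(1)[OF \<xi>(1)]])
    have "\<xi> \<odot>\<^bsub>A\<^esub> (\<xi> \<odot>\<^bsub>A\<^esub> v) = \<xi> \<odot>\<^bsub>A\<^esub> v"
      using A.smult_assoc1[OF c c, of v] v Vd(3) Dd(3)[OF \<xi>(1)] by auto
    then have "{v \<in> V. \<xi> \<odot>\<^bsub>A\<^esub> v = v} \<noteq> {\<zero>\<^bsub>A\<^esub>}" using \<xi>(2) Vd(7)[OF c v(1)] by blast
    moreover obtain W where W: "W \<in> essential_ideals K A AG" "\<forall>a\<in>W. \<kappa> a \<otimes>\<^bsub>Q\<^esub> x \<xi> \<in> \<kappa> ` carrier A"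
      using absorb[OF x[OF \<xi>(1)]] by blast
    ultimately obtain w where w: "w \<in> W" "w \<in> {v \<in> V. \<xi> \<odot>\<^bsub>A\<^esub> v = v}" "w \<noteq> \<zero>\<^bsub>A\<^esub>"
      using A.essential_meets[OF W(1) fixV] by blast
    have "W \<inter> {v \<in> V. \<xi> \<odot>\<^bsub>A\<^esub> v = v} \<subseteq> L"
    proof
      fix a assume a: "a \<in> W \<inter> {v \<in> V. \<xi> \<odot>\<^bsub>A\<^esub> v = v}"
      then have ac: "a \<in> carrier A" and fa: "\<xi> \<odot>\<^bsub>A\<^esub> a = a" using Vd(3) by auto
      obtain b where b: "b \<in> carrier A" "\<kappa> a \<otimes>\<^bsub>Q\<^esub> x \<xi> = \<kappa> b" using W(2) a by blast
      have "\<chi> \<odot>\<^bsub>Q\<^esub> \<kappa> (\<xi> \<odot>\<^bsub>A\<^esub> b) = \<chi> \<odot>\<^bsub>Q\<^esub> (\<kappa> a \<otimes>\<^bsub>Q\<^esub> x \<chi>)" if \<chi>: "\<chi> \<in> D" for \<chi>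
      proof (cases "\<chi> = \<xi>")
        case True
        then show ?thesis
          using b c T.smult_assoc1[OF c c, of "\<kappa> b"] Dd(3)[OF \<xi>(1)] by (simp add: e_smult e_closed)
      next
        case False
        note c\<chi> = Dd(2)[OF \<chi>] and z = Dd(4)[OF \<chi> \<xi>(1) False]
        have "\<chi> \<odot>\<^bsub>Q\<^esub> \<kappa> (\<xi> \<odot>\<^bsub>A\<^esub> b) = (\<chi> \<otimes>\<^bsub>K\<^esub> \<xi>) \<odot>\<^bsub>Q\<^esub> \<kappa> b"
          using b(1) c c\<chi> by (simp add: e_smult e_closed T.smult_assoc1)
        then have 1: "\<chi> \<odot>\<^bsub>Q\<^esub> \<kappa> (\<xi> \<odot>\<^bsub>A\<^esub> b) = \<zero>\<^bsub>Q\<^esub>" using z b(1) by (simp add: e_closed)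
        have "\<chi> \<odot>\<^bsub>A\<^esub> a = (\<chi> \<otimes>\<^bsub>K\<^esub> \<xi>) \<odot>\<^bsub>A\<^esub> a" using A.smult_assoc1[OF c\<chi> c ac] fa by simp
        then have "\<chi> \<odot>\<^bsub>A\<^esub> a = \<zero>\<^bsub>A\<^esub>" using z ac by simp
        then have "\<chi> \<odot>\<^bsub>Q\<^esub> \<kappa> a = \<zero>\<^bsub>Q\<^esub>" using c\<chi> ac by (simp add: e_smult[symmetric] e_zero)
        then have "\<chi> \<odot>\<^bsub>Q\<^esub> (\<kappa> a \<otimes>\<^bsub>Q\<^esub> x \<chi>) = \<zero>\<^bsub>Q\<^esub>"
          using c\<chi> e_closed[OF ac] xc[OF \<chi>] by (simp add: T.prod_l_smult[symmetric] T.prod_l_zero)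
        then show ?thesis using 1 by simp
      qed
      then show "a \<in> L" using ac b(1) c by (auto simp: L_def sums_def)
    qed
    then have "W \<inter> {v \<in> V. \<xi> \<odot>\<^bsub>A\<^esub> v = v} \<subseteq> U"
      unfolding U_def using A.homogeneous_ideal_inter[OF A.essential_ideal[OF W(1)] fixV] by blast
    then show "\<exists>x\<in>U \<inter> V. x \<noteq> \<zero>\<^bsub>A\<^esub>" using w by blast
  qed
  have UA: "a \<in> carrier A" if "a \<in> U" for a using that Ud(3) by auto
  define d where "d = (\<lambda>a\<in>U. THE b. sums a b)"
  have d_eq: "d a = b" if "a \<in> U" "sums a b" for a b
    using that sums_unique by (auto simp: d_def)
  have d: "sums a (d a)" if a: "a \<in> U" for a
  proof -
    obtain b where "sums a b" using a UL by (auto simp: L_def)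
    then show ?thesis using d_eq[OF a] by simp
  qed
  have dA: "d a \<in> carrier A" if "a \<in> U" for a using d[OF that] by (simp add: sums_def)
  have "d \<in> partial_derivations K A AG U \<gamma>"
    unfolding partial_derivations_def
  proof (intro CollectI conjI ballI allI)
    show "d \<in> U \<rightarrow>\<^sub>E carrier A" using dA by (intro PiE_I) (auto simp: d_def)
    fix a b assume ab: "a \<in> U" "b \<in> U"
    show "d (a \<oplus>\<^bsub>A\<^esub> b) = d a \<oplus>\<^bsub>A\<^esub> d b"
      by (rule d_eq[OF Ud(5)[OF ab] sums_add]) (use ab d UA in auto)
    show "d (a \<otimes>\<^bsub>A\<^esub> b) = d a \<otimes>\<^bsub>A\<^esub> b \<oplus>\<^bsub>A\<^esub> a \<otimes>\<^bsub>A\<^esub> d b"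
      by (rule d_eq[OF Ud(8)[OF UA[OF ab(1)] ab(2)] sums_prod]) (use ab d UA in auto)
  next
    fix k a assume "k \<in> carrier K" "a \<in> U"
    then show "d (k \<odot>\<^bsub>A\<^esub> a) = k \<odot>\<^bsub>A\<^esub> d a" using d_eq[OF Ud(7)] sums_smult d UA by blast
  next
    fix \<alpha> show "d ` (U \<inter> AG \<alpha>) \<subseteq> AG (\<alpha> + \<gamma>)"
    proof safe
      fix a assume a: "a \<in> U" "a \<in> AG \<alpha>"
      let ?b = "component A AG (\<alpha> + \<gamma>) (d a)"
      have "d a = ?b"
      proof (rule A.dense_eqI[OF D dA[OF a(1)] A.component_closed[OF dA[OF a(1)]]])
        fix \<xi> assume \<xi>: "\<xi> \<in> D"
        have "\<kappa> (\<xi> \<odot>\<^bsub>A\<^esub> d a) = \<xi> \<odot>\<^bsub>Q\<^esub> (\<kappa> a \<otimes>\<^bsub>Q\<^esub> x \<xi>)"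
          using d[OF a(1)] \<xi> dA[OF a(1)] Dd(2)[OF \<xi>] by (simp add: sums_def e_smult)
        also have "\<dots> \<in> QG (\<alpha> + \<gamma>)"
          by (rule T.grade_smult[OF Dd(2)[OF \<xi>] T.grading_prod[OF e_grade[OF a(2)] x[OF \<xi>]]])
        finally have "\<xi> \<odot>\<^bsub>A\<^esub> d a \<in> AG (\<alpha> + \<gamma>)" using e_grade_iff dA[OF a(1)] Dd(2)[OF \<xi>] by simp
        then show "\<xi> \<odot>\<^bsub>A\<^esub> d a = \<xi> \<odot>\<^bsub>A\<^esub> ?b"
          using A.component_homogeneous[of "\<xi> \<odot>\<^bsub>A\<^esub> d a" "\<alpha> + \<gamma>" "\<alpha> + \<gamma>"] A.component_smult Dd(2)[OF \<xi>]
            dA[OF a(1)] by simp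
      qed
      then show "d a \<in> AG (\<alpha> + \<gamma>)" using A.component_in[OF dA[OF a(1)], of "\<alpha> + \<gamma>"] by simp
    qed
  qed
  with maximal Uess have "\<exists>y\<in>QG \<gamma>. \<forall>a\<in>U. \<kappa> a \<otimes>\<^bsub>Q\<^esub> y = \<kappa> (d a)" by (simp add: maximal_graded_quotients_def)
  then obtain y where y: "y \<in> QG \<gamma>" "\<And>a. a \<in> U \<Longrightarrow> \<kappa> a \<otimes>\<^bsub>Q\<^esub> y = \<kappa> (d a)" by blast
  have "\<xi> \<odot>\<^bsub>Q\<^esub> y = \<xi> \<odot>\<^bsub>Q\<^esub> x \<xi>" if \<xi>: "\<xi> \<in> D" for \<xi>
  proof (rule faithful_eqI[OF Uess])
    show "\<xi> \<odot>\<^bsub>Q\<^esub> y \<in> carrier Q" "\<xi> \<odot>\<^bsub>Q\<^esub> x \<xi> \<in> carrier Q"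
      using Dd(2)[OF \<xi>] T.grade_closed[OF y(1)] xc[OF \<xi>] by auto
    fix a assume a: "a \<in> U"
    then show "\<kappa> a \<otimes>\<^bsub>Q\<^esub> (\<xi> \<odot>\<^bsub>Q\<^esub> y) = \<kappa> a \<otimes>\<^bsub>Q\<^esub> (\<xi> \<odot>\<^bsub>Q\<^esub> x \<xi>)"
      using d[OF a] \<xi> y(2)[OF a] Dd(2)[OF \<xi>] T.grade_closed[OF y(1)] xc[OF \<xi>] e_closed[OF UA[OF a]]
      by (simp add: T.prod_r_smult sums_def)
  qed
  then show ?thesis using y(1) by blast
qed

lemma finite_QG: "finite {\<gamma>. QG \<gamma> \<noteq> {\<zero>\<^bsub>Q\<^esub>}}"
proof -
  let ?S = "{\<gamma>. AG \<gamma> \<noteq> {\<zero>\<^bsub>A\<^esub>}}"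
  have S: "finite ?S" using finite_A by (simp add: finite_grading_def)
  have "{\<gamma>. QG \<gamma> \<noteq> {\<zero>\<^bsub>Q\<^esub>}} \<subseteq> (\<lambda>(\<alpha>, \<beta>). \<alpha> - \<beta>) ` (?S \<times> ?S)"
  proof
    fix \<gamma> assume "\<gamma> \<in> {\<gamma>. QG \<gamma> \<noteq> {\<zero>\<^bsub>Q\<^esub>}}"
    then obtain q where q: "q \<in> QG \<gamma>" "q \<noteq> \<zero>\<^bsub>Q\<^esub>" using T.grade_zero[of \<gamma>] by blast
    obtain U where U: "U \<in> essential_ideals K A AG" "\<forall>a\<in>U. \<kappa> a \<otimes>\<^bsub>Q\<^esub> q \<in> \<kappa> ` carrier A"
      using absorb[OF q(1)] by blast
    note Ud = A.homogeneous_idealD[OF A.essential_ideal[OF U(1)]]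
    have qc: "q \<in> carrier Q" using q(1) T.grade_closed by blast
    have "\<exists>a \<delta>. a \<in> U \<and> a \<in> AG \<delta> \<and> \<kappa> a \<otimes>\<^bsub>Q\<^esub> q \<noteq> \<zero>\<^bsub>Q\<^esub>"
    proof (rule ccontr)
      assume none: "\<not> (\<exists>a \<delta>. a \<in> U \<and> a \<in> AG \<delta> \<and> \<kappa> a \<otimes>\<^bsub>Q\<^esub> q \<noteq> \<zero>\<^bsub>Q\<^esub>)"
      have "\<kappa> a \<otimes>\<^bsub>Q\<^esub> q = \<zero>\<^bsub>Q\<^esub>" if a: "a \<in> U" for a
      proof -
        have ac: "a \<in> carrier A" using a Ud(3) by blast
        show ?thesis using ac
        proof (rule A.component_induct)
          show "\<kappa> (component A AG \<delta> a) \<otimes>\<^bsub>Q\<^esub> q = \<zero>\<^bsub>Q\<^esub>" for \<delta>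
            using none Ud(10)[OF a] A.component_in[OF ac] by blast
        qed (use qc in \<open>simp_all add: e_zero e_add e_closed T.prod_l_zero T.prod_l_distr\<close>)
      qed
      then show False using faithful_carrier[OF qc U(1)] q(2) by blast
    qed
    then obtain a \<delta> where a: "a \<in> U" "a \<in> AG \<delta>" "\<kappa> a \<otimes>\<^bsub>Q\<^esub> q \<noteq> \<zero>\<^bsub>Q\<^esub>" by blast
    obtain b where b: "b \<in> carrier A" "\<kappa> a \<otimes>\<^bsub>Q\<^esub> q = \<kappa> b" using U(2) a(1) by blast
    have "\<kappa> b \<in> QG (\<delta> + \<gamma>)" using T.grading_prod[OF e_grade[OF a(2)] q(1)] b by simp
    then have "b \<in> AG (\<delta> + \<gamma>)" using e_grade_iff b by blast
    moreover have "b \<noteq> \<zero>\<^bsub>A\<^esub>" using a(3) b e_zero by auto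
    moreover have "a \<noteq> \<zero>\<^bsub>A\<^esub>" using a(3) e_zero qc by (auto simp: T.prod_l_zero)
    ultimately have "\<delta> + \<gamma> \<in> ?S" "\<delta> \<in> ?S" using a(2) by blast+
    then show "\<gamma> \<in> (\<lambda>(\<alpha>, \<beta>). \<alpha> - \<beta>) ` (?S \<times> ?S)" by (intro image_eqI[of _ _ "(\<delta> + \<gamma>, \<delta>)"]) auto
  qed
  then show ?thesis using S finite_subset by blast
qed

lemma orth_sum_exists:
  assumes D: "dense_orthogonal K D" and x: "\<And>\<xi>. \<xi> \<in> D \<Longrightarrow> x \<xi> \<in> carrier Q"
  shows "\<exists>s\<in>carrier Q. orth_sum Q D x s"
proof -
  note Dd = A.R.dense_orthogonalD[OF D]
  let ?S = "{\<gamma>. QG \<gamma> \<noteq> {\<zero>\<^bsub>Q\<^esub>}}"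
  have "\<exists>y\<in>QG \<gamma>. \<forall>\<xi>\<in>D. \<xi> \<odot>\<^bsub>Q\<^esub> y = \<xi> \<odot>\<^bsub>Q\<^esub> component Q QG \<gamma> (x \<xi>)" for \<gamma>
    by (rule orth_sum_homogeneous[OF D]) (use x T.component_in in blast)
  then obtain y where y: "\<And>\<gamma>. y \<gamma> \<in> QG \<gamma>"
    "\<And>\<gamma> \<xi>. \<xi> \<in> D \<Longrightarrow> \<xi> \<odot>\<^bsub>Q\<^esub> y \<gamma> = \<xi> \<odot>\<^bsub>Q\<^esub> component Q QG \<gamma> (x \<xi>)" by metis
  have yc: "y \<gamma> \<in> carrier Q" for \<gamma> using y(1) T.grade_closed by blast
  have "\<xi> \<odot>\<^bsub>Q\<^esub> finsum Q y ?S = \<xi> \<odot>\<^bsub>Q\<^esub> x \<xi>" if \<xi>: "\<xi> \<in> D" for \<xi>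
  proof -
    have cmp: "component Q QG \<gamma> (x \<xi>) \<in> carrier Q" for \<gamma> using x[OF \<xi>] T.component_closed by blast
    have "component Q QG \<gamma> (x \<xi>) \<in> {\<zero>\<^bsub>Q\<^esub>}" if "QG \<gamma> = {\<zero>\<^bsub>Q\<^esub>}" for \<gamma>
      using T.component_in[OF x[OF \<xi>], of \<gamma>] that by simp
    then have supp: "{\<gamma>. component Q QG \<gamma> (x \<xi>) \<noteq> \<zero>\<^bsub>Q\<^esub>} \<subseteq> ?S" by blast
    have xs: "x \<xi> = finsum Q (\<lambda>\<gamma>. component Q QG \<gamma> (x \<xi>)) ?S"
      using T.M.fin_decomposition_superset[of "\<lambda>\<gamma>. component Q QG \<gamma> (x \<xi>)" QG ?S "x \<xi>",
          OF T.component_in[OF x[OF \<xi>]] _ finite_QG supp] T.component_decomposition[OF x[OF \<xi>]]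
        T.grade_closed by blast
    have "\<xi> \<odot>\<^bsub>Q\<^esub> finsum Q y ?S = finsum Q (\<lambda>\<gamma>. \<xi> \<odot>\<^bsub>Q\<^esub> y \<gamma>) ?S"
      by (rule T.finsum_smult_ldistr[OF finite_QG Dd(2)[OF \<xi>]]) (use yc in auto)
    also have "\<dots> = finsum Q (\<lambda>\<gamma>. \<xi> \<odot>\<^bsub>Q\<^esub> component Q QG \<gamma> (x \<xi>)) ?S"
      by (rule T.M.finsum_cong') (use y(2)[OF \<xi>] cmp Dd(2)[OF \<xi>] in auto)
    also have "\<dots> = \<xi> \<odot>\<^bsub>Q\<^esub> finsum Q (\<lambda>\<gamma>. component Q QG \<gamma> (x \<xi>)) ?S"
      by (rule T.finsum_smult_ldistr[OF finite_QG Dd(2)[OF \<xi>], symmetric]) (use cmp in auto)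
    finally show ?thesis using xs by simp
  qed
  moreover have "finsum Q y ?S \<in> carrier Q" using yc by (intro T.M.finsum_closed) auto
  ultimately show ?thesis by (auto simp: orth_sum_def)
qed

definition orth_closure :: "'q set \<Rightarrow> 'q set" where
  "orth_closure T = {u \<in> carrier Q. \<exists>D x. dense_orthogonal K D \<and> x \<in> D \<rightarrow> T \<and> orth_sum Q D x u}"

lemma orth_closureI:
  assumes "u \<in> carrier Q" "dense_orthogonal K D" "\<And>\<xi>. \<xi> \<in> D \<Longrightarrow> x \<xi> \<in> T"
    "\<And>\<xi>. \<xi> \<in> D \<Longrightarrow> \<xi> \<odot>\<^bsub>Q\<^esub> u = \<xi> \<odot>\<^bsub>Q\<^esub> x \<xi>"
  shows "u \<in> orth_closure T"
  using assms unfolding orth_closure_def orth_sum_def by blast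

lemma orth_closureE:
  assumes "u \<in> orth_closure T"
  obtains D x where "u \<in> carrier Q" "dense_orthogonal K D" "\<And>\<xi>. \<xi> \<in> D \<Longrightarrow> x \<xi> \<in> T"
    "\<And>\<xi>. \<xi> \<in> D \<Longrightarrow> \<xi> \<odot>\<^bsub>Q\<^esub> u = \<xi> \<odot>\<^bsub>Q\<^esub> x \<xi>"
  using assms unfolding orth_closure_def orth_sum_def by blast

lemma orth_closure_closed: "orth_closure T \<subseteq> carrier Q"
  by (auto simp: orth_closure_def)

lemma orth_closure_incl:
  assumes "T \<subseteq> carrier Q"
  shows "T \<subseteq> orth_closure T"
proof
  fix u assume "u \<in> T"
  then show "u \<in> orth_closure T"
    using assms by (intro orth_closureI[OF _ A.R.dense_orthogonal_one, of _ "\<lambda>_. u"]) auto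
qed

lemma orth_closure_map:
  assumes u: "u \<in> orth_closure T" and T: "T \<subseteq> carrier Q"
    and h: "\<And>u. u \<in> carrier Q \<Longrightarrow> h u \<in> carrier Q" "\<And>x. x \<in> T \<Longrightarrow> h x \<in> T'"
    and loc: "\<And>\<xi> u v. \<lbrakk>\<xi> \<in> carrier K; u \<in> carrier Q; v \<in> carrier Q; \<xi> \<odot>\<^bsub>Q\<^esub> u = \<xi> \<odot>\<^bsub>Q\<^esub> v\<rbrakk>
      \<Longrightarrow> \<xi> \<odot>\<^bsub>Q\<^esub> h u = \<xi> \<odot>\<^bsub>Q\<^esub> h v"
  shows "h u \<in> orth_closure T'"
  using u
proof (rule orth_closureE)
  fix D x
  assume D: "u \<in> carrier Q" "dense_orthogonal K D" "\<And>\<xi>. \<xi> \<in> D \<Longrightarrow> x \<xi> \<in> T"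
    "\<And>\<xi>. \<xi> \<in> D \<Longrightarrow> \<xi> \<odot>\<^bsub>Q\<^esub> u = \<xi> \<odot>\<^bsub>Q\<^esub> x \<xi>"
  show ?thesis
  proof (rule orth_closureI[OF h(1)[OF D(1)] D(2)])
    show "h (x \<xi>) \<in> T'" if "\<xi> \<in> D" for \<xi> using h(2) D(3)[OF that] .
    show "\<xi> \<odot>\<^bsub>Q\<^esub> h u = \<xi> \<odot>\<^bsub>Q\<^esub> h (x \<xi>)" if "\<xi> \<in> D" for \<xi>
      by (rule loc) (use that D T A.R.dense_orthogonalD(2)[OF D(2)] in auto)
  qed
qed

lemma orth_closure_map2:
  assumes u: "u \<in> orth_closure T" and v: "v \<in> orth_closure T'"
    and T: "T \<subseteq> carrier Q" "T' \<subseteq> carrier Q"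
    and h: "\<And>u v. \<lbrakk>u \<in> carrier Q; v \<in> carrier Q\<rbrakk> \<Longrightarrow> h u v \<in> carrier Q"
      "\<And>x y. \<lbrakk>x \<in> T; y \<in> T'\<rbrakk> \<Longrightarrow> h x y \<in> T''"
    and loc: "\<And>\<xi> u v u' v'. \<lbrakk>\<xi> \<in> carrier K; u \<in> carrier Q; v \<in> carrier Q; u' \<in> carrier Q; v' \<in> carrier Q;
      \<xi> \<odot>\<^bsub>Q\<^esub> u = \<xi> \<odot>\<^bsub>Q\<^esub> u'; \<xi> \<odot>\<^bsub>Q\<^esub> v = \<xi> \<odot>\<^bsub>Q\<^esub> v'\<rbrakk> \<Longrightarrow> \<xi> \<odot>\<^bsub>Q\<^esub> h u v = \<xi> \<odot>\<^bsub>Q\<^esub> h u' v'"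
  shows "h u v \<in> orth_closure T''"
  using u
proof (rule orth_closureE)
  fix D x
  assume D: "u \<in> carrier Q" "dense_orthogonal K D" "\<And>\<xi>. \<xi> \<in> D \<Longrightarrow> x \<xi> \<in> T"
    "\<And>\<xi>. \<xi> \<in> D \<Longrightarrow> \<xi> \<odot>\<^bsub>Q\<^esub> u = \<xi> \<odot>\<^bsub>Q\<^esub> x \<xi>"
  from v show ?thesis
  proof (rule orth_closureE)
    fix E y
    assume E: "v \<in> carrier Q" "dense_orthogonal K E" "\<And>\<xi>. \<xi> \<in> E \<Longrightarrow> y \<xi> \<in> T'"
      "\<And>\<xi>. \<xi> \<in> E \<Longrightarrow> \<xi> \<odot>\<^bsub>Q\<^esub> v = \<xi> \<odot>\<^bsub>Q\<^esub> y \<xi>"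
    let ?F = "{\<xi> \<otimes>\<^bsub>K\<^esub> \<chi> | \<xi> \<chi>. \<xi> \<in> D \<and> \<chi> \<in> E}"
    have "\<forall>\<eta>\<in>?F. \<exists>p. fst p \<in> D \<and> snd p \<in> E \<and> \<eta> = fst p \<otimes>\<^bsub>K\<^esub> snd p" by auto
    from bchoice[OF this]
    obtain p where p: "\<forall>\<eta>\<in>?F. fst (p \<eta>) \<in> D \<and> snd (p \<eta>) \<in> E \<and> \<eta> = fst (p \<eta>) \<otimes>\<^bsub>K\<^esub> snd (p \<eta>)" ..
    show ?thesis
    proof (rule orth_closureI[OF h(1)[OF D(1) E(1)] A.R.dense_orthogonal_mult[OF D(2) E(2)],
          of "\<lambda>\<eta>. h (x (fst (p \<eta>))) (y (snd (p \<eta>)))"])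
      fix \<eta> assume "\<eta> \<in> ?F"
      from bspec[OF p this]
      have \<eta>: "fst (p \<eta>) \<in> D" "snd (p \<eta>) \<in> E" "\<eta> = fst (p \<eta>) \<otimes>\<^bsub>K\<^esub> snd (p \<eta>)" by simp_all
      show "h (x (fst (p \<eta>))) (y (snd (p \<eta>))) \<in> T''" using h(2) D(3) E(3) \<eta> by blast
      note c = A.R.dense_orthogonalD(2)[OF D(2) \<eta>(1)] A.R.dense_orthogonalD(2)[OF E(2) \<eta>(2)]
      have xy: "x (fst (p \<eta>)) \<in> carrier Q" "y (snd (p \<eta>)) \<in> carrier Q" using D(3) E(3) \<eta> T by blast+
      have "\<eta> \<odot>\<^bsub>Q\<^esub> u = \<eta> \<odot>\<^bsub>Q\<^esub> x (fst (p \<eta>))"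
      proof -
        have "\<eta> \<odot>\<^bsub>Q\<^esub> w = snd (p \<eta>) \<odot>\<^bsub>Q\<^esub> (fst (p \<eta>) \<odot>\<^bsub>Q\<^esub> w)" if "w \<in> carrier Q" for w
          using that c T.smult_assoc1[of "snd (p \<eta>)" "fst (p \<eta>)" w] A.R.m_comm[of "fst (p \<eta>)" "snd (p \<eta>)"]
          by (subst \<eta>(3)) simp
        then show ?thesis using D(1) D(4)[OF \<eta>(1)] xy by simp
      qed
      moreover have "\<eta> \<odot>\<^bsub>Q\<^esub> v = \<eta> \<odot>\<^bsub>Q\<^esub> y (snd (p \<eta>))"
      proof -
        have "\<eta> \<odot>\<^bsub>Q\<^esub> w = fst (p \<eta>) \<odot>\<^bsub>Q\<^esub> (snd (p \<eta>) \<odot>\<^bsub>Q\<^esub> w)" if "w \<in> carrier Q" for w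
          using that c by (subst \<eta>(3)) (simp add: T.smult_assoc1)
        then show ?thesis using E(1) E(4)[OF \<eta>(2)] xy by simp
      qed
      moreover have "\<eta> \<in> carrier K" using c by (subst \<eta>(3)) simp
      ultimately show "\<eta> \<odot>\<^bsub>Q\<^esub> h u v = \<eta> \<odot>\<^bsub>Q\<^esub> h (x (fst (p \<eta>))) (y (snd (p \<eta>)))"
        using loc D(1) E(1) xy by blast
    qed
  qed
qed

lemma orth_closure_complete:
  assumes T: "T \<subseteq> carrier Q" and D: "dense_orthogonal K D" and x: "\<And>\<xi>. \<xi> \<in> D \<Longrightarrow> x \<xi> \<in> orth_closure T"
  shows "\<exists>s\<in>orth_closure T. orth_sum Q D x s"
proof -
  note Dd = A.R.dense_orthogonalD[OF D]
  have xc: "x \<xi> \<in> carrier Q" if "\<xi> \<in> D" for \<xi> using x[OF that] orth_closure_closed by blast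
  have "\<exists>s\<in>carrier Q. orth_sum Q D x s" by (rule orth_sum_exists[OF D xc])
  then obtain s where s: "s \<in> carrier Q" "orth_sum Q D x s" by (rule bexE)
  have "\<forall>\<xi>\<in>D. \<exists>p. dense_orthogonal K (fst p) \<and> snd p \<in> fst p \<rightarrow> T \<and> orth_sum Q (fst p) (snd p) (x \<xi>)"
  proof
    fix \<xi> assume "\<xi> \<in> D"
    from x[OF this] obtain E y where "dense_orthogonal K E" "y \<in> E \<rightarrow> T" "orth_sum Q E y (x \<xi>)"
      unfolding orth_closure_def by (elim CollectE conjE exE)
    then show "\<exists>p. dense_orthogonal K (fst p) \<and> snd p \<in> fst p \<rightarrow> T \<and> orth_sum Q (fst p) (snd p) (x \<xi>)"
      by (intro exI[of _ "(E, y)"]) simp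
  qed
  from bchoice[OF this]
  obtain p where "\<forall>\<xi>\<in>D. dense_orthogonal K (fst (p \<xi>)) \<and> snd (p \<xi>) \<in> fst (p \<xi>) \<rightarrow> T \<and>
      orth_sum Q (fst (p \<xi>)) (snd (p \<xi>)) (x \<xi>)" ..
  note p = bspec[OF this]
  let ?F = "{\<xi> \<otimes>\<^bsub>K\<^esub> \<chi> | \<xi> \<chi>. \<xi> \<in> D \<and> \<chi> \<in> fst (p \<xi>)}"
  have "\<forall>\<eta>\<in>?F. \<exists>r. fst r \<in> D \<and> snd r \<in> fst (p (fst r)) \<and> \<eta> = fst r \<otimes>\<^bsub>K\<^esub> snd r" by auto
  from bchoice[OF this]
  obtain r where r: "\<forall>\<eta>\<in>?F. fst (r \<eta>) \<in> D \<and> snd (r \<eta>) \<in> fst (p (fst (r \<eta>))) \<and>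
      \<eta> = fst (r \<eta>) \<otimes>\<^bsub>K\<^esub> snd (r \<eta>)" ..
  have "s \<in> orth_closure T"
  proof (rule orth_closureI[OF s(1), of ?F "\<lambda>\<eta>. snd (p (fst (r \<eta>))) (snd (r \<eta>))"])
    show "dense_orthogonal K ?F" by (rule A.R.dense_orthogonal_refine[OF D]) (use p in blast)
    fix \<eta> assume "\<eta> \<in> ?F"
    from bspec[OF r this]
    have \<eta>: "fst (r \<eta>) \<in> D" "snd (r \<eta>) \<in> fst (p (fst (r \<eta>)))" "\<eta> = fst (r \<eta>) \<otimes>\<^bsub>K\<^esub> snd (r \<eta>)"
      by simp_all
    let ?y = "snd (p (fst (r \<eta>))) (snd (r \<eta>))"
    show y: "?y \<in> T" using p[OF \<eta>(1)] \<eta>(2) by blast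
    have yc: "?y \<in> carrier Q" using y T by blast
    have c: "fst (r \<eta>) \<in> carrier K" "snd (r \<eta>) \<in> carrier K"
      using Dd(2)[OF \<eta>(1)] A.R.dense_orthogonalD(2)[OF conjunct1[OF p[OF \<eta>(1)]] \<eta>(2)] by blast+
    have "\<eta> \<odot>\<^bsub>Q\<^esub> s = snd (r \<eta>) \<odot>\<^bsub>Q\<^esub> (fst (r \<eta>) \<odot>\<^bsub>Q\<^esub> s)"
      using s(1) c T.smult_assoc1[of "snd (r \<eta>)" "fst (r \<eta>)" s] A.R.m_comm[of "fst (r \<eta>)" "snd (r \<eta>)"]
      by (subst \<eta>(3)) simp
    also have "\<dots> = snd (r \<eta>) \<odot>\<^bsub>Q\<^esub> (fst (r \<eta>) \<odot>\<^bsub>Q\<^esub> x (fst (r \<eta>)))"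
      using s(2) \<eta>(1) by (simp add: orth_sum_def)
    also have "\<dots> = fst (r \<eta>) \<odot>\<^bsub>Q\<^esub> (snd (r \<eta>) \<odot>\<^bsub>Q\<^esub> x (fst (r \<eta>)))"
      using xc[OF \<eta>(1)] c by (simp add: A.R.m_comm T.smult_assoc1[symmetric])
    also have "\<dots> = fst (r \<eta>) \<odot>\<^bsub>Q\<^esub> (snd (r \<eta>) \<odot>\<^bsub>Q\<^esub> ?y)"
      using p[OF \<eta>(1)] \<eta>(2) by (simp add: orth_sum_def)
    also have "\<dots> = \<eta> \<odot>\<^bsub>Q\<^esub> ?y" using yc c by (subst \<eta>(3)) (simp add: T.smult_assoc1)
    finally show "\<eta> \<odot>\<^bsub>Q\<^esub> s = \<eta> \<odot>\<^bsub>Q\<^esub> ?y" .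
  qed
  then show ?thesis by (rule bexI[rotated]) (rule s(2))
qed

end

section \<open>Subalgebras and homomorphic images\<close>

lemma (in graded_lie_algebra) graded_lie_subalgebra:
  assumes X: "submodule X K A" "\<And>x \<gamma>. x \<in> X \<Longrightarrow> component A AG \<gamma> x \<in> X"
    and prod: "\<And>x y. \<lbrakk>x \<in> X; y \<in> X\<rbrakk> \<Longrightarrow> x \<otimes>\<^bsub>A\<^esub> y \<in> X"
    and N: "carrier N = X" "\<zero>\<^bsub>N\<^esub> = \<zero>\<^bsub>A\<^esub>" "\<And>x y. \<lbrakk>x \<in> X; y \<in> X\<rbrakk> \<Longrightarrow> x \<oplus>\<^bsub>N\<^esub> y = x \<oplus>\<^bsub>A\<^esub> y"
      "\<And>x y. \<lbrakk>x \<in> X; y \<in> X\<rbrakk> \<Longrightarrow> x \<otimes>\<^bsub>N\<^esub> y = x \<otimes>\<^bsub>A\<^esub> y" "\<And>k x. \<lbrakk>k \<in> carrier K; x \<in> X\<rbrakk> \<Longrightarrow> k \<odot>\<^bsub>N\<^esub> x = k \<odot>\<^bsub>A\<^esub> x"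
    and NG: "\<And>\<gamma>. NG \<gamma> = X \<inter> AG \<gamma>"
  shows "graded_lie_algebra K N NG" "\<And>x \<gamma>. x \<in> X \<Longrightarrow> component N NG \<gamma> x = component A AG \<gamma> x"
proof -
  have NG': "NG = (\<lambda>\<gamma>. X \<inter> AG \<gamma>)" using NG by blast
  have sub: "subgroup X (add_monoid A)" using X(1) by (rule submodule.axioms(1))
  note Xd = M.subgroup_add_monoidD[OF sub]
  have XA: "x \<in> carrier A" if "x \<in> X" for x using Xd(1) that by auto
  have sm: "k \<odot>\<^bsub>A\<^esub> x \<in> X" if "k \<in> carrier K" "x \<in> X" for k x
    using submodule.smult_closed[OF X(1)] that .
  have hom: "homogeneous A AG X" by (rule homogeneousI[OF sub X(2)])
  note g = graded_group_restrict[OF sub hom N(1,2,3)]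
  show "\<And>x \<gamma>. x \<in> X \<Longrightarrow> component N NG \<gamma> x = component A AG \<gamma> x" unfolding NG' by (rule g(2))
  have "graded_group N NG" unfolding NG' by (rule g(1))
  then interpret gN: graded_group N NG .
  interpret N: module K N
    by (rule moduleI[OF R.is_cring gN.abelian_group_axioms])
      (use N Xd(3) XA sm in \<open>simp_all add: smult_l_distr smult_r_distr smult_assoc1\<close>)
  show "graded_lie_algebra K N NG"
  proof (intro graded_lie_algebra.intro graded_lie_algebra_axioms.intro graded_algebra.intro
      graded_algebra_axioms.intro nonassoc_algebra.intro nonassoc_algebra_axioms.intro N.module_axioms)
    show "submodule (NG \<gamma>) K N" for \<gamma>
    proof (rule N.submoduleI)
      show "NG \<gamma> \<subseteq> carrier N" "\<zero>\<^bsub>N\<^esub> \<in> NG \<gamma>" using gN.grade_closed gN.grade_zero by auto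
      show "\<ominus>\<^bsub>N\<^esub> a \<in> NG \<gamma>" if "a \<in> NG \<gamma>" for a using gN.grade_neg[OF that] .
      show "a \<oplus>\<^bsub>N\<^esub> b \<in> NG \<gamma>" if "a \<in> NG \<gamma>" "b \<in> NG \<gamma>" for a b using gN.grade_add[OF that] .
      show "k \<odot>\<^bsub>N\<^esub> x \<in> NG \<gamma>" if "k \<in> carrier K" "x \<in> NG \<gamma>" for k x
        using that sm grade_smult unfolding NG by (simp add: N)
    qed
    show "internal_direct_sum N (carrier N) NG" by (rule gN.direct)
    show "x \<otimes>\<^bsub>N\<^esub> y \<in> NG (\<alpha> + \<beta>)" if "x \<in> NG \<alpha>" "y \<in> NG \<beta>" for x y \<alpha> \<beta>
      using that prod grading_prod unfolding NG by (simp add: N)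
    show "x \<otimes>\<^bsub>N\<^esub> y \<otimes>\<^bsub>N\<^esub> z \<oplus>\<^bsub>N\<^esub> y \<otimes>\<^bsub>N\<^esub> z \<otimes>\<^bsub>N\<^esub> x \<oplus>\<^bsub>N\<^esub> z \<otimes>\<^bsub>N\<^esub> x \<otimes>\<^bsub>N\<^esub> y = \<zero>\<^bsub>N\<^esub>"
      if "x \<in> carrier N" "y \<in> carrier N" "z \<in> carrier N" for x y z
      using that jacobi[of x y z] XA prod Xd(3) by (simp add: N)
  qed (use XA prod Xd(3) sm in \<open>simp_all add: N prod_l_distr prod_r_distr prod_l_smult prod_r_smult
      alternating\<close>)
qed

locale graded_lie_image = graded_lie_algebra K A AG
  for K :: "('k, 'n) ring_scheme" and A :: "('k, 'a) module"
    and AG :: "'g::ab_group_add \<Rightarrow> 'a set" +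
  fixes \<pi> :: "'a \<Rightarrow> 'c" and C :: "('k, 'c) module" and CG :: "'g \<Rightarrow> 'c set"
  assumes image: "carrier C = \<pi> ` carrier A" "\<And>\<gamma>. CG \<gamma> = \<pi> ` AG \<gamma>" "\<zero>\<^bsub>C\<^esub> = \<pi> \<zero>\<^bsub>A\<^esub>"
    and image_add: "\<lbrakk>x \<in> carrier A; y \<in> carrier A\<rbrakk> \<Longrightarrow> \<pi> x \<oplus>\<^bsub>C\<^esub> \<pi> y = \<pi> (x \<oplus>\<^bsub>A\<^esub> y)"
    and image_prod: "\<lbrakk>x \<in> carrier A; y \<in> carrier A\<rbrakk> \<Longrightarrow> \<pi> x \<otimes>\<^bsub>C\<^esub> \<pi> y = \<pi> (x \<otimes>\<^bsub>A\<^esub> y)"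
    and image_smult: "\<lbrakk>k \<in> carrier K; x \<in> carrier A\<rbrakk> \<Longrightarrow> k \<odot>\<^bsub>C\<^esub> \<pi> x = \<pi> (k \<odot>\<^bsub>A\<^esub> x)"
    and kernel: "\<lbrakk>x \<in> carrier A; \<pi> x = \<zero>\<^bsub>C\<^esub>\<rbrakk> \<Longrightarrow> \<pi> (component A AG \<gamma> x) = \<zero>\<^bsub>C\<^esub>"
begin

lemma image_abelian_group: "abelian_group C"
proof (rule abelian_groupI)
  show "\<exists>y\<in>carrier C. y \<oplus>\<^bsub>C\<^esub> x = \<zero>\<^bsub>C\<^esub>" if x: "x \<in> carrier C" for x
  proof -
    obtain a where a: "a \<in> carrier A" "x = \<pi> a" using x image by auto
    then have "\<pi> (\<ominus>\<^bsub>A\<^esub> a) \<in> carrier C" "\<pi> (\<ominus>\<^bsub>A\<^esub> a) \<oplus>\<^bsub>C\<^esub> x = \<zero>\<^bsub>C\<^esub>"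
      using image by (auto simp: image_add M.l_neg)
    then show ?thesis by blast
  qed
qed (auto simp: image image_add M.a_ac)

sublocale C: abelian_group C by (rule image_abelian_group)

lemma image_neg: "a \<in> carrier A \<Longrightarrow> \<ominus>\<^bsub>C\<^esub> (\<pi> a) = \<pi> (\<ominus>\<^bsub>A\<^esub> a)"
  by (rule C.minus_equality) (auto simp: image image_add M.l_neg)

lemma image_component_cong:
  assumes "a \<in> carrier A" "b \<in> carrier A" "\<pi> a = \<pi> b"
  shows "\<pi> (component A AG \<gamma> a) = \<pi> (component A AG \<gamma> b)"
proof -
  have "\<pi> (a \<oplus>\<^bsub>A\<^esub> \<ominus>\<^bsub>A\<^esub> b) = \<pi> b \<oplus>\<^bsub>C\<^esub> \<ominus>\<^bsub>C\<^esub> (\<pi> b)"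
    using assms by (simp add: image_add[symmetric] image_neg)
  also have "\<dots> = \<zero>\<^bsub>C\<^esub>" using assms image(1) by (simp add: C.r_neg)
  finally have "\<pi> (component A AG \<gamma> (a \<oplus>\<^bsub>A\<^esub> \<ominus>\<^bsub>A\<^esub> b)) = \<zero>\<^bsub>C\<^esub>" using kernel assms by simp
  then have "\<pi> (component A AG \<gamma> a) \<oplus>\<^bsub>C\<^esub> \<ominus>\<^bsub>C\<^esub> (\<pi> (component A AG \<gamma> b)) = \<zero>\<^bsub>C\<^esub>"
    using assms by (simp add: component_add component_neg component_closed image_add image_neg)
  moreover have "\<pi> (component A AG \<gamma> a) \<in> carrier C" "\<pi> (component A AG \<gamma> b) \<in> carrier C"
    using component_closed assms image(1) by auto
  ultimately show ?thesis
    using C.minus_equality[of "\<pi> (component A AG \<gamma> a)" "\<ominus>\<^bsub>C\<^esub> (\<pi> (component A AG \<gamma> b))"] by simp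
qed

lemma image_subgroup: "subgroup S (add_monoid A) \<Longrightarrow> subgroup (\<pi> ` S) (add_monoid C)"
proof -
  assume S: "subgroup S (add_monoid A)"
  note Sd = M.subgroup_add_monoidD[OF S]
  have SA: "a \<in> carrier A" if "a \<in> S" for a using Sd(1) that by auto
  show ?thesis
  proof (rule C.subgroup_add_monoidI)
    show "\<pi> ` S \<subseteq> carrier C" "\<zero>\<^bsub>C\<^esub> \<in> \<pi> ` S" using SA Sd(2) image by auto
    show "x \<oplus>\<^bsub>C\<^esub> y \<in> \<pi> ` S" if h: "x \<in> \<pi> ` S" "y \<in> \<pi> ` S" for x y
    proof -
      obtain a where a: "a \<in> S" "x = \<pi> a" using h(1) by blast
      obtain b where b: "b \<in> S" "y = \<pi> b" using h(2) by blast
      show ?thesis using Sd(3)[OF a(1) b(1)] a b SA by (simp add: image_add)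
    qed
    show "\<ominus>\<^bsub>C\<^esub> x \<in> \<pi> ` S" if h: "x \<in> \<pi> ` S" for x
    proof -
      obtain a where a: "a \<in> S" "x = \<pi> a" using h by blast
      show ?thesis using Sd(4)[OF a(1)] a SA by (simp add: image_neg)
    qed
  qed
qed

lemma image_graded_group:
  shows "graded_group C CG" "a \<in> carrier A \<Longrightarrow> component C CG \<gamma> (\<pi> a) = \<pi> (component A AG \<gamma> a)"
proof -
  define r where "r x = (SOME a. a \<in> carrier A \<and> \<pi> a = x)" for x
  have r: "r x \<in> carrier A" "\<pi> (r x) = x" if "x \<in> carrier C" for x
  proof -
    have "\<exists>a. a \<in> carrier A \<and> \<pi> a = x" using that image(1) by auto
    from someI_ex[OF this] show "r x \<in> carrier A" "\<pi> (r x) = x" by (simp_all add: r_def)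
  qed
  define c where "c \<gamma> x = \<pi> (component A AG \<gamma> (r x))" for \<gamma> x
  have c: "c \<gamma> (\<pi> a) = \<pi> (component A AG \<gamma> a)" if "a \<in> carrier A" for \<gamma> a
    unfolding c_def by (rule image_component_cong) (use that r[of "\<pi> a"] image(1) in auto)
  have 0: "subgroup (carrier C) (add_monoid C)" using C.add.subgroup_self by simp
  have 1: "subgroup (CG \<gamma>) (add_monoid C)" for \<gamma> unfolding image(2) by (rule image_subgroup[OF grade_subgroup])
  have 2: "CG \<gamma> \<subseteq> carrier C" for \<gamma> using grade_closed by (auto simp: image)
  have 3: "c \<gamma> x \<in> CG \<gamma>" if "x \<in> carrier C" for \<gamma> x
    unfolding c_def image(2) using component_in r(1)[OF that] by blast
  have 4: "c \<gamma> (x \<oplus>\<^bsub>C\<^esub> y) = c \<gamma> x \<oplus>\<^bsub>C\<^esub> c \<gamma> y" if h: "x \<in> carrier C" "y \<in> carrier C" for \<gamma> x y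
  proof -
    obtain a where a: "a \<in> carrier A" "x = \<pi> a" using h(1) image(1) by auto
    obtain b where b: "b \<in> carrier A" "y = \<pi> b" using h(2) image(1) by auto
    show ?thesis using a b by (simp add: image_add c component_add component_closed)
  qed
  have 5: "c \<delta> x = (if \<delta> = \<gamma> then x else \<zero>\<^bsub>C\<^esub>)" if h: "x \<in> CG \<gamma>" for \<gamma> \<delta> x
  proof -
    obtain a where a: "a \<in> AG \<gamma>" "x = \<pi> a" using h image(2) by auto
    show ?thesis using a(2) c[OF grade_closed[OF a(1)]] component_homogeneous[OF a(1), of \<delta>] image(3) by simp
  qed
  have 6: "finite {\<gamma>. c \<gamma> x \<noteq> \<zero>\<^bsub>C\<^esub>}" if h: "x \<in> carrier C" for x
  proof -
    obtain a where a: "a \<in> carrier A" "x = \<pi> a" using h image(1) by auto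
    have "{\<gamma>. c \<gamma> x \<noteq> \<zero>\<^bsub>C\<^esub>} \<subseteq> {\<gamma>. component A AG \<gamma> a \<noteq> \<zero>\<^bsub>A\<^esub>}" using a c image(3) by auto
    then show ?thesis using finite_components[OF a(1)] finite_subset by blast
  qed
  have 7: "x = \<zero>\<^bsub>C\<^esub>" if h: "x \<in> carrier C" and z: "\<And>\<gamma>. c \<gamma> x = \<zero>\<^bsub>C\<^esub>" for x
  proof -
    obtain a where a: "a \<in> carrier A" "x = \<pi> a" using h image(1) by auto
    have za: "\<pi> (component A AG \<gamma> a) = \<zero>\<^bsub>C\<^esub>" for \<gamma> using z[of \<gamma>] a c by simp
    have "\<pi> a = \<zero>\<^bsub>C\<^esub>" using a(1)
    proof (rule component_induct)
      show "\<pi> (y \<oplus>\<^bsub>A\<^esub> z) = \<zero>\<^bsub>C\<^esub>" if "y \<in> carrier A" "z \<in> carrier A" "\<pi> y = \<zero>\<^bsub>C\<^esub>" "\<pi> z = \<zero>\<^bsub>C\<^esub>" for y z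
        using image_add[OF that(1,2)] that(3,4) by simp
    qed (use za image(3) in simp_all)
    then show ?thesis using a by simp
  qed
  have dir: "internal_direct_sum C (carrier C) CG" "\<And>x \<gamma>. x \<in> carrier C \<Longrightarrow> component C CG \<gamma> x = c \<gamma> x"
    by (rule C.internal_direct_sumI[where c = c, OF 0 1 2 3 4 5 6 7]; assumption)+
  show "graded_group C CG" by (intro graded_group.intro graded_group_axioms.intro C.abelian_group_axioms dir(1))
  show "component C CG \<gamma> (\<pi> a) = \<pi> (component A AG \<gamma> a)" if "a \<in> carrier A"
  proof -
    have "\<pi> a \<in> carrier C" using that image(1) by auto
    then show ?thesis using dir(2) c[OF that] by simp
  qed
qed

lemma image_lie: "graded_lie_algebra K C CG"
proof -
  interpret gC: graded_group C CG by (rule image_graded_group)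
  have E: "\<exists>a\<in>carrier A. x = \<pi> a" if "x \<in> carrier C" for x using that image(1) by auto
  have E2: "\<exists>a\<in>carrier A. \<exists>b\<in>carrier A. x = \<pi> a \<and> y = \<pi> b" if "x \<in> carrier C" "y \<in> carrier C" for x y
    using E[OF that(1)] E[OF that(2)] by blast
  have E3: "\<exists>a\<in>carrier A. \<exists>b\<in>carrier A. \<exists>c\<in>carrier A. x = \<pi> a \<and> y = \<pi> b \<and> z = \<pi> c"
    if "x \<in> carrier C" "y \<in> carrier C" "z \<in> carrier C" for x y z
    using E[OF that(1)] E[OF that(2)] E[OF that(3)] by blast
  have I: "\<pi> a \<in> carrier C" if "a \<in> carrier A" for a using that image(1) by auto
  note ops = image_add image_prod image_smult prod_closed
  interpret C': module K C
  proof (rule moduleI[OF R.is_cring C.abelian_group_axioms])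
    fix k k' x y assume k: "k \<in> carrier K" "k' \<in> carrier K" and x: "x \<in> carrier C" "y \<in> carrier C"
    obtain a b where ab: "a \<in> carrier A" "b \<in> carrier A" "x = \<pi> a" "y = \<pi> b" using E2[OF x] by blast
    show "k \<odot>\<^bsub>C\<^esub> (x \<oplus>\<^bsub>C\<^esub> y) = k \<odot>\<^bsub>C\<^esub> x \<oplus>\<^bsub>C\<^esub> k \<odot>\<^bsub>C\<^esub> y" using k ab by (simp add: ops smult_r_distr)
  next
    fix k x assume k: "k \<in> carrier K" and x: "x \<in> carrier C"
    obtain a where a: "a \<in> carrier A" "x = \<pi> a" using E[OF x] by blast
    show "k \<odot>\<^bsub>C\<^esub> x \<in> carrier C" using k a I by (simp add: ops)
    fix k' assume k': "k' \<in> carrier K"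
    show "(k \<oplus>\<^bsub>K\<^esub> k') \<odot>\<^bsub>C\<^esub> x = k \<odot>\<^bsub>C\<^esub> x \<oplus>\<^bsub>C\<^esub> k' \<odot>\<^bsub>C\<^esub> x" using k k' a by (simp add: ops smult_l_distr)
    show "(k \<otimes>\<^bsub>K\<^esub> k') \<odot>\<^bsub>C\<^esub> x = k \<odot>\<^bsub>C\<^esub> (k' \<odot>\<^bsub>C\<^esub> x)" using k k' a by (simp add: ops smult_assoc1)
  next
    show "\<one>\<^bsub>K\<^esub> \<odot>\<^bsub>C\<^esub> x = x" if "x \<in> carrier C" for x using E[OF that] by (auto simp: ops)
  qed
  show ?thesis
  proof (intro graded_lie_algebra.intro graded_lie_algebra_axioms.intro graded_algebra.intro
      graded_algebra_axioms.intro nonassoc_algebra.intro nonassoc_algebra_axioms.intro C'.module_axioms)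
    show "submodule (CG \<gamma>) K C" for \<gamma>
    proof (rule C'.submoduleI)
      show "CG \<gamma> \<subseteq> carrier C" "\<zero>\<^bsub>C\<^esub> \<in> CG \<gamma>" using gC.grade_closed gC.grade_zero by auto
      show "\<ominus>\<^bsub>C\<^esub> a \<in> CG \<gamma>" if "a \<in> CG \<gamma>" for a using gC.grade_neg[OF that] .
      show "a \<oplus>\<^bsub>C\<^esub> b \<in> CG \<gamma>" if "a \<in> CG \<gamma>" "b \<in> CG \<gamma>" for a b using gC.grade_add[OF that] .
      show "k \<odot>\<^bsub>C\<^esub> x \<in> CG \<gamma>" if k: "k \<in> carrier K" and x: "x \<in> CG \<gamma>" for k x
      proof -
        obtain a where a: "a \<in> AG \<gamma>" "x = \<pi> a" using x image(2) by auto
        then show ?thesis using k grade_smult[OF k a(1)] grade_closed[OF a(1)] by (simp add: ops image(2))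
      qed
    qed
    show "internal_direct_sum C (carrier C) CG" by (rule gC.direct)
    show "x \<otimes>\<^bsub>C\<^esub> y \<in> CG (\<alpha> + \<beta>)" if h: "x \<in> CG \<alpha>" "y \<in> CG \<beta>" for x y \<alpha> \<beta>
    proof -
      obtain a where a: "a \<in> AG \<alpha>" "x = \<pi> a" using h(1) image(2) by auto
      obtain b where b: "b \<in> AG \<beta>" "y = \<pi> b" using h(2) image(2) by auto
      show ?thesis using grading_prod[OF a(1) b(1)] a b grade_closed by (simp add: ops image(2))
    qed
  next
    fix x y z assume x: "x \<in> carrier C" "y \<in> carrier C" "z \<in> carrier C"
    obtain a b c where abc: "a \<in> carrier A" "b \<in> carrier A" "c \<in> carrier A" "x = \<pi> a" "y = \<pi> b" "z = \<pi> c"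
      using E3[OF x] by blast
    show "(x \<oplus>\<^bsub>C\<^esub> y) \<otimes>\<^bsub>C\<^esub> z = x \<otimes>\<^bsub>C\<^esub> z \<oplus>\<^bsub>C\<^esub> y \<otimes>\<^bsub>C\<^esub> z" using abc by (simp add: ops prod_l_distr)
    show "z \<otimes>\<^bsub>C\<^esub> (x \<oplus>\<^bsub>C\<^esub> y) = z \<otimes>\<^bsub>C\<^esub> x \<oplus>\<^bsub>C\<^esub> z \<otimes>\<^bsub>C\<^esub> y" using abc by (simp add: ops prod_r_distr)
    show "x \<otimes>\<^bsub>C\<^esub> y \<otimes>\<^bsub>C\<^esub> z \<oplus>\<^bsub>C\<^esub> y \<otimes>\<^bsub>C\<^esub> z \<otimes>\<^bsub>C\<^esub> x \<oplus>\<^bsub>C\<^esub> z \<otimes>\<^bsub>C\<^esub> x \<otimes>\<^bsub>C\<^esub> y = \<zero>\<^bsub>C\<^esub>"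
      using abc jacobi[of a b c] by (simp add: ops image(3))
  next
    fix k x y assume k: "k \<in> carrier K" and x: "x \<in> carrier C" "y \<in> carrier C"
    obtain a b where ab: "a \<in> carrier A" "b \<in> carrier A" "x = \<pi> a" "y = \<pi> b" using E2[OF x] by blast
    show "(k \<odot>\<^bsub>C\<^esub> x) \<otimes>\<^bsub>C\<^esub> y = k \<odot>\<^bsub>C\<^esub> (x \<otimes>\<^bsub>C\<^esub> y)" using k ab by (simp add: ops prod_l_smult)
    show "x \<otimes>\<^bsub>C\<^esub> (k \<odot>\<^bsub>C\<^esub> y) = k \<odot>\<^bsub>C\<^esub> (x \<otimes>\<^bsub>C\<^esub> y)" using k ab by (simp add: ops prod_r_smult)
  next
    fix x y assume x: "x \<in> carrier C" "y \<in> carrier C"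
    obtain a b where ab: "a \<in> carrier A" "b \<in> carrier A" "x = \<pi> a" "y = \<pi> b" using E2[OF x] by blast
    show "x \<otimes>\<^bsub>C\<^esub> y \<in> carrier C" using ab I by (simp add: ops)
  next
    fix x assume "x \<in> carrier C"
    then obtain a where "a \<in> carrier A" "x = \<pi> a" using E by blast
    then show "x \<otimes>\<^bsub>C\<^esub> x = \<zero>\<^bsub>C\<^esub>" by (simp add: ops alternating image(3))
  qed
qed

lemma image_ideal:
  assumes V: "homogeneous_ideal K A AG V"
  shows "homogeneous_ideal K C CG (\<pi> ` V)"
proof -
  interpret L: graded_lie_algebra K C CG by (rule image_lie)
  note Vd = homogeneous_idealD[OF V]
  have VA: "v \<in> carrier A" if "v \<in> V" for v using Vd(3) that by auto
  note Sd = C.subgroup_add_monoidD[OF image_subgroup[OF Vd(2)]]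
  show ?thesis
  proof (rule L.homogeneous_idealI_left)
    show "\<pi> ` V \<subseteq> carrier C" "\<zero>\<^bsub>C\<^esub> \<in> \<pi> ` V" using Sd by auto
    show "x \<oplus>\<^bsub>C\<^esub> y \<in> \<pi> ` V" if "x \<in> \<pi> ` V" "y \<in> \<pi> ` V" for x y using Sd(3) that .
    fix x assume "x \<in> \<pi> ` V"
    then obtain v where v: "v \<in> V" "x = \<pi> v" by blast
    show "k \<odot>\<^bsub>C\<^esub> x \<in> \<pi> ` V" if "k \<in> carrier K" for k
      using Vd(7)[OF that v(1)] that v VA by (simp add: image_smult)
    show "component C CG \<gamma> x \<in> \<pi> ` V" for \<gamma>
      using Vd(10)[OF v(1), of \<gamma>] v VA by (simp add: image_graded_group(2))
    fix a assume "a \<in> carrier C"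
    then obtain b where b: "b \<in> carrier A" "a = \<pi> b" using image(1) by auto
    show "a \<otimes>\<^bsub>C\<^esub> x \<in> \<pi> ` V" using Vd(8)[OF b(1) v(1)] b v VA by (simp add: image_prod)
  qed
qed

end

section \<open>Quotients by ultrafilters\<close>

locale ultra_lie = graded_lie_algebra K A AG
  for K :: "('k, 'n) ring_scheme" and A :: "('k, 'a) module"
    and AG :: "'g::ab_group_add \<Rightarrow> 'a set" +
  fixes B :: "'k set"
  assumes ultra: "idempotent_ultrafilter K B"
begin

lemma ultraD:
  shows "e \<in> B \<Longrightarrow> e \<in> idempotents K" "\<zero>\<^bsub>K\<^esub> \<notin> B" "\<lbrakk>e \<in> B; f \<in> B\<rbrakk> \<Longrightarrow> e \<otimes>\<^bsub>K\<^esub> f \<in> B"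
    and "e \<in> idempotents K \<Longrightarrow> e \<in> B \<or> \<one>\<^bsub>K\<^esub> \<ominus>\<^bsub>K\<^esub> e \<in> B"
  using ultra unfolding idempotent_ultrafilter_def by blast+

lemma ultra_nonempty: "B \<noteq> {}"
  using ultraD(4)[OF R.idempotent_zero] by blast

lemma ultra_kernel_iff:
  "x \<in> ultra_kernel K B A \<longleftrightarrow> x \<in> carrier A \<and> (\<exists>e\<in>B. e \<odot>\<^bsub>A\<^esub> x = \<zero>\<^bsub>A\<^esub>)"
proof
  assume "x \<in> ultra_kernel K B A"
  then obtain f y where h: "x \<in> carrier A" "f \<in> idempotents K" "f \<notin> B" "y \<in> carrier A" "x = f \<odot>\<^bsub>A\<^esub> y"
    unfolding ultra_kernel_def by blast
  note f = R.idempotentD[OF h(2)]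
  have "(\<one>\<^bsub>K\<^esub> \<ominus>\<^bsub>K\<^esub> f) \<otimes>\<^bsub>K\<^esub> f = \<zero>\<^bsub>K\<^esub>"
    using f by (simp add: a_minus_def R.l_distr R.l_minus R.r_neg)
  then have "(\<one>\<^bsub>K\<^esub> \<ominus>\<^bsub>K\<^esub> f) \<odot>\<^bsub>A\<^esub> x = \<zero>\<^bsub>A\<^esub>"
    using smult_assoc1[of "\<one>\<^bsub>K\<^esub> \<ominus>\<^bsub>K\<^esub> f" f y] f h(4,5) by simp
  then show "x \<in> carrier A \<and> (\<exists>e\<in>B. e \<odot>\<^bsub>A\<^esub> x = \<zero>\<^bsub>A\<^esub>)" using h(1) ultraD(4)[OF h(2)] h(3) by blast
next
  assume "x \<in> carrier A \<and> (\<exists>e\<in>B. e \<odot>\<^bsub>A\<^esub> x = \<zero>\<^bsub>A\<^esub>)"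
  then obtain e where x: "x \<in> carrier A" and e: "e \<in> B" "e \<odot>\<^bsub>A\<^esub> x = \<zero>\<^bsub>A\<^esub>" by blast
  note e' = R.idempotentD[OF ultraD(1)[OF e(1)]]
  have id: "\<one>\<^bsub>K\<^esub> \<ominus>\<^bsub>K\<^esub> e \<in> idempotents K" by (rule R.idempotent_complement[OF ultraD(1)[OF e(1)]])
  have "e \<otimes>\<^bsub>K\<^esub> (\<one>\<^bsub>K\<^esub> \<ominus>\<^bsub>K\<^esub> e) = \<zero>\<^bsub>K\<^esub>" using e' by (simp add: a_minus_def R.r_distr R.r_minus R.r_neg)
  then have "\<one>\<^bsub>K\<^esub> \<ominus>\<^bsub>K\<^esub> e \<notin> B" using ultraD(2,3) e(1) by metis
  moreover have "x = (\<one>\<^bsub>K\<^esub> \<ominus>\<^bsub>K\<^esub> e) \<odot>\<^bsub>A\<^esub> x"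
    using x e e' by (simp add: a_minus_def smult_l_distr smult_l_minus)
  ultimately show "x \<in> ultra_kernel K B A" unfolding ultra_kernel_def using x id by blast
qed

abbreviation "N \<equiv> ultra_kernel K B A"

lemma kernel_closed: "n \<in> N \<Longrightarrow> n \<in> carrier A"
  by (simp add: ultra_kernel_iff)

lemma smult_annihilates:
  assumes "e \<in> carrier K" "f \<in> carrier K" "x \<in> carrier A" "e \<odot>\<^bsub>A\<^esub> x = \<zero>\<^bsub>A\<^esub>"
  shows "(f \<otimes>\<^bsub>K\<^esub> e) \<odot>\<^bsub>A\<^esub> x = \<zero>\<^bsub>A\<^esub>" "(e \<otimes>\<^bsub>K\<^esub> f) \<odot>\<^bsub>A\<^esub> x = \<zero>\<^bsub>A\<^esub>" "e \<odot>\<^bsub>A\<^esub> (f \<odot>\<^bsub>A\<^esub> x) = \<zero>\<^bsub>A\<^esub>"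
proof -
  show 1: "(f \<otimes>\<^bsub>K\<^esub> e) \<odot>\<^bsub>A\<^esub> x = \<zero>\<^bsub>A\<^esub>" using assms by (simp add: smult_assoc1)
  then show 2: "(e \<otimes>\<^bsub>K\<^esub> f) \<odot>\<^bsub>A\<^esub> x = \<zero>\<^bsub>A\<^esub>" using assms by (simp add: R.m_comm)
  then show "e \<odot>\<^bsub>A\<^esub> (f \<odot>\<^bsub>A\<^esub> x) = \<zero>\<^bsub>A\<^esub>" using assms by (simp add: smult_assoc1)
qed

lemma kernel_subgroup: "subgroup N (add_monoid A)"
proof (rule M.subgroup_add_monoidI)
  note B = R.idempotentD(1)[OF ultraD(1)]
  show "N \<subseteq> carrier A" using kernel_closed by auto
  show "\<zero>\<^bsub>A\<^esub> \<in> N" using ultra_nonempty B by (auto simp: ultra_kernel_iff)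
  show "\<ominus>\<^bsub>A\<^esub> x \<in> N" if "x \<in> N" for x using that B by (auto simp: ultra_kernel_iff smult_r_minus)
  show "x \<oplus>\<^bsub>A\<^esub> y \<in> N" if h: "x \<in> N" "y \<in> N" for x y
  proof -
    obtain e where e: "e \<in> B" "e \<odot>\<^bsub>A\<^esub> x = \<zero>\<^bsub>A\<^esub>" using h(1) by (auto simp: ultra_kernel_iff)
    obtain f where f: "f \<in> B" "f \<odot>\<^bsub>A\<^esub> y = \<zero>\<^bsub>A\<^esub>" using h(2) by (auto simp: ultra_kernel_iff)
    have "(e \<otimes>\<^bsub>K\<^esub> f) \<odot>\<^bsub>A\<^esub> (x \<oplus>\<^bsub>A\<^esub> y) = \<zero>\<^bsub>A\<^esub>"
      using smult_annihilates(2)[OF B[OF e(1)] B[OF f(1)] kernel_closed[OF h(1)] e(2)]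
        smult_annihilates(1)[OF B[OF f(1)] B[OF e(1)] kernel_closed[OF h(2)] f(2)]
        B[OF e(1)] B[OF f(1)] kernel_closed[OF h(1)] kernel_closed[OF h(2)]
      by (simp add: smult_r_distr)
    then show ?thesis using ultraD(3)[OF e(1) f(1)] kernel_closed[OF h(1)] kernel_closed[OF h(2)]
      by (auto simp: ultra_kernel_iff)
  qed
qed

lemmas kernelD = M.subgroup_add_monoidD[OF kernel_subgroup]

definition coset :: "'a \<Rightarrow> 'a set" where
  "coset x = N +>\<^bsub>A\<^esub> x"

lemma coset_def': "coset x = {n \<oplus>\<^bsub>A\<^esub> x | n. n \<in> N}"
  by (auto simp: coset_def a_r_coset_def r_coset_def)

lemma coset_eq:
  assumes "x \<in> carrier A" "y \<in> carrier A"
  shows "coset x = coset y \<longleftrightarrow> x \<ominus>\<^bsub>A\<^esub> y \<in> N"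
proof
  assume "coset x = coset y"
  moreover have "x \<in> coset x" using assms kernelD(2) by (force simp: coset_def')
  ultimately obtain n where n: "n \<in> N" "x = n \<oplus>\<^bsub>A\<^esub> y" by (auto simp: coset_def')
  then show "x \<ominus>\<^bsub>A\<^esub> y \<in> N" using assms kernel_closed by (simp add: a_minus_def M.a_assoc M.r_neg)
next
  assume d: "x \<ominus>\<^bsub>A\<^esub> y \<in> N"
  have sub: "coset u \<subseteq> coset v" if h: "u \<in> carrier A" "v \<in> carrier A" "u \<ominus>\<^bsub>A\<^esub> v \<in> N" for u v
  proof
    fix z assume "z \<in> coset u"
    then obtain n where n: "n \<in> N" "z = n \<oplus>\<^bsub>A\<^esub> u" by (auto simp: coset_def')
    have "z = (n \<oplus>\<^bsub>A\<^esub> (u \<ominus>\<^bsub>A\<^esub> v)) \<oplus>\<^bsub>A\<^esub> v"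
      using n h kernel_closed by (simp add: a_minus_def M.a_assoc M.l_neg)
    then show "z \<in> coset v" using kernelD(3)[OF n(1) h(3)] by (auto simp: coset_def')
  qed
  have "y \<ominus>\<^bsub>A\<^esub> x = \<ominus>\<^bsub>A\<^esub> (x \<ominus>\<^bsub>A\<^esub> y)" using assms by (simp add: a_minus_def M.minus_add M.a_comm)
  then show "coset x = coset y" using sub assms d kernelD(4) by (metis subset_antisym)
qed

lemma coset_kernel_iff: "x \<in> carrier A \<Longrightarrow> coset x = coset \<zero>\<^bsub>A\<^esub> \<longleftrightarrow> x \<in> N"
  by (simp add: coset_eq a_minus_def)

lemma coset_cong:
  "\<lbrakk>x \<in> carrier A; n \<in> N\<rbrakk> \<Longrightarrow> coset (n \<oplus>\<^bsub>A\<^esub> x) = coset x"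
  by (simp add: coset_eq a_minus_def M.a_assoc M.r_neg kernel_closed)

lemma kernel_ideal:
  shows "\<lbrakk>n \<in> N; x \<in> carrier A\<rbrakk> \<Longrightarrow> n \<otimes>\<^bsub>A\<^esub> x \<in> N" "\<lbrakk>n \<in> N; x \<in> carrier A\<rbrakk> \<Longrightarrow> x \<otimes>\<^bsub>A\<^esub> n \<in> N"
    "\<lbrakk>k \<in> carrier K; n \<in> N\<rbrakk> \<Longrightarrow> k \<odot>\<^bsub>A\<^esub> n \<in> N" "n \<in> N \<Longrightarrow> component A AG \<gamma> n \<in> N"
proof -
  note B = R.idempotentD(1)[OF ultraD(1)]
  assume n: "n \<in> N"
  then obtain e where e: "e \<in> B" "e \<odot>\<^bsub>A\<^esub> n = \<zero>\<^bsub>A\<^esub>" by (auto simp: ultra_kernel_iff)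
  note nc = kernel_closed[OF n]
  show "component A AG \<gamma> n \<in> N"
    using e nc B[OF e(1)] component_smult[of e n \<gamma>]
    by (auto simp: ultra_kernel_iff component_closed component_zero)
  show "k \<odot>\<^bsub>A\<^esub> n \<in> N" if "k \<in> carrier K"
    using smult_annihilates(3)[OF B[OF e(1)] that nc e(2)] e(1) that nc by (auto simp: ultra_kernel_iff)
  assume x: "x \<in> carrier A"
  have "e \<odot>\<^bsub>A\<^esub> (n \<otimes>\<^bsub>A\<^esub> x) = \<zero>\<^bsub>A\<^esub>"
    using e B[OF e(1)] x nc by (simp add: prod_l_smult[symmetric] prod_l_zero)
  moreover have "e \<odot>\<^bsub>A\<^esub> (x \<otimes>\<^bsub>A\<^esub> n) = \<zero>\<^bsub>A\<^esub>"
    using e B[OF e(1)] x nc by (simp add: prod_r_smult[symmetric] prod_r_zero)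
  ultimately show "n \<otimes>\<^bsub>A\<^esub> x \<in> N" "x \<otimes>\<^bsub>A\<^esub> n \<in> N" using e(1) x nc by (auto simp: ultra_kernel_iff prod_closed)
qed

abbreviation "AB \<equiv> ultra_quotient K B A"
abbreviation "ABG \<equiv> ultra_quotient_grading K B A AG"

lemma quotient_image: "graded_lie_image K A AG coset AB ABG"
proof (intro graded_lie_image.intro graded_lie_image_axioms.intro graded_lie_algebra_axioms)
  have zero: "\<zero>\<^bsub>AB\<^esub> = coset \<zero>\<^bsub>A\<^esub>"
    using kernel_closed by (force simp: ultra_quotient_def Let_def coset_def')
  show "carrier AB = coset ` carrier A"
    by (auto simp: ultra_quotient_def Let_def A_RCOSETS_def' coset_def)
  show "ABG \<gamma> = coset ` AG \<gamma>" for \<gamma>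
    by (auto simp: ultra_quotient_grading_def coset_def)
  show "\<zero>\<^bsub>AB\<^esub> = coset \<zero>\<^bsub>A\<^esub>" by (rule zero)
  show "coset (component A AG \<gamma> x) = \<zero>\<^bsub>AB\<^esub>" if "x \<in> carrier A" "coset x = \<zero>\<^bsub>AB\<^esub>" for x \<gamma>
    using that kernel_ideal(4) unfolding zero by (simp add: coset_kernel_iff component_closed)
  show "coset x \<oplus>\<^bsub>AB\<^esub> coset y = coset (x \<oplus>\<^bsub>A\<^esub> y)" if xy: "x \<in> carrier A" "y \<in> carrier A" for x y
  proof -
    interpret abelian_subgroup N A
      by (rule abelian_subgroupI3[OF additive_subgroupI[OF kernel_subgroup] M.abelian_group_axioms])
    show ?thesis using a_rcos_sum[OF xy] by (simp add: ultra_quotient_def Let_def coset_def)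
  qed
  show "coset x \<otimes>\<^bsub>AB\<^esub> coset y = coset (x \<otimes>\<^bsub>A\<^esub> y)" if xy: "x \<in> carrier A" "y \<in> carrier A" for x y
  proof -
    have eq: "coset ((n \<oplus>\<^bsub>A\<^esub> x) \<otimes>\<^bsub>A\<^esub> (m \<oplus>\<^bsub>A\<^esub> y)) = coset (x \<otimes>\<^bsub>A\<^esub> y)" if nm: "n \<in> N" "m \<in> N" for n m
    proof -
      note c = kernel_closed[OF nm(1)] kernel_closed[OF nm(2)]
      have "(n \<oplus>\<^bsub>A\<^esub> x) \<otimes>\<^bsub>A\<^esub> (m \<oplus>\<^bsub>A\<^esub> y) = (n \<otimes>\<^bsub>A\<^esub> (m \<oplus>\<^bsub>A\<^esub> y) \<oplus>\<^bsub>A\<^esub> x \<otimes>\<^bsub>A\<^esub> m) \<oplus>\<^bsub>A\<^esub> x \<otimes>\<^bsub>A\<^esub> y"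
        using c xy by (simp add: prod_l_distr prod_r_distr prod_closed M.a_ac)
      moreover have "n \<otimes>\<^bsub>A\<^esub> (m \<oplus>\<^bsub>A\<^esub> y) \<oplus>\<^bsub>A\<^esub> x \<otimes>\<^bsub>A\<^esub> m \<in> N"
        using kernelD(3) kernel_ideal(1)[OF nm(1)] kernel_ideal(2)[OF nm(2)] c xy by simp
      ultimately show ?thesis using coset_cong xy prod_closed by simp
    qed
    have "coset x \<otimes>\<^bsub>AB\<^esub> coset y = (\<Union>a\<in>coset x. \<Union>b\<in>coset y. coset (a \<otimes>\<^bsub>A\<^esub> b))"
      by (simp add: ultra_quotient_def Let_def rcoset_mult_def coset_def)
    also have "\<dots> = (\<Union>n\<in>N. \<Union>m\<in>N. coset ((n \<oplus>\<^bsub>A\<^esub> x) \<otimes>\<^bsub>A\<^esub> (m \<oplus>\<^bsub>A\<^esub> y)))"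
      unfolding coset_def'[of x] coset_def'[of y] by blast
    also have "\<dots> = coset (x \<otimes>\<^bsub>A\<^esub> y)" using eq kernelD(2) by auto
    finally show ?thesis .
  qed
  show "k \<odot>\<^bsub>AB\<^esub> coset x = coset (k \<odot>\<^bsub>A\<^esub> x)" if kx: "k \<in> carrier K" "x \<in> carrier A" for k x
  proof -
    have eq: "coset (k \<odot>\<^bsub>A\<^esub> (n \<oplus>\<^bsub>A\<^esub> x)) = coset (k \<odot>\<^bsub>A\<^esub> x)" if "n \<in> N" for n
      using coset_cong[OF _ kernel_ideal(3)[OF kx(1) that]] kx kernel_closed[OF that]
      by (simp add: smult_r_distr)
    have "k \<odot>\<^bsub>AB\<^esub> coset x = (\<Union>a\<in>coset x. coset (k \<odot>\<^bsub>A\<^esub> a))"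
      by (simp add: ultra_quotient_def Let_def coset_def)
    also have "\<dots> = (\<Union>n\<in>N. coset (k \<odot>\<^bsub>A\<^esub> (n \<oplus>\<^bsub>A\<^esub> x)))" unfolding coset_def'[of x] by blast
    also have "\<dots> = coset (k \<odot>\<^bsub>A\<^esub> x)" using eq kernelD(2) by auto
    finally show ?thesis .
  qed
qed

sublocale quot: graded_lie_image K A AG coset AB ABG
  by (rule quotient_image)

end

section \<open>The orthogonal completion and its ultrafilter quotients\<close>

locale orth_in_module = orth_quotients K A AG Q QG \<kappa>
  for K :: "('k, 'n) ring_scheme" and A :: "('k, 'a) module"
    and AG :: "'g::ab_group_add \<Rightarrow> 'a set" and Q :: "('k, 'q) module" and QG :: "'g \<Rightarrow> 'q set"
    and \<kappa> :: "'a \<Rightarrow> 'q" +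
  fixes M :: "('k, 'q) module"
  assumes Q_in_M: "carrier Q \<subseteq> carrier M"
    and M_zero: "\<zero>\<^bsub>M\<^esub> = \<zero>\<^bsub>Q\<^esub>"
    and M_add: "\<lbrakk>x \<in> carrier Q; y \<in> carrier Q\<rbrakk> \<Longrightarrow> x \<oplus>\<^bsub>M\<^esub> y = x \<oplus>\<^bsub>Q\<^esub> y"
    and M_smult: "\<lbrakk>k \<in> carrier K; x \<in> carrier Q\<rbrakk> \<Longrightarrow> k \<odot>\<^bsub>M\<^esub> x = k \<odot>\<^bsub>Q\<^esub> x"
    and M_separates: "\<lbrakk>dense_orthogonal K D; x \<in> carrier M; y \<in> carrier M;
      \<And>\<xi>. \<xi> \<in> D \<Longrightarrow> \<xi> \<odot>\<^bsub>M\<^esub> x = \<xi> \<odot>\<^bsub>M\<^esub> y\<rbrakk> \<Longrightarrow> x = y"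
begin

lemma orth_sum_M_iff:
  assumes "dense_orthogonal K D" "\<And>\<xi>. \<xi> \<in> D \<Longrightarrow> x \<xi> \<in> carrier Q" "s \<in> carrier Q"
  shows "orth_sum M D x s \<longleftrightarrow> orth_sum Q D x s"
  using assms A.R.dense_orthogonalD(2)[OF assms(1)] by (simp add: orth_sum_def M_smult)

lemma orth_complete_closure:
  assumes T: "T \<subseteq> carrier Q"
  shows "orth_complete K M (orth_closure T)"
  unfolding orth_complete_def
proof (intro conjI allI impI)
  show "orth_closure T \<subseteq> carrier M" using orth_closure_closed Q_in_M by blast
  fix D x assume h: "dense_orthogonal K D \<and> x \<in> D \<rightarrow> orth_closure T"
  then have D: "dense_orthogonal K D" and x: "\<And>\<xi>. \<xi> \<in> D \<Longrightarrow> x \<xi> \<in> orth_closure T" by auto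
  have "\<exists>s\<in>orth_closure T. orth_sum Q D x s" by (rule orth_closure_complete[OF T D x])
  then obtain s where s: "s \<in> orth_closure T" "orth_sum Q D x s" by (rule bexE)
  have "orth_sum M D x s"
    using orth_sum_M_iff[OF D, of x s] x s orth_closure_closed by blast
  then show "\<exists>s\<in>orth_closure T. orth_sum M D x s" using s(1) by (rule bexI)
qed

lemma orth_hull_eq:
  assumes T: "T \<subseteq> carrier Q"
  shows "orth_hull K M T = orth_closure T"
proof
  show "orth_hull K M T \<subseteq> orth_closure T"
    unfolding orth_hull_def using orth_complete_closure[OF T] orth_closure_incl[OF T] by blast
  have "u \<in> U" if u: "u \<in> orth_closure T" and U: "orth_complete K M U" "T \<subseteq> U" for u U
    using u
  proof (rule orth_closureE)
    fix D x
    assume D: "u \<in> carrier Q" "dense_orthogonal K D" "\<And>\<xi>. \<xi> \<in> D \<Longrightarrow> x \<xi> \<in> T"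
      "\<And>\<xi>. \<xi> \<in> D \<Longrightarrow> \<xi> \<odot>\<^bsub>Q\<^esub> u = \<xi> \<odot>\<^bsub>Q\<^esub> x \<xi>"
    have "x \<in> D \<rightarrow> U" using D(3) U(2) by blast
    then obtain s where s: "s \<in> U" "orth_sum M D x s"
      using U(1) D(2) unfolding orth_complete_def by blast
    have "s = u"
    proof (rule M_separates[OF D(2)])
      show "s \<in> carrier M" using s(1) U(1) unfolding orth_complete_def by blast
      show "u \<in> carrier M" using D(1) Q_in_M by blast
      show "\<xi> \<odot>\<^bsub>M\<^esub> s = \<xi> \<odot>\<^bsub>M\<^esub> u" if "\<xi> \<in> D" for \<xi>
        using s(2) that D(1) D(4)[OF that] M_smult[OF A.R.dense_orthogonalD(2)[OF D(2) that]]
          D(3)[OF that] T by (auto simp: orth_sum_def)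
    qed
    then show ?thesis using s(1) by simp
  qed
  then show "orth_closure T \<subseteq> orth_hull K M T" unfolding orth_hull_def by blast
qed

lemma Q_orth_hull: "orth_hull K M (carrier Q) = carrier Q"
  using orth_hull_eq[of "carrier Q"] orth_closure_closed orth_closure_incl by blast

lemma base_closed: "\<kappa> ` carrier A \<subseteq> carrier Q"
  using e_closed by auto

lemma base_ideal_closed: "homogeneous_ideal K A AG V \<Longrightarrow> \<kappa> ` V \<subseteq> carrier Q"
  using A.homogeneous_idealD(3) e_closed by blast

lemma prod_local:
  assumes "\<xi> \<in> carrier K" "u \<in> carrier Q" "v \<in> carrier Q" "u' \<in> carrier Q" "v' \<in> carrier Q"
    "\<xi> \<odot>\<^bsub>Q\<^esub> u = \<xi> \<odot>\<^bsub>Q\<^esub> u'" "\<xi> \<odot>\<^bsub>Q\<^esub> v = \<xi> \<odot>\<^bsub>Q\<^esub> v'"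
  shows "\<xi> \<odot>\<^bsub>Q\<^esub> (u \<otimes>\<^bsub>Q\<^esub> v) = \<xi> \<odot>\<^bsub>Q\<^esub> (u' \<otimes>\<^bsub>Q\<^esub> v')"
proof -
  have "\<xi> \<odot>\<^bsub>Q\<^esub> (u \<otimes>\<^bsub>Q\<^esub> v) = (\<xi> \<odot>\<^bsub>Q\<^esub> u') \<otimes>\<^bsub>Q\<^esub> v" using assms by (simp add: T.prod_l_smult[symmetric])
  also have "\<dots> = u' \<otimes>\<^bsub>Q\<^esub> (\<xi> \<odot>\<^bsub>Q\<^esub> v)" using assms(1-5) by (simp add: T.prod_l_smult T.prod_r_smult)
  also have "\<dots> = \<xi> \<odot>\<^bsub>Q\<^esub> (u' \<otimes>\<^bsub>Q\<^esub> v')" using assms(1-5) by (simp add: assms(7) T.prod_r_smult)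
  finally show ?thesis .
qed

lemma orth_closure_prod:
  assumes "u \<in> orth_closure T1" "v \<in> orth_closure T2" "T1 \<subseteq> carrier Q" "T2 \<subseteq> carrier Q"
    and "\<And>x y. \<lbrakk>x \<in> T1; y \<in> T2\<rbrakk> \<Longrightarrow> x \<otimes>\<^bsub>Q\<^esub> y \<in> T3"
  shows "u \<otimes>\<^bsub>Q\<^esub> v \<in> orth_closure T3"
  by (rule orth_closure_map2[OF assms(1-4) _ assms(5) prod_local]) (auto simp: T.prod_closed)

lemma orth_closure_add:
  assumes "u \<in> orth_closure S" "v \<in> orth_closure S" "S \<subseteq> carrier Q"
    and "\<And>x y. \<lbrakk>x \<in> S; y \<in> S\<rbrakk> \<Longrightarrow> x \<oplus>\<^bsub>Q\<^esub> y \<in> S"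
  shows "u \<oplus>\<^bsub>Q\<^esub> v \<in> orth_closure S"
  by (rule orth_closure_map2[OF assms(1,2,3,3) _ assms(4)]) (auto simp: T.smult_r_distr)

lemma orth_closure_smult:
  assumes k: "k \<in> carrier K" and "u \<in> orth_closure S" "S \<subseteq> carrier Q" "\<And>x. x \<in> S \<Longrightarrow> k \<odot>\<^bsub>Q\<^esub> x \<in> S"
  shows "k \<odot>\<^bsub>Q\<^esub> u \<in> orth_closure S"
proof (rule orth_closure_map[OF assms(2,3) _ assms(4)])
  fix \<xi> u v assume h: "\<xi> \<in> carrier K" "u \<in> carrier Q" "v \<in> carrier Q" "\<xi> \<odot>\<^bsub>Q\<^esub> u = \<xi> \<odot>\<^bsub>Q\<^esub> v"
  have c: "\<xi> \<odot>\<^bsub>Q\<^esub> (k \<odot>\<^bsub>Q\<^esub> w) = k \<odot>\<^bsub>Q\<^esub> (\<xi> \<odot>\<^bsub>Q\<^esub> w)" if "w \<in> carrier Q" for w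
    using T.smult_assoc1[of \<xi> k w] T.smult_assoc1[of k \<xi> w] A.R.m_comm[of \<xi> k] k h(1) that by simp
  show "\<xi> \<odot>\<^bsub>Q\<^esub> (k \<odot>\<^bsub>Q\<^esub> u) = \<xi> \<odot>\<^bsub>Q\<^esub> (k \<odot>\<^bsub>Q\<^esub> v)" using h by (simp add: c)
qed (use k in auto)

lemma orth_closure_component:
  assumes "u \<in> orth_closure S" "S \<subseteq> carrier Q" "\<And>x. x \<in> S \<Longrightarrow> component Q QG \<gamma> x \<in> S'"
  shows "component Q QG \<gamma> u \<in> orth_closure S'"
  by (rule orth_closure_map[OF assms(1,2) _ assms(3)])
    (auto simp: T.component_closed T.component_smult[symmetric])

abbreviation "OA \<equiv> orth_completion K A M \<kappa>"
abbreviation "OG \<equiv> orth_completion_grading K AG M \<kappa>"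

lemma O_carrier: "carrier OA = orth_closure (\<kappa> ` carrier A)"
  by (simp add: orth_completion_def orth_hull_eq base_closed)

lemma O_closed: "u \<in> carrier OA \<Longrightarrow> u \<in> carrier Q"
  using O_carrier orth_closure_closed by blast

lemma image_prod_in: "\<lbrakk>x \<in> \<kappa> ` carrier A; y \<in> \<kappa> ` carrier A\<rbrakk> \<Longrightarrow> x \<otimes>\<^bsub>Q\<^esub> y \<in> \<kappa> ` carrier A"
  by (auto simp: e_prod[symmetric] A.prod_closed)

lemma O_prod_closed: "\<lbrakk>u \<in> carrier OA; v \<in> carrier OA\<rbrakk> \<Longrightarrow> u \<otimes>\<^bsub>Q\<^esub> v \<in> carrier OA"
  unfolding O_carrier by (rule orth_closure_prod[OF _ _ base_closed base_closed image_prod_in])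

lemma O_mult:
  assumes u: "u \<in> carrier OA" and v: "v \<in> carrier OA"
  shows "u \<otimes>\<^bsub>OA\<^esub> v = u \<otimes>\<^bsub>Q\<^esub> v"
proof -
  note hull = orth_hull_eq[OF base_closed]
  have uvQ: "u \<in> carrier Q" "v \<in> carrier Q" using u v O_closed by auto
  let ?char = "\<lambda>z. z \<in> orth_hull K M (\<kappa> ` carrier A) \<and>
     (\<exists>D E x y. dense_orthogonal K D \<and> dense_orthogonal K E \<and>
        x \<in> D \<rightarrow> carrier A \<and> y \<in> E \<rightarrow> carrier A \<and>
        orth_sum M D (\<lambda>\<xi>. \<kappa> (x \<xi>)) u \<and> orth_sum M E (\<lambda>\<chi>. \<kappa> (y \<chi>)) v \<and>
        (\<forall>\<xi>\<in>D. \<forall>\<chi>\<in>E. (\<xi> \<otimes>\<^bsub>K\<^esub> \<chi>) \<odot>\<^bsub>M\<^esub> z = (\<xi> \<otimes>\<^bsub>K\<^esub> \<chi>) \<odot>\<^bsub>M\<^esub> \<kappa> (x \<xi> \<otimes>\<^bsub>A\<^esub> y \<chi>)))"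
  have local: "(\<xi> \<otimes>\<^bsub>K\<^esub> \<chi>) \<odot>\<^bsub>Q\<^esub> (u \<otimes>\<^bsub>Q\<^esub> v) = (\<xi> \<otimes>\<^bsub>K\<^esub> \<chi>) \<odot>\<^bsub>Q\<^esub> \<kappa> (a \<otimes>\<^bsub>A\<^esub> b)"
    if h: "\<xi> \<in> carrier K" "\<chi> \<in> carrier K" "a \<in> carrier A" "b \<in> carrier A"
      "\<xi> \<odot>\<^bsub>Q\<^esub> u = \<xi> \<odot>\<^bsub>Q\<^esub> \<kappa> a" "\<chi> \<odot>\<^bsub>Q\<^esub> v = \<chi> \<odot>\<^bsub>Q\<^esub> \<kappa> b" for \<xi> \<chi> a b
  proof -
    have "(\<xi> \<otimes>\<^bsub>K\<^esub> \<chi>) \<odot>\<^bsub>Q\<^esub> u = (\<xi> \<otimes>\<^bsub>K\<^esub> \<chi>) \<odot>\<^bsub>Q\<^esub> \<kappa> a"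
      using h uvQ by (simp add: A.R.m_comm[of \<xi> \<chi>] T.smult_assoc1 e_closed)
    moreover have "(\<xi> \<otimes>\<^bsub>K\<^esub> \<chi>) \<odot>\<^bsub>Q\<^esub> v = (\<xi> \<otimes>\<^bsub>K\<^esub> \<chi>) \<odot>\<^bsub>Q\<^esub> \<kappa> b"
      using h uvQ by (simp add: T.smult_assoc1 e_closed)
    ultimately show ?thesis
      using prod_local[of "\<xi> \<otimes>\<^bsub>K\<^esub> \<chi>" u v "\<kappa> a" "\<kappa> b"] h uvQ by (simp add: e_closed e_prod)
  qed
  have family: "\<exists>D x. dense_orthogonal K D \<and> x \<in> D \<rightarrow> carrier A \<and> (\<forall>\<xi>\<in>D. \<xi> \<odot>\<^bsub>Q\<^esub> w = \<xi> \<odot>\<^bsub>Q\<^esub> \<kappa> (x \<xi>))"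
    if w: "w \<in> carrier OA" for w
  proof -
    from w[unfolded O_carrier] show ?thesis
    proof (rule orth_closureE)
      fix D x
      assume D: "w \<in> carrier Q" "dense_orthogonal K D" "\<And>\<xi>. \<xi> \<in> D \<Longrightarrow> x \<xi> \<in> \<kappa> ` carrier A"
        "\<And>\<xi>. \<xi> \<in> D \<Longrightarrow> \<xi> \<odot>\<^bsub>Q\<^esub> w = \<xi> \<odot>\<^bsub>Q\<^esub> x \<xi>"
      have "\<forall>\<xi>\<in>D. \<exists>a. a \<in> carrier A \<and> x \<xi> = \<kappa> a" using D(3) by blast
      from bchoice[OF this] obtain a where "\<forall>\<xi>\<in>D. a \<xi> \<in> carrier A \<and> x \<xi> = \<kappa> (a \<xi>)" ..
      then show ?thesis using D(2,4) by (intro exI[of _ D] exI[of _ a]) auto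
    qed
  qed
  have sumM: "orth_sum M D (\<lambda>\<xi>. \<kappa> (x \<xi>)) w \<longleftrightarrow> (\<forall>\<xi>\<in>D. \<xi> \<odot>\<^bsub>Q\<^esub> w = \<xi> \<odot>\<^bsub>Q\<^esub> \<kappa> (x \<xi>))"
    if h: "dense_orthogonal K D" "x \<in> D \<rightarrow> carrier A" "w \<in> carrier Q" for D x w
  proof -
    have "orth_sum M D (\<lambda>\<xi>. \<kappa> (x \<xi>)) w \<longleftrightarrow> orth_sum Q D (\<lambda>\<xi>. \<kappa> (x \<xi>)) w"
      by (rule orth_sum_M_iff[OF h(1) _ h(3)]) (use h(2) e_closed in blast)
    then show ?thesis by (simp add: orth_sum_def)
  qed
  have char: "?char (u \<otimes>\<^bsub>Q\<^esub> v)"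
  proof -
    obtain D x where D: "dense_orthogonal K D" "x \<in> D \<rightarrow> carrier A" "\<forall>\<xi>\<in>D. \<xi> \<odot>\<^bsub>Q\<^esub> u = \<xi> \<odot>\<^bsub>Q\<^esub> \<kappa> (x \<xi>)"
      using family[OF u] by blast
    obtain E y where E: "dense_orthogonal K E" "y \<in> E \<rightarrow> carrier A" "\<forall>\<xi>\<in>E. \<xi> \<odot>\<^bsub>Q\<^esub> v = \<xi> \<odot>\<^bsub>Q\<^esub> \<kappa> (y \<xi>)"
      using family[OF v] by blast
    have "(\<xi> \<otimes>\<^bsub>K\<^esub> \<chi>) \<odot>\<^bsub>M\<^esub> (u \<otimes>\<^bsub>Q\<^esub> v) = (\<xi> \<otimes>\<^bsub>K\<^esub> \<chi>) \<odot>\<^bsub>M\<^esub> \<kappa> (x \<xi> \<otimes>\<^bsub>A\<^esub> y \<chi>)" if \<xi>\<chi>: "\<xi> \<in> D" "\<chi> \<in> E" for \<xi> \<chi>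
    proof -
      have c: "\<xi> \<in> carrier K" "\<chi> \<in> carrier K" "x \<xi> \<in> carrier A" "y \<chi> \<in> carrier A"
        using A.R.dense_orthogonalD(2)[OF D(1) \<xi>\<chi>(1)] A.R.dense_orthogonalD(2)[OF E(1) \<xi>\<chi>(2)] D(2) E(2) \<xi>\<chi>
        by auto
      show ?thesis
        using local[OF c] D(3) E(3) \<xi>\<chi> c uvQ by (simp add: M_smult T.prod_closed A.prod_closed e_closed)
    qed
    moreover have "u \<otimes>\<^bsub>Q\<^esub> v \<in> orth_hull K M (\<kappa> ` carrier A)"
      using O_prod_closed[OF u v] unfolding hull O_carrier .
    moreover have "orth_sum M D (\<lambda>\<xi>. \<kappa> (x \<xi>)) u" "orth_sum M E (\<lambda>\<xi>. \<kappa> (y \<xi>)) v"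
      using sumM[OF D(1,2) uvQ(1)] sumM[OF E(1,2) uvQ(2)] D(3) E(3) by auto
    ultimately show ?thesis using D(1,2) E(1,2)
      by (intro conjI exI[of _ D] exI[of _ E] exI[of _ x] exI[of _ y] ballI) auto
  qed
  have uniq: "z = u \<otimes>\<^bsub>Q\<^esub> v" if z: "?char z" for z
  proof -
    from z obtain D E x y where D: "dense_orthogonal K D" "x \<in> D \<rightarrow> carrier A"
        "orth_sum M D (\<lambda>\<xi>. \<kappa> (x \<xi>)) u"
      and E: "dense_orthogonal K E" "y \<in> E \<rightarrow> carrier A" "orth_sum M E (\<lambda>\<chi>. \<kappa> (y \<chi>)) v"
      and eq: "\<forall>\<xi>\<in>D. \<forall>\<chi>\<in>E. (\<xi> \<otimes>\<^bsub>K\<^esub> \<chi>) \<odot>\<^bsub>M\<^esub> z = (\<xi> \<otimes>\<^bsub>K\<^esub> \<chi>) \<odot>\<^bsub>M\<^esub> \<kappa> (x \<xi> \<otimes>\<^bsub>A\<^esub> y \<chi>)"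
      by (elim conjE exE)
    have zQ: "z \<in> carrier Q" using z hull orth_closure_closed by blast
    show ?thesis
    proof (rule Q_separates[OF A.R.dense_orthogonal_mult[OF D(1) E(1)] zQ])
      show "u \<otimes>\<^bsub>Q\<^esub> v \<in> carrier Q" using uvQ by (rule T.prod_closed)
      fix \<eta> assume "\<eta> \<in> {\<xi> \<otimes>\<^bsub>K\<^esub> \<chi> | \<xi> \<chi>. \<xi> \<in> D \<and> \<chi> \<in> E}"
      then obtain \<xi> \<chi> where \<eta>: "\<xi> \<in> D" "\<chi> \<in> E" "\<eta> = \<xi> \<otimes>\<^bsub>K\<^esub> \<chi>" by blast
      have c: "\<xi> \<in> carrier K" "\<chi> \<in> carrier K" "x \<xi> \<in> carrier A" "y \<chi> \<in> carrier A"
        using A.R.dense_orthogonalD(2)[OF D(1) \<eta>(1)] A.R.dense_orthogonalD(2)[OF E(1) \<eta>(2)] D(2) E(2) \<eta>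
        by auto
      have "\<eta> \<odot>\<^bsub>Q\<^esub> z = \<eta> \<odot>\<^bsub>Q\<^esub> \<kappa> (x \<xi> \<otimes>\<^bsub>A\<^esub> y \<chi>)"
        using bspec[OF bspec[OF eq \<eta>(1)] \<eta>(2)] c zQ unfolding \<eta>(3)
        by (simp add: M_smult A.prod_closed e_closed)
      then show "\<eta> \<odot>\<^bsub>Q\<^esub> z = \<eta> \<odot>\<^bsub>Q\<^esub> (u \<otimes>\<^bsub>Q\<^esub> v)"
        using local[OF c] sumM[OF D(1,2) uvQ(1)] sumM[OF E(1,2) uvQ(2)] D(3) E(3) \<eta> by simp
    qed
  qed
  have "orth_mult K A M \<kappa> u v = u \<otimes>\<^bsub>Q\<^esub> v"
    unfolding orth_mult_def by (rule the_equality[where P = ?char, OF char uniq])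
  then show ?thesis by (simp add: orth_completion_def)
qed

lemma O_grading: "OG \<gamma> = carrier OA \<inter> QG \<gamma>"
proof -
  have sub: "\<kappa> ` AG \<gamma> \<subseteq> carrier Q" using e_grade T.grade_closed by blast
  have OG: "OG \<gamma> = orth_closure (\<kappa> ` AG \<gamma>)"
    by (simp add: orth_completion_grading_def orth_hull_eq[OF sub])
  show ?thesis unfolding OG O_carrier
  proof safe
    fix u assume u: "u \<in> orth_closure (\<kappa> ` AG \<gamma>)"
    then show "u \<in> orth_closure (\<kappa> ` carrier A)"
      using A.grade_closed unfolding orth_closure_def by blast
    from u show "u \<in> QG \<gamma>"
    proof (rule orth_closureE)
      fix D x
      assume D: "u \<in> carrier Q" "dense_orthogonal K D" "\<And>\<xi>. \<xi> \<in> D \<Longrightarrow> x \<xi> \<in> \<kappa> ` AG \<gamma>"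
        "\<And>\<xi>. \<xi> \<in> D \<Longrightarrow> \<xi> \<odot>\<^bsub>Q\<^esub> u = \<xi> \<odot>\<^bsub>Q\<^esub> x \<xi>"
      have "\<exists>y\<in>QG \<gamma>. \<forall>\<xi>\<in>D. \<xi> \<odot>\<^bsub>Q\<^esub> y = \<xi> \<odot>\<^bsub>Q\<^esub> x \<xi>"
      proof (rule orth_sum_homogeneous[OF D(2)])
        fix \<xi> assume "\<xi> \<in> D"
        then obtain a where "a \<in> AG \<gamma>" "x \<xi> = \<kappa> a" using D(3) by blast
        then show "x \<xi> \<in> QG \<gamma>" using e_grade by simp
      qed
      then obtain y where y: "y \<in> QG \<gamma>" "\<And>\<xi>. \<xi> \<in> D \<Longrightarrow> \<xi> \<odot>\<^bsub>Q\<^esub> y = \<xi> \<odot>\<^bsub>Q\<^esub> x \<xi>" by blast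
      have "u = y" by (rule Q_separates[OF D(2,1) T.grade_closed[OF y(1)]]) (use y D(4) in simp)
      then show ?thesis using y(1) by simp
    qed
  next
    fix u assume u: "u \<in> orth_closure (\<kappa> ` carrier A)" "u \<in> QG \<gamma>"
    have "component Q QG \<gamma> u \<in> orth_closure (\<kappa> ` AG \<gamma>)"
      by (rule orth_closure_component[OF u(1) base_closed]) (auto simp: e_component A.component_in)
    then show "u \<in> orth_closure (\<kappa> ` AG \<gamma>)" using T.component_homogeneous[OF u(2), of \<gamma>] by simp
  qed
qed

lemma O_submodule: "submodule (carrier OA) K Q"
proof (rule T.submoduleI)
  have "\<kappa> \<zero>\<^bsub>A\<^esub> \<in> \<kappa> ` carrier A" by blast
  then show "\<zero>\<^bsub>Q\<^esub> \<in> carrier OA" unfolding O_carrier using orth_closure_incl[OF base_closed] e_zero by auto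
  show "carrier OA \<subseteq> carrier Q" using O_closed by blast
  show smult: "k \<odot>\<^bsub>Q\<^esub> x \<in> carrier OA" if "k \<in> carrier K" "x \<in> carrier OA" for k x
    using that unfolding O_carrier
    by (intro orth_closure_smult[OF _ _ base_closed]) (auto simp: e_smult[symmetric])
  show "\<ominus>\<^bsub>Q\<^esub> x \<in> carrier OA" if "x \<in> carrier OA" for x
    using smult[of "\<ominus>\<^bsub>K\<^esub> \<one>\<^bsub>K\<^esub>" x] that O_closed[OF that] by (simp add: T.smult_l_minus)
  show "x \<oplus>\<^bsub>Q\<^esub> y \<in> carrier OA" if "x \<in> carrier OA" "y \<in> carrier OA" for x y
    using that unfolding O_carrier
    by (intro orth_closure_add[OF _ _ base_closed]) (auto simp: e_add[symmetric])
qed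

lemma O_ops:
  "\<zero>\<^bsub>OA\<^esub> = \<zero>\<^bsub>Q\<^esub>" "\<lbrakk>x \<in> carrier OA; y \<in> carrier OA\<rbrakk> \<Longrightarrow> x \<oplus>\<^bsub>OA\<^esub> y = x \<oplus>\<^bsub>Q\<^esub> y"
  "\<lbrakk>k \<in> carrier K; x \<in> carrier OA\<rbrakk> \<Longrightarrow> k \<odot>\<^bsub>OA\<^esub> x = k \<odot>\<^bsub>Q\<^esub> x"
proof -
  show "\<zero>\<^bsub>OA\<^esub> = \<zero>\<^bsub>Q\<^esub>" by (simp add: orth_completion_def M_zero)
  show "\<lbrakk>x \<in> carrier OA; y \<in> carrier OA\<rbrakk> \<Longrightarrow> x \<oplus>\<^bsub>OA\<^esub> y = x \<oplus>\<^bsub>Q\<^esub> y"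
    using M_add[OF O_closed O_closed] by (simp add: orth_completion_def)
  show "\<lbrakk>k \<in> carrier K; x \<in> carrier OA\<rbrakk> \<Longrightarrow> k \<odot>\<^bsub>OA\<^esub> x = k \<odot>\<^bsub>Q\<^esub> x"
    using M_smult[OF _ O_closed] by (simp add: orth_completion_def)
qed

lemma O_component_closed: "x \<in> carrier OA \<Longrightarrow> component Q QG \<gamma> x \<in> carrier OA"
  unfolding O_carrier
  by (rule orth_closure_component[OF _ base_closed]) (auto simp: e_component A.component_closed)

lemma O_lie: "graded_lie_algebra K OA OG"
  and O_component: "x \<in> carrier OA \<Longrightarrow> component OA OG \<gamma> x = component Q QG \<gamma> x"
  by (rule T.graded_lie_subalgebra[OF O_submodule O_component_closed O_prod_closed refl O_ops(1,2) O_mult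
        O_ops(3) O_grading]; assumption)+

lemma O_embedding: "graded_embedding K OA OG Q QG (\<lambda>x. x)"
  unfolding graded_embedding_def using O_closed by (auto simp: O_ops O_mult O_grading)

sublocale OA: graded_lie_algebra K OA OG by (rule O_lie)

definition ideal_completion :: "'a set \<Rightarrow> 'q set" where
  "ideal_completion V = orth_closure (\<kappa> ` V)"

lemma ideal_completion_ideal:
  assumes V: "homogeneous_ideal K A AG V"
  shows "homogeneous_ideal K OA OG (ideal_completion V)"
proof -
  note Vd = A.homogeneous_idealD[OF V] and sub = base_ideal_closed[OF V]
  have VA: "v \<in> carrier A" if "v \<in> V" for v using that Vd(3) by auto
  have VO: "u \<in> carrier OA" if "u \<in> ideal_completion V" for u
    using that Vd(3) unfolding ideal_completion_def O_carrier orth_closure_def by blast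
  show ?thesis
  proof (rule OA.homogeneous_idealI_left)
    show "ideal_completion V \<subseteq> carrier OA" using VO by blast
    have "\<kappa> \<zero>\<^bsub>A\<^esub> \<in> \<kappa> ` V" using Vd(4) by blast
    then show "\<zero>\<^bsub>OA\<^esub> \<in> ideal_completion V"
      unfolding ideal_completion_def using orth_closure_incl[OF sub] e_zero O_ops(1) by auto
    show "x \<oplus>\<^bsub>OA\<^esub> y \<in> ideal_completion V" if "x \<in> ideal_completion V" "y \<in> ideal_completion V" for x y
      unfolding O_ops(2)[OF VO[OF that(1)] VO[OF that(2)]] using that unfolding ideal_completion_def
      by (intro orth_closure_add[OF _ _ sub]) (auto simp: e_add[symmetric] VA Vd(5))
    show "k \<odot>\<^bsub>OA\<^esub> x \<in> ideal_completion V" if "k \<in> carrier K" "x \<in> ideal_completion V" for k x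
      unfolding O_ops(3)[OF that(1) VO[OF that(2)]] using that unfolding ideal_completion_def
      by (intro orth_closure_smult[OF _ _ sub]) (auto simp: e_smult[symmetric] VA Vd(7))
    show "a \<otimes>\<^bsub>OA\<^esub> x \<in> ideal_completion V" if "a \<in> carrier OA" "x \<in> ideal_completion V" for a x
      unfolding O_mult[OF that(1) VO[OF that(2)]] using that unfolding ideal_completion_def O_carrier
      by (intro orth_closure_prod[OF _ _ base_closed sub]) (auto simp: e_prod[symmetric] VA Vd(8))
    show "component OA OG \<gamma> x \<in> ideal_completion V" if "x \<in> ideal_completion V" for \<gamma> x
      unfolding O_component[OF VO[OF that]] using that unfolding ideal_completion_def
      by (intro orth_closure_component[OF _ sub]) (auto simp: e_component VA Vd(10))
  qed
qed

text \<open>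
  A maximal orthogonal family of idempotents on which single elements of the ideal detect the given
  element is dense, so these elements can be glued.
\<close>

lemma detecting_element:
  assumes U: "U \<in> essential_ideals K A AG" and u: "u \<in> carrier Q"
  shows "\<exists>k\<in>ideal_completion U. \<forall>e\<in>idempotents K. e \<odot>\<^bsub>Q\<^esub> (k \<otimes>\<^bsub>Q\<^esub> u) = \<zero>\<^bsub>Q\<^esub> \<longrightarrow> e \<odot>\<^bsub>Q\<^esub> u = \<zero>\<^bsub>Q\<^esub>"
proof -
  note Ud = A.homogeneous_idealD[OF A.essential_ideal[OF U]]
  have UA: "a \<in> carrier A" if "a \<in> U" for a using that Ud(3) by auto
  define G where "G = {\<xi> \<in> idempotents K. \<exists>k\<in>U. \<forall>e\<in>idempotents K.
    e \<odot>\<^bsub>Q\<^esub> (\<xi> \<odot>\<^bsub>Q\<^esub> (\<kappa> k \<otimes>\<^bsub>Q\<^esub> u)) = \<zero>\<^bsub>Q\<^esub> \<longrightarrow> e \<odot>\<^bsub>Q\<^esub> (\<xi> \<odot>\<^bsub>Q\<^esub> u) = \<zero>\<^bsub>Q\<^esub>}"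
  have G_id: "\<xi> \<in> idempotents K" if "\<xi> \<in> G" for \<xi> using that by (simp add: G_def)
  have below: "\<exists>\<xi>\<in>G. \<xi> \<noteq> \<zero>\<^bsub>K\<^esub> \<and> \<xi> \<otimes>\<^bsub>K\<^esub> \<beta> = \<xi>" if \<beta>: "\<beta> \<in> idempotents K" "\<beta> \<noteq> \<zero>\<^bsub>K\<^esub>" for \<beta>
  proof (cases "\<beta> \<odot>\<^bsub>Q\<^esub> u = \<zero>\<^bsub>Q\<^esub>")
    case True
    note c = A.R.idempotentD[OF \<beta>(1)]
    have "\<beta> \<in> G"
      unfolding G_def using \<beta>(1) Ud(4) True A.R.idempotentD(1) by (auto intro!: bexI[of _ "\<zero>\<^bsub>A\<^esub>"])
    then show ?thesis using \<beta>(2) c by blast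
  next
    case False
    note c = A.R.idempotentD[OF \<beta>(1)]
    obtain W where W: "W \<in> essential_ideals K A AG" "\<forall>a\<in>W. \<kappa> a \<otimes>\<^bsub>Q\<^esub> u \<in> \<kappa> ` carrier A"
      using absorb_carrier[OF u] by blast
    have bu: "\<beta> \<odot>\<^bsub>Q\<^esub> u \<in> carrier Q" using c u by simp
    have "\<exists>k\<in>U \<inter> W. \<kappa> k \<otimes>\<^bsub>Q\<^esub> (\<beta> \<odot>\<^bsub>Q\<^esub> u) \<noteq> \<zero>\<^bsub>Q\<^esub>"
      using faithful_carrier[OF bu A.essential_inter[OF U W(1)]] False by blast
    then obtain k where k: "k \<in> U" "k \<in> W" "\<kappa> k \<otimes>\<^bsub>Q\<^esub> (\<beta> \<odot>\<^bsub>Q\<^esub> u) \<noteq> \<zero>\<^bsub>Q\<^esub>" by blast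
    note kc = e_closed[OF UA[OF k(1)]]
    obtain b where b: "b \<in> carrier A" "\<kappa> k \<otimes>\<^bsub>Q\<^esub> u = \<kappa> b" using W(2) k(2) by blast
    define z where "z = \<beta> \<odot>\<^bsub>A\<^esub> b"
    have z: "z \<in> carrier A" using b c by (simp add: z_def)
    have \<kappa>z: "\<kappa> z = \<beta> \<odot>\<^bsub>Q\<^esub> (\<kappa> k \<otimes>\<^bsub>Q\<^esub> u)" using b c by (simp add: z_def e_smult)
    have "\<kappa> z \<noteq> \<zero>\<^bsub>Q\<^esub>" using k(3) \<kappa>z c kc u by (simp add: T.prod_r_smult)
    then have znz: "z \<noteq> \<zero>\<^bsub>A\<^esub>" using e_zero by auto
    obtain f where f: "f \<in> idempotents K"
      "\<And>\<alpha>. \<alpha> \<in> idempotents K \<Longrightarrow> \<alpha> \<odot>\<^bsub>A\<^esub> z = \<zero>\<^bsub>A\<^esub> \<longleftrightarrow> \<alpha> \<otimes>\<^bsub>K\<^esub> f = \<zero>\<^bsub>K\<^esub>"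
      using A.element_support[OF z] by blast
    note fc = A.R.idempotentD[OF f(1)]
    define \<xi> where "\<xi> = f \<otimes>\<^bsub>K\<^esub> \<beta>"
    have \<xi>_id: "\<xi> \<in> idempotents K" unfolding \<xi>_def by (rule A.R.idempotent_mult[OF f(1) \<beta>(1)])
    have \<beta>z: "\<beta> \<odot>\<^bsub>A\<^esub> z = z" unfolding z_def using A.smult_assoc1[OF c(1) c(1) b(1)] c(2) by simp
    have "\<xi> \<noteq> \<zero>\<^bsub>K\<^esub>"
    proof
      assume "\<xi> = \<zero>\<^bsub>K\<^esub>"
      then have "\<beta> \<otimes>\<^bsub>K\<^esub> f = \<zero>\<^bsub>K\<^esub>" using c fc by (simp add: \<xi>_def A.R.m_comm)
      then have "\<beta> \<odot>\<^bsub>A\<^esub> z = \<zero>\<^bsub>A\<^esub>" using f(2)[OF \<beta>(1)] by simp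
      then show False using \<beta>z znz by simp
    qed
    moreover have "\<xi> \<otimes>\<^bsub>K\<^esub> \<beta> = \<xi>" unfolding \<xi>_def using c fc by (simp add: A.R.m_assoc)
    moreover have "e \<odot>\<^bsub>Q\<^esub> (\<xi> \<odot>\<^bsub>Q\<^esub> u) = \<zero>\<^bsub>Q\<^esub>"
      if e: "e \<in> idempotents K" and 0: "e \<odot>\<^bsub>Q\<^esub> (\<xi> \<odot>\<^bsub>Q\<^esub> (\<kappa> k \<otimes>\<^bsub>Q\<^esub> u)) = \<zero>\<^bsub>Q\<^esub>" for e
    proof -
      note ec = A.R.idempotentD[OF e]
      have "\<kappa> ((e \<otimes>\<^bsub>K\<^esub> f) \<odot>\<^bsub>A\<^esub> z) = e \<odot>\<^bsub>Q\<^esub> (\<xi> \<odot>\<^bsub>Q\<^esub> (\<kappa> k \<otimes>\<^bsub>Q\<^esub> u))"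
        using ec fc c z kc u \<kappa>z
        by (simp add: e_smult \<xi>_def T.smult_assoc1 T.prod_closed)
      then have "(e \<otimes>\<^bsub>K\<^esub> f) \<odot>\<^bsub>A\<^esub> z = \<zero>\<^bsub>A\<^esub>" using 0 e_zero e_inj z ec fc by simp
      then have "(e \<otimes>\<^bsub>K\<^esub> f) \<otimes>\<^bsub>K\<^esub> f = \<zero>\<^bsub>K\<^esub>" using f(2)[OF A.R.idempotent_mult[OF e f(1)]] by simp
      then have ef: "e \<otimes>\<^bsub>K\<^esub> f = \<zero>\<^bsub>K\<^esub>" using ec fc by (simp add: A.R.m_assoc)
      have "e \<odot>\<^bsub>Q\<^esub> (\<xi> \<odot>\<^bsub>Q\<^esub> u) = (e \<otimes>\<^bsub>K\<^esub> f) \<odot>\<^bsub>Q\<^esub> (\<beta> \<odot>\<^bsub>Q\<^esub> u)"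
        using ec fc c u by (simp add: \<xi>_def T.smult_assoc1)
      then show ?thesis using ef bu by simp
    qed
    then have "\<xi> \<in> G" unfolding G_def using \<xi>_id k(1) by blast
    ultimately show ?thesis by blast
  qed
  define orth where "orth = {D. D \<subseteq> G \<and> (\<forall>\<xi>\<in>D. \<forall>\<chi>\<in>D. \<xi> \<noteq> \<chi> \<longrightarrow> \<xi> \<otimes>\<^bsub>K\<^esub> \<chi> = \<zero>\<^bsub>K\<^esub>)}"
  have "\<exists>D\<in>orth. \<forall>D'\<in>orth. D \<subseteq> D' \<longrightarrow> D' = D"
  proof (rule subset_Zorn')
    fix \<C> assume chain: "subset.chain orth \<C>"
    then have sub: "\<C> \<subseteq> orth" and tot: "\<And>D D'. \<lbrakk>D \<in> \<C>; D' \<in> \<C>\<rbrakk> \<Longrightarrow> D \<subseteq> D' \<or> D' \<subseteq> D"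
      by (auto simp: subset_chain_def)
    have "\<xi> \<otimes>\<^bsub>K\<^esub> \<chi> = \<zero>\<^bsub>K\<^esub>" if h: "\<xi> \<in> \<Union>\<C>" "\<chi> \<in> \<Union>\<C>" "\<xi> \<noteq> \<chi>" for \<xi> \<chi>
    proof -
      obtain D D' where DD: "D \<in> \<C>" "\<xi> \<in> D" "D' \<in> \<C>" "\<chi> \<in> D'" using h by blast
      then obtain D'' where "D'' \<in> \<C>" "\<xi> \<in> D''" "\<chi> \<in> D''" using tot[OF DD(1,3)] by blast
      then show ?thesis using sub h(3) unfolding orth_def by blast
    qed
    then show "\<Union>\<C> \<in> orth" using sub unfolding orth_def by blast
  qed
  then obtain D where D: "D \<in> orth" and max: "\<And>D'. \<lbrakk>D' \<in> orth; D \<subseteq> D'\<rbrakk> \<Longrightarrow> D' = D" by blast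
  have DG: "D \<subseteq> G" and Dorth: "\<And>\<xi> \<chi>. \<lbrakk>\<xi> \<in> D; \<chi> \<in> D; \<xi> \<noteq> \<chi>\<rbrakk> \<Longrightarrow> \<xi> \<otimes>\<^bsub>K\<^esub> \<chi> = \<zero>\<^bsub>K\<^esub>"
    using D by (auto simp: orth_def)
  have dense: "dense_orthogonal K D"
  proof (rule A.R.dense_orthogonalI)
    show "\<xi> \<in> idempotents K" if "\<xi> \<in> D" for \<xi> using that DG G_id by blast
    show "\<xi> \<otimes>\<^bsub>K\<^esub> \<chi> = \<zero>\<^bsub>K\<^esub>" if "\<xi> \<in> D" "\<chi> \<in> D" "\<xi> \<noteq> \<chi>" for \<xi> \<chi> using Dorth that .
    fix \<beta> assume \<beta>: "\<beta> \<in> idempotents K" and ann: "\<And>\<xi>. \<xi> \<in> D \<Longrightarrow> \<beta> \<otimes>\<^bsub>K\<^esub> \<xi> = \<zero>\<^bsub>K\<^esub>"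
    show "\<beta> = \<zero>\<^bsub>K\<^esub>"
    proof (rule ccontr)
      assume "\<beta> \<noteq> \<zero>\<^bsub>K\<^esub>"
      then obtain \<xi> where \<xi>: "\<xi> \<in> G" "\<xi> \<noteq> \<zero>\<^bsub>K\<^esub>" "\<xi> \<otimes>\<^bsub>K\<^esub> \<beta> = \<xi>" using below[OF \<beta>] by blast
      note \<xi>c = A.R.idempotentD[OF G_id[OF \<xi>(1)]] and \<beta>c = A.R.idempotentD[OF \<beta>]
      have z: "\<xi> \<otimes>\<^bsub>K\<^esub> \<chi> = \<zero>\<^bsub>K\<^esub>" "\<chi> \<otimes>\<^bsub>K\<^esub> \<xi> = \<zero>\<^bsub>K\<^esub>" if \<chi>: "\<chi> \<in> D" for \<chi>
      proof -
        have \<chi>c: "\<chi> \<in> carrier K" using A.R.idempotentD(1) G_id DG \<chi> by blast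
        have "\<xi> \<otimes>\<^bsub>K\<^esub> \<chi> = \<xi> \<otimes>\<^bsub>K\<^esub> (\<beta> \<otimes>\<^bsub>K\<^esub> \<chi>)" using \<xi>(3) \<xi>c \<beta>c \<chi>c by (simp add: A.R.m_assoc[symmetric])
        then show "\<xi> \<otimes>\<^bsub>K\<^esub> \<chi> = \<zero>\<^bsub>K\<^esub>" using ann[OF \<chi>] \<xi>c by simp
        then show "\<chi> \<otimes>\<^bsub>K\<^esub> \<xi> = \<zero>\<^bsub>K\<^esub>" using \<xi>c \<chi>c by (simp add: A.R.m_comm)
      qed
      have "insert \<xi> D \<in> orth"
        unfolding orth_def using DG \<xi>(1) Dorth z by blast
      then have "\<xi> \<in> D" using max by blast
      then show False using z(1)[of \<xi>] \<xi>c(2) \<xi>(2) by simp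
    qed
  qed
  note Dd = A.R.dense_orthogonalD[OF dense]
  have "\<forall>\<xi>\<in>D. \<exists>k. k \<in> U \<and> (\<forall>e\<in>idempotents K.
    e \<odot>\<^bsub>Q\<^esub> (\<xi> \<odot>\<^bsub>Q\<^esub> (\<kappa> k \<otimes>\<^bsub>Q\<^esub> u)) = \<zero>\<^bsub>Q\<^esub> \<longrightarrow> e \<odot>\<^bsub>Q\<^esub> (\<xi> \<odot>\<^bsub>Q\<^esub> u) = \<zero>\<^bsub>Q\<^esub>)"
    using DG unfolding G_def by blast
  from bchoice[OF this] obtain k where k: "\<And>\<xi>. \<xi> \<in> D \<Longrightarrow> k \<xi> \<in> U"
    "\<And>\<xi> e. \<lbrakk>\<xi> \<in> D; e \<in> idempotents K; e \<odot>\<^bsub>Q\<^esub> (\<xi> \<odot>\<^bsub>Q\<^esub> (\<kappa> (k \<xi>) \<otimes>\<^bsub>Q\<^esub> u)) = \<zero>\<^bsub>Q\<^esub>\<rbrakk>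
      \<Longrightarrow> e \<odot>\<^bsub>Q\<^esub> (\<xi> \<odot>\<^bsub>Q\<^esub> u) = \<zero>\<^bsub>Q\<^esub>" by blast
  have kQ: "\<kappa> (k \<xi>) \<in> carrier Q" if "\<xi> \<in> D" for \<xi> using e_closed[OF UA[OF k(1)[OF that]]] .
  have "\<exists>s\<in>carrier Q. orth_sum Q D (\<lambda>\<xi>. \<kappa> (k \<xi>)) s" by (rule orth_sum_exists[OF dense kQ])
  then obtain s where s: "s \<in> carrier Q" "\<And>\<xi>. \<xi> \<in> D \<Longrightarrow> \<xi> \<odot>\<^bsub>Q\<^esub> s = \<xi> \<odot>\<^bsub>Q\<^esub> \<kappa> (k \<xi>)"
    unfolding orth_sum_def by blast
  have "s \<in> ideal_completion U"
    unfolding ideal_completion_def by (rule orth_closureI[OF s(1) dense _ s(2)]) (use k(1) in auto)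
  moreover have "e \<odot>\<^bsub>Q\<^esub> u = \<zero>\<^bsub>Q\<^esub>" if e: "e \<in> idempotents K" and 0: "e \<odot>\<^bsub>Q\<^esub> (s \<otimes>\<^bsub>Q\<^esub> u) = \<zero>\<^bsub>Q\<^esub>" for e
  proof (rule Q_separates[OF dense])
    note ec = A.R.idempotentD(1)[OF e]
    show "e \<odot>\<^bsub>Q\<^esub> u \<in> carrier Q" "\<zero>\<^bsub>Q\<^esub> \<in> carrier Q" using ec u by simp_all
    have swap: "\<xi> \<odot>\<^bsub>Q\<^esub> (e \<odot>\<^bsub>Q\<^esub> w) = e \<odot>\<^bsub>Q\<^esub> (\<xi> \<odot>\<^bsub>Q\<^esub> w)" if "\<xi> \<in> carrier K" "w \<in> carrier Q" for \<xi> w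
      using T.smult_assoc1[of \<xi> e w] T.smult_assoc1[of e \<xi> w] A.R.m_comm[of \<xi> e] ec that by simp
    fix \<xi> assume \<xi>: "\<xi> \<in> D"
    have "\<xi> \<odot>\<^bsub>Q\<^esub> (\<kappa> (k \<xi>) \<otimes>\<^bsub>Q\<^esub> u) = (\<xi> \<odot>\<^bsub>Q\<^esub> s) \<otimes>\<^bsub>Q\<^esub> u"
      using s(2)[OF \<xi>] Dd(2)[OF \<xi>] kQ[OF \<xi>] u by (simp add: T.prod_l_smult[symmetric])
    also have "\<dots> = \<xi> \<odot>\<^bsub>Q\<^esub> (s \<otimes>\<^bsub>Q\<^esub> u)" using Dd(2)[OF \<xi>] s(1) u by (simp add: T.prod_l_smult)
    finally have "e \<odot>\<^bsub>Q\<^esub> (\<xi> \<odot>\<^bsub>Q\<^esub> (\<kappa> (k \<xi>) \<otimes>\<^bsub>Q\<^esub> u)) = \<xi> \<odot>\<^bsub>Q\<^esub> (e \<odot>\<^bsub>Q\<^esub> (s \<otimes>\<^bsub>Q\<^esub> u))"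
      using swap[OF Dd(2)[OF \<xi>] T.prod_closed[OF s(1) u]] by simp
    then have "e \<odot>\<^bsub>Q\<^esub> (\<xi> \<odot>\<^bsub>Q\<^esub> u) = \<zero>\<^bsub>Q\<^esub>" using k(2)[OF \<xi> e] 0 Dd(2)[OF \<xi>] by simp
    then show "\<xi> \<odot>\<^bsub>Q\<^esub> (e \<odot>\<^bsub>Q\<^esub> u) = \<xi> \<odot>\<^bsub>Q\<^esub> \<zero>\<^bsub>Q\<^esub>" using swap[OF Dd(2)[OF \<xi>] u] Dd(2)[OF \<xi>] by simp
  qed
  ultimately show ?thesis by blast
qed

theorem ultra_quotients:
  assumes B: "idempotent_ultrafilter K B"
  shows "graded_algebra_of_quotients K (ultra_quotient K B OA) (ultra_quotient_grading K B OA OG)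
    (ultra_quotient K B Q) (ultra_quotient_grading K B Q QG) (ultra_inclusion K B Q)"
proof -
  interpret UQ: ultra_lie K Q QG B by unfold_locales (rule B)
  interpret UO: ultra_lie K OA OG B by unfold_locales (rule B)
  let ?i = "ultra_inclusion K B Q"
  have kernels: "x \<in> UO.N \<longleftrightarrow> x \<in> UQ.N" if "x \<in> carrier OA" for x
    unfolding UO.ultra_kernel_iff UQ.ultra_kernel_iff
    using that O_closed A.R.idempotentD(1)[OF UQ.ultraD(1)] by (simp add: O_ops cong: bex_cong)
  have incl: "?i (UO.coset x) = UQ.coset x" if x: "x \<in> carrier OA" for x
  proof -
    have xQ: "x \<in> carrier Q" using O_closed[OF x] .
    have eq: "UQ.coset y = UQ.coset x" if y: "y \<in> UO.coset x" for y
    proof -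
      obtain n where n: "n \<in> UO.N" "y = n \<oplus>\<^bsub>OA\<^esub> x" using y unfolding UO.coset_def' by blast
      have nO: "n \<in> carrier OA" using UO.kernel_closed[OF n(1)] .
      have "UQ.coset (n \<oplus>\<^bsub>Q\<^esub> x) = UQ.coset x" by (rule UQ.coset_cong[OF xQ]) (use kernels[OF nO] n(1) in simp)
      then show ?thesis using n(2) O_ops(2)[OF nO x] by simp
    qed
    have "x \<in> UO.coset x" using UO.kernelD(2) x by (force simp: UO.coset_def')
    moreover have "?i (UO.coset x) = (\<Union>y\<in>UO.coset x. UQ.coset y)"
      by (simp add: ultra_inclusion_def UQ.coset_def)
    ultimately show ?thesis using eq by blast
  qed
  have minusO: "x \<ominus>\<^bsub>OA\<^esub> y = x \<ominus>\<^bsub>Q\<^esub> y" if "x \<in> carrier OA" "y \<in> carrier OA" for x y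
  proof -
    have "\<ominus>\<^bsub>OA\<^esub> y = \<ominus>\<^bsub>Q\<^esub> y"
      by (rule T.M.abelian_group_restrict(2)[OF submodule.axioms(1)[OF O_submodule] refl O_ops(1,2) that(2)])
    moreover have "\<ominus>\<^bsub>OA\<^esub> y \<in> carrier OA" using that(2) by simp
    ultimately show ?thesis using that O_ops(2)[of x "\<ominus>\<^bsub>OA\<^esub> y"] by (simp add: a_minus_def)
  qed
  show ?thesis
    unfolding graded_algebra_of_quotients_def
  proof (intro conjI allI ballI impI UO.quot.image_lie UQ.quot.image_lie)
    show "graded_embedding K UO.AB UO.ABG UQ.AB UQ.ABG ?i"
      unfolding graded_embedding_def
    proof (intro conjI ballI allI)
      show "?i \<in> carrier UO.AB \<rightarrow> carrier UQ.AB"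
        using O_closed by (auto simp: UO.quot.image(1) UQ.quot.image(1) incl)
      show "inj_on ?i (carrier UO.AB)"
      proof (rule inj_onI)
        fix X Y assume XY: "X \<in> carrier UO.AB" "Y \<in> carrier UO.AB" "?i X = ?i Y"
        then obtain x y where xy: "x \<in> carrier OA" "X = UO.coset x" "y \<in> carrier OA" "Y = UO.coset y"
          unfolding UO.quot.image(1) by blast
        have "UQ.coset x = UQ.coset y" using XY(3) xy incl by simp
        then have "x \<ominus>\<^bsub>Q\<^esub> y \<in> UQ.N" using UQ.coset_eq O_closed xy by simp
        moreover have "x \<ominus>\<^bsub>OA\<^esub> y \<in> carrier OA" using xy by simp
        ultimately have "x \<ominus>\<^bsub>OA\<^esub> y \<in> UO.N" using kernels minusO[OF xy(1,3)] by metis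
        then show "X = Y" using UO.coset_eq xy by simp
      qed
      fix X Y assume "X \<in> carrier UO.AB" "Y \<in> carrier UO.AB"
      then obtain x y where xy: "x \<in> carrier OA" "X = UO.coset x" "y \<in> carrier OA" "Y = UO.coset y"
        unfolding UO.quot.image(1) by blast
      note c = O_closed[OF xy(1)] O_closed[OF xy(3)]
      show "?i (X \<oplus>\<^bsub>UO.AB\<^esub> Y) = ?i X \<oplus>\<^bsub>UQ.AB\<^esub> ?i Y"
        using xy c by (simp add: UO.quot.image_add incl UQ.quot.image_add O_ops(2)[symmetric])
      show "?i (X \<otimes>\<^bsub>UO.AB\<^esub> Y) = ?i X \<otimes>\<^bsub>UQ.AB\<^esub> ?i Y"
        using xy c by (simp add: UO.quot.image_prod incl UQ.quot.image_prod O_mult O_prod_closed)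
    next
      fix k X assume k: "k \<in> carrier K" and "X \<in> carrier UO.AB"
      then obtain x where x: "x \<in> carrier OA" "X = UO.coset x" unfolding UO.quot.image(1) by blast
      then show "?i (k \<odot>\<^bsub>UO.AB\<^esub> X) = k \<odot>\<^bsub>UQ.AB\<^esub> ?i X"
        using k O_closed[OF x(1)] by (simp add: UO.quot.image_smult incl UQ.quot.image_smult O_ops(3)[symmetric])
    next
      fix \<gamma> show "?i ` UO.ABG \<gamma> \<subseteq> UQ.ABG \<gamma>"
        unfolding UO.quot.image(2) UQ.quot.image(2) using incl by (auto simp: O_grading)
    qed
  next
    fix \<gamma> X assume X: "X \<in> UQ.ABG \<gamma>" "X \<noteq> \<zero>\<^bsub>UQ.AB\<^esub>"
    obtain q where q: "q \<in> QG \<gamma>" "X = UQ.coset q" using X(1) unfolding UQ.quot.image(2) by blast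
    have qQ: "q \<in> carrier Q" using q(1) T.grade_closed by blast
    obtain U where U: "U \<in> essential_ideals K A AG" "\<forall>a\<in>U. \<kappa> a \<otimes>\<^bsub>Q\<^esub> q \<in> \<kappa> ` carrier A"
      using absorb[OF q(1)] by blast
    let ?V = "ideal_completion U"
    have V: "homogeneous_ideal K OA OG ?V" by (rule ideal_completion_ideal[OF A.essential_ideal[OF U(1)]])
    have VO: "k \<in> carrier OA" if "k \<in> ?V" for k using that OA.homogeneous_idealD(3)[OF V] by blast
    have detect: "\<exists>k\<in>?V. k \<otimes>\<^bsub>Q\<^esub> u \<notin> UQ.N" if u: "u \<in> carrier Q" "u \<notin> UQ.N" for u
    proof -
      obtain k where k: "k \<in> ?V" "\<forall>e\<in>idempotents K. e \<odot>\<^bsub>Q\<^esub> (k \<otimes>\<^bsub>Q\<^esub> u) = \<zero>\<^bsub>Q\<^esub> \<longrightarrow> e \<odot>\<^bsub>Q\<^esub> u = \<zero>\<^bsub>Q\<^esub>"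
        using detecting_element[OF U(1) u(1)] by blast
      have "k \<otimes>\<^bsub>Q\<^esub> u \<notin> UQ.N"
      proof
        assume "k \<otimes>\<^bsub>Q\<^esub> u \<in> UQ.N"
        then obtain e where "e \<in> B" "e \<odot>\<^bsub>Q\<^esub> (k \<otimes>\<^bsub>Q\<^esub> u) = \<zero>\<^bsub>Q\<^esub>" unfolding UQ.ultra_kernel_iff by blast
        then have "e \<odot>\<^bsub>Q\<^esub> u = \<zero>\<^bsub>Q\<^esub>" using k(2) UQ.ultraD(1) by blast
        then show False using u \<open>e \<in> B\<close> unfolding UQ.ultra_kernel_iff by blast
      qed
      then show ?thesis using k(1) by blast
    qed
    have "homogeneous_ideal K UO.AB UO.ABG (UO.coset ` ?V)" by (rule UO.quot.image_ideal[OF V])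
    moreover have "annihilator UO.AB (UO.coset ` ?V) = {\<zero>\<^bsub>UO.AB\<^esub>}"
    proof -
      have "Y = \<zero>\<^bsub>UO.AB\<^esub>" if Y: "Y \<in> annihilator UO.AB (UO.coset ` ?V)" for Y
      proof (rule ccontr)
        assume nz: "Y \<noteq> \<zero>\<^bsub>UO.AB\<^esub>"
        have "Y \<in> carrier UO.AB" using Y by (simp add: annihilator_def)
        then obtain u where u: "u \<in> carrier OA" "Y = UO.coset u" unfolding UO.quot.image(1) by blast
        have "u \<notin> UO.N" using nz UO.coset_kernel_iff[OF u(1)] u(2) UO.quot.image(3) by simp
        then have "u \<notin> UQ.N" using kernels[OF u(1)] by simp
        then obtain k where k: "k \<in> ?V" "k \<otimes>\<^bsub>Q\<^esub> u \<notin> UQ.N" using detect[OF O_closed[OF u(1)]] by blast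
        note kO = VO[OF k(1)]
        have "Y \<otimes>\<^bsub>UO.AB\<^esub> UO.coset k = \<zero>\<^bsub>UO.AB\<^esub>" using Y k(1) by (simp add: annihilator_def)
        then have "UO.coset (u \<otimes>\<^bsub>OA\<^esub> k) = UO.coset \<zero>\<^bsub>OA\<^esub>"
          using u kO UO.quot.image_prod UO.quot.image(3) by simp
        then have "u \<otimes>\<^bsub>OA\<^esub> k \<in> UO.N" using UO.coset_kernel_iff[OF OA.prod_closed[OF u(1) kO]] by simp
        then have "u \<otimes>\<^bsub>Q\<^esub> k \<in> UQ.N" using kernels[OF O_prod_closed[OF u(1) kO]] O_mult[OF u(1) kO] by simp
        then have "\<ominus>\<^bsub>Q\<^esub> (u \<otimes>\<^bsub>Q\<^esub> k) \<in> UQ.N" by (rule UQ.kernelD(4))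
        then show False using k(2) T.anticommutative[OF O_closed[OF u(1)] O_closed[OF kO]] by simp
      qed
      moreover have "\<zero>\<^bsub>UO.AB\<^esub> \<in> annihilator UO.AB (UO.coset ` ?V)"
        using VO UO.quot.image(1) unfolding annihilator_def
        by (auto simp: UO.quot.image(3) UO.quot.image_prod OA.prod_l_zero)
      ultimately show ?thesis by blast
    qed
    moreover have "?i Y \<otimes>\<^bsub>UQ.AB\<^esub> X \<in> ?i ` carrier UO.AB" if Y: "Y \<in> UO.coset ` ?V" for Y
    proof -
      obtain k where k: "k \<in> ?V" "Y = UO.coset k" using Y by blast
      note kO = VO[OF k(1)]
      have "k \<otimes>\<^bsub>Q\<^esub> q \<in> orth_closure (\<kappa> ` carrier A)"
        by (rule orth_closure_prod[OF k(1)[unfolded ideal_completion_def] subsetD[OF orth_closure_incl, of "{q}"]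
              base_ideal_closed[OF A.essential_ideal[OF U(1)]]])
          (use qQ U(2) in auto)
      then have kq: "k \<otimes>\<^bsub>Q\<^esub> q \<in> carrier OA" unfolding O_carrier .
      have "?i Y \<otimes>\<^bsub>UQ.AB\<^esub> X = ?i (UO.coset (k \<otimes>\<^bsub>Q\<^esub> q))"
        using incl[OF kO] incl[OF kq] k(2) q(2) UQ.quot.image_prod[OF O_closed[OF kO] qQ] by simp
      then show ?thesis using kq UO.quot.image(1) by blast
    qed
    moreover have "\<exists>Y\<in>UO.coset ` ?V. ?i Y \<otimes>\<^bsub>UQ.AB\<^esub> X \<noteq> \<zero>\<^bsub>UQ.AB\<^esub>"
    proof -
      have "q \<notin> UQ.N" using X(2) q(2) UQ.coset_kernel_iff[OF qQ] UQ.quot.image(3) by simp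
      then obtain k where k: "k \<in> ?V" "k \<otimes>\<^bsub>Q\<^esub> q \<notin> UQ.N" using detect[OF qQ] by blast
      note kO = VO[OF k(1)]
      have "?i (UO.coset k) \<otimes>\<^bsub>UQ.AB\<^esub> X = UQ.coset (k \<otimes>\<^bsub>Q\<^esub> q)"
        using incl[OF kO] q(2) UQ.quot.image_prod[OF O_closed[OF kO] qQ] by simp
      then have "?i (UO.coset k) \<otimes>\<^bsub>UQ.AB\<^esub> X \<noteq> \<zero>\<^bsub>UQ.AB\<^esub>"
        using k(2) UQ.coset_kernel_iff[OF T.prod_closed[OF O_closed[OF kO] qQ]] UQ.quot.image(3) by simp
      then show ?thesis using k(1) by blast
    qed
    ultimately show "\<exists>I. homogeneous_ideal K UO.AB UO.ABG I \<and> annihilator UO.AB I = {\<zero>\<^bsub>UO.AB\<^esub>} \<and>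
        (\<forall>x\<in>I. ?i x \<otimes>\<^bsub>UQ.AB\<^esub> X \<in> ?i ` carrier UO.AB) \<and> (\<exists>x\<in>I. ?i x \<otimes>\<^bsub>UQ.AB\<^esub> X \<noteq> \<zero>\<^bsub>UQ.AB\<^esub>)"
      by blast
  qed
qed

end


section \<open>The graded central closure as an algebra of quotients\<close>

lemma (in graded_hull) dense_separates_hull:
  assumes S: "\<And>x. \<lbrakk>x \<in> carrier A; \<And>\<xi>. \<xi> \<in> D \<Longrightarrow> \<xi> \<odot>\<^bsub>A\<^esub> x = \<zero>\<^bsub>A\<^esub>\<rbrakk> \<Longrightarrow> x = \<zero>\<^bsub>A\<^esub>" and D: "D \<subseteq> carrier K"
    and m: "m \<in> carrier I" "n \<in> carrier I" "\<And>\<xi>. \<xi> \<in> D \<Longrightarrow> kact \<xi> m = kact \<xi> n"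
  shows "m = n"
proof -
  define Z where "Z = {z \<in> carrier I. \<forall>\<xi>\<in>D. kact \<xi> z = \<zero>\<^bsub>I\<^esub>}"
  have Z: "homogeneous_right_submodule (mult_alg K A) I IG Z"
  proof (rule homogeneous_right_submoduleI)
    have D': "\<xi> \<in> carrier K" if "\<xi> \<in> D" for \<xi> using that D by auto
    show "Z \<subseteq> carrier I" "\<zero>\<^bsub>I\<^esub> \<in> Z" using D' by (auto simp: Z_def kact_zero)
    show "p \<oplus>\<^bsub>I\<^esub> q \<in> Z" if "p \<in> Z" "q \<in> Z" for p q using that D' by (simp add: Z_def kact_add)
    show "kact k p \<in> Z" if k: "k \<in> carrier K" and p: "p \<in> Z" for k p
    proof -
      have "kact \<xi> (kact k p) = \<zero>\<^bsub>I\<^esub>" if \<xi>: "\<xi> \<in> D" for \<xi>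
        using mult_kact[OF D'[OF \<xi>] k, of p] mult_kact[OF k D'[OF \<xi>], of p] R.m_comm[OF k D'[OF \<xi>]]
          p \<xi> k by (simp add: Z_def kact_zero)
      then show ?thesis using k p by (simp add: Z_def kact_closed)
    qed
    show "lact x p \<in> Z" if x: "x \<in> carrier A" and p: "p \<in> Z" for x p
    proof -
      have "kact \<xi> (lact x p) = \<zero>\<^bsub>I\<^esub>" if \<xi>: "\<xi> \<in> D" for \<xi>
        using smult_lact(1)[OF D'[OF \<xi>] x, of p] smult_lact(2)[OF D'[OF \<xi>] x, of p] p \<xi> x
        by (simp add: Z_def lact_zero)
      then show ?thesis using x p by (simp add: Z_def lact_closed)
    qed
    show "component I IG \<gamma> p \<in> Z" if "p \<in> Z" for \<gamma> p
      using that D' by (simp add: Z_def component_kact[symmetric] Im.component_closed Im.component_zero)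
  qed
  have d: "m \<oplus>\<^bsub>I\<^esub> \<ominus>\<^bsub>I\<^esub> n \<in> Z"
    using m D by (auto simp: Z_def kact_add kact_neg Im.M.r_neg kact_closed subset_iff)
  have "m \<oplus>\<^bsub>I\<^esub> \<ominus>\<^bsub>I\<^esub> n = \<zero>\<^bsub>I\<^esub>"
  proof (rule ccontr)
    assume "m \<oplus>\<^bsub>I\<^esub> \<ominus>\<^bsub>I\<^esub> n \<noteq> \<zero>\<^bsub>I\<^esub>"
    then obtain x where x: "x \<in> carrier A" "\<iota> x \<in> Z" "x \<noteq> \<zero>\<^bsub>A\<^esub>" using submodule_meets[OF Z d] by blast
    have "\<xi> \<odot>\<^bsub>A\<^esub> x = \<zero>\<^bsub>A\<^esub>" if \<xi>: "\<xi> \<in> D" for \<xi>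
    proof -
      have "\<iota> (\<xi> \<odot>\<^bsub>A\<^esub> x) = \<iota> \<zero>\<^bsub>A\<^esub>" using x \<xi> D by (auto simp: \<iota>_smult \<iota>_zero Z_def)
      then show ?thesis using \<iota>_inj x(1) \<xi> D by auto
    qed
    then show False using S x by blast
  qed
  then show ?thesis using Im.M.minus_equality[of m "\<ominus>\<^bsub>I\<^esub> n"] m by simp
qed

lemma (in graded_hull) central_closure_supported: "supported_lie_algebra CM PA PG"
proof (intro supported_lie_algebra.intro supported_lie_algebra_axioms.intro
    semiprime_graded_lie_algebra.intro semiprime_graded_lie_algebra_axioms.intro
    central_closure_lie central_closure_semiprime)
  fix V assume "homogeneous_ideal CM PA PG V"
  from support_idempotent[OF this]
  show "\<exists>e\<in>idempotents CM. \<forall>\<alpha>\<in>idempotents CM. (\<forall>v\<in>V. \<alpha> \<odot>\<^bsub>PA\<^esub> v = \<zero>\<^bsub>PA\<^esub>) \<longleftrightarrow> \<alpha> \<otimes>\<^bsub>CM\<^esub> e = \<zero>\<^bsub>CM\<^esub>"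
    unfolding central_closure_simps by (auto simp: idempotents_def)
qed

lemma (in graded_hull) central_closure_orth_in_module:
  fixes J :: "('i \<Rightarrow> 'i, 'j) module"
  assumes fin: "finite_grading A AG" and J: "hull_of_algebra CM PA PG J JG \<kappa>"
    and Q: "maximal_graded_quotients CM PA PG Q QG \<kappa>" and real: "realised_in CM PA J JG \<kappa> Q QG"
  shows "orth_in_module CM PA PG Q QG \<kappa> (scalars_of PA J)"
proof -
  interpret S: supported_lie_algebra CM PA PG by (rule central_closure_supported)
  interpret H: graded_hull CM PA PG J JG \<kappa> by unfold_locales (rule J)
  have Q_sub: "subgroup (carrier Q) (add_monoid J)"
    using real by (simp add: realised_in_def homogeneous_right_submodule_def)
  show ?thesis
  proof (intro orth_in_module.intro orth_quotients.intro orth_in_module_axioms.intro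
      orth_quotients_axioms.intro S.supported_lie_algebra_axioms Q central_closure_finite[OF fin]
      graded_quotients_if_maximal[OF S.graded_lie_algebra_axioms S.semiprime Q])
    show "carrier Q \<subseteq> carrier (scalars_of PA J)"
      using H.Im.M.subgroup_add_monoidD(1)[OF Q_sub] by (simp add: scalars_of_def)
    show "\<zero>\<^bsub>scalars_of PA J\<^esub> = \<zero>\<^bsub>Q\<^esub>" using real by (simp add: realised_in_def scalars_of_def)
    show "x \<oplus>\<^bsub>scalars_of PA J\<^esub> y = x \<oplus>\<^bsub>Q\<^esub> y" if "x \<in> carrier Q" "y \<in> carrier Q" for x y
      using real that by (simp add: realised_in_def scalars_of_def)
    show "k \<odot>\<^bsub>scalars_of PA J\<^esub> x = k \<odot>\<^bsub>Q\<^esub> x" if "k \<in> carrier CM" "x \<in> carrier Q" for k x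
      using real that by (simp add: realised_in_def scalars_of_def)
    show "x = y" if D: "dense_orthogonal CM D" and x: "x \<in> carrier (scalars_of PA J)"
        "y \<in> carrier (scalars_of PA J)"
        "\<And>\<xi>. \<xi> \<in> D \<Longrightarrow> \<xi> \<odot>\<^bsub>scalars_of PA J\<^esub> x = \<xi> \<odot>\<^bsub>scalars_of PA J\<^esub> y" for D x y
    proof (rule H.dense_separates_hull)
      show "D \<subseteq> carrier CM" using S.R.dense_orthogonalD(2)[OF D] by blast
      show "z = \<zero>\<^bsub>PA\<^esub>" if "z \<in> carrier PA" "\<And>\<xi>. \<xi> \<in> D \<Longrightarrow> \<xi> \<odot>\<^bsub>PA\<^esub> z = \<zero>\<^bsub>PA\<^esub>" for z
        using S.dense_separates[OF D that] .
      show "x \<in> carrier J" "y \<in> carrier J" using x by (simp_all add: scalars_of_def)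
      show "H.kact \<xi> x = H.kact \<xi> y" if "\<xi> \<in> D" for \<xi>
        using x(3)[OF that] by (simp add: scalars_of_def H.kact_def)
    qed
  qed
qed

theorem proposition3p1:
  fixes F :: "('f, 'n) ring_scheme"
    and R :: "('f, 'r) module" and RG :: "'g::ab_group_add \<Rightarrow> 'r set"
    and I :: "('r \<Rightarrow> 'r, 'i) module" and IG :: "'g \<Rightarrow> 'i set" and \<iota> :: "'r \<Rightarrow> 'i"
    and CM :: "('i \<Rightarrow> 'i) ring"
    and P :: "('i \<Rightarrow> 'i, 'i) module" and P\<^sub>F :: "('f, 'i) module" and PG :: "'g \<Rightarrow> 'i set"
  assumes lie: "graded_lie_algebra F R RG"
    and semiprime: "homogeneously_semiprime F R RG"
    and fin: "finite_grading R RG"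
    and hull_R: "hull_of_algebra F R RG I IG \<iota>"
    and CM: "CM = extended_centroid F R I IG \<iota>"
    and P: "P = central_closure F R I IG \<iota>"
    and P\<^sub>F: "P\<^sub>F = central_closure_base F R I IG \<iota>"
    and PG: "PG = central_closure_grading F R I IG \<iota> RG"
  shows "graded_algebra_of_quotients F R RG P\<^sub>F PG \<iota> \<and>
    (\<forall>(QR :: ('f, 'q) module) QRG \<epsilon>.
      maximal_graded_quotients F R RG QR QRG \<epsilon> \<longrightarrow>
      (\<exists>\<psi>. graded_embedding F P\<^sub>F PG QR QRG \<psi> \<and> (\<forall>x\<in>carrier R. \<psi> (\<iota> x) = \<epsilon> x))) \<and>
    (\<forall>(J :: ('i \<Rightarrow> 'i, 'j) module) JG \<kappa> Q QG.
      hull_of_algebra CM P PG J JG \<kappa> \<and>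
      maximal_graded_quotients CM P PG Q QG \<kappa> \<and> realised_in CM P J JG \<kappa> Q QG \<longrightarrow>
      (let J\<^sub>C = scalars_of P J;
           O\<^sub>P = orth_completion CM P J\<^sub>C \<kappa>;
           OG = orth_completion_grading CM PG J\<^sub>C \<kappa>
       in carrier O\<^sub>P \<subseteq> carrier Q \<and> graded_embedding CM O\<^sub>P OG Q QG (\<lambda>x. x) \<and>
          carrier Q = orth_hull CM J\<^sub>C (carrier Q) \<and>
          (\<forall>B. idempotent_ultrafilter CM B \<longrightarrow>
            graded_algebra_of_quotients CM
              (ultra_quotient CM B O\<^sub>P) (ultra_quotient_grading CM B O\<^sub>P OG)
              (ultra_quotient CM B Q) (ultra_quotient_grading CM B Q QG)
              (ultra_inclusion CM B Q))))"
proof -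
  interpret graded_hull F R RG I IG \<iota>
    by (intro graded_hull.intro graded_hull_axioms.intro semiprime_graded_lie_algebra.intro
        semiprime_graded_lie_algebra_axioms.intro lie semiprime hull_R)
  interpret quot: graded_quotients F R RG P\<^sub>F PG \<iota>
    unfolding P\<^sub>F PG by (rule central_closure_quotients)
  show ?thesis
  proof (intro conjI allI impI)
    show "graded_algebra_of_quotients F R RG P\<^sub>F PG \<iota>" by (rule quot.graded_algebra_of_quotients)
    show "\<exists>\<psi>. graded_embedding F P\<^sub>F PG QR QRG \<psi> \<and> (\<forall>x\<in>carrier R. \<psi> (\<iota> x) = \<epsilon> x)"
      if "maximal_graded_quotients F R RG QR QRG \<epsilon>" for QR :: "('f, 'q) module" and QRG \<epsilon>
      using that by (rule quot.embeds_in_maximal)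
  next
    fix J :: "('i \<Rightarrow> 'i, 'j) module" and JG \<kappa> Q QG
    assume h: "hull_of_algebra CM P PG J JG \<kappa> \<and>
      maximal_graded_quotients CM P PG Q QG \<kappa> \<and> realised_in CM P J JG \<kappa> Q QG"
    interpret orth: orth_in_module CM P PG Q QG \<kappa> "scalars_of P J"
      using h central_closure_orth_in_module[OF fin] unfolding CM P PG by blast
    show "let J\<^sub>C = scalars_of P J; O\<^sub>P = orth_completion CM P J\<^sub>C \<kappa>;
           OG = orth_completion_grading CM PG J\<^sub>C \<kappa>
       in carrier O\<^sub>P \<subseteq> carrier Q \<and> graded_embedding CM O\<^sub>P OG Q QG (\<lambda>x. x) \<and>
          carrier Q = orth_hull CM J\<^sub>C (carrier Q) \<and>
          (\<forall>B. idempotent_ultrafilter CM B \<longrightarrow>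
            graded_algebra_of_quotients CM
              (ultra_quotient CM B O\<^sub>P) (ultra_quotient_grading CM B O\<^sub>P OG)
              (ultra_quotient CM B Q) (ultra_quotient_grading CM B Q QG)
              (ultra_inclusion CM B Q))"
      using orth.O_closed orth.O_embedding orth.Q_orth_hull orth.ultra_quotients by (auto simp: Let_def)
  qed
qed

end
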